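(* Let $n\ge 0$ be an integer and let $x=(x_1,x_2,\dots,x_N)$ be an alphabet of arbitrary (possibly infinite) size. The quantity $$Z_{n}(x;q,t;a,b,c,d)=\sum_{\mu\subseteq\lambda:\ \lambda_1\le n}\frac{h_{n-\lambda_1}(ab;q)\,h_{\lambda'}(a,b;q)}{(q;q)_{n-\lambda_1}\prod_{i\ge1}(q;q)_{\lambda_i-\lambda_{i+1}}}\cdot P_{\lambda/\mu}(x;q,0)\cdot t^{|\mu|/2}h_{\mu'}(c/\sqrt t,d/\sqrt t;q)$$ (sum over pairs of partitions $\mu\subseteq\lambda$ with $\lambda_1\le n$) is separately symmetric in the parameters $(q,t)$ and $(a,b,c,d)$; that is, it is invariant under exchanging $q$ and $t$, and it is invariant under every permutation of $a,b,c,d$.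
   Context: Notation: $(z;q)_m=\prod_{i=0}^{m-1}(1-zq^i)$. For a partition $\lambda$: $|\lambda|$ is its size, $\lambda'$ its conjugate, $m_i(\lambda)$ the number of parts equal to $i$. Rogers--Szegő polynomials: $h_m(z;q)=\sum_{k=0}^m\frac{(q;q)_m}{(q;q)_k(q;q)_{m-k}}z^k$ for $m\ge0$. For a partition $\lambda=1^{m_1}2^{m_2}\cdots$: $h_\lambda(a,b;q)=\prod_{i\ge1}a^{m_{2i-1}}h_{m_{2i-1}}(b/a;q)\,h_{m_{2i}}(ab;q)$, a polynomial in $a,b$ (here $a^mh_m(b/a;q)=\sum_k\frac{(q;q)_m}{(q;q)_k(q;q)_{m-k}}a^{m-k}b^k$). Equivalently $h_{\lambda'}(a,b;q)=\prod_{i\ge1}a^{\lambda_{2i-1}-\lambda_{2i}}h_{\lambda_{2i-1}-\lambda_{2i}}(b/a;q)\,h_{\lambda_{2i}-\lambda_{2i+1}}(ab;q)$. $P_{\lambda/\mu}(x;q,0)$ is the skew $q$-Whittaker polynomial, i.e. the $t=0$ specialization of the skew Macdonald polynomial $P_{\lambda/\mu}(x;q,t)$ (Macdonald's conventions). Explicitly, for one variable $P_{\lambda/\mu}(x_1;q,0)=x_1^{|\lambda|-|\mu|}\prod_{i\ge1}\frac{(q;q)_{\lambda_i-\lambda_{i+1}}}{(q;q)_{\lambda_i-\mu_i}(q;q)_{\mu_i-\lambda_{i+1}}}$ if $\lambda_1\ge\mu_1\ge\lambda_2\ge\mu_2\ge\cdots$ and $0$ otherwise; for several variables it is determined by the branching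 rule $P_{\lambda/\mu}(x,y;q,0)=\sum_\nu P_{\lambda/\nu}(x;q,0)P_{\nu/\mu}(y;q,0)$. $Z_n$ is viewed as a formal power series in $q,t$ and the $x_i$ with coefficients polynomial in $a,b,c,d$; the expression $t^{|\mu|/2}h_{\mu'}(c/\sqrt t,d/\sqrt t;q)$ is a polynomial in $t,c,d,q$. *)

theory Defs
  imports
    "HOL-Computational_Algebra.Formal_Laurent_Series"
    "HOL-Library.Poly_Mapping"
    "HOL-Library.Extended_Nat"
    "HOL-Library.Multiset"
begin

text \<open>
  Partitions are weakly decreasing, finitely supported sequences indexed from 0:
  \<open>lam i\<close> is the part usually written \<open>\<lambda>\<^sub>i\<^sub>+\<^sub>1\<close>.
  Inclusion of partitions is the pointwise order \<open>\<le>\<close> on functions.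
\<close>

definition is_partition :: "(nat \<Rightarrow> nat) \<Rightarrow> bool" where
  "is_partition lam \<longleftrightarrow> antimono lam \<and> finite {i. lam i \<noteq> 0}"

definition psize :: "(nat \<Rightarrow> nat) \<Rightarrow> nat" where
  "psize lam = Sum_any lam"

definition conj_part :: "(nat \<Rightarrow> nat) \<Rightarrow> (nat \<Rightarrow> nat)" where
  "conj_part lam = (\<lambda>i. card {j. i < lam j})"

text \<open>Only meaningful for \<open>i \<ge> 1\<close>: the set of indices is infinite for \<open>i = 0\<close>.\<close>

definition mult_part :: "nat \<Rightarrow> (nat \<Rightarrow> nat) \<Rightarrow> nat" where
  "mult_part i lam = card {j. lam j = i}"

text \<open>
  The variable \<open>q\<close> is the indeterminate of a ring \<open>'f fps\<close> of formal power series over a field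
  \<open>'f\<close>; all further parameters live in \<open>'f\<close>. Denominators are products of factors
  \<open>1 - q^i\<close> with \<open>i \<ge> 1\<close>, hence units.
\<close>

abbreviation qvar :: "'f::field fps" where
  "qvar \<equiv> fps_X"

definition qpoch :: "'f::field fps \<Rightarrow> nat \<Rightarrow> 'f fps" where
  "qpoch z m = (\<Prod>i<m. 1 - z * qvar ^ i)"

definition qbinom :: "nat \<Rightarrow> nat \<Rightarrow> 'f::field fps" where
  "qbinom m k = qpoch qvar m / (qpoch qvar k * qpoch qvar (m - k))"

definition rogers_szego :: "nat \<Rightarrow> 'f::field \<Rightarrow> 'f fps" where
  "rogers_szego m z = (\<Sum>k\<le>m. qbinom m k * fps_const (z ^ k))"

text \<open>The polynomial \<open>a^m h\<^sub>m(b/a;q)\<close>, also for \<open>a = 0\<close>.\<close>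

definition rogers_szego_hom :: "nat \<Rightarrow> 'f::field \<Rightarrow> 'f \<Rightarrow> 'f fps" where
  "rogers_szego_hom m a b = (\<Sum>k\<le>m. qbinom m k * fps_const (a ^ (m - k) * b ^ k))"

text \<open>
  \<open>h\<^sub>\<lambda>(a,b;q)\<close>; the factors with zero multiplicities are 1, so the product is finite.
\<close>

definition h_part :: "(nat \<Rightarrow> nat) \<Rightarrow> 'f::field \<Rightarrow> 'f \<Rightarrow> 'f fps" where
  "h_part lam a b = Prod_any (\<lambda>i.
     rogers_szego_hom (mult_part (2 * i + 1) lam) a b *
     rogers_szego (mult_part (2 * i + 2) lam) (a * b))"

text \<open>
  Polynomials in \<open>x\<^sub>0, x\<^sub>1, \<dots>\<close> over \<open>'f fps\<close> have type \<open>(nat \<Rightarrow>\<^sub>0 nat) \<Rightarrow>\<^sub>0 'f fps\<close>.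
  \<open>qwhit1 k lam mu\<close> is \<open>P\<^sub>\<lambda>\<^sub>/\<^sub>\<mu>(x\<^sub>k;q,0)\<close> in the single variable \<open>x\<^sub>k\<close>, and
  \<open>qwhit k lam mu\<close> is \<open>P\<^sub>\<lambda>\<^sub>/\<^sub>\<mu>(x\<^sub>0,\<dots>,x\<^sub>k\<^sub>-\<^sub>1;q,0)\<close>.
\<close>

definition qwhit1 :: "nat \<Rightarrow> (nat \<Rightarrow> nat) \<Rightarrow> (nat \<Rightarrow> nat) \<Rightarrow> (nat \<Rightarrow>\<^sub>0 nat) \<Rightarrow>\<^sub>0 'f::field fps" where
  "qwhit1 k lam mu =
     (if \<forall>i. mu i \<le> lam i \<and> lam (Suc i) \<le> mu i then
        Poly_Mapping.single (Poly_Mapping.single k (psize lam - psize mu))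
          (Prod_any (\<lambda>i. qpoch qvar (lam i - lam (Suc i)) /
             (qpoch qvar (lam i - mu i) * qpoch qvar (mu i - lam (Suc i)))))
      else 0)"

primrec qwhit :: "nat \<Rightarrow> (nat \<Rightarrow> nat) \<Rightarrow> (nat \<Rightarrow> nat) \<Rightarrow> (nat \<Rightarrow>\<^sub>0 nat) \<Rightarrow>\<^sub>0 'f::field fps" where
  "qwhit 0 lam mu = (if lam = mu then 1 else 0)"
| "qwhit (Suc k) lam mu =
     (\<Sum>nu | is_partition nu \<and> mu \<le> nu \<and> nu \<le> lam. qwhit k lam nu * qwhit1 k nu mu)"

text \<open>
  The coefficient of the monomial \<open>x^\<alpha>\<close> in \<open>P\<^sub>\<lambda>\<^sub>/\<^sub>\<mu>(x;q,0)\<close> for an alphabet with \<open>N\<close> letters.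
  For \<open>N = \<infinity>\<close> it is taken in any finite set of variables containing those of \<open>x^\<alpha>\<close>;
  the choice is irrelevant because setting the last variable to 0 turns \<open>qwhit (Suc k) lam mu\<close>
  into \<open>qwhit k lam mu\<close>.
\<close>

definition qwhit_coeff ::
  "enat \<Rightarrow> (nat \<Rightarrow> nat) \<Rightarrow> (nat \<Rightarrow> nat) \<Rightarrow> (nat \<Rightarrow>\<^sub>0 nat) \<Rightarrow> 'f::field fps" where
  "qwhit_coeff N lam mu \<alpha> = Poly_Mapping.lookup
     (qwhit (case N of enat k \<Rightarrow> k | \<infinity> \<Rightarrow> (LEAST k. Poly_Mapping.keys \<alpha> \<subseteq> {..<k})) lam mu) \<alpha>"

text \<open>
  To make sense of \<open>\<surd>t\<close> the summands are computed in \<open>'a fls fps\<close>: power series in \<open>q\<close> over the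
  field of formal Laurent series over \<open>'a\<close> in the indeterminate \<open>sqrt_t\<close>, and \<open>t = sqrt_t\<^sup>2\<close>.
\<close>

abbreviation sqrt_t :: "'a::field fls" where
  "sqrt_t \<equiv> fls_X"

definition Z_summand ::
  "nat \<Rightarrow> enat \<Rightarrow> 'a::field \<Rightarrow> 'a \<Rightarrow> 'a \<Rightarrow> 'a \<Rightarrow> (nat \<Rightarrow>\<^sub>0 nat) \<Rightarrow>
     (nat \<Rightarrow> nat) \<Rightarrow> (nat \<Rightarrow> nat) \<Rightarrow> 'a fls fps" where
  "Z_summand n N a b c d \<alpha> lam mu =
     rogers_szego (n - lam 0) (fls_const a * fls_const b) *
     h_part (conj_part lam) (fls_const a) (fls_const b) /
     (qpoch qvar (n - lam 0) * Prod_any (\<lambda>i. qpoch qvar (lam i - lam (Suc i)))) *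
     qwhit_coeff N lam mu \<alpha> *
     (fps_const (sqrt_t ^ psize mu) *
      h_part (conj_part mu) (fls_const c / sqrt_t) (fls_const d / sqrt_t))"

text \<open>
  \<open>Z n N a b c d \<alpha>\<close> is the coefficient of \<open>x^\<alpha>\<close> in \<open>Z\<^sub>n(x;q,t;a,b,c,d)\<close>, for an alphabet
  \<open>x\<close> of \<open>N\<close> letters, as a power series in \<open>q\<close> (outer) and \<open>t\<close> (inner): the coefficient of
  \<open>q^i t^j\<close> is read off at \<open>q^i sqrt_t^(2j)\<close>. No other powers of \<open>sqrt_t\<close> occur, since
  \<open>t^(|\<mu>|/2) h\<^sub>\<mu>\<^sub>'(c/\<surd>t, d/\<surd>t; q)\<close> is a polynomial in \<open>t\<close>. Its order in \<open>t\<close> is at least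
  \<open>\<mu>\<^sub>3 + \<mu>\<^sub>5 + \<mu>\<^sub>7 + \<dots>\<close>; together with \<open>\<mu>\<^sub>1 \<le> \<lambda>\<^sub>1 \<le> n\<close> and
  \<open>|\<lambda>| - |\<mu>| = |\<alpha>|\<close> this leaves only finitely many nonzero terms in each sum below.
\<close>

definition Z :: "nat \<Rightarrow> enat \<Rightarrow> 'a::field \<Rightarrow> 'a \<Rightarrow> 'a \<Rightarrow> 'a \<Rightarrow> (nat \<Rightarrow>\<^sub>0 nat) \<Rightarrow> 'a fps fps" where
  "Z n N a b c d \<alpha> = Abs_fps (\<lambda>i. Abs_fps (\<lambda>j. Sum_any (\<lambda>(lam, mu).
     if is_partition lam \<and> is_partition mu \<and> mu \<le> lam \<and> lam 0 \<le> n
     then fls_nth (fps_nth (Z_summand n N a b c d \<alpha> lam mu) i) (2 * int j)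
     else 0)))"

end

theory Submission
  imports Defs "HOL-Library.Function_Algebras"
begin

text \<open>
  Work with Laurent polynomials in \<open>z\<^sub>0, \<dots>, z\<^sub>n\<^sub>-\<^sub>1\<close> and read \<open>t\<close> as their degree. Let \<open>K\<close> be the
  functional on exponents that is antisymmetric under the dot action of the symmetric group and, on
  dominant exponents, is the indicator of having only even nonnegative entries. Applied to
  \<open>\<Prod>\<^sub>k\<^sub><\<^sub>l (1 - q z\<^sub>k/z\<^sub>l) \<Prod>\<^sub>k\<^sub>\<le>\<^sub>l 1/(1 - q z\<^sub>k z\<^sub>l)\<close> times a monomial it produces, up to normalization, the
  indicator of \<open>\<lambda>\<^sub>1 = \<lambda>\<^sub>2, \<lambda>\<^sub>3 = \<lambda>\<^sub>4, \<dots>\<close>. By the Pieri rules, multiplication by \<open>\<Sum>\<^sub>r a\<^sup>r e\<^sub>r(z)\<close> is a sum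
  over horizontal strips with \<open>q\<close>-Whittaker weights. Two such multiplications create the boundary
  factor in \<open>a, b\<close>, two more the factor in \<open>c, d\<close>, and taking the coefficient of \<open>x\<^sup>\<alpha>\<close> of the skew
  \<open>q\<close>-Whittaker polynomial is multiplication by \<open>\<Prod>\<^sub>i e\<^bsub>\<alpha> i\<^esub>(z)\<close>. So \<open>a, b, c, d\<close> enter only through one
  commutative product \<open>E\<close>.

  Summing over the partitions \<open>\<mu>\<close> amounts to expanding an antisymmetric function in
  Hall--Littlewood functions. This gives the coefficient of \<open>q\<^sup>i t\<^sup>m\<close> as
  \<open>(1/n!) \<Sum>\<^sub>k K(B\<^sub>k A\<^sub>m\<^sub>-\<^sub>k A\<^sub>i\<^sub>-\<^sub>k \<Delta> E)\<close>, where \<open>\<Sum>\<^sub>k A\<^sub>k q\<^sup>k = \<Prod>\<^sub>k\<^sub>\<le>\<^sub>l 1/(1 - q z\<^sub>k z\<^sub>l)\<close>,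
  \<open>\<Sum>\<^sub>k B\<^sub>k q\<^sup>k = \<Prod>\<^sub>k\<^sub><\<^sub>l (1 - q z\<^sub>k z\<^sub>l)\<close> and \<open>\<Delta> = \<Prod>\<^sub>k\<^sub><\<^sub>l (1 - z\<^sub>k/z\<^sub>l)\<close>: symmetric in \<open>i\<close> and \<open>m\<close>.
\<close>

section \<open>Alternating sums over lists\<close>

text \<open>The pairing with \<open>K\<close> replaces division by Weyl denominators, which Laurent
  polynomials do not permit: no symmetric function is ever divided out. Degree by degree, the
  generating series of \<open>K\<close> is \<open>DL\<close> times Littlewood's product of all 1/(1
  - z_k z_l), k <= l. Both Hall-Littlewood identities rest on one difference equation: raising the
  top exponent by 2 changes \<open>K\<close> by terms that multiplication by z_j z_n leaves
  unchanged. On such a term z_j z_n acts as 1, factors cancel, and the exponents that remain are too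
  small to contribute. So the top exponent may be sent to infinity, where a variable splits off.

  The factor n! stems from the product of all 1 - p z_k/z_l, k < l, which an antisymmetric
  functional evaluates to the Poincare polynomial of the symmetric group: p = q gives (q;q)_n up to
  a power of 1 - q, and p = 1 gives n!.

  The t-degree yields A_{m-k} because the values of \<open>K\<close> are themselves coefficients of
  that product; the power of q yields A_{i-k} from the same product. B_k comes from the dual
  identity and carries both gradings at once.\<close>

fun altsum :: "('b \<Rightarrow> 'c::comm_ring_1) \<Rightarrow> ('b list \<Rightarrow> 'c) \<Rightarrow> 'b list \<Rightarrow> 'c" where
  "altsum w F [] = 0"
| "altsum w F (z # zs) = w z * F zs - altsum w (\<lambda>l. F (z # l)) zs"

lemma altsum_cong:
  assumes "\<And>l. Suc (length l) = length zs \<Longrightarrow> set l \<subseteq> set zs \<Longrightarrow> F l = G l" "\<And>z. z \<in> set zs \<Longrightarrow> w z = v z"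
  shows "altsum w F zs = altsum v G zs"
  using assms
proof (induction zs arbitrary: F G)
  case (Cons z zs)
  have "altsum w (\<lambda>l. F (z # l)) zs = altsum v (\<lambda>l. G (z # l)) zs"
  proof (rule Cons.IH)
    fix l assume "Suc (length l) = length zs" "set l \<subseteq> set zs"
    then show "F (z # l) = G (z # l)" by (intro Cons.prems) auto
  qed (use Cons.prems in auto)
  moreover have "F zs = G zs" "w z = v z" by (rule Cons.prems; auto)+
  ultimately show ?case by simp
qed simp

lemma altsum_diff_weight: "altsum (\<lambda>z. w z - v z) F zs = altsum w F zs - altsum v F zs"
  by (induction zs arbitrary: F) (auto simp: algebra_simps)

lemma altsum_diff_fun: "altsum w (\<lambda>l. F l - G l) zs = altsum w F zs - altsum w G zs"
  by (induction zs arbitrary: F G) (auto simp: algebra_simps)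

lemma altsum_scale: "altsum w (\<lambda>l. c * F l) zs = c * altsum w F zs"
  by (induction zs arbitrary: F) (auto simp: algebra_simps)

lemma altsum_zero: "altsum (\<lambda>z. 0) F zs = 0"
  by (induction zs arbitrary: F) auto

text \<open>Deleting two entries in either order leaves the same list, but the sign of the second
  deletion depends on whether the entry deleted first stood before it.\<close>

lemma altsum_anticomm: "altsum w (altsum v F) zs = - altsum v (altsum w F) zs"
proof (induction zs arbitrary: F)
  case (Cons z zs)
  show ?case
    by (simp add: altsum_diff_fun altsum_scale Cons.IH[of "\<lambda>l. F (z # l)"])
qed simp

text \<open>Deleting one of the two swapped entries leaves the same list from a neighbouring
  position, hence with opposite sign; deleting any other entry falls under the antisymmetry of
  \<open>F\<close>.\<close>

lemma altsum_swap:
  assumes "\<And>pre a b post. Suc (length pre + length post) = length ps + length qs \<Longrightarrow>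
     F (pre @ a # b # post) = - F (pre @ b # a # post)"
  shows "altsum w F (ps @ x # y # qs) = - altsum w F (ps @ y # x # qs)"
  using assms
proof (induction ps arbitrary: F)
  case Nil
  have "altsum w (\<lambda>l. F (x # y # l)) qs = altsum w (\<lambda>l. - 1 * F (y # x # l)) qs"
  proof (rule altsum_cong)
    fix l :: "'a list" assume "Suc (length l) = length qs"
    then show "F (x # y # l) = - 1 * F (y # x # l)" using Nil[of "[]" l x y] by simp
  qed simp
  also have "\<dots> = - altsum w (\<lambda>l. F (y # x # l)) qs"
    unfolding altsum_scale by simp
  finally show ?case by simp
next
  case (Cons p ps)
  have 1: "F (ps @ x # y # qs) = - F (ps @ y # x # qs)"
    by (rule Cons.prems) simp
  have 2: "altsum w (\<lambda>l. F (p # l)) (ps @ x # y # qs) = - altsum w (\<lambda>l. F (p # l)) (ps @ y # x # qs)"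
  proof (rule Cons.IH)
    fix pre post :: "'a list" and a b
    assume "Suc (length pre + length post) = length ps + length qs"
    then show "F (p # pre @ a # b # post) = - F (p # pre @ b # a # post)"
      using Cons.prems[of "p # pre" post a b] by simp
  qed
  show ?case using 1 2 by simp
qed

text \<open>The correction for an unsorted pair. For entries 0 <= x < y the parity tests accept x
  odd, y even; subtracting 1 for every pair of opposite parity leaves minus the value of the sorted
  list y, x.\<close>

definition odd_gap_above :: "int \<Rightarrow> int \<Rightarrow> 'c::comm_ring_1" where
  "odd_gap_above x y = (if y > x \<and> odd (y - x) then 1 else 0)"

text \<open>
  The value on a list is the alternating function that is 1 on \<open>a\<^sub>n\<^sub>-\<^sub>1 + n - 1 > \<dots> > a\<^sub>0\<close> if all \<open>a\<^sub>k\<close> are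
  even and nonnegative, and 0 on other decreasing lists. The recursion expands along the head; the alternating sum vanishes on
  decreasing lists and makes the extension antisymmetric. The first argument is the length.
\<close>

fun even_char_rec :: "nat \<Rightarrow> int list \<Rightarrow> 'c::comm_ring_1" where
  "even_char_rec 0 = (\<lambda>xs. 1)"
| "even_char_rec (Suc m) = (\<lambda>xs. if hd xs < 0 then 0 else
     (if even (hd xs - int m) then even_char_rec m (tl xs) else 0) - altsum (odd_gap_above (hd xs)) (even_char_rec (m - 1)) (tl xs))"

definition even_char_list :: "int list \<Rightarrow> 'c::comm_ring_1" where
  "even_char_list xs = even_char_rec (length xs) xs"

lemma even_char_list_Nil [simp]: "even_char_list [] = 1" by (simp add: even_char_list_def)

lemma even_char_list_Cons: "(even_char_list (x # xs) :: 'b::comm_ring_1) = (if x < 0 then 0 else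
   (if even (x - int (length xs)) then even_char_list xs else 0) - altsum (odd_gap_above x) even_char_list xs)"
proof -
  have "altsum (odd_gap_above x) (even_char_rec (length xs - 1)) xs = (altsum (odd_gap_above x) even_char_list xs :: 'b)"
  proof (rule altsum_cong)
    fix l :: "int list" assume "Suc (length l) = length xs"
    then have "length xs - 1 = length l" by simp
    then show "even_char_rec (length xs - 1) l = (even_char_list l :: 'b)" by (simp only: even_char_list_def)
  qed simp
  then show ?thesis by (simp add: even_char_list_def)
qed

text \<open>Unfolding both heads gives a multiple of \<open>even_char_list zs\<close>, two single
  alternating sums and one double sum. The single sums visibly exchange with a sign, the double sum
  does so by \<open>altsum_anticomm\<close>, and for the multiple it is a parity check on x and
  y.\<close>

lemma even_char_list_swap_hd:
  "even_char_list (x # y # zs) = - even_char_list (y # x # zs)"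
proof -
  define m where "m = length zs"
  define ev :: "int \<Rightarrow> 'a" where "ev x = (if even (x - int m) then 1 else 0)" for x
  define ev' :: "int \<Rightarrow> 'a" where "ev' x = (if odd (x - int m) then 1 else 0)" for x
  have main: "even_char_list (x # y # zs) = (if x < 0 \<or> y < 0 then 0 else
      (ev' x * ev y - odd_gap_above x y) * even_char_list zs - ev' x * altsum (odd_gap_above y) even_char_list zs + ev' y * altsum (odd_gap_above x) even_char_list zs
       - altsum (odd_gap_above x) (altsum (odd_gap_above y) even_char_list) zs)" for x y
  proof (cases "x < 0")
    case True then show ?thesis by (simp add: even_char_list_Cons)
  next
    case x: False
    have y: "even_char_list (y # zs) = (if y < 0 then 0 else ev y * even_char_list zs - altsum (odd_gap_above y) even_char_list zs)"
      by (simp add: even_char_list_Cons ev_def m_def)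
    have a: "altsum (odd_gap_above x) (\<lambda>l. even_char_list (y # l)) zs = (if y < 0 then 0 else
        ev' y * altsum (odd_gap_above x) even_char_list zs - altsum (odd_gap_above x) (altsum (odd_gap_above y) even_char_list) zs)"
    proof -
      have "altsum (odd_gap_above x) (\<lambda>l. even_char_list (y # l)) zs =
        altsum (odd_gap_above x) (\<lambda>l. (if y < 0 then 0 else 1) * (ev' y * even_char_list l - altsum (odd_gap_above y) even_char_list l)) zs"
        proof (rule altsum_cong)
        fix l :: "int list" assume "Suc (length l) = length zs"
        then have "int m = int (length l) + 1" by (simp add: m_def)
        then have "even (y - int (length l)) \<longleftrightarrow> odd (y - int m)" by presburger
        then show "even_char_list (y # l) = (if y < 0 then 0 else 1) * (ev' y * even_char_list l - altsum (odd_gap_above y) even_char_list l)"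
          by (simp add: even_char_list_Cons ev'_def)
      qed simp
      then show ?thesis by (simp only: altsum_scale altsum_diff_fun) simp
    qed
    have "int (length (y # zs)) = int m + 1" by (simp add: m_def)
    then have "even (x - int (length (y # zs))) \<longleftrightarrow> odd (x - int m)" by presburger
    then have "even_char_list (x # y # zs) = ev' x * even_char_list (y # zs) - odd_gap_above x y * even_char_list zs + altsum (odd_gap_above x) (\<lambda>l. even_char_list (y # l)) zs"
      using x by (simp add: even_char_list_Cons[of x] ev'_def)
    moreover have "odd_gap_above x y = (0::'a)" if "y < 0" using that x by (simp add: odd_gap_above_def)
    ultimately show ?thesis using x unfolding y a by (auto simp: algebra_simps)
  qed
  have "(ev' x * ev y - odd_gap_above x y) + (ev' y * ev x - odd_gap_above y x) = 0"
    unfolding ev_def ev'_def odd_gap_above_def by (cases "x = y"; cases "x < y") auto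
  then have e: "(ev' x * ev y - odd_gap_above x y) * even_char_list zs = - ((ev' y * ev x - odd_gap_above y x) * even_char_list zs)"
    by (metis add_eq_0_iff2 minus_mult_left)
  show ?thesis
  proof (cases "x < 0 \<or> y < 0")
    case True
    then have "even_char_list (x # y # zs) = (0 :: 'a)" "even_char_list (y # x # zs) = (0 :: 'a)"
      unfolding main[of x y] main[of y x] by auto
    then show ?thesis by simp
  next
    case False
    then have "even_char_list (x # y # zs) + even_char_list (y # x # zs) = (0 :: 'a)"
      unfolding main[of x y] main[of y x] e altsum_anticomm[of "odd_gap_above x" "odd_gap_above y" even_char_list zs] by simp
    then show ?thesis by (rule eq_neg_iff_add_eq_0[THEN iffD2])
  qed
qed

lemma even_char_list_swap: "(even_char_list (pre @ x # y # post) :: 'c::comm_ring_1) = - even_char_list (pre @ y # x # post)"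
proof (induction "length pre + length post" arbitrary: pre post x y rule: less_induct)
  case less
  show ?case
  proof (cases pre)
    case Nil then show ?thesis by (simp only: append_Nil) (rule even_char_list_swap_hd)
  next
    case (Cons p ps)
    have 1: "(even_char_list (ps @ x # y # post) :: 'c) = - even_char_list (ps @ y # x # post)"
      by (rule less) (simp add: Cons)
    have 2: "(altsum (odd_gap_above p) even_char_list (ps @ x # y # post) :: 'c) = - altsum (odd_gap_above p) even_char_list (ps @ y # x # post)"
      by (rule altsum_swap, rule less) (simp add: Cons)
    have L: "length (ps @ x # y # post) = length (ps @ y # x # post)" by simp
    show ?thesis unfolding Cons append_Cons even_char_list_Cons 1 2 L
      by (cases "even (p - int (length (ps @ y # x # post)))") (simp_all only: if_True if_False, simp_all)
  qed
qed

text \<open>A negative entry can be moved to the head at the cost of signs, and there the recursion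
  returns 0.\<close>

lemma even_char_list_neg:
  assumes "z \<in> set xs" "z < 0"
  shows "even_char_list xs = (0 :: 'c::comm_ring_1)"
proof -
  have "even_char_list (ps @ z # qs) = (0 :: 'c)" for ps qs
  proof (induction ps arbitrary: qs rule: rev_induct)
    case Nil then show ?case using assms(2) by (simp add: even_char_list_Cons)
  next
    case (snoc p ps)
    show ?case using even_char_list_swap[of ps p z qs, where 'c = 'c] snoc[of "p # qs"] by simp
  qed
  then show ?thesis using split_list[OF assms(1)] by metis
qed

text \<open>The parity test on the head does not notice a shift by 2, and the odd gaps above x and
  above x + 2 differ exactly at y = x + 1.\<close>

lemma even_char_list_step:
  assumes "x \<ge> 0"
  shows "even_char_list ((x + 2) # xs) - even_char_list (x # xs) = (altsum (\<lambda>y. if y = x + 1 then 1 else 0) even_char_list xs :: 'c::comm_ring_1)"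
proof -
  have "altsum (\<lambda>y. odd_gap_above x y - odd_gap_above (x + 2) y) even_char_list xs = (altsum (\<lambda>y. if y = x + 1 then 1 else 0) even_char_list xs :: 'c)"
  proof (rule altsum_cong)
    fix y show "odd_gap_above x y - odd_gap_above (x + 2) y = (if y = x + 1 then 1 else (0 :: 'c))"
      unfolding odd_gap_above_def by (cases "y = x + 1"; cases "y = x + 2"; cases "y > x") auto
  qed simp
  then show ?thesis using assms by (simp add: even_char_list_Cons altsum_diff_weight)
qed

text \<open>Prepares the step from head -1 to head 1, where the parity test on the head has no
  partner to cancel against. Unfolding the head leads to the same sum over shorter lists, once
  directly and once inside an \<open>odd_gap_above\<close> sum after anticommuting; the parity of
  the length decides which part survives.\<close>

lemma altsum_even_char_list:
  assumes "\<And>z. z \<in> set xs \<Longrightarrow> z \<ge> 0"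
  shows "altsum (\<lambda>y. if even y then 1 else 0) even_char_list xs = (if odd (length xs) then even_char_list xs else (0 :: 'c::comm_ring_1))"
  using assms
proof (induction "length xs" arbitrary: xs rule: less_induct)
  case less
  define e :: "int \<Rightarrow> 'c" where "e y = (if even y then 1 else 0)" for y
  show ?case
  proof (cases xs)
    case (Cons x ys)
    define m where "m = length ys"
    define p where "p = (if even (x - int m) then 0 else (1 :: 'c))"
    define r where "r = (if odd m then even_char_list ys else (0 :: 'c))"
    have x: "x \<ge> 0" using less.prems Cons by simp
    have ys: "z \<in> set ys \<Longrightarrow> z \<ge> 0" for z using less.prems Cons by simp
    have ih: "altsum e even_char_list ys = r"
      unfolding r_def m_def e_def by (rule less.hyps) (use Cons ys in auto)
    have a: "altsum e (\<lambda>l. even_char_list (x # l)) ys = p * r + altsum (odd_gap_above x) (altsum e even_char_list) ys"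
    proof -
      have "altsum e (\<lambda>l. even_char_list (x # l)) ys = altsum e (\<lambda>l. p * even_char_list l - altsum (odd_gap_above x) even_char_list l) ys"
      proof (rule altsum_cong)
        fix l :: "int list" assume "Suc (length l) = length ys"
        then have "int m = int (length l) + 1" by (simp add: m_def)
        then have "odd (x - int (length l)) \<longleftrightarrow> even (x - int m)" by presburger
        then show "even_char_list (x # l) = p * even_char_list l - altsum (odd_gap_above x) even_char_list l"
          using x by (cases "even (x - int m)") (auto simp: even_char_list_Cons p_def)
      qed simp
      then show ?thesis
        by (simp only: altsum_scale altsum_diff_fun ih altsum_anticomm[of e "odd_gap_above x"]) simp
    qed
    have b: "altsum (odd_gap_above x) (altsum e even_char_list) ys = (if odd m then 0 else altsum (odd_gap_above x) even_char_list ys)"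
    proof -
      have "altsum (odd_gap_above x) (altsum e even_char_list) ys = altsum (odd_gap_above x) (\<lambda>l. (if odd m then 0 else 1) * even_char_list l) ys"
      proof (rule altsum_cong)
        fix l :: "int list" assume l: "Suc (length l) = length ys" "set l \<subseteq> set ys"
        have "altsum e even_char_list l = (if odd (length l) then even_char_list l else (0 :: 'c))"
          unfolding e_def by (rule less.hyps) (use l Cons ys in auto)
        moreover have "odd (length l) \<longleftrightarrow> even m" using l(1) m_def by (metis even_Suc)
        ultimately show "altsum e even_char_list l = (if odd m then 0 else 1) * even_char_list l" by (cases "odd m") auto
      qed simp
      then show ?thesis by (simp only: altsum_scale) simp
    qed
    have "altsum e even_char_list xs = e x * even_char_list ys - (p * r + altsum (odd_gap_above x) (altsum e even_char_list) ys)"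
      by (simp add: Cons a)
    also have "\<dots> = (if odd (length xs) then even_char_list xs else 0)"
    proof (cases "odd m")
      case True
      then show ?thesis using x by (cases "even x") (auto simp: b Cons e_def p_def r_def m_def)
    next
      case False
      then show ?thesis using x by (cases "even x") (auto simp: b Cons even_char_list_Cons e_def p_def r_def m_def)
    qed
    finally show ?thesis unfolding e_def .
  qed simp
qed

text \<open>Head -1 itself contributes 0, and the parity sum of the previous lemma takes its place:
  a nonnegative y that is even but not an odd gap above 1 is 0. Head -1 arises in
  \<open>Schur_Littlewood_dominant\<close> when the top exponent is 1.\<close>

lemma even_char_list_step':
  assumes "x \<ge> - 1" "\<And>z. z \<in> set xs \<Longrightarrow> z \<ge> 0"
  shows "even_char_list ((x + 2) # xs) - even_char_list (x # xs) = (altsum (\<lambda>y. if y = x + 1 then 1 else 0) even_char_list xs :: 'c::comm_ring_1)"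
proof (cases "x \<ge> 0")
  case True then show ?thesis by (rule even_char_list_step)
next
  case False
  then have x: "x = - 1" using assms by simp
  have "even_char_list ((x + 2) # xs) - even_char_list (x # xs) =
      altsum (\<lambda>y. if even y then 1 else 0) even_char_list xs - (altsum (odd_gap_above 1) even_char_list xs :: 'c)"
    by (simp add: x even_char_list_Cons altsum_even_char_list[OF assms(2)])
  also have "\<dots> = altsum (\<lambda>y. (if even y then 1 else 0) - odd_gap_above 1 y) even_char_list xs"
    by (simp add: altsum_diff_weight)
  also have "\<dots> = altsum (\<lambda>y. if y = x + 1 then 1 else 0) even_char_list xs"
  proof (rule altsum_cong)
    fix z assume "z \<in> set xs"
    then have "z \<ge> 0" by (rule assms)
    then show "(if even z then 1 else 0) - odd_gap_above 1 z = (if z = x + 1 then 1 else (0 :: 'c))"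
      unfolding odd_gap_above_def x by (cases "z = 0"; cases "z = 1") auto
  qed simp
  finally show ?thesis .
qed

lemma even_char_list_large:
  assumes "x \<ge> 0" "\<And>z. z \<in> set xs \<Longrightarrow> z < x"
  shows "even_char_list (x # xs) = (if even (x - int (length xs)) then even_char_list xs else (0 :: 'c::comm_ring_1))"
proof -
  have "altsum (odd_gap_above x) even_char_list xs = altsum (\<lambda>_. 0) (even_char_list :: int list \<Rightarrow> 'c) xs"
    by (rule altsum_cong) (use assms(2) in \<open>auto simp: odd_gap_above_def dest: order.asym\<close>)
  then show ?thesis using assms(1) by (simp add: even_char_list_Cons altsum_zero)
qed

section \<open>Power series over Laurent polynomials\<close>

abbreviation "lk \<equiv> Poly_Mapping.lookup"
abbreviation "sgl \<equiv> Poly_Mapping.single"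

type_synonym 'f laurent = "(nat \<Rightarrow> int) \<Rightarrow>\<^sub>0 'f"

lemma laurent_decomp: "(g :: 'k \<Rightarrow>\<^sub>0 'f::comm_monoid_add) = (\<Sum>b\<in>Poly_Mapping.keys g. sgl b (lk g b))"
  by (rule poly_mapping_eqI) (auto simp: lookup_sum lookup_single when_def in_keys_iff sum.delta' if_distrib)

text \<open>The linear functional \<open>z\<^sup>b \<mapsto> F b\<close>; \<open>ev F\<close> extends it to power series in \<open>q\<close>.\<close>

definition ev1 :: "('k \<Rightarrow> 'f) \<Rightarrow> ('k \<Rightarrow>\<^sub>0 'f) \<Rightarrow> 'f::comm_ring_1" where
  "ev1 F g = (\<Sum>b\<in>Poly_Mapping.keys g. lk g b * F b)"

lemma ev1_superset: "finite A \<Longrightarrow> Poly_Mapping.keys g \<subseteq> A \<Longrightarrow> ev1 F g = (\<Sum>b\<in>A. lk g b * F b)"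
  unfolding ev1_def by (rule sum.mono_neutral_left) (auto simp: in_keys_iff)

lemma ev1_add: "ev1 F (g + h) = ev1 F g + ev1 F h"
proof -
  let ?A = "Poly_Mapping.keys g \<union> Poly_Mapping.keys h"
  have "Poly_Mapping.keys (g + h) \<subseteq> ?A" by (rule keys_add)
  then show ?thesis
    by (simp add: ev1_superset[of ?A] lookup_add algebra_simps sum.distrib)
qed

lemma ev1_zero [simp]: "ev1 F 0 = 0" by (simp add: ev1_def)

lemma ev1_sum: "ev1 F (sum g A) = (\<Sum>a\<in>A. ev1 F (g a))"
  by (induction A rule: infinite_finite_induct) (auto simp: ev1_add)

lemma ev1_single [simp]: "ev1 F (sgl a c) = c * F a"
  by (cases "c = 0") (auto simp: ev1_def)

lemma ev1_uminus: "ev1 F (- g) = - ev1 F g"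
  using ev1_add[of F g "- g"] by (simp add: eq_neg_iff_add_eq_0 add.commute)

lemma ev1_diff: "ev1 F (g - h) = ev1 F g - ev1 F h"
  using ev1_add[of F g "- h"] by (simp add: ev1_uminus)

lemma ev1_scale: "ev1 (\<lambda>b. c * F b) g = c * ev1 F g"
  by (simp add: ev1_def sum_distrib_left mult_ac)

lemma ev1_cong: "(\<And>b. b \<in> Poly_Mapping.keys g \<Longrightarrow> F b = G b) \<Longrightarrow> ev1 F g = ev1 G g"
  by (simp add: ev1_def)

lemma ev1_fun_sum: "ev1 (\<lambda>b. \<Sum>i\<in>I. F i b) g = (\<Sum>i\<in>I. ev1 (F i) g)"
  by (simp add: ev1_def sum_distrib_left) (rule sum.swap)

lemma ev1_fun_diff: "ev1 (\<lambda>b. F b - G b) g = ev1 F g - ev1 G g"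
  by (simp add: ev1_def algebra_simps sum_subtractf)

lemma ev1_single_mult: "ev1 F (sgl a c * g) = c * ev1 (\<lambda>b. F (a + b)) g"
proof -
  have "sgl a c * g = (\<Sum>b\<in>Poly_Mapping.keys g. sgl (a + b) (c * lk g b))"
    by (subst laurent_decomp[of g]) (simp add: sum_distrib_left mult_single)
  then show ?thesis by (simp add: ev1_sum) (simp add: ev1_def sum_distrib_left mult_ac)
qed

lemma ev1_mult: "ev1 F (g * h) = ev1 (\<lambda>a. ev1 (\<lambda>b. F (a + b)) h) g"
proof -
  have "g * h = (\<Sum>a\<in>Poly_Mapping.keys g. sgl a (lk g a) * h)"
    by (subst laurent_decomp[of g]) (simp add: sum_distrib_right)
  then show ?thesis by (simp add: ev1_sum ev1_single_mult) (simp add: ev1_def)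
qed

lemma lookup_eq_ev1: "lk g a = ev1 (\<lambda>b. if b = a then 1 else 0) g"
  by (simp add: ev1_def sum.delta if_distrib in_keys_iff cong: if_cong)

definition ev :: "('k \<Rightarrow> 'f) \<Rightarrow> ('k \<Rightarrow>\<^sub>0 'f) fps \<Rightarrow> 'f::comm_ring_1 fps" where
  "ev F g = Abs_fps (\<lambda>i. ev1 F (fps_nth g i))"

lemma ev_nth [simp]: "fps_nth (ev F g) i = ev1 F (fps_nth g i)" by (simp add: ev_def)

lemma ev_add: "ev F (g + h) = ev F g + ev F h" by (rule fps_ext) (simp add: ev1_add)
lemma ev_diff: "ev F (g - h) = ev F g - ev F h" by (rule fps_ext) (simp add: ev1_diff)
lemma ev_uminus: "ev F (- g) = - ev F g" by (rule fps_ext) (simp add: ev1_uminus)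
lemma ev_zero [simp]: "ev F 0 = 0" by (rule fps_ext) simp
lemma ev_sum: "ev F (sum g A) = (\<Sum>a\<in>A. ev F (g a))"
  by (rule fps_ext) (simp add: fps_sum_nth ev1_sum)
lemma ev_fun_diff: "ev (\<lambda>b. F b - G b) g = ev F g - ev G g"
  by (rule fps_ext) (simp add: ev1_fun_diff)
lemma ev_fun_sum: "ev (\<lambda>b. \<Sum>i\<in>I. F i b) g = (\<Sum>i\<in>I. ev (F i) g)"
  by (rule fps_ext) (simp add: fps_sum_nth ev1_fun_sum)
lemma ev_fun_scale: "ev (\<lambda>b. c * F b) g = fps_const c * ev F g"
  by (rule fps_ext) (simp add: ev1_scale)
lemma ev_cong: "(\<And>i b. b \<in> Poly_Mapping.keys (fps_nth g i) \<Longrightarrow> F b = G b) \<Longrightarrow> ev F g = ev G g"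
  by (rule fps_ext) (auto intro: ev1_cong)

definition mon :: "'k \<Rightarrow> ('k \<Rightarrow>\<^sub>0 'f::comm_ring_1) fps" where "mon a = fps_const (sgl a 1)"

definition emb :: "'f fps \<Rightarrow> ('k::comm_monoid_add \<Rightarrow>\<^sub>0 'f::comm_ring_1) fps" where
  "emb c = Abs_fps (\<lambda>i. sgl 0 (fps_nth c i))"

lemma emb_nth [simp]: "fps_nth (emb c) i = sgl 0 (fps_nth c i)" by (simp add: emb_def)

lemma mon_zero [simp]: "mon (0 :: 'k::comm_monoid_add) = 1" by (simp add: mon_def)

lemma mon_add: "mon (a + b) = mon a * mon (b :: 'k::comm_monoid_add)"
  by (simp add: mon_def mult_single)

lemma ev_mon: "ev F (mon a * g) = ev (\<lambda>b. F (a + b)) g"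
  by (rule fps_ext) (simp add: mon_def ev1_single_mult)

lemma ev_X: "ev F (fps_X * g) = fps_X * ev F g"
  by (rule fps_ext) simp

lemma ev_emb: "ev F (emb c * g) = c * ev F g"
  by (rule fps_ext) (simp add: fps_mult_nth ev1_sum ev1_single_mult)

lemma single_zero_sum: "sgl k (\<Sum>i\<in>A. f i) = (\<Sum>i\<in>A. sgl k (f i))"
  by (induction A rule: infinite_finite_induct) (auto simp: single_add)

lemma emb_mult: "emb (c * d) = emb c * emb d"
  by (rule fps_ext) (simp add: fps_mult_nth single_zero_sum mult_single)
lemma emb_add: "emb (c + d) = emb c + emb d" by (rule fps_ext) (simp add: single_add)
lemma emb_0 [simp]: "emb 0 = 0" by (rule fps_ext) simp
lemma emb_1 [simp]: "emb 1 = 1" by (rule fps_ext) simp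

definition scale_exp :: "nat \<Rightarrow> (nat \<Rightarrow> int) \<Rightarrow> nat \<Rightarrow> int" where "scale_exp i a = (\<lambda>k. int i * a k)"

definition geom :: "(nat \<Rightarrow> int) \<Rightarrow> 'f::comm_ring_1 laurent fps" where
  "geom a = Abs_fps (\<lambda>i. sgl (scale_exp i a) 1)"

definition lin :: "(nat \<Rightarrow> int) \<Rightarrow> 'f::comm_ring_1 laurent fps" where
  "lin a = 1 - fps_X * mon a"

lemma geom_nth [simp]: "fps_nth (geom a) i = sgl (scale_exp i a) 1" by (simp add: geom_def)

lemma scale_exp_0 [simp]: "scale_exp 0 a = 0" by (auto simp: scale_exp_def)
lemma scale_exp_Suc: "scale_exp (Suc i) a = a + scale_exp i a" by (auto simp: scale_exp_def algebra_simps)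

lemma lin_geom: "lin a * geom a = (1 :: 'f::comm_ring_1 laurent fps)"
proof (rule fps_ext)
  fix i
  have "fps_nth (fps_X * (mon a * (geom a :: 'f laurent fps))) i = (if i = 0 then 0 else sgl (scale_exp i a) 1)"
    by (cases i) (auto simp: mon_def mult_single scale_exp_Suc)
  moreover have "lin a * (geom a :: 'f laurent fps) = geom a - fps_X * (mon a * geom a)"
    by (simp add: lin_def algebra_simps)
  ultimately have "fps_nth (lin a * (geom a :: 'f laurent fps)) i = fps_nth (geom a) i - (if i = 0 then 0 else sgl (scale_exp i a) 1)"
    by (simp only: fps_sub_nth)
  then show "fps_nth (lin a * geom a) i = fps_nth (1 :: 'f laurent fps) i" by (cases i) simp_all
qed

section \<open>Supports of series and bounds on linear weights of exponents\<close>

definition exps_in :: "('k \<Rightarrow> bool) \<Rightarrow> ('k \<Rightarrow>\<^sub>0 'f::zero) fps \<Rightarrow> bool" where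
  "exps_in P g \<longleftrightarrow> (\<forall>i. \<forall>b\<in>Poly_Mapping.keys (fps_nth g i). P b)"

lemma exps_inI: "(\<And>i b. b \<in> Poly_Mapping.keys (fps_nth g i) \<Longrightarrow> P b) \<Longrightarrow> exps_in P g" by (auto simp: exps_in_def)
lemma exps_inD: "exps_in P g \<Longrightarrow> b \<in> Poly_Mapping.keys (fps_nth g i) \<Longrightarrow> P b" by (auto simp: exps_in_def)

lemma keys_sum_subset: "Poly_Mapping.keys (sum f A) \<subseteq> (\<Union>a\<in>A. Poly_Mapping.keys (f a))"
proof (induction A rule: infinite_finite_induct)
  case (insert x F)
  then show ?case using keys_add[of "f x" "sum f F"] by fastforce
qed auto

lemma exps_in_mult:
  assumes "exps_in P g" "exps_in Q h" "\<And>a b. P a \<Longrightarrow> Q b \<Longrightarrow> R (a + b)"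
  shows "exps_in R (g * h)"
proof (rule exps_inI)
  fix i b assume "b \<in> Poly_Mapping.keys (fps_nth (g * h) i)"
  then have "b \<in> Poly_Mapping.keys (\<Sum>j\<in>{0..i}. fps_nth g j * fps_nth h (i - j))"
    by (simp only: fps_mult_nth)
  from subsetD[OF keys_sum_subset this] obtain j
    where "b \<in> Poly_Mapping.keys (fps_nth g j * fps_nth h (i - j))" by (rule UN_E)
  from subsetD[OF keys_mult this] obtain x y
    where "x \<in> Poly_Mapping.keys (fps_nth g j)" "y \<in> Poly_Mapping.keys (fps_nth h (i - j))" "b = x + y"
    by auto
  then show "R b" using assms by (auto dest: exps_inD)
qed

lemma exps_in_add: "exps_in P g \<Longrightarrow> exps_in P h \<Longrightarrow> exps_in P (g + h)"
  unfolding exps_in_def using keys_add by fastforce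

lemma exps_in_1: "P 0 \<Longrightarrow> exps_in P 1"
  by (auto simp: exps_in_def fps_one_nth)

lemma exps_in_mon: "P a \<Longrightarrow> exps_in P (mon a)"
  by (auto simp: exps_in_def mon_def split: if_splits)

lemma lin_nth: "fps_nth (lin a) i = (if i = 0 then 1 else if i = 1 then - sgl a 1 else 0)"
  by (cases i) (auto simp: lin_def mon_def)

lemma exps_in_lin: "P 0 \<Longrightarrow> P a \<Longrightarrow> exps_in P (lin a)"
  by (auto simp: exps_in_def lin_nth in_keys_iff lookup_one lookup_single when_def split: if_splits)

lemma exps_in_geom: "(\<And>i. P (scale_exp i a)) \<Longrightarrow> exps_in P (geom a)"
  by (auto simp: exps_in_def)

lemma exps_in_emb: "P 0 \<Longrightarrow> exps_in P (emb c)"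
  by (auto simp: exps_in_def split: if_splits)

lemma exps_in_prod:
  assumes "\<And>i. i \<in> I \<Longrightarrow> exps_in (P i) (g i)" "Q {} (0 :: 'k::comm_monoid_add)"
    "\<And>i J a b. i \<in> I \<Longrightarrow> i \<notin> J \<Longrightarrow> J \<subseteq> I \<Longrightarrow> finite J \<Longrightarrow> P i a \<Longrightarrow> Q J b \<Longrightarrow> Q (insert i J) (a + b)" "finite I"
  shows "exps_in (Q I) (prod g I)"
proof -
  have "exps_in (Q J) (prod g J)" if "finite J" "J \<subseteq> I" for J
    using that
  proof (induction J rule: finite_induct)
    case empty then show ?case using assms(2) by (auto intro: exps_in_1)
  next
    case (insert i J)
    then show ?case using assms(1,3) by (auto intro!: exps_in_mult[of "P i" _ "Q J"])
  qed
  then show ?thesis using assms(4) by blast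
qed

definition additive_wt :: "((nat \<Rightarrow> int) \<Rightarrow> int) \<Rightarrow> bool" where
  "additive_wt \<theta> \<longleftrightarrow> (\<forall>a b. \<theta> (a + b) = \<theta> a + \<theta> b)"

lemma additive_wt_0: "additive_wt \<theta> \<Longrightarrow> \<theta> 0 = 0"
  unfolding additive_wt_def by (metis add.right_neutral add_cancel_right_right)

lemma additive_wt_scale_exp: "additive_wt \<theta> \<Longrightarrow> \<theta> (scale_exp i a) = int i * \<theta> a"
  by (induction i) (auto simp: additive_wt_0 scale_exp_Suc algebra_simps additive_wt_def)

definition wt_bound :: "((nat \<Rightarrow> int) \<Rightarrow> int) \<Rightarrow> int \<Rightarrow> 'f::comm_ring_1 laurent fps \<Rightarrow> bool" where
  "wt_bound \<theta> c g = exps_in (\<lambda>b. \<theta> b \<le> c) g"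

lemma wt_bound_mono: "wt_bound \<theta> c g \<Longrightarrow> c \<le> d \<Longrightarrow> wt_bound \<theta> d g" by (force simp: wt_bound_def exps_in_def)
lemma wt_bound_1: "additive_wt \<theta> \<Longrightarrow> c \<ge> 0 \<Longrightarrow> wt_bound \<theta> c 1" unfolding wt_bound_def by (rule exps_in_1) (simp add: additive_wt_0)
lemma wt_bound_mult: "additive_wt \<theta> \<Longrightarrow> wt_bound \<theta> c g \<Longrightarrow> wt_bound \<theta> d h \<Longrightarrow> wt_bound \<theta> (c + d) (g * h)"
  unfolding wt_bound_def by (rule exps_in_mult[where P = "\<lambda>b. \<theta> b \<le> c" and Q = "\<lambda>b. \<theta> b \<le> d"]) (auto simp: additive_wt_def)
lemma wt_bound_prod: "additive_wt \<theta> \<Longrightarrow> (\<And>i. i \<in> I \<Longrightarrow> wt_bound \<theta> (c i) (g i)) \<Longrightarrow> wt_bound \<theta> (\<Sum>i\<in>I. c i) (\<Prod>i\<in>I. g i)"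
  by (induction I rule: infinite_finite_induct) (auto intro: wt_bound_1 wt_bound_mult)
lemma wt_bound_lin: "additive_wt \<theta> \<Longrightarrow> wt_bound \<theta> (max 0 (\<theta> a)) (lin a)"
  unfolding wt_bound_def by (rule exps_in_lin) (auto simp: additive_wt_0)
lemma wt_bound_geom: "additive_wt \<theta> \<Longrightarrow> \<theta> a \<le> 0 \<Longrightarrow> wt_bound \<theta> 0 (geom a)"
  unfolding wt_bound_def by (rule exps_in_geom) (auto simp: additive_wt_scale_exp mult_nonneg_nonpos)
definition unit_exp :: "nat \<Rightarrow> nat \<Rightarrow> int" where "unit_exp k = (\<lambda>i. if i = k then 1 else 0)"

section \<open>Adjacent swaps, the dot action and antisymmetric functionals\<close>

definition swap_exp :: "nat \<Rightarrow> (nat \<Rightarrow> int) \<Rightarrow> nat \<Rightarrow> int" where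
  "swap_exp k a = a(k := a (Suc k), Suc k := a k)"

text \<open>Exchanges the shifted entries a_k + k and a_{k+1} + k + 1, hence a reflection centred at
  minus (0, 1, 2, ...). Its fixed points are the exponents with a_k = a_{k+1} + 1.\<close>

definition dot_swap :: "nat \<Rightarrow> (nat \<Rightarrow> int) \<Rightarrow> nat \<Rightarrow> int" where
  "dot_swap k a = a(k := a (Suc k) + 1, Suc k := a k - 1)"

lemma swap_exp_involution [simp]: "swap_exp k (swap_exp k a) = a" by (auto simp: swap_exp_def)
lemma swap_exp_add: "swap_exp k (a + b) = swap_exp k a + swap_exp k b" by (auto simp: swap_exp_def)
lemma swap_exp_0 [simp]: "swap_exp k 0 = 0" by (auto simp: swap_exp_def)
lemma swap_exp_scale_exp: "swap_exp k (scale_exp i a) = scale_exp i (swap_exp k a)" by (auto simp: swap_exp_def scale_exp_def)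
lemma inj_swap_exp: "inj (swap_exp k)" by (metis injI swap_exp_involution)
lemma dot_swap_eq: "dot_swap k a = (unit_exp k - unit_exp (Suc k)) + swap_exp k a" by (auto simp: dot_swap_def swap_exp_def unit_exp_def)

definition swap1 :: "nat \<Rightarrow> 'f::comm_ring_1 laurent \<Rightarrow> 'f laurent" where
  "swap1 k g = Poly_Mapping.map_key (swap_exp k) g"

lemma lookup_swap1 [simp]: "lk (swap1 k g) a = lk g (swap_exp k a)"
  unfolding swap1_def by (simp add: map_key.rep_eq inj_swap_exp)

lemma ev1_swap1: "ev1 F (swap1 k g) = ev1 (\<lambda>b. F (swap_exp k b)) g"
proof -
  have "Poly_Mapping.keys (swap1 k g) = swap_exp k ` Poly_Mapping.keys g"
    by (force simp: in_keys_iff image_iff intro: swap_exp_involution[symmetric])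
  moreover have "inj_on (swap_exp k) (Poly_Mapping.keys g)" using inj_swap_exp by (rule inj_on_subset) simp
  ultimately show ?thesis by (simp add: ev1_def sum.reindex)
qed

lemma swap1_mult: "swap1 k (g * h) = swap1 k g * swap1 k h"
proof (rule poly_mapping_eqI)
  fix c
  have e: "swap_exp k c = x + y \<longleftrightarrow> c = swap_exp k x + swap_exp k y" for x y
    by (metis swap_exp_add swap_exp_involution)
  show "lk (swap1 k (g * h)) c = lk (swap1 k g * swap1 k h) c"
    unfolding lookup_eq_ev1[of "swap1 k g * swap1 k h"] ev1_mult ev1_swap1
    by (simp add: lookup_eq_ev1[of "g * h"] ev1_mult e eq_commute[of c] eq_commute[of _ "swap_exp k c"])
qed

lemma swap1_add: "swap1 k (g + h) = swap1 k g + swap1 k h" by (rule poly_mapping_eqI) (simp add: lookup_add)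
lemma swap1_0 [simp]: "swap1 k 0 = 0" by (rule poly_mapping_eqI) simp
lemma swap1_sum: "swap1 k (sum f A) = (\<Sum>a\<in>A. swap1 k (f a))"
  by (induction A rule: infinite_finite_induct) (auto simp: swap1_add)
lemma swap1_single: "swap1 k (sgl a c) = sgl (swap_exp k a) c"
  by (rule poly_mapping_eqI) (auto simp: lookup_single when_def)
lemma swap1_1 [simp]: "swap1 k 1 = 1" using swap1_single[of k 0 1] by simp

definition swap_fps :: "nat \<Rightarrow> 'f::comm_ring_1 laurent fps \<Rightarrow> 'f laurent fps" where
  "swap_fps k g = Abs_fps (\<lambda>i. swap1 k (fps_nth g i))"

lemma swap_fps_nth [simp]: "fps_nth (swap_fps k g) i = swap1 k (fps_nth g i)" by (simp add: swap_fps_def)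

lemma swap_fps_mult: "swap_fps k (g * h) = swap_fps k g * swap_fps k h"
  by (rule fps_ext) (simp add: fps_mult_nth swap1_sum swap1_mult)
lemma swap_fps_add: "swap_fps k (g + h) = swap_fps k g + swap_fps k h" by (rule fps_ext) (simp add: swap1_add)
lemma swap_fps_1 [simp]: "swap_fps k 1 = 1" by (rule fps_ext) (simp add: fps_one_nth)
lemma swap_fps_prod: "swap_fps k (prod f A) = (\<Prod>a\<in>A. swap_fps k (f a))"
  by (induction A rule: infinite_finite_induct) (auto simp: swap_fps_mult)
lemma swap_fps_mon: "swap_fps k (mon a) = mon (swap_exp k a)" by (rule fps_ext) (simp add: mon_def swap1_single)
lemma swap_fps_emb: "swap_fps k (emb c) = emb c" by (rule fps_ext) (simp add: swap1_single)
lemma swap_fps_geom: "swap_fps k (geom a) = geom (swap_exp k a)" by (rule fps_ext) (simp add: swap1_single swap_exp_scale_exp)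
lemma swap_fps_lin: "swap_fps k (lin a) = (lin (swap_exp k a) :: 'f::comm_ring_1 laurent fps)"
proof (rule fps_ext)
  have "swap1 k (- sgl a (1 :: 'f)) = - sgl (swap_exp k a) 1" by (simp add: swap1_single flip: single_uminus)
  then show "fps_nth (swap_fps k (lin a)) i = fps_nth (lin (swap_exp k a) :: 'f laurent fps) i" for i by (simp add: lin_nth)
qed

definition antisym_fun :: "nat \<Rightarrow> ((nat \<Rightarrow> int) \<Rightarrow> 'f::comm_ring_1) \<Rightarrow> bool" where
  "antisym_fun n F \<longleftrightarrow> (\<forall>k a. Suc k < n \<longrightarrow> F (dot_swap k a) = - F a)"

definition symm_fps :: "nat \<Rightarrow> 'f::comm_ring_1 laurent fps \<Rightarrow> bool" where
  "symm_fps n g \<longleftrightarrow> (\<forall>k. Suc k < n \<longrightarrow> swap_fps k g = g)"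

lemma symm_fps_mult: "symm_fps n g \<Longrightarrow> symm_fps n h \<Longrightarrow> symm_fps n (g * h)" by (simp add: symm_fps_def swap_fps_mult)

lemma ev_swap_fps: "ev F (swap_fps k g) = ev (\<lambda>b. F (swap_exp k b)) g"
  by (rule fps_ext) (simp add: ev1_swap1)

text \<open>The dot action moved from the functional to the series: the shift of the reflection
  becomes the factor z_k/z_{k+1}.\<close>

lemma ev_antisym_fun:
  assumes "antisym_fun n F" "Suc k < n"
  shows "ev F (mon (unit_exp k - unit_exp (Suc k)) * swap_fps k g) = - ev F g"
proof -
  have "ev F (mon (unit_exp k - unit_exp (Suc k)) * swap_fps k g) = ev (\<lambda>b. F (dot_swap k b)) g"
    by (simp add: ev_mon ev_swap_fps dot_swap_eq)
  also have "\<dots> = ev (\<lambda>b. - 1 * F b) g"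
    by (rule ev_cong) (use assms in \<open>simp add: antisym_fun_def\<close>)
  also have "\<dots> = - ev F g" by (simp only: ev_fun_scale) (simp flip: fps_const_neg)
  finally show ?thesis .
qed

section \<open>The functional K and two Littlewood identities\<close>

definition two_unit :: "nat \<Rightarrow> nat \<Rightarrow> int" where "two_unit n = (\<lambda>k. if k = n then 2 else 0)"

lemma unit_exp_double: "unit_exp n + unit_exp n = two_unit n" "2 * unit_exp n = two_unit n"
  by (auto simp: two_unit_def unit_exp_def)

definition shifted_list :: "nat \<Rightarrow> (nat \<Rightarrow> int) \<Rightarrow> int list" where
  "shifted_list n a = map (\<lambda>k. a k + int k) (rev [0..<n])"

definition shifted_list_without :: "nat \<Rightarrow> nat \<Rightarrow> (nat \<Rightarrow> int) \<Rightarrow> int list" where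
  "shifted_list_without n j a = map (\<lambda>k. a k + int k) (filter (\<lambda>k. k \<noteq> j) (rev [0..<n]))"

definition K :: "nat \<Rightarrow> (nat \<Rightarrow> int) \<Rightarrow> 'f::comm_ring_1" where "K n a = even_char_list (shifted_list n a)"

lemma shifted_list_0 [simp]: "shifted_list 0 a = []" by (simp add: shifted_list_def)
lemma shifted_list_Suc: "shifted_list (Suc n) a = (a n + int n) # shifted_list n a" by (simp add: shifted_list_def)
lemma set_shifted_list: "set (shifted_list n a) = (\<lambda>k. a k + int k) ` {..<n}" by (auto simp: shifted_list_def)
lemma length_shifted_list [simp]: "length (shifted_list n a) = n" by (simp add: shifted_list_def)
lemma shifted_list_cong: "(\<And>k. k < n \<Longrightarrow> a k = b k) \<Longrightarrow> shifted_list n a = shifted_list n b" by (simp add: shifted_list_def)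
lemma K_cong: "(\<And>k. k < n \<Longrightarrow> a k = b k) \<Longrightarrow> K n a = K n b" unfolding K_def by (metis shifted_list_cong)
lemma K_0 [simp]: "K 0 a = 1" by (simp add: K_def)

lemma shifted_list_without_last: "shifted_list_without (Suc n) n a = shifted_list n a"
proof -
  have "filter (\<lambda>k. k \<noteq> n) (rev [0..<n]) = rev [0..<n]" by (simp add: filter_id_conv)
  then show ?thesis by (simp add: shifted_list_without_def shifted_list_def)
qed

lemma shifted_list_without_Suc: "j < n \<Longrightarrow> shifted_list_without (Suc n) j a = (a n + int n) # shifted_list_without n j a"
  by (simp add: shifted_list_without_def)

text \<open>Larger indices come first in the list, so index j stands at position n - 1 - j; this is
  the sign.\<close>

lemma altsum_shifted_list: "altsum w F (shifted_list n a) = (\<Sum>j<n. (-1) ^ (n - 1 - j) * (w (a j + int j) * F (shifted_list_without n j a)))"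
proof (induction n arbitrary: F)
  case (Suc n)
  have "(\<Sum>j<n. (-1) ^ (n - j) * (w (a j + int j) * F (shifted_list_without (Suc n) j a))) =
     - (\<Sum>j<n. (-1) ^ (n - 1 - j) * (w (a j + int j) * F ((a n + int n) # shifted_list_without n j a)))"
    unfolding sum_negf[symmetric]
  proof (rule sum.cong)
    fix j assume j: "j \<in> {..<n}"
    then have "n - j = Suc (n - 1 - j)" by auto
    then show "(-1) ^ (n - j) * (w (a j + int j) * F (shifted_list_without (Suc n) j a)) =
      - ((-1) ^ (n - 1 - j) * (w (a j + int j) * F ((a n + int n) # shifted_list_without n j a)))"
      using j by (simp only: shifted_list_without_Suc lessThan_iff power_Suc) simp
  qed simp
  then show ?case by (simp add: shifted_list_Suc Suc.IH shifted_list_without_last)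
qed simp

lemma K_antisym_fun: "antisym_fun n (K n)"
  unfolding antisym_fun_def
proof (intro allI impI)
  fix k a assume k: "Suc k < n"
  have split: "rev [0..<n] = rev [Suc (Suc k)..<n] @ Suc k # k # rev [0..<k]"
  proof -
    have "[0..<n] = [0..<k] @ k # Suc k # [Suc (Suc k)..<n]"
      using k by (metis Suc_lessD le0 less_or_eq_imp_le upt_add_eq_append upt_conv_Cons le_add_diff_inverse)
    then show ?thesis by simp
  qed
  let ?p = "map (\<lambda>k. a k + int k) (rev [Suc (Suc k)..<n])" and ?q = "map (\<lambda>k. a k + int k) (rev [0..<k])"
  have "shifted_list n a = ?p @ (a (Suc k) + int (Suc k)) # (a k + int k) # ?q"
    unfolding shifted_list_def split by simp
  moreover have "shifted_list n (dot_swap k a) = ?p @ (a k + int k) # (a (Suc k) + int (Suc k)) # ?q"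
    unfolding shifted_list_def split by (simp add: dot_swap_def)
  ultimately show "K n (dot_swap k a) = - K n a" by (simp only: K_def even_char_list_swap[of ?p "a k + int k"])
qed

lemma K_neg: "k < n \<Longrightarrow> a k + int k < 0 \<Longrightarrow> K n a = 0"
  unfolding K_def by (rule even_char_list_neg[of "a k + int k"]) (auto simp: set_shifted_list)

text \<open>The convention is that index \<open>n - 1\<close> carries the largest part.\<close>

definition dominant :: "nat \<Rightarrow> (nat \<Rightarrow> int) \<Rightarrow> bool" where
  "dominant n a \<longleftrightarrow> (\<forall>k l. k \<le> l \<longrightarrow> l < n \<longrightarrow> a k \<le> a l)"

lemma dominant_Suc: "dominant (Suc n) a \<Longrightarrow> dominant n a" by (auto simp: dominant_def)

lemma K_large:
  assumes "a n + int n \<ge> 0" "\<And>k. k < n \<Longrightarrow> a k + int k < a n + int n"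
  shows "K (Suc n) a = (if even (a n) then K n a else 0)"
  unfolding K_def shifted_list_Suc using assms by (subst even_char_list_large) (auto simp: set_shifted_list)

lemma K_dominant:
  assumes "dominant n a"
  shows "K n a = (if \<forall>k<n. a k \<ge> 0 \<and> even (a k) then 1 else 0)"
  using assms
proof (induction n)
  case (Suc n)
  show ?case
  proof (cases "a 0 < 0")
    case True
    then show ?thesis using K_neg[of 0 "Suc n" a] by force
  next
    case False
    have le: "a k \<le> a n" if "k \<le> n" for k using Suc.prems that by (auto simp: dominant_def)
    have "K (Suc n) a = (if even (a n) then K n a else 0)"
    proof (rule K_large)
      show "a n + int n \<ge> 0" using le[of 0] False by simp
      show "a k + int k < a n + int n" if "k < n" for k using le[of k] that by simp
    qed
    then show ?thesis using Suc.IH[OF dominant_Suc[OF Suc.prems]] le[of 0] False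
      by (auto simp: less_Suc_eq)
  qed
qed simp

text \<open>One term of the alternating sum in \<open>even_char_list_step'\<close>: with top entry
  a_n + n, the entry to be deleted is the one exceeding it by 1. The value depends on a_j and a_n
  only through a_j - a_n, and this is all that the cancellations below exploit.\<close>

definition step_term :: "nat \<Rightarrow> nat \<Rightarrow> (nat \<Rightarrow> int) \<Rightarrow> 'f::comm_ring_1" where
  "step_term n j a = (if a j + int j = a n + int n + 1 then even_char_list (shifted_list_without n j a) else 0)"

lemma K_step:
  assumes "a n + int n \<ge> - 1"
  shows "K (Suc n) (a + two_unit n) - K (Suc n) a = (\<Sum>j<n. (-1) ^ (n - 1 - j) * (step_term n j a :: 'c::comm_ring_1))"
proof (cases "\<exists>k<n. a k + int k < 0")
  case True
  then obtain k where k: "k < n" "a k + int k < 0" by auto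
  have "step_term n j a = (0 :: 'c)" for j
  proof (cases "j = k")
    \<comment> \<open>The hypothesis -1 enters here: the entry to be deleted would have to be a n +
      int n + 1, which is nonnegative, while entry k is negative.\<close>
    case True then show ?thesis using k assms by (simp add: step_term_def)
  next
    case False
    have "even_char_list (shifted_list_without n j a) = (0 :: 'c)"
      by (rule even_char_list_neg[of "a k + int k"]) (use k False in \<open>auto simp: shifted_list_without_def\<close>)
    then show ?thesis by (simp add: step_term_def)
  qed
  moreover have "K (Suc n) (a + two_unit n) = (0 :: 'c)" "K (Suc n) a = (0 :: 'c)"
    using k by (auto intro!: K_neg[of k] simp: unit_exp_def two_unit_def)
  ultimately show ?thesis by simp
next
  case False
  have "shifted_list n (a + two_unit n) = shifted_list n a" by (rule shifted_list_cong) (simp add: unit_exp_def two_unit_def)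
  then have "K (Suc n) (a + two_unit n) - K (Suc n) a =
      (even_char_list ((a n + int n + 2) # shifted_list n a) - even_char_list ((a n + int n) # shifted_list n a) :: 'c)"
    by (simp add: K_def shifted_list_Suc unit_exp_def two_unit_def add_ac)
  also have "\<dots> = altsum (\<lambda>y. if y = a n + int n + 1 then 1 else 0) even_char_list (shifted_list n a)"
    by (rule even_char_list_step'[OF assms]) (use False in \<open>auto simp: set_shifted_list\<close>)
  also have "\<dots> = (\<Sum>j<n. (-1) ^ (n - 1 - j) * step_term n j a)"
    unfolding altsum_shifted_list by (rule sum.cong) (auto simp: step_term_def)
  finally show ?thesis .
qed

lemma step_term_cong: "(\<And>k. k < n \<Longrightarrow> k \<noteq> j \<Longrightarrow> a k = b k) \<Longrightarrow> a j - a n = b j - b n \<Longrightarrow> step_term n j a = step_term n j b"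
proof -
  assume 1: "\<And>k. k < n \<Longrightarrow> k \<noteq> j \<Longrightarrow> a k = b k" and 2: "a j - a n = b j - b n"
  have "shifted_list_without n j a = shifted_list_without n j b" unfolding shifted_list_without_def using 1 by (auto intro!: map_cong)
  moreover have "a j + int j = a n + int n + 1 \<longleftrightarrow> b j + int j = b n + int n + 1" using 2 by linarith
  ultimately show ?thesis by (simp add: step_term_def)
qed

text \<open>On such a functional the monomial z^u acts as 1, so any exponent inside a product may be
  shifted by u.\<close>

definition inv_under :: "(nat \<Rightarrow> int) \<Rightarrow> ((nat \<Rightarrow> int) \<Rightarrow> 'f) \<Rightarrow> bool" where
  "inv_under u F \<longleftrightarrow> (\<forall>b. F (u + b) = F b)"

lemma ev_mon_inv: "inv_under u F \<Longrightarrow> ev F (mon u * g) = ev F g"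
  unfolding ev_mon by (simp add: inv_under_def)

lemma ev_lin: "ev F (lin a * g) = ev F g - fps_X * ev F (mon a * g)"
  by (simp add: lin_def algebra_simps ev_diff ev_X)

lemma ev_lin_inv: "inv_under u F \<Longrightarrow> ev F (lin (u + a) * g) = ev F (lin a * g)"
  by (simp add: ev_lin mon_add mult.assoc ev_mon_inv)

lemma ev_prod_lin_inv:
  assumes "inv_under u F"
  shows "ev F ((\<Prod>k\<in>A. lin (u + a k)) * g) = ev F ((\<Prod>k\<in>A. lin (a k)) * g)"
proof (induction A arbitrary: g rule: infinite_finite_induct)
  case (insert x A)
  have "ev F ((\<Prod>k\<in>insert x A. lin (u + a k)) * g) = ev F ((\<Prod>k\<in>A. lin (u + a k)) * (lin (u + a x) * g))"
    using insert by (simp add: mult_ac)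
  also have "\<dots> = ev F (lin (u + a x) * ((\<Prod>k\<in>A. lin (a k)) * g))"
    unfolding insert.IH by (simp add: mult_ac)
  also have "\<dots> = ev F ((\<Prod>k\<in>insert x A. lin (a k)) * g)"
    unfolding ev_lin_inv[OF assms] using insert by (simp add: mult_ac)
  finally show ?case .
qed auto

lemma prod_lin_geom: "(\<Prod>k\<in>A. lin (a k)) * (\<Prod>k\<in>A. geom (a k)) = (1 :: 'f::comm_ring_1 laurent fps)"
  by (simp add: prod.distrib[symmetric] lin_geom)

section \<open>Products over pairs of variables\<close>

definition pairs_less :: "nat \<Rightarrow> (nat \<times> nat) set" where "pairs_less n = {(k, l). k < l \<and> l < n}"
definition pairs_le :: "nat \<Rightarrow> (nat \<times> nat) set" where "pairs_le n = {(k, l). k \<le> l \<and> l < n}"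

lemma finite_pairs_less [simp]: "finite (pairs_less n)" by (rule finite_subset[of _ "{..<n} \<times> {..<n}"]) (auto simp: pairs_less_def)
lemma finite_pairs_le [simp]: "finite (pairs_le n)" by (rule finite_subset[of _ "{..<n} \<times> {..<n}"]) (auto simp: pairs_le_def)
lemma pairs_less_0 [simp]: "pairs_less 0 = {}" by (auto simp: pairs_less_def)
lemma pairs_le_0 [simp]: "pairs_le 0 = {}" by (auto simp: pairs_le_def)

lemma pairs_less_Suc: "pairs_less (Suc n) = pairs_less n \<union> (\<lambda>k. (k, n)) ` {..<n}" "pairs_less n \<inter> (\<lambda>k. (k, n)) ` {..<n} = {}"
  by (auto simp: pairs_less_def)
lemma pairs_le_Suc: "pairs_le (Suc n) = pairs_le n \<union> (\<lambda>k. (k, n)) ` {..n}" "pairs_le n \<inter> (\<lambda>k. (k, n)) ` {..n} = {}"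
  by (auto simp: pairs_le_def)

lemma prod_pairs_less_Suc: "(\<Prod>p\<in>pairs_less (Suc n). f p) = (\<Prod>p\<in>pairs_less n. f p) * (\<Prod>k<n. f (k, n))"
  unfolding pairs_less_Suc(1) by (subst prod.union_disjoint) (auto simp: pairs_less_Suc(2) prod.reindex inj_on_def)
lemma prod_pairs_le_Suc: "(\<Prod>p\<in>pairs_le (Suc n). f p) = (\<Prod>p\<in>pairs_le n. f p) * (\<Prod>k<n. f (k, n)) * f (n, n)"
proof -
  have "(\<Prod>p\<in>pairs_le (Suc n). f p) = (\<Prod>p\<in>pairs_le n. f p) * (\<Prod>p\<in>(\<lambda>k. (k, n)) ` {..n}. f p)"
    unfolding pairs_le_Suc(1) by (rule prod.union_disjoint) (use pairs_le_Suc(2) in auto)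
  also have "(\<Prod>p\<in>(\<lambda>k. (k, n)) ` {..n}. f p) = (\<Prod>k\<in>{..n}. f (k, n))"
    by (simp add: prod.reindex inj_on_def)
  finally show ?thesis by (simp add: lessThan_Suc_atMost[symmetric] mult.assoc)
qed
lemma sum_pairs_less_Suc: "(\<Sum>p\<in>pairs_less (Suc n). f p) = (\<Sum>p\<in>pairs_less n. f p) + (\<Sum>k<n. f (k, n))"
  unfolding pairs_less_Suc(1) by (subst sum.union_disjoint) (auto simp: pairs_less_Suc(2) sum.reindex inj_on_def)

definition HH :: "nat \<Rightarrow> 'f::comm_ring_1 laurent fps" where "HH n = (\<Prod>p\<in>pairs_less n. lin (unit_exp (fst p) - unit_exp (snd p)))"
definition AA :: "nat \<Rightarrow> 'f::comm_ring_1 laurent fps" where "AA n = (\<Prod>p\<in>pairs_le n. geom (unit_exp (fst p) + unit_exp (snd p)))"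
definition BB :: "nat \<Rightarrow> 'f::comm_ring_1 laurent fps" where "BB n = (\<Prod>p\<in>pairs_less n. lin (unit_exp (fst p) + unit_exp (snd p)))"
definition GG :: "nat \<Rightarrow> 'f::comm_ring_1 laurent fps" where "GG n = (\<Prod>p\<in>pairs_less n. geom (unit_exp (fst p) - unit_exp (snd p)))"

lemma HH_Suc: "HH (Suc n) = HH n * (\<Prod>k<n. lin (unit_exp k - unit_exp n))" by (simp add: HH_def prod_pairs_less_Suc)
lemma AA_Suc: "AA (Suc n) = AA n * (\<Prod>k<n. geom (unit_exp k + unit_exp n)) * geom (two_unit n)"
  by (simp add: AA_def prod_pairs_le_Suc unit_exp_double)
lemma BB_Suc: "BB (Suc n) = BB n * (\<Prod>k<n. lin (unit_exp k + unit_exp n))" by (simp add: BB_def prod_pairs_less_Suc)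
lemma GG_Suc: "GG (Suc n) = GG n * (\<Prod>k<n. geom (unit_exp k - unit_exp n))" by (simp add: GG_def prod_pairs_less_Suc)

text \<open>The equation tested by \<open>step_term\<close> at a + b reads b_j - b_n = a_n - a_j + n
  + 1 - j. A series whose exponents stay below that value never meets it.\<close>

lemma step_term_theta:
  assumes "wt_bound (\<lambda>b. b j - b n) c g" "c < a n - a j + int n + 1 - int j"
  shows "ev (\<lambda>b. step_term n j (a + b)) g = 0"
proof -
  have "ev (\<lambda>b. step_term n j (a + b)) g = ev (\<lambda>b. 0) g"
  proof (rule ev_cong)
    fix i b assume "b \<in> Poly_Mapping.keys (fps_nth g i)"
    then have "b j - b n \<le> c" using assms(1) by (auto simp: wt_bound_def exps_in_def)
    then show "step_term n j (a + b) = 0" using assms(2) by (auto simp: step_term_def)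
  qed
  then show ?thesis by (simp add: fps_eq_iff ev1_def)
qed

lemma step_term_theta':
  assumes "wt_bound (\<lambda>b. b n - b j) c g" "c < a n - a j + int n + 1 - int j"
  shows "ev (\<lambda>b. step_term n j (a - b)) g = 0"
proof -
  have "ev (\<lambda>b. step_term n j (a - b)) g = ev (\<lambda>b. 0) g"
  proof (rule ev_cong)
    fix i b assume "b \<in> Poly_Mapping.keys (fps_nth g i)"
    then have "b n - b j \<le> c" using assms(1) by (auto simp: wt_bound_def exps_in_def)
    then show "step_term n j (a - b) = 0" using assms(2) by (auto simp: step_term_def)
  qed
  then show ?thesis by (simp add: fps_eq_iff ev1_def)
qed

lemma additive_wt_coord: "additive_wt (\<lambda>b. b j)" "additive_wt (\<lambda>b. - b j)" "additive_wt (\<lambda>b. b j - b k)" by (auto simp: additive_wt_def)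

text \<open>Counts the factors of \<open>HH\<close> with z_j in the numerator, which limits how far
  the exponent of z_j can rise there.\<close>

lemma sum_pairs_less_fst: "j < n \<Longrightarrow> (\<Sum>p\<in>pairs_less n. if fst p = j then 1 else 0) = int n - 1 - int j"
proof (induction n)
  case (Suc n)
  show ?case
  proof (cases "j = n")
    case True
    have "(\<Sum>p\<in>pairs_less n. if fst p = n then 1 else 0) = (\<Sum>p\<in>pairs_less n. 0 :: int)"
      by (rule sum.cong) (auto simp: pairs_less_def)
    then show ?thesis using True by (simp add: sum_pairs_less_Suc sum.delta')
  next
    case False
    then show ?thesis using Suc by (simp add: sum_pairs_less_Suc)
  qed
qed simp

lemma wt_bound_prod_lin:
  assumes "additive_wt \<theta>" "\<And>p. p \<in> I \<Longrightarrow> \<theta> (f p) \<le> c p" "\<And>p. p \<in> I \<Longrightarrow> 0 \<le> c p"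
  shows "wt_bound \<theta> (\<Sum>p\<in>I. c p) (\<Prod>p\<in>I. lin (f p))"
  by (rule wt_bound_prod[OF assms(1)]) (use assms in \<open>auto intro: wt_bound_mono[OF wt_bound_lin]\<close>)

lemma wt_bound_prod_geom:
  assumes "additive_wt \<theta>" "\<And>p. p \<in> I \<Longrightarrow> \<theta> (f p) \<le> 0"
  shows "wt_bound \<theta> 0 (\<Prod>p\<in>I. geom (f p))"
  using wt_bound_prod[OF assms(1), of I "\<lambda>_. 0" "\<lambda>p. geom (f p)"] assms by (simp add: wt_bound_geom)

lemma sgn_sum_zero:
  assumes "\<And>j. j < n \<Longrightarrow> ev (F j) g = 0"
  shows "ev (\<lambda>b. \<Sum>j<n. (-1) ^ (n - 1 - j) * F j b) g = 0"
  by (simp add: ev_fun_sum ev_fun_scale assms)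

lemma inv_step_term: "j < n \<Longrightarrow> inv_under (unit_exp n + unit_exp j) (\<lambda>b. step_term n j (a + b))"
  unfolding inv_under_def by (intro allI step_term_cong) (auto simp: unit_exp_def two_unit_def)

lemma inv_step_term': "j < n \<Longrightarrow> inv_under (- (unit_exp n + unit_exp j)) (\<lambda>b. step_term n j (a - b))"
  unfolding inv_under_def by (intro allI step_term_cong) (auto simp: unit_exp_def two_unit_def)

text \<open>
  On functionals invariant under \<open>z\<^sub>n z\<^sub>j\<close> the factors \<open>1 - q z\<^sub>k / z\<^sub>n\<close> become
  \<open>1 - q z\<^sub>k z\<^sub>j\<close> and cancel the factors of \<open>AA\<close> containing \<open>z\<^sub>j\<close>.
\<close>

lemma HA_remainder:
  assumes "j < n" "a j \<le> a n"
  shows "ev (\<lambda>b. step_term n j (a + b)) (HH (Suc n) * AA (Suc n)) = (0 :: 'f::comm_ring_1 fps)"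
proof -
  let ?F = "\<lambda>b. step_term n j (a + b) :: 'f"
  define P where "P = {p \<in> pairs_le n. fst p = j \<or> snd p = j}"
  define R where "R = (\<Prod>p\<in>pairs_le n - P. geom (unit_exp (fst p) + unit_exp (snd p)) :: 'f laurent fps)"
  \<comment> \<open>The pairs that contain j, one for each k < n; k = j stands for the factor with
    z_j squared.\<close>
  have P: "(\<Prod>p\<in>P. geom (unit_exp (fst p) + unit_exp (snd p))) = (\<Prod>k<n. geom (unit_exp j + unit_exp k) :: 'f laurent fps)"
    by (rule prod.reindex_bij_witness[of _ "\<lambda>k. (min k j, max k j)" "\<lambda>p. if fst p = j then snd p else fst p"])
      (use assms in \<open>auto simp: P_def pairs_le_def min_def max_def add.commute split: if_splits\<close>)
  have "AA n = (\<Prod>p\<in>P. geom (unit_exp (fst p) + unit_exp (snd p))) * R"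
    unfolding AA_def R_def by (subst prod.subset_diff[of P]) (auto simp: P_def mult.commute)
  then have A: "AA n = (\<Prod>k<n. geom (unit_exp j + unit_exp k)) * R" by (simp only: P)
  define g where "g = HH n * (R * ((\<Prod>k<n. geom (unit_exp k + unit_exp n)) * geom (two_unit n)))"
  have "HH (Suc n) * AA (Suc n) = (\<Prod>k<n. lin (unit_exp k - unit_exp n)) * ((\<Prod>k<n. geom (unit_exp j + unit_exp k)) * g)"
    by (simp add: HH_Suc AA_Suc A g_def mult_ac)
  moreover have "ev ?F ((\<Prod>k<n. lin (unit_exp k - unit_exp n)) * h) = ev ?F ((\<Prod>k<n. lin (unit_exp j + unit_exp k)) * h)" for h
  proof -
    have "unit_exp j + unit_exp k = (unit_exp n + unit_exp j) + (unit_exp k - unit_exp n)" for k by simp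
    then show ?thesis by (simp only: ev_prod_lin_inv[OF inv_step_term[OF assms(1)]])
  qed
  ultimately have "ev ?F (HH (Suc n) * AA (Suc n)) =
      ev ?F ((\<Prod>k<n. lin (unit_exp j + unit_exp k)) * ((\<Prod>k<n. geom (unit_exp j + unit_exp k)) * g))"
    by simp
  then have "ev ?F (HH (Suc n) * AA (Suc n)) = ev ?F g"
    by (simp only: mult.assoc[symmetric] prod_lin_geom mult_1_left)
  also have "\<dots> = 0"
  proof (rule step_term_theta)
    \<comment> \<open>After the cancellation only \<open>HH n\<close> can raise b_j - b_n, by 1 in
      each of n - 1 - j factors, whereas \<open>step_term\<close> demands at least n + 1 - j because
      a_j <= a_n.\<close>
    let ?t = "\<lambda>b :: nat \<Rightarrow> int. b j - b n"
    have "wt_bound ?t (\<Sum>p\<in>pairs_less n. if fst p = j then 1 else 0) (HH n :: 'f laurent fps)"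
      unfolding HH_def by (rule wt_bound_prod_lin) (use assms in \<open>auto simp: additive_wt_coord pairs_less_def unit_exp_def\<close>)
    then have 1: "wt_bound ?t (int n - 1 - int j) (HH n :: 'f laurent fps)" by (simp add: sum_pairs_less_fst assms)
    have 2: "wt_bound ?t 0 R" unfolding R_def
      by (rule wt_bound_prod_geom) (use assms in \<open>auto simp: P_def pairs_le_def unit_exp_def two_unit_def two_unit_def additive_wt_coord\<close>)
    have 3: "wt_bound ?t 0 (\<Prod>k<n. geom (unit_exp k + unit_exp n) :: 'f laurent fps)"
      by (rule wt_bound_prod_geom) (use assms in \<open>auto simp: unit_exp_def two_unit_def additive_wt_coord\<close>)
    have 4: "wt_bound ?t 0 (geom (two_unit n) :: 'f laurent fps)"
      by (rule wt_bound_geom) (use assms in \<open>auto simp: unit_exp_def two_unit_def additive_wt_coord\<close>)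
    show "wt_bound ?t (int n - 1 - int j) g"
      using wt_bound_mult[OF additive_wt_coord(3) 1 wt_bound_mult[OF additive_wt_coord(3) 2 wt_bound_mult[OF additive_wt_coord(3) 3 4]]]
      by (simp add: g_def)
  qed (use assms in auto)
  finally show ?thesis .
qed

text \<open>Only the n factors 1 - q z_k/z_n lower the exponent of z_n, each by at most 1. Together
  with a_n >= 0 this secures the hypothesis of \<open>K_step\<close> on the whole support.\<close>

lemma wt_bound_HA: "wt_bound (\<lambda>b. - b n) (int n) (HH (Suc n) * AA (Suc n) :: 'f::comm_ring_1 laurent fps)"
proof -
  let ?t = "\<lambda>b :: nat \<Rightarrow> int. - b n"
  have 1: "wt_bound ?t (\<Sum>p\<in>pairs_less n. 0) (HH n :: 'f laurent fps)" unfolding HH_def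
    by (rule wt_bound_prod_lin) (auto simp: additive_wt_coord pairs_less_def unit_exp_def)
  have 2: "wt_bound ?t (\<Sum>k<n. 1) (\<Prod>k<n. lin (unit_exp k - unit_exp n) :: 'f laurent fps)"
    by (rule wt_bound_prod_lin) (auto simp: additive_wt_coord unit_exp_def)
  have 3: "wt_bound ?t 0 (AA (Suc n) :: 'f laurent fps)" unfolding AA_def
    by (rule wt_bound_prod_geom) (auto simp: pairs_le_def unit_exp_def two_unit_def two_unit_def additive_wt_coord)
  show ?thesis
    using wt_bound_mult[OF additive_wt_coord(2) wt_bound_mult[OF additive_wt_coord(2) 1 2] 3] by (simp add: HH_Suc)
qed

lemma HA_step:
  assumes "dominant (Suc n) a" "a n \<ge> 0"
  shows "ev (\<lambda>b. K (Suc n) (a + two_unit n + b)) (HH (Suc n) * AA (Suc n)) =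
         ev (\<lambda>b. K (Suc n) (a + b)) (HH (Suc n) * AA (Suc n) :: 'f::comm_ring_1 laurent fps)"
proof -
  let ?g = "HH (Suc n) * AA (Suc n) :: 'f laurent fps"
  have "ev (\<lambda>b. K (Suc n) (a + two_unit n + b) - K (Suc n) (a + b)) ?g =
      ev (\<lambda>b. \<Sum>j<n. (-1) ^ (n - 1 - j) * step_term n j (a + b)) ?g"
  proof (rule ev_cong)
    fix i b assume "b \<in> Poly_Mapping.keys (fps_nth ?g i)"
    then have "- b n \<le> int n" using wt_bound_HA[of n, where 'f = 'f] by (auto simp: wt_bound_def exps_in_def)
    then have "(a + b) n + int n \<ge> - 1" using assms by simp
    then show "K (Suc n) (a + two_unit n + b) - K (Suc n) (a + b) =
       (\<Sum>j<n. (-1) ^ (n - 1 - j) * step_term n j (a + b) :: 'f)"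
      by (subst K_step[symmetric]) (auto simp: add_ac)
  qed
  also have "\<dots> = 0"
    by (rule sgn_sum_zero) (use assms in \<open>auto intro!: HA_remainder simp: dominant_def\<close>)
  finally show ?thesis by (simp add: ev_fun_diff)
qed

text \<open>Dual to \<open>HA_remainder\<close>: exponents enter negatively, and since z_n z_j acts
  as 1, the factor 1 - q z_k z_n turns into 1 - q z_k/z_j. Only the k < j find a partner to cancel
  in \<open>GG n\<close>; the rows k >= j are kept and bounded by weight.\<close>

lemma BG_remainder:
  assumes "j < n" "a j \<le> a n"
  shows "ev (\<lambda>b. step_term n j (a - b)) (BB (Suc n) * GG (Suc n)) = (0 :: 'f::comm_ring_1 fps)"
proof -
  let ?F = "\<lambda>b. step_term n j (a - b) :: 'f"
  define P where "P = {p \<in> pairs_less n. snd p = j}"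
  define R where "R = (\<Prod>p\<in>pairs_less n - P. geom (unit_exp (fst p) - unit_exp (snd p)) :: 'f laurent fps)"
  have P: "(\<Prod>p\<in>P. geom (unit_exp (fst p) - unit_exp (snd p))) = (\<Prod>k<j. geom (unit_exp k - unit_exp j) :: 'f laurent fps)"
    by (rule prod.reindex_bij_witness[of _ "\<lambda>k. (k, j)" fst])
      (use assms in \<open>auto simp: P_def pairs_less_def\<close>)
  have "GG n = (\<Prod>p\<in>P. geom (unit_exp (fst p) - unit_exp (snd p))) * R"
    unfolding GG_def R_def by (subst prod.subset_diff[of P]) (auto simp: P_def mult.commute)
  then have A: "GG n = (\<Prod>k<j. geom (unit_exp k - unit_exp j)) * R" by (simp only: P)
  have B: "(\<Prod>k<n. lin (unit_exp k + unit_exp n)) = (\<Prod>k<j. lin (unit_exp k + unit_exp n)) * (\<Prod>k=j..<n. lin (unit_exp k + unit_exp n) :: 'f laurent fps)"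
    using assms by (simp add: atLeast0LessThan[symmetric] prod.atLeastLessThan_concat)
  define g where "g = BB n * (R * ((\<Prod>k=j..<n. lin (unit_exp k + unit_exp n)) * (\<Prod>k<n. geom (unit_exp k - unit_exp n))))"
  have "BB (Suc n) * GG (Suc n) = (\<Prod>k<j. lin (unit_exp k + unit_exp n)) * ((\<Prod>k<j. geom (unit_exp k - unit_exp j)) * g)"
    by (simp add: BB_Suc GG_Suc A B g_def mult_ac)
  moreover have "ev ?F ((\<Prod>k<j. lin (unit_exp k + unit_exp n)) * h) = ev ?F ((\<Prod>k<j. lin (unit_exp k - unit_exp j)) * h)" for h
  proof -
    have "unit_exp k - unit_exp j = - (unit_exp n + unit_exp j) + (unit_exp k + unit_exp n)" for k by simp
    then show ?thesis by (simp only: ev_prod_lin_inv[OF inv_step_term'[OF assms(1)]])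
  qed
  ultimately have "ev ?F (BB (Suc n) * GG (Suc n)) =
      ev ?F ((\<Prod>k<j. lin (unit_exp k - unit_exp j)) * ((\<Prod>k<j. geom (unit_exp k - unit_exp j)) * g))"
    by simp
  then have "ev ?F (BB (Suc n) * GG (Suc n)) = ev ?F g"
    by (simp only: mult.assoc[symmetric] prod_lin_geom mult_1_left)
  also have "\<dots> = 0"
  proof (rule step_term_theta')
    let ?t = "\<lambda>b :: nat \<Rightarrow> int. b n - b j"
    have 1: "wt_bound ?t (\<Sum>p\<in>pairs_less n. 0) (BB n :: 'f laurent fps)" unfolding BB_def
      by (rule wt_bound_prod_lin) (use assms in \<open>auto simp: additive_wt_coord pairs_less_def unit_exp_def\<close>)
    have 2: "wt_bound ?t 0 R" unfolding R_def
      by (rule wt_bound_prod_geom) (use assms in \<open>auto simp: P_def pairs_less_def unit_exp_def two_unit_def additive_wt_coord\<close>)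
    \<comment> \<open>The factor with k = j raises b_n and b_j together, so it has weight 0; the
      other kept factors number n - 1 - j.\<close>
    have 3: "wt_bound ?t (\<Sum>k=j..<n. if k = j then 0 else 1) (\<Prod>k=j..<n. lin (unit_exp k + unit_exp n) :: 'f laurent fps)"
      by (rule wt_bound_prod_lin) (use assms in \<open>auto simp: additive_wt_coord unit_exp_def\<close>)
    have "(\<Sum>k=j..<n. if k = j then 0 else (1 :: int)) = (\<Sum>k=j..<n. 1 - (if k = j then 1 else 0))"
      by (rule sum.cong) auto
    also have "\<dots> = int n - 1 - int j" using assms by (simp add: sum_subtractf)
    finally have 5: "(\<Sum>k=j..<n. if k = j then 0 else (1 :: int)) = int n - 1 - int j" .
    have 4: "wt_bound ?t 0 (\<Prod>k<n. geom (unit_exp k - unit_exp n) :: 'f laurent fps)"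
      by (rule wt_bound_prod_geom) (use assms in \<open>auto simp: unit_exp_def two_unit_def additive_wt_coord\<close>)
    show "wt_bound ?t (int n - 1 - int j) g"
      using wt_bound_mult[OF additive_wt_coord(3) 1 wt_bound_mult[OF additive_wt_coord(3) 2 wt_bound_mult[OF additive_wt_coord(3) 3 4]]]
      by (simp add: g_def 5)
  qed (use assms in auto)
  finally show ?thesis .
qed

lemma wt_bound_BG: "wt_bound (\<lambda>b. b n) (int n) (BB (Suc n) * GG (Suc n) :: 'f::comm_ring_1 laurent fps)"
proof -
  let ?t = "\<lambda>b :: nat \<Rightarrow> int. b n"
  have 1: "wt_bound ?t (\<Sum>p\<in>pairs_less n. 0) (BB n :: 'f laurent fps)" unfolding BB_def
    by (rule wt_bound_prod_lin) (auto simp: additive_wt_coord pairs_less_def unit_exp_def)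
  have 2: "wt_bound ?t (\<Sum>k<n. 1) (\<Prod>k<n. lin (unit_exp k + unit_exp n) :: 'f laurent fps)"
    by (rule wt_bound_prod_lin) (auto simp: additive_wt_coord unit_exp_def)
  have 3: "wt_bound ?t 0 (GG (Suc n) :: 'f laurent fps)" unfolding GG_def
    by (rule wt_bound_prod_geom) (auto simp: pairs_less_def unit_exp_def two_unit_def additive_wt_coord)
  show ?thesis
    using wt_bound_mult[OF additive_wt_coord(1) wt_bound_mult[OF additive_wt_coord(1) 1 2] 3] by (simp add: BB_Suc)
qed

lemma BG_step:
  assumes "dominant (Suc n) a" "a n \<ge> 0"
  shows "ev (\<lambda>b. K (Suc n) (a + two_unit n - b)) (BB (Suc n) * GG (Suc n)) =
         ev (\<lambda>b. K (Suc n) (a - b)) (BB (Suc n) * GG (Suc n) :: 'f::comm_ring_1 laurent fps)"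
proof -
  let ?g = "BB (Suc n) * GG (Suc n) :: 'f laurent fps"
  have "ev (\<lambda>b. K (Suc n) (a + two_unit n - b) - K (Suc n) (a - b)) ?g =
      ev (\<lambda>b. \<Sum>j<n. (-1) ^ (n - 1 - j) * step_term n j (a - b)) ?g"
  proof (rule ev_cong)
    fix i b assume "b \<in> Poly_Mapping.keys (fps_nth ?g i)"
    then have "b n \<le> int n" using wt_bound_BG[of n, where 'f = 'f] by (auto simp: wt_bound_def exps_in_def)
    then have "(a - b) n + int n \<ge> - 1" using assms by simp
    then show "K (Suc n) (a + two_unit n - b) - K (Suc n) (a - b) =
       (\<Sum>j<n. (-1) ^ (n - 1 - j) * step_term n j (a - b) :: 'f)"
      by (subst K_step[symmetric]) (auto simp: algebra_simps)
  qed
  also have "\<dots> = 0"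
    by (rule sgn_sum_zero) (use assms in \<open>auto intro!: BG_remainder simp: dominant_def\<close>)
  finally show ?thesis by (simp add: ev_fun_diff)
qed

lemma scale_exp_two_unit: "scale_exp N (two_unit n) = (\<lambda>k. if k = n then 2 * int N else 0)"
  by (auto simp: scale_exp_def two_unit_def)

lemma dominant_shift: "dominant (Suc n) a \<Longrightarrow> dominant (Suc n) (a + scale_exp N (two_unit n))"
  unfolding dominant_def scale_exp_two_unit by (auto simp: less_Suc_eq_le) (metis add_increasing2 mult_nonneg_nonneg of_nat_0_le_iff order_refl zero_le_numeral)+

lemma HA_steps:
  assumes "dominant (Suc n) a" "a n \<ge> 0"
  shows "ev (\<lambda>b. K (Suc n) (a + scale_exp N (two_unit n) + b)) (HH (Suc n) * AA (Suc n)) =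
         ev (\<lambda>b. K (Suc n) (a + b)) (HH (Suc n) * AA (Suc n) :: 'f::comm_ring_1 laurent fps)"
proof (induction N)
  case (Suc N)
  have e: "a + scale_exp (Suc N) (two_unit n) = a + scale_exp N (two_unit n) + two_unit n"
    by (simp add: scale_exp_Suc add_ac)
  have "(a + scale_exp N (two_unit n)) n \<ge> 0" using assms(2) by (simp add: scale_exp_two_unit)
  from trans[OF HA_step[OF dominant_shift[OF assms(1)] this] Suc] show ?case unfolding e .
qed simp

lemma BG_steps:
  assumes "dominant (Suc n) a" "a n \<ge> 0"
  shows "ev (\<lambda>b. K (Suc n) (a + scale_exp N (two_unit n) - b)) (BB (Suc n) * GG (Suc n)) =
         ev (\<lambda>b. K (Suc n) (a - b)) (BB (Suc n) * GG (Suc n) :: 'f::comm_ring_1 laurent fps)"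
proof (induction N)
  case (Suc N)
  have e: "a + scale_exp (Suc N) (two_unit n) = a + scale_exp N (two_unit n) + two_unit n"
    by (simp add: scale_exp_Suc add_ac)
  have "(a + scale_exp N (two_unit n)) n \<ge> 0" using assms(2) by (simp add: scale_exp_two_unit)
  from trans[OF BG_step[OF dominant_shift[OF assms(1)] this] Suc] show ?case unfolding e .
qed simp

text \<open>Once the top shifted entry exceeds all others, \<open>K\<close> reduces to a parity test
  on it. How large N must be depends on the finite support, so it is chosen anew for each power of
  q.\<close>

lemma K_far:
  assumes "finite B"
  obtains N where "\<And>b. b \<in> B \<Longrightarrow> K (Suc n) (a + scale_exp N (two_unit n) + b) =
     (if even (a n + b n) then K n (a + b) else (0 :: 'f::comm_ring_1))"
proof -
  have "\<exists>N. \<forall>b\<in>B. \<forall>k\<le>n. \<bar>a k + b k\<bar> + int n < int N"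
    using assms
  proof (induction B rule: finite_induct)
    case (insert b B)
    then obtain N where N: "\<forall>b\<in>B. \<forall>k\<le>n. \<bar>a k + b k\<bar> + int n < int N" by auto
    define M where "M = (\<Sum>k\<le>n. \<bar>a k + b k\<bar>) + int n + 1"
    have "\<bar>a k + b k\<bar> \<le> (\<Sum>k\<le>n. \<bar>a k + b k\<bar>)" if "k \<le> n" for k
      by (rule member_le_sum) (use that in auto)
    then have "\<forall>k\<le>n. \<bar>a k + b k\<bar> + int n < M" by (force simp: M_def)
    then have "\<forall>b'\<in>insert b B. \<forall>k\<le>n. \<bar>a k + b' k\<bar> + int n < int (N + nat M)" using N by force
    then show ?case by blast
  qed auto
  then obtain N where N: "\<And>b k. b \<in> B \<Longrightarrow> k \<le> n \<Longrightarrow> \<bar>a k + b k\<bar> + int n < int N" by auto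
  have "K (Suc n) (a + scale_exp N (two_unit n) + b) = (if even (a n + b n) then K n (a + b) else (0 :: 'f))"
    if b: "b \<in> B" for b
  proof -
    let ?c = "a + scale_exp N (two_unit n) + b"
    have "K (Suc n) ?c = (if even (?c n) then K n ?c else (0 :: 'f))"
    proof (rule K_large)
      show "?c n + int n \<ge> 0" using N[OF b, of n] by (simp add: scale_exp_two_unit)
      show "?c k + int k < ?c n + int n" if "k < n" for k
        using N[OF b, of n] N[OF b, of k] that by (simp add: scale_exp_two_unit)
    qed
    moreover have "K n ?c = (K n (a + b) :: 'f)" by (rule K_cong) (simp add: scale_exp_two_unit)
    ultimately show ?thesis by (simp add: scale_exp_two_unit)
  qed
  then show thesis by (rule that)
qed

text \<open>With z^u acting as 1, the series 1/(1 - q z^u) becomes 1/(1 - q). Each variable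
  contributes one such factor through its square, hence the powers of 1 - q below.\<close>

lemma ev_geom_inv:
  assumes "inv_under u F"
  shows "(1 - fps_X) * ev F (geom u * g) = ev F g"
proof -
  have "ev F g = ev F (lin u * (geom u * g))" by (simp add: mult.assoc[symmetric] lin_geom)
  also have "\<dots> = (1 - fps_X) * ev F (geom u * g)"
    by (simp only: ev_lin ev_mon_inv[OF assms]) (simp only: left_diff_distrib mult_1_left)
  finally show ?thesis by simp
qed

lemma wt_bound_zero_coord:
  assumes "wt_bound (\<lambda>b. b n) 0 g" "wt_bound (\<lambda>b. - b n) 0 g" "b \<in> Poly_Mapping.keys (fps_nth g i)"
  shows "b n = 0"
  using assms by (force simp: wt_bound_def exps_in_def)

lemma coord_HA: "b \<in> Poly_Mapping.keys (fps_nth (HH n * AA n :: 'f::comm_ring_1 laurent fps) i) \<Longrightarrow> b n = 0"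
proof (rule wt_bound_zero_coord)
  have *: "wt_bound (\<lambda>b. c * b n) (0 + 0) (HH n * AA n :: 'f laurent fps)" for c
  proof (rule wt_bound_mult)
    have "wt_bound (\<lambda>b. c * b n) (\<Sum>p\<in>pairs_less n. 0) (HH n :: 'f laurent fps)"
      unfolding HH_def by (rule wt_bound_prod_lin) (auto simp: pairs_less_def unit_exp_def additive_wt_def algebra_simps)
    then show "wt_bound (\<lambda>b. c * b n) 0 (HH n :: 'f laurent fps)" by simp
    show "wt_bound (\<lambda>b. c * b n) 0 (AA n :: 'f laurent fps)"
      unfolding AA_def by (rule wt_bound_prod_geom) (auto simp: pairs_le_def unit_exp_def two_unit_def additive_wt_def algebra_simps)
  qed (auto simp: additive_wt_def algebra_simps)
  show "wt_bound (\<lambda>b. b n) 0 (HH n * AA n :: 'f laurent fps)" using *[of 1] by simp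
  show "wt_bound (\<lambda>b. - b n) 0 (HH n * AA n :: 'f laurent fps)" using *[of "- 1"] by simp
qed

lemma coord_BG: "b \<in> Poly_Mapping.keys (fps_nth (BB n * GG n :: 'f::comm_ring_1 laurent fps) i) \<Longrightarrow> b n = 0"
proof (rule wt_bound_zero_coord)
  have *: "wt_bound (\<lambda>b. c * b n) (0 + 0) (BB n * GG n :: 'f laurent fps)" for c
  proof (rule wt_bound_mult)
    have "wt_bound (\<lambda>b. c * b n) (\<Sum>p\<in>pairs_less n. 0) (BB n :: 'f laurent fps)"
      unfolding BB_def by (rule wt_bound_prod_lin) (auto simp: pairs_less_def unit_exp_def additive_wt_def algebra_simps)
    then show "wt_bound (\<lambda>b. c * b n) 0 (BB n :: 'f laurent fps)" by simp
    show "wt_bound (\<lambda>b. c * b n) 0 (GG n :: 'f laurent fps)"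
      unfolding GG_def by (rule wt_bound_prod_geom) (auto simp: pairs_less_def unit_exp_def additive_wt_def algebra_simps)
  qed (auto simp: additive_wt_def algebra_simps)
  show "wt_bound (\<lambda>b. b n) 0 (BB n * GG n :: 'f laurent fps)" using *[of 1] by simp
  show "wt_bound (\<lambda>b. - b n) 0 (BB n * GG n :: 'f laurent fps)" using *[of "- 1"] by simp
qed

text \<open>Steps of 2 push the top exponent to infinity without changing the value. The limit
  \<open>F\<close> sees z_n only through a parity, so the square of z_n acts as 1; then z_k/z_n may
  be read as z_k z_n, all factors linking z_n to the other variables cancel, and one variable has
  been removed.\<close>

lemma even_char_HH_AA:
  assumes "dominant n a" "\<And>k. k < n \<Longrightarrow> a k \<ge> 0"
  shows "(1 - fps_X) ^ n * ev (\<lambda>b. K n (a + b)) (HH n * AA n) =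
     (if \<forall>k<n. even (a k) then 1 else (0 :: 'f::comm_ring_1 fps))"
  using assms
proof (induction n)
  case 0
  have "ev (\<lambda>b. 1) 1 = (1 :: 'f fps)"
    by (rule fps_ext) (simp add: fps_one_nth flip: single_one)
  then show ?case by (simp add: HH_def AA_def)
next
  case (Suc n)
  let ?u = "two_unit n"
  let ?g = "HH (Suc n) * AA (Suc n) :: 'f laurent fps"
  define F :: "(nat \<Rightarrow> int) \<Rightarrow> 'f" where "F b = (if even (a n + b n) then K n (a + b) else 0)" for b
  have 1: "ev (\<lambda>b. K (Suc n) (a + b)) ?g = ev F ?g"
  proof (rule fps_ext)
    fix i
    obtain N where N: "\<And>b. b \<in> Poly_Mapping.keys (fps_nth ?g i) \<Longrightarrow> K (Suc n) (a + scale_exp N ?u + b) = F b"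
      unfolding F_def using K_far[of "Poly_Mapping.keys (fps_nth ?g i)" n a] by auto
    have "fps_nth (ev (\<lambda>b. K (Suc n) (a + b)) ?g) i = fps_nth (ev (\<lambda>b. K (Suc n) (a + scale_exp N ?u + b)) ?g) i"
      using HA_steps[OF Suc.prems(1), of N, where 'f = 'f] Suc.prems(2)[of n] by simp
    also have "\<dots> = ev1 F (fps_nth ?g i)" unfolding ev_nth by (rule ev1_cong) (rule N)
    finally show "fps_nth (ev (\<lambda>b. K (Suc n) (a + b)) ?g) i = fps_nth (ev F ?g) i" by simp
  qed
  have inv: "inv_under ?u F"
  proof -
    have "K n (a + (?u + b)) = (K n (a + b) :: 'f)" for b by (rule K_cong) (simp add: unit_exp_def two_unit_def)
    then show ?thesis by (simp add: inv_under_def F_def unit_exp_def two_unit_def)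
  qed
  define h where "h = HH n * AA n * geom ?u * (\<Prod>k<n. geom (unit_exp k + unit_exp n) :: 'f laurent fps)"
  have "ev F ?g = ev F ((\<Prod>k<n. lin (unit_exp k - unit_exp n)) * h)" by (simp add: HH_Suc AA_Suc h_def mult_ac)
  also have "\<dots> = ev F ((\<Prod>k<n. lin (?u + (unit_exp k - unit_exp n))) * h)" by (simp only: ev_prod_lin_inv[OF inv])
  also have "\<dots> = ev F ((\<Prod>k<n. lin (unit_exp k + unit_exp n)) * h)"
  proof -
    have "?u + (unit_exp k - unit_exp n) = unit_exp k + unit_exp n" for k by (auto simp: unit_exp_def two_unit_def)
    then show ?thesis by (simp only:)
  qed
  also have "(\<Prod>k<n. lin (unit_exp k + unit_exp n)) * h = geom ?u * (HH n * AA n) *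
      ((\<Prod>k<n. lin (unit_exp k + unit_exp n)) * (\<Prod>k<n. geom (unit_exp k + unit_exp n)))"
    by (simp add: h_def mult_ac)
  also have "\<dots> = geom ?u * (HH n * AA n)" by (simp only: prod_lin_geom mult_1_right)
  finally have 2: "(1 - fps_X) * ev F ?g = ev F (HH n * AA n)" by (simp only: ev_geom_inv[OF inv])
  have 3: "ev F (HH n * AA n) = (if even (a n) then ev (\<lambda>b. K n (a + b)) (HH n * AA n) else 0)"
  proof -
    have "ev F (HH n * AA n) = ev (\<lambda>b. (if even (a n) then 1 else 0) * K n (a + b)) (HH n * AA n)"
      by (rule ev_cong) (auto simp: F_def dest!: coord_HA)
    then show ?thesis by (simp only: ev_fun_scale) simp
  qed
  have "(1 - fps_X) ^ Suc n * ev (\<lambda>b. K (Suc n) (a + b)) ?g = (1 - fps_X) ^ n * ev F (HH n * AA n)"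
    unfolding 1 2[symmetric] by (simp add: mult_ac)
  also have "\<dots> = (if even (a n) then (1 - fps_X) ^ n * ev (\<lambda>b. K n (a + b)) (HH n * AA n) else 0)"
    by (cases "even (a n)") (simp_all only: 3 if_True if_False mult_zero_right)
  finally have 4: "(1 - fps_X) ^ Suc n * ev (\<lambda>b. K (Suc n) (a + b)) ?g = \<dots>" .
  have ih: "(1 - fps_X) ^ n * ev (\<lambda>b. K n (a + b)) (HH n * AA n) = (if \<forall>k<n. even (a k) then 1 else (0 :: 'f fps))"
    by (rule Suc.IH[OF dominant_Suc[OF Suc.prems(1)]]) (use Suc.prems(2) in simp)
  show ?case unfolding 4 ih by (auto simp: less_Suc_eq)
qed

text \<open>The argument of \<open>even_char_HH_AA\<close> with exponents negated. No power of 1 - q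
  arises, since \<open>BB\<close> and \<open>GG\<close> have no factor in a single variable.\<close>

lemma even_char_BB_GG:
  assumes "dominant n a" "\<And>k. k < n \<Longrightarrow> a k \<ge> 0"
  shows "ev (\<lambda>b. K n (a - b)) (BB n * GG n) = (if \<forall>k<n. even (a k) then 1 else (0 :: 'f::comm_ring_1 fps))"
  using assms
proof (induction n)
  case 0
  have "ev (\<lambda>b. 1) 1 = (1 :: 'f fps)"
    by (rule fps_ext) (simp add: fps_one_nth flip: single_one)
  then show ?case by (simp add: BB_def GG_def)
next
  case (Suc n)
  let ?u = "two_unit n"
  let ?g = "BB (Suc n) * GG (Suc n) :: 'f laurent fps"
  define F :: "(nat \<Rightarrow> int) \<Rightarrow> 'f" where "F b = (if even (a n - b n) then K n (a - b) else 0)" for b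
  have 1: "ev (\<lambda>b. K (Suc n) (a - b)) ?g = ev F ?g"
  proof (rule fps_ext)
    fix i
    obtain N where N: "\<And>b. b \<in> Poly_Mapping.keys (fps_nth ?g i) \<Longrightarrow> K (Suc n) (a + scale_exp N ?u + (- b)) = F b"
      unfolding F_def using K_far[of "uminus ` Poly_Mapping.keys (fps_nth ?g i)" n a]
      by (metis (no_types, lifting) add_uminus_conv_diff even_minus finite_imageI finite_keys imageI fun_Compl_def even_add uminus_apply even_diff)
    have "fps_nth (ev (\<lambda>b. K (Suc n) (a - b)) ?g) i = fps_nth (ev (\<lambda>b. K (Suc n) (a + scale_exp N ?u - b)) ?g) i"
      using BG_steps[OF Suc.prems(1), of N, where 'f = 'f] Suc.prems(2)[of n] by simp
    also have "\<dots> = ev1 F (fps_nth ?g i)" unfolding ev_nth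
      by (rule ev1_cong) (use N in simp)
    finally show "fps_nth (ev (\<lambda>b. K (Suc n) (a - b)) ?g) i = fps_nth (ev F ?g) i" by simp
  qed
  have inv: "inv_under (- ?u) F"
  proof -
    have "K n (a - (- ?u + b)) = (K n (a - b) :: 'f)" for b by (rule K_cong) (simp add: unit_exp_def two_unit_def)
    then show ?thesis unfolding inv_under_def F_def by (simp add: unit_exp_def two_unit_def)
  qed
  define h where "h = BB n * GG n * (\<Prod>k<n. geom (unit_exp k - unit_exp n) :: 'f laurent fps)"
  have e: "unit_exp k - unit_exp n = - ?u + (unit_exp k + unit_exp n)" for k by (auto simp: unit_exp_def two_unit_def)
  have "ev F ?g = ev F ((\<Prod>k<n. lin (unit_exp k + unit_exp n)) * h)" by (simp add: BB_Suc GG_Suc h_def mult_ac)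
  also have "\<dots> = ev F ((\<Prod>k<n. lin (unit_exp k - unit_exp n)) * h)" unfolding e by (simp only: ev_prod_lin_inv[OF inv])
  also have "(\<Prod>k<n. lin (unit_exp k - unit_exp n)) * h = BB n * GG n *
      ((\<Prod>k<n. lin (unit_exp k - unit_exp n)) * (\<Prod>k<n. geom (unit_exp k - unit_exp n)))"
    by (simp add: h_def mult_ac)
  also have "\<dots> = BB n * GG n" by (simp only: prod_lin_geom mult_1_right)
  finally have 2: "ev F ?g = ev F (BB n * GG n)" .
  have 3: "ev F (BB n * GG n) = (if even (a n) then ev (\<lambda>b. K n (a - b)) (BB n * GG n) else 0)"
  proof -
    have "ev F (BB n * GG n) = ev (\<lambda>b. (if even (a n) then 1 else 0) * K n (a - b)) (BB n * GG n)"
      by (rule ev_cong) (auto simp: F_def dest!: coord_BG)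
    then show ?thesis by (simp only: ev_fun_scale) simp
  qed
  have ih: "ev (\<lambda>b. K n (a - b)) (BB n * GG n) = (if \<forall>k<n. even (a k) then 1 else (0 :: 'f fps))"
    by (rule Suc.IH[OF dominant_Suc[OF Suc.prems(1)]]) (use Suc.prems(2) in simp)
  show ?case unfolding 1 2 3 ih by (auto simp: less_Suc_eq)
qed

section \<open>Adjacent transpositions\<close>

definition tr_idx :: "nat \<Rightarrow> nat \<Rightarrow> nat" where
  "tr_idx k i = (if i = k then Suc k else if i = Suc k then k else i)"

lemma swap_exp_unit_exp: "swap_exp k (unit_exp i) = unit_exp (tr_idx k i)" by (auto simp: swap_exp_def unit_exp_def tr_idx_def)
lemma swap_exp_minus: "swap_exp k (a - b) = swap_exp k a - swap_exp k b" by (auto simp: swap_exp_def)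

text \<open>The transposition reverses the pair k, k + 1, which is therefore left out, and keeps
  every other pair in order.\<close>

lemma prod_tr_idx_pairs_less:
  assumes "Suc k < n"
  shows "(\<Prod>p\<in>pairs_less n - {(k, Suc k)}. f (tr_idx k (fst p)) (tr_idx k (snd p))) = (\<Prod>p\<in>pairs_less n - {(k, Suc k)}. f (fst p) (snd p))"
  by (rule prod.reindex_bij_witness[of _ "\<lambda>p. (tr_idx k (fst p), tr_idx k (snd p))" "\<lambda>p. (tr_idx k (fst p), tr_idx k (snd p))"])
    (use assms in \<open>auto simp: pairs_less_def tr_idx_def split: if_splits\<close>)

lemma prod_tr_idx_pairs_le:
  assumes "Suc k < n" "\<And>i j. f i j = f j i"
  shows "(\<Prod>p\<in>pairs_le n. f (tr_idx k (fst p)) (tr_idx k (snd p))) = (\<Prod>p\<in>pairs_le n. f (fst p) (snd p))"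
proof (rule prod.reindex_bij_witness[of _
    "\<lambda>p. (min (tr_idx k (fst p)) (tr_idx k (snd p)), max (tr_idx k (fst p)) (tr_idx k (snd p)))"
    "\<lambda>p. (min (tr_idx k (fst p)) (tr_idx k (snd p)), max (tr_idx k (fst p)) (tr_idx k (snd p)))"])
  fix p assume p: "p \<in> pairs_le n"
  show "f (fst (min (tr_idx k (fst p)) (tr_idx k (snd p)), max (tr_idx k (fst p)) (tr_idx k (snd p))))
     (snd (min (tr_idx k (fst p)) (tr_idx k (snd p)), max (tr_idx k (fst p)) (tr_idx k (snd p)))) = f (tr_idx k (fst p)) (tr_idx k (snd p))"
    using assms(2) by (auto simp: min_def max_def)
qed (use assms(1) in \<open>auto simp: pairs_le_def tr_idx_def min_def max_def split: if_splits\<close>)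

lemma prod_tr_idx_pairs_less_both:
  assumes "Suc k < n" "\<And>i j. f i j = f j i"
  shows "(\<Prod>p\<in>pairs_less n. f (tr_idx k (fst p)) (tr_idx k (snd p))) = (\<Prod>p\<in>pairs_less n. f (fst p) (snd p))"
proof (rule prod.reindex_bij_witness[of _
    "\<lambda>p. (min (tr_idx k (fst p)) (tr_idx k (snd p)), max (tr_idx k (fst p)) (tr_idx k (snd p)))"
    "\<lambda>p. (min (tr_idx k (fst p)) (tr_idx k (snd p)), max (tr_idx k (fst p)) (tr_idx k (snd p)))"])
  fix p assume p: "p \<in> pairs_less n"
  show "f (fst (min (tr_idx k (fst p)) (tr_idx k (snd p)), max (tr_idx k (fst p)) (tr_idx k (snd p))))
     (snd (min (tr_idx k (fst p)) (tr_idx k (snd p)), max (tr_idx k (fst p)) (tr_idx k (snd p)))) = f (tr_idx k (fst p)) (tr_idx k (snd p))"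
    using assms(2) by (auto simp: min_def max_def)
qed (use assms(1) in \<open>auto simp: pairs_less_def tr_idx_def min_def max_def split: if_splits\<close>)

lemma symm_fps_AA: "symm_fps n (AA n)"
  unfolding symm_fps_def AA_def swap_fps_prod swap_fps_geom swap_exp_add swap_exp_unit_exp
  by (intro allI impI) (rule prod_tr_idx_pairs_le[where f = "\<lambda>i j. geom (unit_exp i + unit_exp j)"], auto simp: add.commute)

lemma symm_fps_BB: "symm_fps n (BB n)"
  unfolding symm_fps_def BB_def swap_fps_prod swap_fps_lin swap_exp_add swap_exp_unit_exp
  by (intro allI impI) (rule prod_tr_idx_pairs_less_both[where f = "\<lambda>i j. lin (unit_exp i + unit_exp j)"], auto simp: add.commute)

lemma pairs_less_remove: "Suc k < n \<Longrightarrow> prod f (pairs_less n) = f (k, Suc k) * prod f (pairs_less n - {(k, Suc k)})"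
  by (rule prod.remove[OF finite_pairs_less]) (simp add: pairs_less_def)

lemma HH_split:
  assumes "Suc k < n"
  obtains R where "HH n = lin (unit_exp k - unit_exp (Suc k)) * R" "swap_fps k R = (R :: 'f::comm_ring_1 laurent fps)"
proof (rule that)
  let ?R = "\<Prod>p\<in>pairs_less n - {(k, Suc k)}. lin (unit_exp (fst p) - unit_exp (snd p)) :: 'f laurent fps"
  show "HH n = lin (unit_exp k - unit_exp (Suc k)) * ?R" unfolding HH_def by (subst pairs_less_remove[OF assms]) simp
  show "swap_fps k ?R = ?R" unfolding swap_fps_prod swap_fps_lin swap_exp_minus swap_exp_unit_exp
    by (rule prod_tr_idx_pairs_less[OF assms, where f = "\<lambda>i j. lin (unit_exp i - unit_exp j)"])
qed

lemma GG_split: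
  assumes "Suc k < n"
  obtains R where "GG n = geom (unit_exp k - unit_exp (Suc k)) * R" "swap_fps k R = (R :: 'f::comm_ring_1 laurent fps)"
proof (rule that)
  let ?R = "\<Prod>p\<in>pairs_less n - {(k, Suc k)}. geom (unit_exp (fst p) - unit_exp (snd p)) :: 'f laurent fps"
  show "GG n = geom (unit_exp k - unit_exp (Suc k)) * ?R" unfolding GG_def by (subst pairs_less_remove[OF assms]) simp
  show "swap_fps k ?R = ?R" unfolding swap_fps_prod swap_fps_geom swap_exp_minus swap_exp_unit_exp
    by (rule prod_tr_idx_pairs_less[OF assms, where f = "\<lambda>i j. geom (unit_exp i - unit_exp j)"])
qed

text \<open>Hall--Littlewood straightening for adjacent exponents differing by one.\<close>

definition hl_relation :: "nat \<Rightarrow> ((nat \<Rightarrow> int) \<Rightarrow> 'f::comm_ring_1 fps) \<Rightarrow> bool" where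
  "hl_relation n X \<longleftrightarrow> (\<forall>k a. Suc k < n \<longrightarrow> a k = a (Suc k) + 1 \<longrightarrow> X a = fps_X * X (swap_exp k a))"

lemma eq_neg_zero_field: "(x :: 'f::field_char_0) = - x \<Longrightarrow> x = 0"
  by (metis add.right_inverse mult_2 mult_eq_0_iff zero_neq_numeral)

lemma eq_neg_zero_fps: "(x :: 'f::field_char_0 fps) = - x \<Longrightarrow> x = 0"
  by (rule fps_ext) (metis eq_neg_zero_field fps_neg_nth fps_zero_nth)

text \<open>Multiplying by the missing factor 1 - q z_{k+1}/z_k makes the product symmetric in the
  two variables, and z^a lies at a fixed point of the dot action. So the pairing equals its own
  negative; expanding the missing factor in the resulting 0 gives the relation.\<close>

lemma hl_relation_up:
  assumes "antisym_fun n F" "symm_fps n S"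
  shows "hl_relation n (\<lambda>a. ev (\<lambda>b. F (a + b)) (HH n * S :: 'f::field_char_0 laurent fps))"
  unfolding hl_relation_def
proof (intro allI impI)
  fix k a assume k: "Suc k < n" and a: "a k = a (Suc k) + (1 :: int)"
  let ?w = "unit_exp k - unit_exp (Suc k)"
  obtain R where R: "HH n = lin ?w * R" "swap_fps k R = (R :: 'f laurent fps)" by (rule HH_split[OF k])
  define g where "g = mon a * (lin (- ?w) * (lin ?w * (R * S)))"
  have sw: "swap_exp k a = - ?w + a" "swap_exp k ?w = - ?w" "swap_exp k (- ?w) = ?w"
    using a by (auto simp: swap_exp_def unit_exp_def)
  have "mon ?w * swap_fps k g = g"
    unfolding g_def swap_fps_mult swap_fps_mon swap_fps_lin sw R(2)
    using assms(2) k by (simp add: symm_fps_def mon_add mult_ac) (simp flip: mon_add mult.assoc)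
  then have "ev F g = - ev F g" using ev_antisym_fun[OF assms(1) k, of g] by simp
  then have "ev F g = 0" by (rule eq_neg_zero_fps)
  moreover have "g = lin (- ?w) * (mon a * (HH n * S))" by (simp add: g_def R(1) mult_ac)
  ultimately have "ev F (mon a * (HH n * S)) = fps_X * ev F (mon (- ?w + a) * (HH n * S))"
    by (simp add: ev_lin mon_add mult.assoc)
  then show "ev (\<lambda>b. F (a + b)) (HH n * S) = fps_X * ev (\<lambda>b. F (swap_exp k a + b)) (HH n * S)"
    unfolding sw(1) by (simp only: ev_mon)
qed

definition coeff_at :: "(nat \<Rightarrow> int) \<Rightarrow> 'f::comm_ring_1 laurent fps \<Rightarrow> 'f fps" where
  "coeff_at a y = Abs_fps (\<lambda>i. lk (fps_nth y i) a)"

lemma coeff_at_nth [simp]: "fps_nth (coeff_at a y) i = lk (fps_nth y i) a" by (simp add: coeff_at_def)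

lemma coeff_at_ev: "coeff_at a y = ev (\<lambda>b. if b = a then 1 else 0) y"
  by (rule fps_ext) (simp add: lookup_eq_ev1)

lemma coeff_at_mon: "coeff_at a (mon b * y) = coeff_at (a - b) y"
  unfolding coeff_at_ev ev_mon by (rule arg_cong[where f = "\<lambda>F. ev F y"]) (auto simp: fun_eq_iff algebra_simps)

lemma coeff_at_lin: "coeff_at a (lin b * y) = coeff_at a y - fps_X * coeff_at (a - b) y"
  unfolding coeff_at_mon[symmetric] by (simp add: coeff_at_ev ev_lin)

lemma coeff_at_swap_fps: "coeff_at a (swap_fps k y) = coeff_at (swap_exp k a) y" by (rule fps_ext) simp
lemma coeff_at_uminus: "coeff_at a (- y) = - coeff_at a y" by (simp add: coeff_at_ev ev_uminus)
lemma coeff_at_add: "coeff_at a (x + y) = coeff_at a x + coeff_at a y" by (simp add: coeff_at_ev ev_add)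
lemma coeff_at_diff: "coeff_at a (x - y) = coeff_at a x - coeff_at a y" by (simp add: coeff_at_ev ev_diff)
lemma coeff_at_sum: "coeff_at a (sum f A) = (\<Sum>i\<in>A. coeff_at a (f i))" by (simp add: coeff_at_ev ev_sum)
lemma coeff_at_emb: "coeff_at a (emb c * y) = c * coeff_at a y" by (simp add: coeff_at_ev ev_emb)

text \<open>Equivalently, the coefficients are antisymmetric under the dot action, as those of
  \<open>DL\<close> are.\<close>

definition skew :: "nat \<Rightarrow> 'f::comm_ring_1 laurent fps \<Rightarrow> bool" where
  "skew n y \<longleftrightarrow> (\<forall>k. Suc k < n \<longrightarrow> swap_fps k y = - (mon (unit_exp (Suc k) - unit_exp k) * y))"

lemma skew_mult: "skew n y \<Longrightarrow> symm_fps n S \<Longrightarrow> skew n (S * y)"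
  by (simp add: skew_def symm_fps_def swap_fps_mult mult_ac)
lemma swap_fps_0 [simp]: "swap_fps k 0 = 0" by (rule fps_ext) simp
lemma swap_fps_uminus: "swap_fps k (- y) = - swap_fps k y"
proof -
  have "swap_fps k y + swap_fps k (- y) = 0" using swap_fps_add[of k y "- y"] by simp
  then show ?thesis by (metis add_eq_0_iff)
qed
lemma swap_fps_diff: "swap_fps k (x - y) = swap_fps k x - swap_fps k y"
  using swap_fps_add[of k x "- y"] by (simp add: swap_fps_uminus)
lemma symm_fps_emb: "symm_fps n (emb c)" by (simp add: symm_fps_def swap_fps_emb)
lemma skew_emb: "skew n y \<Longrightarrow> skew n (emb c * y)" by (rule skew_mult[OF _ symm_fps_emb])
lemma skew_sum: "(\<And>i. i \<in> A \<Longrightarrow> skew n (f i)) \<Longrightarrow> skew n (sum f A)"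
proof (induction A rule: infinite_finite_induct)
  case (insert x F)
  have *: "skew n (a + b)" if "skew n a" "skew n b" for a b :: "'b laurent fps"
    using that unfolding skew_def by (simp add: swap_fps_add algebra_simps)
  show ?case using insert by (auto intro!: *)
qed (auto simp: skew_def)

text \<open>A skew series has coefficient 0 at a fixed point of the dot action. Without the factor
  of the pair k, k + 1, the product \<open>GG n * y\<close> is skew; its vanishing coefficient,
  rewritten by 1 - q z_k/z_{k+1}, is the relation.\<close>

lemma hl_relation_down:
  assumes "skew n (y :: 'f::field_char_0 laurent fps)"
  shows "hl_relation n (\<lambda>a. coeff_at a (GG n * y))"
  unfolding hl_relation_def
proof (intro allI impI)
  fix k a assume k: "Suc k < n" and a: "a k = a (Suc k) + (1 :: int)"
  let ?w = "unit_exp k - unit_exp (Suc k)"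
  obtain R where R: "GG n = geom ?w * R" "swap_fps k R = (R :: 'f laurent fps)" by (rule GG_split[OF k])
  have sw: "swap_exp k a = a - ?w" using a by (auto simp: swap_exp_def unit_exp_def)
  have m: "unit_exp (Suc k) - unit_exp k = - ?w" by simp
  have "swap_fps k (R * y) = - (mon (- ?w) * (R * y))"
    using assms k unfolding skew_def swap_fps_mult R(2) m by (simp add: mult_ac)
  then have "coeff_at (a - ?w) (swap_fps k (R * y)) = - coeff_at (a - ?w - - ?w) (R * y)"
    by (simp only: coeff_at_uminus coeff_at_mon)
  moreover have "swap_exp k (a - ?w) = a" "a - ?w - - ?w = a" using sw by (metis swap_exp_involution, simp)
  ultimately have "coeff_at a (R * y) = - coeff_at a (R * y)" by (simp only: coeff_at_swap_fps)
  then have "coeff_at a (R * y) = 0" by (rule eq_neg_zero_fps)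
  moreover have "R * y = lin ?w * (GG n * y)" by (simp add: R(1) mult.assoc[symmetric] lin_geom)
  ultimately show "coeff_at a (GG n * y) = fps_X * coeff_at (swap_exp k a) (GG n * y)"
    by (simp add: coeff_at_lin sw)
qed

lemma dominantI:
  assumes "\<And>k. Suc k < n \<Longrightarrow> a k \<le> a (Suc k)"
  shows "dominant n a"
  unfolding dominant_def
proof (intro allI impI)
  fix k l :: nat assume "k \<le> l" "l < n"
  then show "a k \<le> a l"
    by (induction l rule: dec_induct) (auto intro: order_trans assms)
qed

text \<open>Sorting by adjacent dot swaps ends at a dominant exponent or meets a fixed point, where
  antisymmetry gives 0. It terminates because \<open>W\<close> grows with every swap of an unsorted
  pair and is bounded by \<open>B\<close>, which the swaps preserve.\<close>

lemma antisym_fun_zero: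
  assumes "antisym_fun n (F :: _ \<Rightarrow> 'f::field_char_0)" "\<And>k a. Suc k < n \<Longrightarrow> P a \<Longrightarrow> P (dot_swap k a)"
    "\<And>a. P a \<Longrightarrow> dominant n a \<Longrightarrow> F a = 0"
  shows "P a \<Longrightarrow> F a = 0"
proof -
  define B where "B a = int n * (\<Sum>k<n. \<bar>a k + int k\<bar>)" for a
  define W where "W a = (\<Sum>k<n. int k * (a k + int k))" for a
  have split: "(\<Sum>i<n. g i) = g k + g (Suc k) + (\<Sum>i\<in>{..<n} - {k, Suc k}. g i)"
    if "Suc k < n" for g :: "nat \<Rightarrow> int" and k
  proof -
    have "(\<Sum>i<n. g i) = (\<Sum>i\<in>{..<n} - {k, Suc k}. g i) + (\<Sum>i\<in>{k, Suc k}. g i)"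
      by (rule sum.subset_diff) (use that in auto)
    then show ?thesis by simp
  qed
  have WB: "W a \<le> B a" for a
    unfolding W_def B_def sum_distrib_left
  proof (rule sum_mono)
    fix k assume "k \<in> {..<n}"
    then have "int k * (a k + int k) \<le> int k * \<bar>a k + int k\<bar>" "int k * \<bar>a k + int k\<bar> \<le> int n * \<bar>a k + int k\<bar>"
      by (auto intro!: mult_left_mono mult_right_mono)
    then show "int k * (a k + int k) \<le> int n * \<bar>a k + int k\<bar>" by linarith
  qed
  show "P a \<Longrightarrow> F a = 0"
  proof (induction "nat (B a - W a)" arbitrary: a rule: less_induct)
    case less
    show ?case
    proof (cases "dominant n a")
      case True then show ?thesis using less.prems assms(3) by blast
    next
      case False
      then obtain k where k: "Suc k < n" "a k > a (Suc k)" using dominantI[of n a] by force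
      have anti: "F (dot_swap k a) = - F a" using assms(1) k by (auto simp: antisym_fun_def)
      show ?thesis
      proof (cases "a k = a (Suc k) + 1")
        case True
        then have "dot_swap k a = a" by (auto simp: dot_swap_def)
        then show ?thesis using anti eq_neg_zero_field by metis
      next
        case ne: False
        have rest: "(\<Sum>i\<in>{..<n} - {k, Suc k}. h i (dot_swap k a i)) = (\<Sum>i\<in>{..<n} - {k, Suc k}. h i (a i))"
          for h :: "nat \<Rightarrow> int \<Rightarrow> int"
          by (rule sum.cong) (auto simp: dot_swap_def)
        have "B (dot_swap k a) = B a" unfolding B_def split[OF k(1)] rest[of "\<lambda>i x. \<bar>x + int i\<bar>"]
          by (simp add: dot_swap_def add_ac)
        moreover have "W (dot_swap k a) > W a" unfolding W_def split[OF k(1)] rest[of "\<lambda>i x. int i * (x + int i)"]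
          using k ne by (simp add: dot_swap_def algebra_simps)
        ultimately have "F (dot_swap k a) = 0"
          using WB[of "dot_swap k a"] less.prems k(1) assms(2) by (intro less.hyps) auto
        then show ?thesis using anti by simp
      qed
    qed
  qed
qed

lemma swap1_prod: "swap1 k (prod f A) = (\<Prod>a\<in>A. swap1 k (f a))"
  by (induction A rule: infinite_finite_induct) (auto simp: swap1_mult)
lemma swap1_uminus: "swap1 k (- y) = - swap1 k y"
proof -
  have "swap1 k y + swap1 k (- y) = 0" using swap1_add[of k y "- y"] by simp
  then show ?thesis by (metis add_eq_0_iff)
qed
lemma swap1_diff: "swap1 k (x - y) = swap1 k x - swap1 k y"
  using swap1_add[of k x "- y"] by (simp add: swap1_uminus)

section \<open>A Schur--Littlewood expansion\<close>

text \<open>The inverse of Littlewood's product at q = 1. The product itself is not a Laurent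
  polynomial there, so the identity is stated with its inverse.\<close>

definition UL :: "nat \<Rightarrow> 'f::comm_ring_1 laurent" where
  "UL n = (\<Prod>p\<in>pairs_le n. 1 - sgl (unit_exp (fst p) + unit_exp (snd p)) 1)"
definition DL :: "nat \<Rightarrow> 'f::comm_ring_1 laurent" where
  "DL n = (\<Prod>p\<in>pairs_less n. 1 - sgl (unit_exp (fst p) - unit_exp (snd p)) 1)"

lemma swap1_UL: "Suc k < n \<Longrightarrow> swap1 k (UL n) = UL n"
  unfolding UL_def swap1_prod swap1_diff swap1_1 swap1_single swap_exp_add swap_exp_unit_exp
  by (rule prod_tr_idx_pairs_le[where f = "\<lambda>i j. 1 - sgl (unit_exp i + unit_exp j) 1"]) (auto simp: add.commute)

lemma swap1_DL:
  assumes "Suc k < n"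
  shows "swap1 k (DL n) = - (sgl (unit_exp (Suc k) - unit_exp k) 1 * DL n :: 'f::comm_ring_1 laurent)"
proof -
  define R where "R = (\<Prod>p\<in>pairs_less n - {(k, Suc k)}. 1 - sgl (unit_exp (fst p) - unit_exp (snd p)) 1 :: 'f laurent)"
  have D: "DL n = (1 - sgl (unit_exp k - unit_exp (Suc k)) 1) * R"
    unfolding DL_def R_def by (subst pairs_less_remove[OF assms]) simp
  have "swap1 k R = R" unfolding R_def swap1_prod swap1_diff swap1_1 swap1_single swap_exp_minus swap_exp_unit_exp
    by (rule prod_tr_idx_pairs_less[OF assms, where f = "\<lambda>i j. 1 - sgl (unit_exp i - unit_exp j) 1"])
  moreover have "swap_exp k (unit_exp k - unit_exp (Suc k)) = unit_exp (Suc k) - unit_exp k"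
    by (simp add: swap_exp_minus swap_exp_unit_exp tr_idx_def)
  ultimately have "swap1 k (DL n) = (1 - sgl (unit_exp (Suc k) - unit_exp k) 1) * R"
    by (simp add: D swap1_mult swap1_diff swap1_single)
  also have "1 - sgl (unit_exp (Suc k) - unit_exp k) 1 =
     - (sgl (unit_exp (Suc k) - unit_exp k) 1 * (1 - sgl (unit_exp k - unit_exp (Suc k)) (1 :: 'f)))"
    by (simp add: right_diff_distrib mult_single)
  finally show ?thesis by (simp add: D mult_ac)
qed

lemma lookup_single_mult: "lk (sgl a c * g :: 'f::comm_ring_1 laurent) b = c * lk g (b - a)"
  unfolding lookup_eq_ev1[of "sgl a c * g"] lookup_eq_ev1[of g] ev1_single_mult
  by (rule arg_cong[where f = "\<lambda>F. c * ev1 F g"]) (auto simp: fun_eq_iff algebra_simps)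

lemma DL_antisym_fun: "antisym_fun n (lk (DL n :: 'f::comm_ring_1 laurent))"
  unfolding antisym_fun_def
proof (intro allI impI)
  fix k a assume k: "Suc k < n"
  have "lk (swap1 k (DL n)) (swap_exp k a) = - lk (DL n :: 'f laurent) (swap_exp k a - (unit_exp (Suc k) - unit_exp k))"
    unfolding swap1_DL[OF k] by (simp add: lookup_single_mult)
  moreover have "swap_exp k a - (unit_exp (Suc k) - unit_exp k) = dot_swap k a" by (simp add: dot_swap_eq)
  ultimately show "lk (DL n :: 'f laurent) (dot_swap k a) = - lk (DL n) a" by simp
qed

definition exps_in1 :: "((nat \<Rightarrow> int) \<Rightarrow> bool) \<Rightarrow> 'f::zero laurent \<Rightarrow> bool" where
  "exps_in1 P g \<longleftrightarrow> (\<forall>b\<in>Poly_Mapping.keys g. P b)"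

lemma exps_in1_mult:
  assumes "exps_in1 P g" "exps_in1 Q h" "\<And>a b. P a \<Longrightarrow> Q b \<Longrightarrow> R (a + b)"
  shows "exps_in1 R (g * h)"
  unfolding exps_in1_def
proof
  fix b assume "b \<in> Poly_Mapping.keys (g * h)"
  from subsetD[OF keys_mult this] show "R b" using assms by (auto simp: exps_in1_def)
qed

lemma exps_in1_prod:
  assumes "\<And>i. i \<in> I \<Longrightarrow> exps_in1 P (g i)" "P 0" "\<And>a b. P a \<Longrightarrow> P b \<Longrightarrow> P (a + b)"
  shows "exps_in1 P (prod g I)"
  using assms(1)
proof (induction I rule: infinite_finite_induct)
  case (insert x F)
  have "exps_in1 P (g x * prod g F)" by (rule exps_in1_mult[of P _ P]) (use insert assms(3) in auto)
  then show ?case using insert by simp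
qed (use assms(2) in \<open>auto simp: exps_in1_def\<close>)

lemma exps_in1_bin: "P 0 \<Longrightarrow> P a \<Longrightarrow> exps_in1 P (1 - sgl a 1 :: 'f::comm_ring_1 laurent)"
  by (auto simp: exps_in1_def in_keys_iff lookup_minus lookup_one lookup_single when_def split: if_splits)

lemma exps_in1_UL: "exps_in1 (\<lambda>b. (\<forall>k. b k \<ge> 0) \<and> (\<forall>k\<ge>n. b k = 0)) (UL n)"
  unfolding UL_def by (intro exps_in1_prod exps_in1_bin) (auto simp: unit_exp_def pairs_le_def)

lemma exps_in1_DL: "exps_in1 (\<lambda>b. b 0 \<ge> 0 \<and> b (n - 1) \<le> 0 \<and> (\<forall>k\<ge>n. b k = 0) \<and> (\<Sum>k<n. b k) = 0) (DL n :: 'f::comm_ring_1 laurent)"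
proof -
  have "(\<Sum>k<n. (unit_exp i - unit_exp j) k) = 0" if "i < n" "j < n" for i j
    using that by (simp add: unit_exp_def sum_subtractf)
  then show ?thesis
  unfolding DL_def by (intro exps_in1_prod exps_in1_bin) (auto simp: unit_exp_def pairs_less_def sum.distrib)
qed

lemma UL_Suc: "UL (Suc n) = (1 - sgl (two_unit n) 1) * (UL n * (\<Prod>k<n. 1 - sgl (unit_exp k + unit_exp n) 1))"
  by (simp add: UL_def prod_pairs_le_Suc unit_exp_double mult_ac)

lemma ev1_mul_bin: "ev1 F ((1 - sgl u 1) * g) = ev1 F g - ev1 (\<lambda>b. F (u + b)) g"
  by (simp add: left_diff_distrib ev1_diff ev1_single_mult)

text \<open>If 0 is the only exponent of minimal weight in both factors, the constant term of the
  product can arise only from the two constant terms.\<close>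

lemma lookup_mult_zero:
  assumes "exps_in1 (\<lambda>b. \<theta> b \<ge> 0 \<and> (\<theta> b = 0 \<longrightarrow> b = 0)) g"
    "exps_in1 (\<lambda>b. \<theta> b \<ge> 0 \<and> (\<theta> b = 0 \<longrightarrow> b = 0)) (h :: 'f::comm_ring_1 laurent)" "additive_wt \<theta>"
  shows "lk (g * h) 0 = lk g 0 * lk h 0"
proof -
  have "lk (g * h) 0 = ev1 (\<lambda>a. if a = 0 then lk h 0 else 0) g"
    unfolding lookup_eq_ev1[of "g * h"] ev1_mult
  proof (rule ev1_cong)
    fix a assume a: "a \<in> Poly_Mapping.keys g"
    have "ev1 (\<lambda>b. if a + b = 0 then 1 else 0) h = ev1 (\<lambda>b. (if a = 0 then 1 else 0) * (if b = 0 then 1 else 0)) h"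
    proof (rule ev1_cong)
      fix b assume b: "b \<in> Poly_Mapping.keys h"
      have "a + b = 0 \<longleftrightarrow> a = 0 \<and> b = 0"
      proof
        assume "a + b = 0"
        then have "\<theta> a + \<theta> b = 0" using assms(3) additive_wt_0[OF assms(3)] by (metis additive_wt_def)
        then show "a = 0 \<and> b = 0" using assms(1,2) a b by (auto simp: exps_in1_def add_nonneg_eq_0_iff)
      qed auto
      then show "(if a + b = 0 then 1 else 0) = (if a = 0 then 1 else 0) * (if b = 0 then 1 else (0 :: 'f))" by auto
    qed
    then show "ev1 (\<lambda>b. if a + b = 0 then 1 else 0) h = (if a = 0 then lk h 0 else 0)"
      by (simp add: ev1_scale flip: lookup_eq_ev1)
  qed
  also have "\<dots> = ev1 (\<lambda>a. lk h 0 * (if a = 0 then 1 else 0)) g" by (rule ev1_cong) auto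
  finally show ?thesis by (simp add: ev1_scale mult.commute flip: lookup_eq_ev1)
qed

lemma lookup_prod_zero:
  assumes "\<And>i. i \<in> I \<Longrightarrow> lk (g i) 0 = 1" "\<And>i. i \<in> I \<Longrightarrow> exps_in1 (\<lambda>b. \<theta> b \<ge> 0 \<and> (\<theta> b = 0 \<longrightarrow> b = 0)) (g i)" "additive_wt \<theta>"
  shows "lk (prod g I) 0 = (1 :: 'f::comm_ring_1)"
proof -
  let ?P = "\<lambda>b. \<theta> b \<ge> 0 \<and> (\<theta> b = 0 \<longrightarrow> b = 0)"
  have add: "?P (a + b)" if "?P a" "?P b" for a b
    using that assms(3) by (auto simp: additive_wt_def add_nonneg_eq_0_iff)
  have mul: "lk (g * h) 0 = lk g 0 * lk h 0" if "exps_in1 ?P g" "exps_in1 ?P h" for g h :: "'f laurent"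
    using that assms(3) by (rule lookup_mult_zero)
  show ?thesis using assms(1,2)
  proof (induction I rule: infinite_finite_induct)
    case (insert x F)
    have "exps_in1 ?P (prod g F)"
    proof (rule exps_in1_prod)
      show "exps_in1 ?P (g i)" if "i \<in> F" for i by (rule insert.prems(2)) (use that in simp)
    qed (use add additive_wt_0[OF assms(3)] in simp_all)
    moreover have "exps_in1 ?P (g x)" by (rule insert.prems(2)) simp
    moreover have "lk (g x) 0 = 1" by (rule insert.prems(1)) simp
    moreover have "lk (prod g F) 0 = 1" by (rule insert.IH) (use insert.prems in auto)
    ultimately show ?case unfolding prod.insert[OF insert.hyps] by (simp only: mul mult_1_left)
  qed auto
qed

definition weight :: "(nat \<Rightarrow> int) \<Rightarrow> nat \<Rightarrow> (nat \<Rightarrow> int) \<Rightarrow> int" where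
  "weight c n b = (\<Sum>k<n. c k * b k)"

lemma additive_wt_weight: "additive_wt (weight c n)"
  by (simp add: additive_wt_def weight_def sum.distrib algebra_simps)

lemma weight_unit_exp: "k < n \<Longrightarrow> weight c n (unit_exp k) = c k"
  by (simp add: weight_def unit_exp_def if_distrib sum.delta' cong: if_cong)

lemma additive_wt_minus: "additive_wt \<theta> \<Longrightarrow> \<theta> (a - b) = \<theta> a - \<theta> b"
  unfolding additive_wt_def by (metis add_diff_cancel_right' diff_add_cancel)

lemma lookup_UL_0: "lk (UL n) 0 = (1 :: 'f::comm_ring_1)"
  unfolding UL_def
proof (rule lookup_prod_zero[OF _ _ additive_wt_weight[of "\<lambda>_. 1" n]])
  fix p assume p: "p \<in> pairs_le n"
  have w: "weight (\<lambda>_. 1) n (unit_exp (fst p) + unit_exp (snd p)) = 2"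
    using additive_wt_weight[of "\<lambda>_. 1" n] p by (auto simp: additive_wt_def weight_unit_exp pairs_le_def)
  then have "unit_exp (fst p) + unit_exp (snd p) \<noteq> 0" using additive_wt_0[OF additive_wt_weight] by (metis zero_neq_numeral)
  then show "lk (1 - sgl (unit_exp (fst p) + unit_exp (snd p)) 1) 0 = (1 :: 'f)"
    by (simp add: lookup_minus lookup_single)
  show "exps_in1 (\<lambda>b. weight (\<lambda>_. 1) n b \<ge> 0 \<and> (weight (\<lambda>_. 1) n b = 0 \<longrightarrow> b = 0)) (1 - sgl (unit_exp (fst p) + unit_exp (snd p)) 1 :: 'f laurent)"
    by (rule exps_in1_bin) (simp_all add: w additive_wt_0[OF additive_wt_weight])
qed

lemma lookup_DL_0: "lk (DL n) 0 = (1 :: 'f::comm_ring_1)"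
  unfolding DL_def
proof (rule lookup_prod_zero[OF _ _ additive_wt_weight[of "\<lambda>k. - int k" n]])
  fix p assume p: "p \<in> pairs_less n"
  have w: "weight (\<lambda>k. - int k) n (unit_exp (fst p) - unit_exp (snd p)) > 0"
    using p by (auto simp: additive_wt_minus[OF additive_wt_weight] weight_unit_exp pairs_less_def)
  then have "unit_exp (fst p) - unit_exp (snd p) \<noteq> 0" using additive_wt_0[OF additive_wt_weight] by (metis less_irrefl)
  then show "lk (1 - sgl (unit_exp (fst p) - unit_exp (snd p)) 1) 0 = (1 :: 'f)"
    by (simp add: lookup_minus lookup_single)
  show "exps_in1 (\<lambda>b. weight (\<lambda>k. - int k) n b \<ge> 0 \<and> (weight (\<lambda>k. - int k) n b = 0 \<longrightarrow> b = 0)) (1 - sgl (unit_exp (fst p) - unit_exp (snd p)) 1 :: 'f laurent)"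
    by (rule exps_in1_bin) (use w in \<open>simp_all add: additive_wt_0[OF additive_wt_weight]\<close>)
qed

lemma sum_dot_swap:
  assumes "Suc k < n"
  shows "(\<Sum>i<n. dot_swap k a i) = (\<Sum>i<n. a i)"
proof -
  have "(\<Sum>i<n. g i) = (\<Sum>i\<in>{..<n} - {k, Suc k}. g i) + (\<Sum>i\<in>{k, Suc k}. g i)" for g :: "nat \<Rightarrow> int"
    by (rule sum.subset_diff) (use assms in auto)
  moreover have "(\<Sum>i\<in>{..<n} - {k, Suc k}. dot_swap k a i) = (\<Sum>i\<in>{..<n} - {k, Suc k}. a i)"
    by (rule sum.cong) (auto simp: dot_swap_def)
  ultimately show ?thesis by (simp add: dot_swap_def)
qed

lemma K_degree:
  assumes "(\<Sum>k<n. a k) < 0 \<or> odd (\<Sum>k<n. a k)"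
  shows "K n a = (0 :: 'f::field_char_0)"
proof (rule antisym_fun_zero[OF K_antisym_fun, where P = "\<lambda>a. (\<Sum>k<n. a k) < 0 \<or> odd (\<Sum>k<n. a k)"])
  fix a assume P: "(\<Sum>k<n. a k) < 0 \<or> odd (\<Sum>k<n. a k)" and d: "dominant n (a :: nat \<Rightarrow> int)"
  have "\<not> (\<forall>k<n. a k \<ge> 0 \<and> even (a k))"
  proof
    assume "\<forall>k<n. a k \<ge> 0 \<and> even (a k)"
    then have "(\<Sum>k<n. a k) \<ge> 0" "even (\<Sum>k<n. a k)" by (auto intro: sum_nonneg dvd_sum)
    then show False using P by simp
  qed
  then show "K n a = (0 :: 'f)" by (simp only: K_dominant[OF d] if_False)
qed (use assms in \<open>simp_all add: sum_dot_swap\<close>)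

lemma ev1_exps_in1_cong: "exps_in1 P g \<Longrightarrow> (\<And>b. P b \<Longrightarrow> F b = G b) \<Longrightarrow> ev1 F g = ev1 G g"
  by (rule ev1_cong) (auto simp: exps_in1_def)

lemma exps_in1_row: "exps_in1 (\<lambda>b. b n \<le> int m) (\<Prod>k<m. 1 - sgl (unit_exp k + unit_exp n) (1 :: 'f::comm_ring_1))" if "m \<le> n"
  using that
proof (induction m)
  case (Suc m)
  have "exps_in1 (\<lambda>b. b n \<le> int (Suc m)) ((\<Prod>k<m. 1 - sgl (unit_exp k + unit_exp n) (1 :: 'f)) * (1 - sgl (unit_exp m + unit_exp n) 1))"
    by (rule exps_in1_mult[OF Suc.IH exps_in1_bin[of "\<lambda>b. b n \<le> 1"]]) (use Suc.prems in \<open>auto simp: unit_exp_def\<close>)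
  then show ?case unfolding prod.lessThan_Suc .
qed (auto simp: exps_in1_def)

text \<open>The value of \<open>step_term\<close> does not change under multiplication by z_j z_n,
  so the factor 1 - z_j z_n of the row annihilates it.\<close>

lemma UL_remainder:
  assumes "j < n"
  shows "ev1 (\<lambda>b. step_term n j (c - b)) (UL n * (\<Prod>k<n. 1 - sgl (unit_exp k + unit_exp n) 1)) = (0 :: 'f::comm_ring_1)"
proof -
  let ?f = "\<lambda>k. 1 - sgl (unit_exp k + unit_exp n) (1 :: 'f)"
  have "prod ?f {..<n} = ?f j * prod ?f ({..<n} - {j})" by (rule prod.remove) (use assms in auto)
  then have "UL n * prod ?f {..<n} = ?f j * (UL n * prod ?f ({..<n} - {j}))" by (simp add: mult_ac)
  moreover have "step_term n j (c - (unit_exp j + unit_exp n + b)) = (step_term n j (c - b) :: 'f)" for b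
    by (rule step_term_cong) (use assms in \<open>auto simp: unit_exp_def\<close>)
  ultimately show ?thesis by (simp only: ev1_mul_bin) simp
qed

text \<open>Littlewood's sum of Schur functions over partitions with even parts, cleared of
  denominators. If the top exponent is positive, the factor of \<open>UL\<close> in the square of
  z_m forms the difference of \<open>K_step\<close>, and every resulting term dies; the other cases
  are a negative lowest exponent and the zero exponent.\<close>

lemma Schur_Littlewood_dominant:
  assumes "dominant n a" "\<And>k. k \<ge> n \<Longrightarrow> a k = 0"
  shows "ev1 (\<lambda>b. K n (a - b)) (UL n) = lk (DL n :: 'f::field_char_0 laurent) a"
proof (cases n)
  case 0
  then have "a = 0" using assms(2) by auto
  then show ?thesis unfolding 0 by (simp add: UL_def DL_def ev1_single flip: single_one)
next
  case (Suc m)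
  consider (part_exp) "a m \<ge> 1" | (neg) "a 0 < 0" | (zero) "a m \<le> 0" "a 0 \<ge> 0" by linarith
  then show ?thesis
  proof cases
    case part_exp
    let ?V = "UL m * (\<Prod>k<m. 1 - sgl (unit_exp k + unit_exp m) 1) :: 'f laurent"
    define c where "c = a - two_unit m"
    have V: "exps_in1 (\<lambda>b. b m \<le> int m) ?V"
      by (rule exps_in1_mult[OF exps_in1_UL exps_in1_row]) auto
    have "ev1 (\<lambda>b. K n (a - b)) (UL n) = ev1 (\<lambda>b. K n (a - b) - K n (a - (two_unit m + b))) ?V"
      unfolding Suc UL_Suc ev1_mul_bin ev1_fun_diff ..
    also have "\<dots> = ev1 (\<lambda>b. \<Sum>j<m. (-1) ^ (m - 1 - j) * step_term m j (c - b)) ?V"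
    proof (rule ev1_exps_in1_cong[OF V])
      fix b :: "nat \<Rightarrow> int" assume b: "b m \<le> int m"
      have "a - b = (c - b) + two_unit m" "a - (two_unit m + b) = c - b" by (auto simp: c_def)
      \<comment> \<open>The extreme case a_m = 1, b_m = m attains -1, which is why
        \<open>K_step\<close> must reach that far.\<close>
      moreover have "(c - b) m + int m \<ge> - 1" using part_exp b by (simp add: c_def two_unit_def)
      ultimately show "K n (a - b) - K n (a - (two_unit m + b)) = (\<Sum>j<m. (-1) ^ (m - 1 - j) * step_term m j (c - b) :: 'f)"
        unfolding Suc by (simp only: K_step)
    qed
    also have "\<dots> = 0" by (simp add: ev1_fun_sum ev1_scale UL_remainder)
    also have "lk (DL n :: 'f laurent) a = 0"
    proof (rule ccontr)
      assume "lk (DL n :: 'f laurent) a \<noteq> 0"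
      then have "a \<in> Poly_Mapping.keys (DL n :: 'f laurent)" by (simp add: in_keys_iff)
      from bspec[OF exps_in1_DL[unfolded exps_in1_def] this] show False using part_exp Suc by simp
    qed
    finally show ?thesis by simp
  next
    case neg
    have "ev1 (\<lambda>b. K n (a - b)) (UL n) = ev1 (\<lambda>b. 0) (UL n :: 'f laurent)"
      by (rule ev1_exps_in1_cong[OF exps_in1_UL], rule K_neg[of 0]) (use neg Suc in \<open>auto intro: less_le_trans[of _ 0]\<close>)
    moreover have "lk (DL n :: 'f laurent) a = 0"
    proof (rule ccontr)
      assume "lk (DL n :: 'f laurent) a \<noteq> 0"
      then have "a \<in> Poly_Mapping.keys (DL n :: 'f laurent)" by (simp add: in_keys_iff)
      from bspec[OF exps_in1_DL[unfolded exps_in1_def] this] show False using neg by simp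
    qed
    ultimately show ?thesis by (simp add: ev1_def)
  next
    case zero
    have "a k = 0" for k
    proof (cases "k < n")
      case True
      then have "a 0 \<le> a k" "a k \<le> a m" using assms(1) Suc by (auto simp: dominant_def)
      then show ?thesis using zero by simp
    qed (use assms(2) in simp)
    then have a: "a = 0" by auto
    have "ev1 (\<lambda>b. K n (a - b)) (UL n) = ev1 (\<lambda>b. if b = 0 then 1 else 0) (UL n :: 'f laurent)"
    proof (rule ev1_exps_in1_cong[OF exps_in1_UL])
      fix b :: "nat \<Rightarrow> int" assume b: "(\<forall>k. b k \<ge> 0) \<and> (\<forall>k\<ge>n. b k = 0)"
      show "K n (a - b) = (if b = 0 then 1 else (0 :: 'f))"
      proof (cases "b = 0")
        case True
        then show ?thesis using K_dominant[of n 0] by (simp add: a dominant_def)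
      next
        case False
        then obtain k where k: "b k \<noteq> 0" by (auto simp: fun_eq_iff)
        then have "k < n" using b by (meson not_le)
        then have "(\<Sum>k<n. b k) > 0" using b k by (intro sum_pos2[of _ k]) (auto simp: order.strict_iff_order)
        then have "K n (a - b) = (0 :: 'f)" by (intro K_degree) (simp add: a sum_negf)
        then show ?thesis using False by simp
      qed
    qed
    also have "\<dots> = lk (UL n) 0" by (simp add: lookup_eq_ev1)
    finally show ?thesis by (simp add: lookup_UL_0 lookup_DL_0 a)
  qed
qed

lemma Schur_Littlewood:
  assumes "\<And>k. k \<ge> n \<Longrightarrow> a k = 0"
  shows "ev1 (\<lambda>b. K n (a - b)) (UL n) = lk (DL n :: 'f::field_char_0 laurent) a"
proof -
  define F where "F a = ev1 (\<lambda>b. K n (a - b)) (UL n) - lk (DL n :: 'f laurent) a" for a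
  have "F a = 0"
  proof (rule antisym_fun_zero[of n F "\<lambda>a. \<forall>k\<ge>n. a k = 0"])
    show "antisym_fun n F" unfolding antisym_fun_def
    proof (intro allI impI)
      fix k a assume k: "Suc k < n"
      have "ev1 (\<lambda>b. K n (dot_swap k a - b)) (UL n) = ev1 (\<lambda>b. - 1 * K n (a - swap_exp k b)) (UL n :: 'f laurent)"
      proof (rule ev1_cong)
        fix b
        have "dot_swap k a - b = dot_swap k (a - swap_exp k b)" by (auto simp: dot_swap_def swap_exp_def)
        then show "K n (dot_swap k a - b) = - 1 * (K n (a - swap_exp k b) :: 'f)"
          using K_antisym_fun[of n, where 'a = 'f] k by (simp add: antisym_fun_def)
      qed
      also have "\<dots> = - ev1 (\<lambda>b. K n (a - b)) (swap1 k (UL n))" by (simp only: ev1_scale ev1_swap1) simp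
      finally show "F (dot_swap k a) = - F a"
        using DL_antisym_fun[of n, where 'f = 'f] k by (simp add: F_def swap1_UL[OF k] antisym_fun_def)
    qed
  qed (use assms Schur_Littlewood_dominant in \<open>auto simp: F_def dot_swap_def\<close>)
  then show ?thesis by (simp add: F_def)
qed

lemma lookup_times: "lk (g * h :: 'f::comm_ring_1 laurent) a = ev1 (\<lambda>b. lk h (a - b)) g"
  unfolding lookup_eq_ev1[of "g * h"] ev1_mult
proof (rule arg_cong[where f = "\<lambda>F. ev1 F g"], rule ext)
  fix b
  have "(\<lambda>c. if b + c = a then 1 else 0) = (\<lambda>c. if c = a - b then 1 else (0 :: 'f))"
    by (auto simp: fun_eq_iff algebra_simps)
  then show "ev1 (\<lambda>c. if b + c = a then 1 else 0) h = lk h (a - b)" by (simp only: lookup_eq_ev1[of h])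
qed

definition supp_below :: "nat \<Rightarrow> (nat \<Rightarrow> int) \<Rightarrow> bool" where "supp_below n a \<longleftrightarrow> (\<forall>k\<ge>n. a k = 0)"

definition exp_size :: "nat \<Rightarrow> (nat \<Rightarrow> int) \<Rightarrow> int" where "exp_size n a = (\<Sum>k<n. a k)"

lemma additive_wt_exp_size: "additive_wt (exp_size n)" by (simp add: additive_wt_def exp_size_def sum.distrib)

lemma exp_size_unit: "k < n \<Longrightarrow> exp_size n (unit_exp k) = 1"
  by (simp add: exp_size_def unit_exp_def)

lemma supp_below_simps: "supp_below n a \<Longrightarrow> supp_below n b \<Longrightarrow> supp_below n (a + b)" "supp_below n a \<Longrightarrow> supp_below n b \<Longrightarrow> supp_below n (a - b)"
  "k < n \<Longrightarrow> supp_below n (unit_exp k)" "supp_below n 0" "supp_below n a \<Longrightarrow> supp_below n (scale_exp i a)"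
  by (auto simp: supp_below_def unit_exp_def scale_exp_def)

text \<open>Couples the power of q to the degree in z. For c = 2 the power of q can be read from the
  monomial, which allows q to be set to 1 and recovered later.\<close>

definition graded :: "nat \<Rightarrow> int \<Rightarrow> 'f::comm_ring_1 laurent fps \<Rightarrow> bool" where
  "graded n c g \<longleftrightarrow> (\<forall>i. \<forall>b\<in>Poly_Mapping.keys (fps_nth g i). exp_size n b = c * int i \<and> supp_below n b)"

lemma graded_1: "graded n c 1"
  by (auto simp: graded_def fps_one_nth supp_below_simps additive_wt_0[OF additive_wt_exp_size])

lemma graded_mult:
  assumes "graded n c g" "graded n c h"
  shows "graded n c (g * h)"
  unfolding graded_def
proof (intro allI ballI)
  fix i b assume "b \<in> Poly_Mapping.keys (fps_nth (g * h) i)"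
  then have "b \<in> Poly_Mapping.keys (\<Sum>j\<in>{0..i}. fps_nth g j * fps_nth h (i - j))"
    by (simp only: fps_mult_nth)
  from subsetD[OF keys_sum_subset this] obtain j
    where j: "j \<le> i" and "b \<in> Poly_Mapping.keys (fps_nth g j * fps_nth h (i - j))" by auto
  from subsetD[OF keys_mult this(2)] obtain x y
    where "x \<in> Poly_Mapping.keys (fps_nth g j)" "y \<in> Poly_Mapping.keys (fps_nth h (i - j))" "b = x + y"
    by auto
  then have "exp_size n x = c * int j" "exp_size n y = c * int (i - j)" "supp_below n x" "supp_below n y" and b: "b = x + y"
    using assms by (auto simp: graded_def)
  then show "exp_size n b = c * int i \<and> supp_below n b"
    using additive_wt_exp_size[of n] j by (simp add: additive_wt_def supp_below_simps of_nat_diff algebra_simps)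
qed

lemma graded_prod: "(\<And>i. i \<in> I \<Longrightarrow> graded n c (g i)) \<Longrightarrow> graded n c (prod g I)"
  by (induction I rule: infinite_finite_induct) (auto intro: graded_1 graded_mult)

lemma graded_lin: "exp_size n a = c \<Longrightarrow> supp_below n a \<Longrightarrow> graded n c (lin a)"
  by (auto simp: graded_def lin_nth in_keys_iff lookup_one lookup_single when_def supp_below_simps additive_wt_0[OF additive_wt_exp_size]
      split: if_splits)

lemma graded_geom: "exp_size n a = c \<Longrightarrow> supp_below n a \<Longrightarrow> graded n c (geom a)"
  by (auto simp: graded_def supp_below_simps additive_wt_scale_exp[OF additive_wt_exp_size])

definition BE :: "nat \<Rightarrow> 'f::comm_ring_1 laurent fps" where
  "BE n = (\<Prod>p\<in>pairs_le n. lin (unit_exp (fst p) + unit_exp (snd p)))"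

lemma BE_AA: "BE n * AA n = 1" unfolding BE_def AA_def by (rule prod_lin_geom)

lemma exp_size_pair: "i < n \<Longrightarrow> j < n \<Longrightarrow> exp_size n (unit_exp i + unit_exp j) = 2" "i < n \<Longrightarrow> j < n \<Longrightarrow> exp_size n (unit_exp i - unit_exp j) = 0"
  using additive_wt_exp_size[of n] by (auto simp: additive_wt_def additive_wt_minus exp_size_unit)

lemma graded_BE: "graded n 2 (BE n :: 'f::comm_ring_1 laurent fps)" unfolding BE_def
  by (intro graded_prod graded_lin) (auto simp: pairs_le_def exp_size_pair supp_below_simps)
lemma graded_AA: "graded n 2 (AA n :: 'f::comm_ring_1 laurent fps)" unfolding AA_def
  by (intro graded_prod graded_geom) (auto simp: pairs_le_def exp_size_pair supp_below_simps)
lemma graded_BB: "graded n 2 (BB n :: 'f::comm_ring_1 laurent fps)" unfolding BB_def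
  by (intro graded_prod graded_lin) (auto simp: pairs_less_def exp_size_pair supp_below_simps)
lemma graded_GG: "graded n 0 (GG n :: 'f::comm_ring_1 laurent fps)" unfolding GG_def
  by (intro graded_prod graded_geom) (auto simp: pairs_less_def exp_size_pair supp_below_simps)

text \<open>Evaluation at q = 1: a product of linear factors is a polynomial in q of degree at most
  \<open>card I\<close>, so adding up its coefficients is legitimate.\<close>

lemma sum_prod_lin:
  assumes "finite I" "card I \<le> M"
  shows "(\<Sum>i\<le>M. fps_nth (\<Prod>p\<in>I. lin (f p)) i) = (\<Prod>p\<in>I. 1 - sgl (f p) (1 :: 'f::comm_ring_1))"
  using assms
proof (induction I arbitrary: M rule: finite_induct)
  case empty
  show ?case by (simp add: fps_one_nth)
next
  case (insert x I)
  then obtain L where M: "M = Suc L" and L: "card I \<le> L" by (cases M) auto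
  let ?g = "\<Prod>p\<in>I. lin (f p) :: 'f laurent fps"
  have n: "fps_nth (lin (f x) * ?g) (Suc i) = fps_nth ?g (Suc i) - sgl (f x) 1 * fps_nth ?g i" for i
    by (simp add: lin_def left_diff_distrib mult.assoc mon_def)
  have n0: "fps_nth (lin (f x) * ?g) 0 = fps_nth ?g 0"
    by (simp add: lin_nth)
  have "(\<Sum>i\<le>M. fps_nth (lin (f x) * ?g) i) = (\<Sum>i\<le>M. fps_nth ?g i) - sgl (f x) 1 * (\<Sum>i\<le>L. fps_nth ?g i)"
    unfolding M sum.atMost_Suc_shift n n0 by (simp add: sum_subtractf sum_distrib_left algebra_simps)
  also have "\<dots> = (1 - sgl (f x) 1) * (\<Prod>p\<in>I. 1 - sgl (f p) (1 :: 'f))"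
    using insert.IH[of M] insert.IH[of L] M L by (simp add: algebra_simps)
  finally show ?case using insert by simp
qed

lemma lookup_DL_size: "exp_size n a \<noteq> 0 \<Longrightarrow> lk (DL n :: 'f::comm_ring_1 laurent) a = 0"
  using exps_in1_DL[of n, where 'f = 'f] by (auto simp: exps_in1_def in_keys_iff exp_size_def)

lemma nth_0_prod: "fps_nth (\<Prod>p\<in>A. f p) 0 = (\<Prod>p\<in>A. fps_nth (f p :: 'c::comm_ring_1 fps) 0)"
  by (induction A rule: infinite_finite_induct) auto

text \<open>\<open>Schur_Littlewood\<close> inverted one degree at a time. The induction uses that
  \<open>BE\<close> is inverse to \<open>AA\<close> and becomes \<open>UL\<close> when its
  coefficients are summed; thus \<open>K\<close> is the coefficient function of \<open>DL\<close>
  times Littlewood's product, the power of q being fixed by the degree.\<close>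

lemma AA_DL:
  assumes "supp_below n a"
  shows "lk (fps_nth (AA n) m * DL n) a = (if exp_size n a = 2 * int m then K n a else (0 :: 'f::field_char_0))"
  using assms
proof (induction m arbitrary: a rule: less_induct)
  case (less m)
  let ?B = "\<lambda>i. fps_nth (BE n :: 'f laurent fps) i" and ?A = "\<lambda>i. fps_nth (AA n :: 'f laurent fps) i"
  let ?k = "\<lambda>b. K n (a - b) :: 'f"
  have B0: "?B 0 = 1" by (simp add: BE_def nth_0_prod lin_nth)
  have conv: "lk (?B i * (?A (m - i) * DL n)) a = (if exp_size n a = 2 * int m then ev1 ?k (?B i) else 0)"
    if i: "0 < i" "i \<le> m" for i
  proof -
    have "lk (?B i * (?A (m - i) * DL n)) a = ev1 (\<lambda>b. lk (?A (m - i) * DL n) (a - b)) (?B i)"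
      by (rule lookup_times)
    also have "\<dots> = ev1 (\<lambda>b. (if exp_size n a = 2 * int m then 1 else 0) * ?k b) (?B i)"
    proof (rule ev1_cong)
      fix b assume "b \<in> Poly_Mapping.keys (?B i)"
      then have b: "exp_size n b = 2 * int i" "supp_below n b" using graded_BE[of n] by (auto simp: graded_def)
      have "exp_size n (a - b) = 2 * int (m - i) \<longleftrightarrow> exp_size n a = 2 * int m"
        using i b by (auto simp: additive_wt_minus[OF additive_wt_exp_size] of_nat_diff)
      then show "lk (?A (m - i) * DL n) (a - b) = (if exp_size n a = 2 * int m then 1 else 0) * ?k b"
        by (subst less.IH) (use i b less.prems in \<open>auto simp: supp_below_simps\<close>)
    qed
    also have "\<dots> = (if exp_size n a = 2 * int m then ev1 ?k (?B i) else 0)" by (simp only: ev1_scale) simp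
    finally show ?thesis .
  qed
  have "fps_nth (BE n * AA n) m = (\<Sum>i=0..m. ?B i * ?A (m - i))" by (rule fps_mult_nth)
  then have "(if m = 0 then 1 else 0) = ?A m + (\<Sum>i=1..m. ?B i * ?A (m - i))"
    by (simp add: BE_AA sum.atLeast_Suc_atMost B0)
  then have "(if m = 0 then 1 else 0) * DL n = (?A m + (\<Sum>i=1..m. ?B i * ?A (m - i))) * DL n" by simp
  then have "(if m = 0 then DL n else 0) = ?A m * DL n + (\<Sum>i=1..m. ?B i * (?A (m - i) * DL n))"
    by (simp add: distrib_right sum_distrib_right mult.assoc split: if_splits)
  then have "lk (if m = 0 then DL n else 0) a = lk (?A m * DL n) a + (\<Sum>i=1..m. lk (?B i * (?A (m - i) * DL n)) a)"
    by (simp only: lookup_add lookup_sum)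
  then have main: "lk (?A m * DL n) a = lk (if m = 0 then DL n else 0) a -
      (\<Sum>i=1..m. if exp_size n a = 2 * int m then ev1 ?k (?B i) else 0)"
    by (simp add: conv)
  show ?case
  proof (cases "exp_size n a = 2 * int m")
    case False
    then have "lk (if m = 0 then DL n else 0) a = (0 :: 'f)" using lookup_DL_size[of n a, where 'f = 'f] by auto
    then show ?thesis using False main by simp
  next
    case True
    define M where "M = m + card (pairs_le n)"
    have "lk (DL n) a = ev1 ?k (UL n)"
      using less.prems by (simp add: Schur_Littlewood supp_below_def)
    also have "UL n = (\<Sum>i\<le>M. ?B i)"
      unfolding UL_def BE_def by (rule sum_prod_lin[symmetric]) (auto simp: M_def)
    also have "ev1 ?k (\<Sum>i\<le>M. ?B i) = (\<Sum>i\<le>M. ev1 ?k (?B i))" by (rule ev1_sum)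
    \<comment> \<open>For i > m the argument of \<open>K\<close> has negative total degree, so
      \<open>K_degree\<close> removes these terms.\<close>
    also have "\<dots> = (\<Sum>i\<le>m. ev1 ?k (?B i))"
    proof (rule sum.mono_neutral_right)
      show "\<forall>i\<in>{..M} - {..m}. ev1 ?k (?B i) = 0"
      proof
        fix i assume i: "i \<in> {..M} - {..m}"
        have "ev1 ?k (?B i) = ev1 (\<lambda>b. 0) (?B i)"
        proof (rule ev1_cong)
          fix b assume "b \<in> Poly_Mapping.keys (?B i)"
          then have "exp_size n b = 2 * int i" using graded_BE[of n] by (auto simp: graded_def)
          then have "exp_size n (a - b) < 0" using i True by (simp add: additive_wt_minus[OF additive_wt_exp_size])
          then show "?k b = 0" by (intro K_degree) (simp add: exp_size_def)
        qed
        then show "ev1 ?k (?B i) = 0" by (simp add: ev1_def)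
      qed
    qed (auto simp: M_def)
    also have "\<dots> = K n a + (\<Sum>i=1..m. ev1 ?k (?B i))"
      by (simp add: atMost_atLeast0 sum.atLeast_Suc_atMost B0 flip: single_one)
    finally have "lk (DL n) a = K n a + (\<Sum>i=1..m. ev1 ?k (?B i))" .
    moreover have "lk (if m = 0 then DL n else 0) a = lk (DL n :: 'f laurent) a"
      using lookup_DL_size[of n a, where 'f = 'f] True by auto
    ultimately show ?thesis using True main by simp
  qed
qed

text \<open>
  Read off by \<open>GG\<close>, the Schur--Littlewood coefficients \<open>K\<close> of \<open>AA * DL\<close> turn into those of the
  second Littlewood identity, so that \<open>YY n m\<close> detects the partitions of \<open>2 m\<close> with even parts.
\<close>

definition YY :: "nat \<Rightarrow> nat \<Rightarrow> 'f::comm_ring_1 laurent fps" where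
  "YY n m = Abs_fps (\<lambda>k. if k \<le> m then fps_nth (BB n) k * (fps_nth (AA n) (m - k) * DL n) else 0)"

text \<open>The coefficient B_k has degree 2 k, so degree 2 m is completed by A_{m-k} alone, and by
  \<open>AA_DL\<close> that factor times \<open>DL\<close> has the values of \<open>K\<close> as
  coefficients. For k > m the remaining degree is negative and \<open>K\<close> vanishes, in
  accordance with the cut-off in \<open>YY\<close>.\<close>

lemma coeff_at_YY:
  assumes "supp_below n a" "exp_size n a = 2 * int m"
  shows "coeff_at a (GG n * YY n m) = ev (\<lambda>b. K n (a - b)) (BB n * GG n :: 'f::field_char_0 laurent fps)"
proof (rule fps_ext)
  fix i
  let ?A = "\<lambda>i. fps_nth (AA n :: 'f laurent fps) i" and ?B = "\<lambda>i. fps_nth (BB n :: 'f laurent fps) i"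
  let ?G = "\<lambda>i. fps_nth (GG n :: 'f laurent fps) i"
  have "lk (?G j * fps_nth (YY n m) (i - j)) a = ev1 (\<lambda>b. K n (a - b)) (?B (i - j) * ?G j)" if "j \<le> i" for j
  proof -
    let ?k = "i - j"
    have keys: "exp_size n b = 2 * int ?k \<and> supp_below n b" if "b \<in> Poly_Mapping.keys (?B ?k * ?G j)" for b
    proof -
      from subsetD[OF keys_mult that] obtain x y
        where "x \<in> Poly_Mapping.keys (?B ?k)" "y \<in> Poly_Mapping.keys (?G j)" "b = x + y" by auto
      then have "exp_size n x = 2 * int ?k" "exp_size n y = 0" "supp_below n x" "supp_below n y" "b = x + y"
        using graded_BB[of n, where 'f = 'f] graded_GG[of n, where 'f = 'f] by (auto simp: graded_def)
      then show ?thesis using additive_wt_exp_size[of n] by (simp add: additive_wt_def supp_below_simps)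
    qed
    show ?thesis
    proof (cases "?k \<le> m")
      case True
      have "lk (?G j * fps_nth (YY n m) ?k) a = lk ((?B ?k * ?G j) * (?A (m - ?k) * DL n)) a"
        using True by (simp add: YY_def mult_ac)
      also have "\<dots> = ev1 (\<lambda>b. lk (?A (m - ?k) * DL n) (a - b)) (?B ?k * ?G j)" by (rule lookup_times)
      also have "\<dots> = ev1 (\<lambda>b. K n (a - b)) (?B ?k * ?G j)"
      proof (rule ev1_cong)
        fix b assume "b \<in> Poly_Mapping.keys (?B ?k * ?G j)"
        from keys[OF this] show "lk (?A (m - ?k) * DL n) (a - b) = K n (a - b)"
          using True assms by (subst AA_DL) (auto simp: supp_below_simps additive_wt_minus[OF additive_wt_exp_size] of_nat_diff)
      qed
      finally show ?thesis .
    next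
      case False
      have "ev1 (\<lambda>b. K n (a - b)) (?B ?k * ?G j) = ev1 (\<lambda>b. 0) (?B ?k * ?G j)"
      proof (rule ev1_cong)
        fix b assume "b \<in> Poly_Mapping.keys (?B ?k * ?G j)"
        from keys[OF this] have "exp_size n (a - b) < 0"
          using False assms by (auto simp: additive_wt_minus[OF additive_wt_exp_size])
        then show "K n (a - b) = (0 :: 'f)" by (intro K_degree) (simp add: exp_size_def)
      qed
      then show ?thesis using False by (simp add: YY_def ev1_def)
    qed
  qed
  then have "(\<Sum>j=0..i. lk (?G j * fps_nth (YY n m) (i - j)) a) = (\<Sum>j=0..i. ev1 (\<lambda>b. K n (a - b)) (?G j * ?B (i - j)))"
    by (intro sum.cong) (auto simp: mult.commute)
  then show "fps_nth (coeff_at a (GG n * YY n m)) i = fps_nth (ev (\<lambda>b. K n (a - b)) (BB n * GG n :: 'f laurent fps)) i"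
    unfolding coeff_at_nth ev_nth mult.commute[of "BB n"] fps_mult_nth lookup_sum ev1_sum .
qed

section \<open>Elementary symmetric polynomials\<close>

text \<open>This is \<open>\<Sum>\<^sub>r \<phi> r \<cdot> e\<^sub>r(z)\<close>.\<close>

fun elem_sym :: "nat \<Rightarrow> (nat \<Rightarrow> 'f) \<Rightarrow> 'f::comm_ring_1 laurent fps" where
  "elem_sym 0 \<phi> = emb (fps_const (\<phi> 0))"
| "elem_sym (Suc n) \<phi> = elem_sym n \<phi> + mon (unit_exp n) * elem_sym n (\<lambda>r. \<phi> (Suc r))"

lemma swap_fps_elem_sym_le: "n \<le> k \<Longrightarrow> swap_fps k (elem_sym n \<phi>) = elem_sym n \<phi>"
proof (induction n arbitrary: \<phi>)
  case (Suc n)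
  then show ?case by (simp add: swap_fps_add swap_fps_mult swap_fps_mon swap_exp_unit_exp tr_idx_def)
qed (simp add: swap_fps_emb)

lemma symm_fps_elem_sym: "symm_fps n (elem_sym n \<phi>)"
  unfolding symm_fps_def
proof (intro allI impI)
  fix k assume "Suc k < n"
  then show "swap_fps k (elem_sym n \<phi>) = elem_sym n \<phi>"
  proof (induction n arbitrary: \<phi>)
    case (Suc m)
    show ?case
    proof (cases "m = Suc k")
      case True
      then show ?thesis
        by (simp add: swap_fps_add swap_fps_mult swap_fps_mon swap_exp_unit_exp tr_idx_def swap_fps_elem_sym_le algebra_simps)
    next
      case False
      then have "Suc k < m" using Suc.prems by simp
      then show ?thesis using Suc.IH by (simp add: swap_fps_add swap_fps_mult swap_fps_mon swap_exp_unit_exp tr_idx_def)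
    qed
  qed simp
qed

text \<open>As the weight of \<open>elem_sym\<close> it selects the single polynomial e_r.\<close>

definition kdelta :: "nat \<Rightarrow> nat \<Rightarrow> 'f::comm_ring_1" where "kdelta r = (\<lambda>i. if i = r then 1 else 0)"

lemma elem_sym_zero: "elem_sym n (\<lambda>_. 0) = 0" by (induction n) auto

lemma elem_sym_kdelta_0: "elem_sym (Suc n) (kdelta 0) = elem_sym n (kdelta 0)"
  by (simp add: kdelta_def elem_sym_zero)
lemma elem_sym_kdelta_Suc: "elem_sym (Suc n) (kdelta (Suc r)) = elem_sym n (kdelta (Suc r)) + mon (unit_exp n) * elem_sym n (kdelta r)"
  by (simp add: kdelta_def)
lemma elem_sym_one: "elem_sym n (kdelta 0) = 1"
proof (induction n)
  case 0 show ?case by (simp add: kdelta_def)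
qed (simp add: elem_sym_kdelta_0 del: elem_sym.simps)
lemma elem_sym_big: "r > n \<Longrightarrow> elem_sym n (kdelta r) = 0"
proof (induction n arbitrary: r)
  case 0 then show ?case by (simp add: kdelta_def)
next
  case (Suc n) then show ?case by (cases r) (auto simp: elem_sym_kdelta_Suc simp del: elem_sym.simps)
qed

lemma prod_elem_sym: "(\<Prod>k<n. 1 + w * mon (unit_exp k)) = (\<Sum>r\<le>n. w ^ r * (elem_sym n (kdelta r) :: 'f::comm_ring_1 laurent fps))"
proof (induction n)
  case 0 show ?case by (simp add: elem_sym_one del: elem_sym.simps)
next
  case (Suc n)
  have "(\<Sum>r\<le>Suc n. w ^ r * (elem_sym (Suc n) (kdelta r) :: 'f laurent fps)) =
     elem_sym n (kdelta 0) + (\<Sum>r\<le>n. w ^ Suc r * elem_sym n (kdelta (Suc r))) + w * mon (unit_exp n) * (\<Sum>r\<le>n. w ^ r * elem_sym n (kdelta r))"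
    unfolding sum.atMost_Suc_shift elem_sym_kdelta_0 elem_sym_kdelta_Suc
    by (simp add: sum.distrib sum_distrib_left algebra_simps del: elem_sym.simps)
  also have "elem_sym n (kdelta 0) + (\<Sum>r\<le>n. w ^ Suc r * elem_sym n (kdelta (Suc r))) = (\<Sum>r\<le>Suc n. w ^ r * (elem_sym n (kdelta r) :: 'f laurent fps))"
    unfolding sum.atMost_Suc_shift by simp
  also have "\<dots> = (\<Sum>r\<le>n. w ^ r * elem_sym n (kdelta r))" by (simp add: elem_sym_big)
  finally show ?case by (simp add: Suc.IH algebra_simps del: elem_sym.simps)
qed

section \<open>The Poincare polynomial of the symmetric group\<close>

lemma antisym_fun_le: "antisym_fun n F \<Longrightarrow> m \<le> n \<Longrightarrow> antisym_fun m F" by (auto simp: antisym_fun_def)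
lemma symm_fps_le: "symm_fps n S \<Longrightarrow> m \<le> n \<Longrightarrow> symm_fps m S" by (auto simp: symm_fps_def)

lemma unit_exp_neq: "swap_exp k (unit_exp m) = unit_exp m" if "k \<noteq> m" "Suc k \<noteq> m"
  using that by (simp add: swap_exp_unit_exp tr_idx_def)

text \<open>A dot swap turns the r-th inverse power of z_m, up to sign, into 1/z_m times the (r -
  1)-st inverse power of z_{m-1}. The factor 1/z_m is absorbed into \<open>T\<close>, which then
  only has to be symmetric in the variables of smaller index. So r and m fall together until r = 1,
  where the term is its own negative.\<close>

lemma mon_neg_power_zero:
  assumes "antisym_fun n (F :: _ \<Rightarrow> 'f::field_char_0)" "symm_fps n S"
  shows "m < n \<Longrightarrow> 1 \<le> r \<Longrightarrow> r \<le> m \<Longrightarrow> (\<And>k. Suc k \<le> m \<Longrightarrow> swap_fps k T = T) \<Longrightarrow>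
     ev F (mon (scale_exp r (- unit_exp m)) * (T * S)) = 0"
proof (induction r arbitrary: m T)
  case (Suc r)
  then obtain k where m: "m = Suc k" by (cases m) auto
  let ?g = "mon (scale_exp (Suc r) (- unit_exp m)) * (T * S)"
  have sw: "swap_exp k (scale_exp (Suc r) (- unit_exp m)) = scale_exp (Suc r) (- unit_exp k)"
    by (auto simp: swap_exp_def scale_exp_def unit_exp_def m)
  have k: "Suc k < n" using Suc.prems m by simp
  have "swap_fps k ?g = mon (scale_exp (Suc r) (- unit_exp k)) * (T * S)"
  proof -
    have "swap_fps k S = S" "swap_fps k T = T" using assms(2) k Suc.prems(4)[of k] by (auto simp: symm_fps_def m)
    then show ?thesis by (simp only: swap_fps_mult swap_fps_mon sw)
  qed
  moreover have "mon (unit_exp k - unit_exp (Suc k)) * (mon (scale_exp (Suc r) (- unit_exp k)) * (T * S)) =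
      mon (scale_exp r (- unit_exp k)) * ((mon (- unit_exp m) * T) * S)"
  proof -
    have e: "(unit_exp k - unit_exp (Suc k)) + scale_exp (Suc r) (- unit_exp k) = scale_exp r (- unit_exp k) + - unit_exp m"
      by (auto simp: scale_exp_Suc m)
    show ?thesis unfolding mult.assoc[symmetric] mon_add[symmetric] e ..
  qed
  ultimately have 1: "ev F (mon (scale_exp r (- unit_exp k)) * ((mon (- unit_exp m) * T) * S)) = - ev F ?g"
    using ev_antisym_fun[OF assms(1) k, of ?g] by simp
  show ?case
  proof (cases "r = 0")
    case True
    then have "ev F ?g = - ev F ?g" using 1 by (simp add: scale_exp_Suc mult.assoc)
    then show ?thesis by (rule eq_neg_zero_fps)
  next
    case False
    have "ev F (mon (scale_exp r (- unit_exp k)) * ((mon (- unit_exp m) * T) * S)) = 0"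
    proof (rule Suc.IH)
      fix i assume i: "Suc i \<le> k"
      have "swap_exp i (- unit_exp m) = - unit_exp m" using i m by (auto simp: swap_exp_def unit_exp_def)
      then show "swap_fps i (mon (- unit_exp m) * T) = mon (- unit_exp m) * T"
        using Suc.prems(4)[of i] i m by (simp add: swap_fps_mult swap_fps_mon)
    qed (use Suc.prems m False in auto)
    from trans[OF 1[symmetric] this] show ?thesis by (rule neg_equal_0_iff_equal[THEN iffD1])
  qed
qed simp

text \<open>Split e_{r+1} in n + 1 variables along z_n: the fully symmetric part vanishes by
  \<open>mon_neg_power_zero\<close>, and what is left is the case r with a minus sign.\<close>

lemma ev_elem_sym_neg:
  assumes "antisym_fun (Suc n) (F :: _ \<Rightarrow> 'f::field_char_0)" "symm_fps (Suc n) S"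
  shows "r \<le> n \<Longrightarrow> ev F (mon (scale_exp r (- unit_exp n)) * (elem_sym n (kdelta r) * S)) = (-1) ^ r * ev F S"
proof (induction r)
  case 0 show ?case by (simp only: scale_exp_0 mon_zero elem_sym_one power_0 mult_1_left)
next
  case (Suc r)
  have e: "scale_exp (Suc r) (- unit_exp n) + unit_exp n = scale_exp r (- unit_exp n)" by (simp add: scale_exp_Suc)
  have "elem_sym n (kdelta (Suc r)) = elem_sym (Suc n) (kdelta (Suc r)) - mon (unit_exp n) * (elem_sym n (kdelta r) :: 'f laurent fps)"
    by (simp only: elem_sym_kdelta_Suc add_diff_cancel_right')
  then have "mon (scale_exp (Suc r) (- unit_exp n)) * (elem_sym n (kdelta (Suc r)) * S) =
     mon (scale_exp (Suc r) (- unit_exp n)) * (1 * (elem_sym (Suc n) (kdelta (Suc r)) * S)) -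
     mon (scale_exp (Suc r) (- unit_exp n) + unit_exp n) * (elem_sym n (kdelta r) * S)"
    by (simp only: mon_add mult_1_left) (simp only: algebra_simps)
  moreover have "ev F (mon (scale_exp (Suc r) (- unit_exp n)) * (1 * (elem_sym (Suc n) (kdelta (Suc r)) * S))) = 0"
    by (rule mon_neg_power_zero[OF assms(1) symm_fps_mult[OF symm_fps_elem_sym assms(2)]]) (use Suc.prems in auto)
  ultimately have "ev F (mon (scale_exp (Suc r) (- unit_exp n)) * (elem_sym n (kdelta (Suc r)) * S)) =
      0 - ev F (mon (scale_exp r (- unit_exp n)) * (elem_sym n (kdelta r) * S))"
    by (simp only: ev_diff e)
  also have "ev F (mon (scale_exp r (- unit_exp n)) * (elem_sym n (kdelta r) * S)) = (- 1) ^ r * ev F S"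
    by (rule Suc.IH) (use Suc.prems in simp)
  finally show ?case by (simp only: power_Suc) simp
qed

text \<open>A free parameter in place of q, because the product is evaluated both at p = q, for
  \<open>HH\<close>, and at p = 1, for \<open>DL\<close>.\<close>

definition lin_gen :: "'f::comm_ring_1 fps \<Rightarrow> (nat \<Rightarrow> int) \<Rightarrow> 'f laurent fps" where
  "lin_gen p a = 1 - emb p * mon a"

lemma swap_fps_lin_gen: "swap_fps k (lin_gen p a) = lin_gen p (swap_exp k a)"
  by (simp add: lin_gen_def swap_fps_diff swap_fps_mult swap_fps_emb swap_fps_mon)

lemma emb_power: "emb (p ^ r) = emb p ^ r" by (induction r) (auto simp: emb_mult)
lemma emb_uminus: "emb (- p) = - emb p"
  using emb_add[of p "- p"] by (metis add.right_inverse add_eq_0_iff emb_0)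

lemma ev_row:
  assumes "antisym_fun (Suc n) (F :: _ \<Rightarrow> 'f::field_char_0)" "symm_fps (Suc n) S"
  shows "ev F ((\<Prod>k<n. lin_gen p (unit_exp k - unit_exp n)) * S) = (\<Sum>i\<le>n. p ^ i) * ev F S"
proof -
  let ?w = "- emb p * mon (- unit_exp n) :: 'f laurent fps"
  have "lin_gen p (unit_exp k - unit_exp n) = 1 + ?w * mon (unit_exp k)" for k
    by (simp add: lin_gen_def mult.assoc flip: mon_add)
  then have "(\<Prod>k<n. lin_gen p (unit_exp k - unit_exp n)) = (\<Sum>r\<le>n. ?w ^ r * elem_sym n (kdelta r))"
    by (simp only: prod_elem_sym)
  also have "\<dots> = (\<Sum>r\<le>n. emb ((- p) ^ r) * (mon (scale_exp r (- unit_exp n)) * elem_sym n (kdelta r)))"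
  proof (rule sum.cong)
    fix r
    have "mon (- unit_exp n) ^ r = (mon (scale_exp r (- unit_exp n)) :: 'f laurent fps)"
      by (induction r) (simp_all only: power_0 scale_exp_0 mon_zero power_Suc scale_exp_Suc mon_add)
    then show "?w ^ r * elem_sym n (kdelta r) = emb ((- p) ^ r) * (mon (scale_exp r (- unit_exp n)) * elem_sym n (kdelta r))"
      by (simp only: power_mult_distrib emb_power emb_uminus mult.assoc)
  qed simp
  finally have "ev F ((\<Prod>k<n. lin_gen p (unit_exp k - unit_exp n)) * S) =
      (\<Sum>r\<le>n. (- p) ^ r * ev F (mon (scale_exp r (- unit_exp n)) * (elem_sym n (kdelta r) * S)))"
    by (simp only: sum_distrib_right ev_sum mult.assoc ev_emb)
  also have "\<dots> = (\<Sum>r\<le>n. p ^ r * ev F S)"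
  proof (rule sum.cong)
    fix r assume "r \<in> {..n}"
    then have "ev F (mon (scale_exp r (- unit_exp n)) * (elem_sym n (kdelta r) * S)) = (- 1) ^ r * ev F S"
      by (intro ev_elem_sym_neg[OF assms]) simp
    then show "(- p) ^ r * ev F (mon (scale_exp r (- unit_exp n)) * (elem_sym n (kdelta r) * S)) = p ^ r * ev F S"
      by (simp only: mult.assoc[symmetric] power_mult_distrib[symmetric]) simp
  qed simp
  finally show ?thesis by (simp add: sum_distrib_right)
qed

text \<open>Each row of factors ending in z_m is traded for 1 + p + ... + p^m; the outcome is the
  sum of p to the length over the symmetric group. The row removed is symmetric in the earlier
  variables, so it can stay inside \<open>S\<close> meanwhile.\<close>

lemma ev_lin_gen_all:
  assumes "antisym_fun n (F :: _ \<Rightarrow> 'f::field_char_0)" "symm_fps n S"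
  shows "ev F ((\<Prod>q\<in>pairs_less n. lin_gen p (unit_exp (fst q) - unit_exp (snd q))) * S) = (\<Prod>m<n. \<Sum>i\<le>m. p ^ i) * ev F S"
  using assms
proof (induction n arbitrary: S)
  case (Suc n)
  let ?R = "\<Prod>k<n. lin_gen p (unit_exp k - unit_exp n) :: 'f laurent fps"
  have "symm_fps n ?R" unfolding symm_fps_def swap_fps_prod swap_fps_lin_gen
  proof (intro allI impI)
    fix k assume k: "Suc k < n"
    have "swap_exp k (unit_exp i - unit_exp n) = unit_exp (tr_idx k i) - unit_exp n" for i
      using k by (simp add: swap_exp_minus unit_exp_neq) (simp add: swap_exp_unit_exp)
    then show "(\<Prod>i<n. lin_gen p (swap_exp k (unit_exp i - unit_exp n))) = ?R"
      by (intro prod.reindex_bij_witness[of _ "tr_idx k" "tr_idx k"]) (use k in \<open>auto simp: tr_idx_def\<close>)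
  qed
  then have "symm_fps n (?R * S)" using Suc.prems(2) by (intro symm_fps_mult) (auto intro: symm_fps_le)
  then have "ev F ((\<Prod>q\<in>pairs_less n. lin_gen p (unit_exp (fst q) - unit_exp (snd q))) * (?R * S)) =
      (\<Prod>m<n. \<Sum>i\<le>m. p ^ i) * ev F (?R * S)"
    by (intro Suc.IH antisym_fun_le[OF Suc.prems(1)]) auto
  then show ?case unfolding prod_pairs_less_Suc fst_conv snd_conv mult.assoc ev_row[OF Suc.prems]
    by (simp only: prod.lessThan_Suc mult.assoc)
qed simp

section \<open>Pieri rules on lists\<close>

definition qfac :: "nat \<Rightarrow> 'f::field fps" where "qfac m = qpoch fps_X m"
definition inv_qfac :: "nat \<Rightarrow> 'f::field fps" where "inv_qfac m = inverse (qfac m)"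
definition gauss_binom :: "nat \<Rightarrow> nat \<Rightarrow> 'f::field fps" where "gauss_binom m k = qfac m * inv_qfac k * inv_qfac (m - k)"

lemma qfac_0 [simp]: "qfac 0 = 1" by (simp add: qfac_def qpoch_def)
lemma qfac_Suc: "qfac (Suc m) = qfac m * (1 - fps_X ^ Suc m)" by (simp add: qfac_def qpoch_def)
lemma qfac_nth_0 [simp]: "fps_nth (qfac m :: 'f::field fps) 0 = 1"
  by (induction m) (auto simp: qfac_Suc)
lemma inv_qfac_0 [simp]: "inv_qfac 0 = 1" by (simp add: inv_qfac_def)
lemma qfac_inverse [simp]: "qfac m * inv_qfac m = 1" "inv_qfac m * qfac m = 1"
  by (simp_all add: inv_qfac_def inverse_mult_eq_1 inverse_mult_eq_1')
lemma inv_qfac_Suc: "(1 - fps_X ^ Suc m) * inv_qfac (Suc m) = inv_qfac m"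
proof -
  have "(1 - fps_X ^ Suc m) * inv_qfac (Suc m) = inv_qfac m * (qfac m * (1 - fps_X ^ Suc m)) * inv_qfac (Suc m)"
    by (simp add: mult.assoc[symmetric])
  also have "\<dots> = inv_qfac m * (qfac (Suc m) * inv_qfac (Suc m))" by (simp only: qfac_Suc mult.assoc)
  also have "\<dots> = inv_qfac m" by (simp only: qfac_inverse mult_1_right)
  finally show ?thesis .
qed

lemma divide_qp2: "a / (qfac m * qfac k) = a * inv_qfac m * inv_qfac k"
  by (simp add: fps_divide_unit inv_qfac_def fps_inverse_mult mult_ac)

lemma gauss_binom_0 [simp]: "gauss_binom m 0 = 1" by (simp add: gauss_binom_def)
lemma gauss_binom_self [simp]: "gauss_binom m m = 1" by (simp add: gauss_binom_def)
lemma gauss_binom_diff: "k \<le> m \<Longrightarrow> gauss_binom m (m - k) = gauss_binom m k" by (simp add: gauss_binom_def mult_ac)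

lemma gauss_binom_Suc:
  assumes "j < m"
  shows "gauss_binom (Suc m) (Suc j) = fps_X ^ Suc j * gauss_binom m (Suc j) + gauss_binom m j"
proof -
  obtain d where d: "m = Suc j + d" using assms less_iff_Suc_add by auto
  have e: "1 - fps_X ^ Suc m = fps_X ^ Suc j * (1 - fps_X ^ Suc d) + (1 - fps_X ^ Suc j :: 'a fps)"
    by (simp add: d algebra_simps power_add)
  have "gauss_binom (Suc m) (Suc j) = qfac m * (1 - fps_X ^ Suc m) * inv_qfac (Suc j) * (inv_qfac (Suc d) :: 'a fps)"
    by (simp only: gauss_binom_def qfac_Suc) (simp add: d)
  also have "\<dots> = fps_X ^ Suc j * (qfac m * inv_qfac (Suc j) * ((1 - fps_X ^ Suc d) * inv_qfac (Suc d)))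
      + qfac m * ((1 - fps_X ^ Suc j) * inv_qfac (Suc j)) * inv_qfac (Suc d)"
    unfolding e by (simp only: algebra_simps)
  also have "\<dots> = fps_X ^ Suc j * gauss_binom m (Suc j) + gauss_binom m j"
    unfolding inv_qfac_Suc gauss_binom_def by (simp add: d)
  finally show ?thesis .
qed

lemma gauss_binom_Suc':
  assumes "j < m"
  shows "gauss_binom (Suc m) (Suc j) = gauss_binom m (Suc j) + fps_X ^ (m - j) * (gauss_binom m j :: 'f::field fps)"
proof -
  obtain d where d: "m = Suc j + d" using assms less_iff_Suc_add by auto
  have 1: "gauss_binom (Suc m) (Suc m - Suc j) = (gauss_binom (Suc m) (Suc j) :: 'f fps)"
    "gauss_binom m (m - j) = (gauss_binom m j :: 'f fps)" "gauss_binom m (m - Suc j) = (gauss_binom m (Suc j) :: 'f fps)"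
    by (rule gauss_binom_diff; simp add: d)+
  have 2: "Suc m - Suc j = Suc d" "m - j = Suc d" "m - Suc j = d" by (simp_all add: d)
  have "gauss_binom (Suc m) (Suc d) = fps_X ^ Suc d * gauss_binom m (Suc d) + (gauss_binom m d :: 'f fps)" by (rule gauss_binom_Suc) (simp add: d)
  then show ?thesis using 1 unfolding 2 by (simp add: algebra_simps)
qed

section \<open>Exponents as lists\<close>

text \<open>The head of the list belongs to the highest index, so weakly decreasing lists are the
  dominant exponents.\<close>

definition list_exp :: "int list \<Rightarrow> nat \<Rightarrow> int" where
  "list_exp xs = (\<lambda>k. if k < length xs then rev xs ! k else 0)"

lemma list_exp_Cons: "list_exp (x # xs) = (\<lambda>k. if k = length xs then x else list_exp xs k)"
  by (auto simp: list_exp_def nth_append fun_eq_iff)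

lemma list_exp_upd: "list_exp (pre @ a # as) + unit_exp (length as) = list_exp (pre @ (a + 1) # as)"
  by (induction pre) (auto simp: list_exp_Cons unit_exp_def fun_eq_iff)

lemma list_exp_upd': "list_exp (pre @ a # as) - unit_exp (length as) = list_exp (pre @ (a - 1) # as)"
  by (induction pre) (auto simp: list_exp_Cons unit_exp_def fun_eq_iff)

text \<open>
  The action of \<open>\<Sum>\<^sub>r \<phi> r \<cdot> e\<^sub>r\<close> on exponents: each entry of the last list is raised or kept, \<open>pre\<close> is
  the part already treated, and \<open>\<phi>\<close> is shifted once for every raised entry.
\<close>

fun raise_sum :: "(nat \<Rightarrow> 'f) \<Rightarrow> (int list \<Rightarrow> 'f fps) \<Rightarrow> int list \<Rightarrow> int list \<Rightarrow> 'f::field fps" where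
  "raise_sum \<phi> Y pre [] = fps_const (\<phi> 0) * Y pre"
| "raise_sum \<phi> Y pre (a # as) = raise_sum \<phi> Y (pre @ [a]) as + raise_sum (\<lambda>r. \<phi> (Suc r)) Y (pre @ [a + 1]) as"

fun lower_sum :: "(nat \<Rightarrow> 'f) \<Rightarrow> (int list \<Rightarrow> 'f fps) \<Rightarrow> int list \<Rightarrow> int list \<Rightarrow> 'f::field fps" where
  "lower_sum \<phi> Y pre [] = fps_const (\<phi> 0) * Y pre"
| "lower_sum \<phi> Y pre (a # as) = lower_sum \<phi> Y (pre @ [a]) as + lower_sum (\<lambda>r. \<phi> (Suc r)) Y (pre @ [a - 1]) as"

lemma ev_elem_sym_raise_sum:
  "ev (\<lambda>b. F (list_exp (pre @ as) + b)) (elem_sym (length as) \<phi> * g) = raise_sum \<phi> (\<lambda>xs. ev (\<lambda>b. F (list_exp xs + b)) g) pre as"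
proof (induction as arbitrary: pre \<phi>)
  case Nil show ?case by (simp add: ev_emb)
next
  case (Cons a as)
  have "ev (\<lambda>b. F (list_exp (pre @ a # as) + b)) (elem_sym (length (a # as)) \<phi> * g) =
      ev (\<lambda>b. F (list_exp (pre @ a # as) + b)) (elem_sym (length as) \<phi> * g) +
      ev (\<lambda>b. F (list_exp (pre @ a # as) + (unit_exp (length as) + b))) (elem_sym (length as) (\<lambda>r. \<phi> (Suc r)) * g)"
    by (simp only: list.size elem_sym.simps distrib_right ev_add mult.assoc ev_mon add_0 add_Suc_right add_0_right)
  also have "\<dots> = raise_sum \<phi> (\<lambda>xs. ev (\<lambda>b. F (list_exp xs + b)) g) pre (a # as)"
    using Cons.IH[of "pre @ [a]" \<phi>] Cons.IH[of "pre @ [a + 1]" "\<lambda>r. \<phi> (Suc r)"]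
    by (simp only: add.assoc[symmetric] list_exp_upd raise_sum.simps append_assoc append.simps)
  finally show ?case .
qed

lemma coeff_at_elem_sym_lower_sum:
  "coeff_at (list_exp (pre @ as)) (elem_sym (length as) \<phi> * g) = lower_sum \<phi> (\<lambda>xs. coeff_at (list_exp xs) g) pre as"
proof (induction as arbitrary: pre \<phi>)
  case Nil show ?case by (simp add: coeff_at_emb)
next
  case (Cons a as)
  have "coeff_at (list_exp (pre @ a # as)) (elem_sym (length (a # as)) \<phi> * g) =
      coeff_at (list_exp (pre @ a # as)) (elem_sym (length as) \<phi> * g) +
      coeff_at (list_exp (pre @ a # as) - unit_exp (length as)) (elem_sym (length as) (\<lambda>r. \<phi> (Suc r)) * g)"
    by (simp only: list.size elem_sym.simps distrib_right coeff_at_add mult.assoc coeff_at_mon add_0 add_Suc_right add_0_right)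
  also have "\<dots> = lower_sum \<phi> (\<lambda>xs. coeff_at (list_exp xs) g) pre (a # as)"
    using Cons.IH[of "pre @ [a]" \<phi>] Cons.IH[of "pre @ [a - 1]" "\<lambda>r. \<phi> (Suc r)"]
    by (simp only: list_exp_upd' lower_sum.simps append_assoc append.simps)
  finally show ?case .
qed

definition hl_relation_list :: "nat \<Rightarrow> (int list \<Rightarrow> 'f::field fps) \<Rightarrow> bool" where
  "hl_relation_list n Y \<longleftrightarrow> (\<forall>pre b post. length pre + 2 + length post = n \<longrightarrow>
     Y (pre @ b # (b + 1) # post) = fps_X * Y (pre @ (b + 1) # b # post))"

lemma hl_relation_list_exp:
  assumes "hl_relation n X"
  shows "hl_relation_list n (\<lambda>xs. X (list_exp xs))"
  unfolding hl_relation_list_def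
proof (intro allI impI)
  fix pre post :: "int list" and b :: int
  assume n: "length pre + 2 + length post = n"
  let ?k = "length post"
  have list_exp: "list_exp (pre @ x # y # post) = (list_exp (pre @ (b + 1) # b # post))(Suc ?k := x, ?k := y)" for x y
    by (induction pre) (auto simp: list_exp_Cons fun_eq_iff)
  have sw: "swap_exp ?k (list_exp (pre @ b # (b + 1) # post)) = list_exp (pre @ (b + 1) # b # post)"
    unfolding list_exp[of b "b + 1"] by (subst (2) list_exp) (auto simp: swap_exp_def fun_eq_iff)
  have "list_exp (pre @ b # (b + 1) # post) ?k = list_exp (pre @ b # (b + 1) # post) (Suc ?k) + 1"
    unfolding list_exp[of b "b + 1"] by simp
  then show "X (list_exp (pre @ b # (b + 1) # post)) = fps_X * X (list_exp (pre @ (b + 1) # b # post))"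
    using assms n unfolding hl_relation_def sw[symmetric] by simp
qed

text \<open>Allows the treated prefix to be straightened while the rest of the list still awaits
  treatment.\<close>

lemma hl_relation_list_raise_sum: "hl_relation_list n Y \<Longrightarrow> length as \<le> n \<Longrightarrow> hl_relation_list (n - length as) (\<lambda>pre. raise_sum \<phi> Y pre as)"
proof (induction as arbitrary: \<phi> n)
  case Nil then show ?case by (simp add: hl_relation_list_def)
next
  case (Cons a as)
  have *: "hl_relation_list (n - length as) (\<lambda>pre. raise_sum \<phi> Y pre as)" for \<phi> by (rule Cons.IH) (use Cons.prems in auto)
  show ?case unfolding hl_relation_list_def
  proof (intro allI impI)
    fix pre post :: "int list" and b :: int
    assume "length pre + 2 + length post = n - length (a # as)"
    then have "length pre + 2 + length (post @ [x]) = n - length as" for x using Cons.prems by simp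
    then have "raise_sum \<phi> Y (pre @ b # (b + 1) # (post @ [x])) as = fps_X * raise_sum \<phi> Y (pre @ (b + 1) # b # (post @ [x])) as" for x \<phi>
      using *[of \<phi>] unfolding hl_relation_list_def by blast
    then show "raise_sum \<phi> Y (pre @ b # (b + 1) # post) (a # as) = fps_X * raise_sum \<phi> Y (pre @ (b + 1) # b # post) (a # as)"
      by (simp add: distrib_left)
  qed
qed

lemma hl_relation_list_lower_sum: "hl_relation_list n Y \<Longrightarrow> length as \<le> n \<Longrightarrow> hl_relation_list (n - length as) (\<lambda>pre. lower_sum \<phi> Y pre as)"
proof (induction as arbitrary: \<phi> n)
  case Nil then show ?case by (simp add: hl_relation_list_def)
next
  case (Cons a as)
  have *: "hl_relation_list (n - length as) (\<lambda>pre. lower_sum \<phi> Y pre as)" for \<phi> by (rule Cons.IH) (use Cons.prems in auto)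
  show ?case unfolding hl_relation_list_def
  proof (intro allI impI)
    fix pre post :: "int list" and b :: int
    assume "length pre + 2 + length post = n - length (a # as)"
    then have "length pre + 2 + length (post @ [x]) = n - length as" for x using Cons.prems by simp
    then have "lower_sum \<phi> Y (pre @ b # (b + 1) # (post @ [x])) as = fps_X * lower_sum \<phi> Y (pre @ (b + 1) # b # (post @ [x])) as" for x \<phi>
      using *[of \<phi>] unfolding hl_relation_list_def by blast
    then show "lower_sum \<phi> Y (pre @ b # (b + 1) # post) (a # as) = fps_X * lower_sum \<phi> Y (pre @ (b + 1) # b # post) (a # as)"
      by (simp add: distrib_left)
  qed
qed

lemma hl_relation_list_move:
  assumes "hl_relation_list n Y"
  shows "length pre + 1 + j + length post = n \<Longrightarrow>
     Y (pre @ b # replicate j (b + 1) @ post) = fps_X ^ j * Y (pre @ replicate j (b + 1) @ b # post)"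
proof (induction j arbitrary: pre)
  case (Suc j)
  have "Y (pre @ b # replicate (Suc j) (b + 1) @ post) = fps_X * Y ((pre @ [b + 1]) @ b # replicate j (b + 1) @ post)"
    using assms Suc.prems unfolding hl_relation_list_def by simp
  also have "Y ((pre @ [b + 1]) @ b # replicate j (b + 1) @ post) = fps_X ^ j * Y ((pre @ [b + 1]) @ replicate j (b + 1) @ b # post)"
    by (rule Suc.IH) (use Suc.prems in simp)
  finally show ?case by (simp add: mult.assoc)
qed simp

text \<open>Among m equal entries the raised ones are gathered in front, and each passage of a
  raised entry over a kept one costs a factor q. Summing q to the number of passages gives the
  Gaussian binomial, here through the Pascal rule for the first entry.\<close>

lemma raise_sum_block:
  assumes "hl_relation_list n Y"
  shows "length pre + m + length rest = n \<Longrightarrow> raise_sum \<phi> Y pre (replicate m a @ rest) =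
     (\<Sum>j\<le>m. gauss_binom m j * raise_sum (\<lambda>r. \<phi> (r + j)) Y (pre @ replicate j (a + 1) @ replicate (m - j) a) rest)"
proof (induction m arbitrary: pre \<phi>)
  case (Suc m)
  let ?T = "\<lambda>j. raise_sum (\<lambda>r. \<phi> (r + j)) Y (pre @ replicate j (a + 1) @ replicate (Suc m - j) a) rest"
  have len: "length rest \<le> n" using Suc.prems by simp
  have 1: "raise_sum \<phi> Y (pre @ [a]) (replicate m a @ rest) = (\<Sum>j\<le>m. fps_X ^ j * gauss_binom m j * ?T j)"
  proof -
    have "raise_sum \<phi> Y (pre @ [a]) (replicate m a @ rest) =
      (\<Sum>j\<le>m. gauss_binom m j * raise_sum (\<lambda>r. \<phi> (r + j)) Y ((pre @ [a]) @ replicate j (a + 1) @ replicate (m - j) a) rest)"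
      by (rule Suc.IH) (use Suc.prems in simp)
    also have "\<dots> = (\<Sum>j\<le>m. fps_X ^ j * gauss_binom m j * ?T j)"
    proof (rule sum.cong)
      fix j assume j: "j \<in> {..m}"
      have "raise_sum (\<lambda>r. \<phi> (r + j)) Y (pre @ a # replicate j (a + 1) @ replicate (m - j) a) rest =
         fps_X ^ j * raise_sum (\<lambda>r. \<phi> (r + j)) Y (pre @ replicate j (a + 1) @ a # replicate (m - j) a) rest"
        by (rule hl_relation_list_move[OF hl_relation_list_raise_sum[OF assms len]]) (use Suc.prems j in simp)
      moreover have "a # replicate (m - j) a = replicate (Suc m - j) a" using j by (simp add: Suc_diff_le)
      ultimately show "gauss_binom m j * raise_sum (\<lambda>r. \<phi> (r + j)) Y ((pre @ [a]) @ replicate j (a + 1) @ replicate (m - j) a) rest =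
         fps_X ^ j * gauss_binom m j * ?T j" by (simp add: mult_ac)
    qed simp
    finally show ?thesis .
  qed
  have 2: "raise_sum (\<lambda>r. \<phi> (Suc r)) Y (pre @ [a + 1]) (replicate m a @ rest) = (\<Sum>j\<le>m. gauss_binom m j * ?T (Suc j))"
    by (subst Suc.IH) (use Suc.prems in auto)
  have "(\<Sum>j\<le>Suc m. gauss_binom (Suc m) j * ?T j) = ?T 0 + (\<Sum>j\<le>m. gauss_binom (Suc m) (Suc j) * ?T (Suc j))"
    unfolding sum.atMost_Suc_shift by simp
  also have "(\<Sum>j\<le>m. gauss_binom (Suc m) (Suc j) * ?T (Suc j)) =
      (\<Sum>j\<le>m. (if j < m then fps_X ^ Suc j * gauss_binom m (Suc j) else 0) * ?T (Suc j) + gauss_binom m j * ?T (Suc j))"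
    by (rule sum.cong) (auto simp: gauss_binom_Suc algebra_simps)
  also have "\<dots> = (\<Sum>j<m. fps_X ^ Suc j * gauss_binom m (Suc j) * ?T (Suc j)) + (\<Sum>j\<le>m. gauss_binom m j * ?T (Suc j))"
    unfolding sum.distrib by (simp add: lessThan_Suc_atMost[symmetric] del: power_Suc)
  finally have "(\<Sum>j\<le>Suc m. gauss_binom (Suc m) j * ?T j) =
      (?T 0 + (\<Sum>j<m. fps_X ^ Suc j * gauss_binom m (Suc j) * ?T (Suc j))) + (\<Sum>j\<le>m. gauss_binom m j * ?T (Suc j))"
    by (simp only: add.assoc)
  also have "?T 0 + (\<Sum>j<m. fps_X ^ Suc j * gauss_binom m (Suc j) * ?T (Suc j)) = (\<Sum>j\<le>m. fps_X ^ j * gauss_binom m j * ?T j)"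
    by (simp only: sum.atMost_shift) simp
  finally show ?case by (simp only: replicate_Suc append_Cons raise_sum.simps 1 2)
qed simp

text \<open>Here a lowered entry has to pass the kept entries behind it, so the power of q falls on
  the other term and the second Pascal rule is the right one.\<close>

lemma lower_sum_block:
  assumes "hl_relation_list n Y"
  shows "length pre + m + length rest = n \<Longrightarrow> lower_sum \<phi> Y pre (replicate m a @ rest) =
     (\<Sum>j\<le>m. gauss_binom m j * lower_sum (\<lambda>r. \<phi> (r + j)) Y (pre @ replicate (m - j) a @ replicate j (a - 1)) rest)"
proof (induction m arbitrary: pre \<phi>)
  case (Suc m)
  let ?T = "\<lambda>j. lower_sum (\<lambda>r. \<phi> (r + j)) Y (pre @ replicate (Suc m - j) a @ replicate j (a - 1)) rest"
  have len: "length rest \<le> n" using Suc.prems by simp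
  have 1: "lower_sum \<phi> Y (pre @ [a]) (replicate m a @ rest) = (\<Sum>j\<le>m. gauss_binom m j * ?T j)"
  proof -
    have "lower_sum \<phi> Y (pre @ [a]) (replicate m a @ rest) =
      (\<Sum>j\<le>m. gauss_binom m j * lower_sum (\<lambda>r. \<phi> (r + j)) Y ((pre @ [a]) @ replicate (m - j) a @ replicate j (a - 1)) rest)"
      by (rule Suc.IH) (use Suc.prems in simp)
    also have "\<dots> = (\<Sum>j\<le>m. gauss_binom m j * ?T j)" by (rule sum.cong) (auto simp: Suc_diff_le)
    finally show ?thesis .
  qed
  have 2: "lower_sum (\<lambda>r. \<phi> (Suc r)) Y (pre @ [a - 1]) (replicate m a @ rest) = (\<Sum>j\<le>m. fps_X ^ (m - j) * gauss_binom m j * ?T (Suc j))"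
  proof -
    have "lower_sum (\<lambda>r. \<phi> (Suc r)) Y (pre @ [a - 1]) (replicate m a @ rest) =
      (\<Sum>j\<le>m. gauss_binom m j * lower_sum (\<lambda>r. \<phi> (Suc (r + j))) Y ((pre @ [a - 1]) @ replicate (m - j) a @ replicate j (a - 1)) rest)"
      by (rule Suc.IH) (use Suc.prems in simp)
    also have "\<dots> = (\<Sum>j\<le>m. fps_X ^ (m - j) * gauss_binom m j * ?T (Suc j))"
    proof (rule sum.cong)
      fix j assume j: "j \<in> {..m}"
      have "lower_sum (\<lambda>r. \<phi> (Suc (r + j))) Y (pre @ (a - 1) # replicate (m - j) (a - 1 + 1) @ replicate j (a - 1)) rest =
         fps_X ^ (m - j) * lower_sum (\<lambda>r. \<phi> (Suc (r + j))) Y (pre @ replicate (m - j) (a - 1 + 1) @ (a - 1) # replicate j (a - 1)) rest"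
        by (rule hl_relation_list_move[OF hl_relation_list_lower_sum[OF assms len]]) (use Suc.prems j in simp)
      then show "gauss_binom m j * lower_sum (\<lambda>r. \<phi> (Suc (r + j))) Y ((pre @ [a - 1]) @ replicate (m - j) a @ replicate j (a - 1)) rest =
         fps_X ^ (m - j) * gauss_binom m j * ?T (Suc j)" by (simp add: mult_ac)
    qed simp
    finally show ?thesis .
  qed
  have "(\<Sum>j\<le>Suc m. gauss_binom (Suc m) j * ?T j) = ?T 0 + (\<Sum>j\<le>m. gauss_binom (Suc m) (Suc j) * ?T (Suc j))"
    unfolding sum.atMost_Suc_shift by simp
  also have "(\<Sum>j\<le>m. gauss_binom (Suc m) (Suc j) * ?T (Suc j)) =
      (\<Sum>j\<le>m. (if j < m then gauss_binom m (Suc j) else 0) * ?T (Suc j) + fps_X ^ (m - j) * gauss_binom m j * ?T (Suc j))"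
    by (rule sum.cong) (auto simp: gauss_binom_Suc' algebra_simps)
  also have "\<dots> = (\<Sum>j<m. gauss_binom m (Suc j) * ?T (Suc j)) + (\<Sum>j\<le>m. fps_X ^ (m - j) * gauss_binom m j * ?T (Suc j))"
    unfolding sum.distrib by (simp add: lessThan_Suc_atMost[symmetric] del: power_Suc)
  finally have "(\<Sum>j\<le>Suc m. gauss_binom (Suc m) j * ?T j) =
      (?T 0 + (\<Sum>j<m. gauss_binom m (Suc j) * ?T (Suc j))) + (\<Sum>j\<le>m. fps_X ^ (m - j) * gauss_binom m j * ?T (Suc j))"
    by (simp only: add.assoc)
  also have "?T 0 + (\<Sum>j<m. gauss_binom m (Suc j) * ?T (Suc j)) = (\<Sum>j\<le>m. gauss_binom m j * ?T j)"
    by (simp only: sum.atMost_shift) simp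
  finally show ?case by (simp only: replicate_Suc append_Cons lower_sum.simps 1 2)
qed simp

text \<open>Fixing the value 0 from b on makes the set finite. Horizontal strips above or below a
  partition are such boxes, so sums over strips of products over rows factor.\<close>

definition fun_box :: "nat \<Rightarrow> (nat \<Rightarrow> nat) \<Rightarrow> (nat \<Rightarrow> nat) \<Rightarrow> (nat \<Rightarrow> nat) set" where
  "fun_box b lo hi = {f. \<forall>i. if i < b then lo i \<le> f i \<and> f i \<le> hi i else f i = 0}"

lemma fun_box_0: "fun_box 0 lo hi = {\<lambda>_. 0}" by (auto simp: fun_box_def)

lemma fun_box_Suc: "fun_box (Suc b) lo hi = (\<lambda>(v, f). f(b := v)) ` ({lo b..hi b} \<times> fun_box b lo hi)"
proof (intro equalityI subsetI)
  fix f assume f: "f \<in> fun_box (Suc b) lo hi"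
  have "f b \<in> {lo b..hi b}" "f(b := 0) \<in> fun_box b lo hi"
    using f unfolding fun_box_def by (force, force simp: less_Suc_eq)
  then show "f \<in> (\<lambda>(v, f). f(b := v)) ` ({lo b..hi b} \<times> fun_box b lo hi)"
    by (intro image_eqI[of _ _ "(f b, f(b := 0))"]) auto
next
  fix f assume "f \<in> (\<lambda>(v, f). f(b := v)) ` ({lo b..hi b} \<times> fun_box b lo hi)"
  then obtain v g where "f = g(b := v)" "v \<in> {lo b..hi b}" "g \<in> fun_box b lo hi" by auto
  then show "f \<in> fun_box (Suc b) lo hi" unfolding fun_box_def by (auto simp: less_Suc_eq)
qed

lemma sum_fun_box_Suc: "(\<Sum>f\<in>fun_box (Suc b) lo hi. G f) = (\<Sum>v\<in>{lo b..hi b}. \<Sum>f\<in>fun_box b lo hi. G (f(b := v)))"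
proof -
  have inj: "inj_on (\<lambda>(v, f). f(b := v)) ({lo b..hi b} \<times> fun_box b lo hi)"
  proof (rule inj_onI, clarify)
    fix v f w g assume *: "f \<in> fun_box b lo hi" "g \<in> fun_box b lo hi" "f(b := v) = g(b := w)"
    have "v = w" using fun_cong[OF *(3), of b] by simp
    moreover have "f i = g i" for i
    proof (cases "i = b")
      case True then show ?thesis using *(1,2) by (simp add: fun_box_def)
    next
      case False then show ?thesis using fun_cong[OF *(3), of i] by simp
    qed
    ultimately show "v = w \<and> f = g" by auto
  qed
  show ?thesis unfolding fun_box_Suc sum.reindex[OF inj] sum.cartesian_product by (simp add: case_prod_beta o_def)
qed

lemma finite_fun_box [simp]: "finite (fun_box b lo hi)"
  by (induction b) (auto simp: fun_box_0 fun_box_Suc)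

lemma sum_prod_fun_box: "(\<Sum>f\<in>fun_box b lo hi. \<Prod>i<b. g i (f i)) = (\<Prod>i<b. \<Sum>v\<in>{lo i..hi i}. (g i v :: 'c::comm_semiring_1))"
proof (induction b)
  case 0 then show ?case by (simp add: fun_box_0)
next
  case (Suc b)
  have "(\<Prod>i<Suc b. g i ((f(b := v)) i)) = (\<Prod>i<b. g i (f i)) * g b v" for f v
    by simp
  then have "(\<Sum>f\<in>fun_box (Suc b) lo hi. \<Prod>i<Suc b. g i (f i)) = (\<Sum>v\<in>{lo b..hi b}. \<Sum>f\<in>fun_box b lo hi. (\<Prod>i<b. g i (f i)) * g b v)"
    by (simp only: sum_fun_box_Suc)
  also have "\<dots> = (\<Sum>v\<in>{lo b..hi b}. (\<Prod>i<b. \<Sum>v\<in>{lo i..hi i}. g i v) * g b v)"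
    by (simp only: sum_distrib_right[symmetric] Suc.IH)
  also have "\<dots> = (\<Prod>i<Suc b. \<Sum>v\<in>{lo i..hi i}. g i v)"
    by (simp add: sum_distrib_left)
  finally show ?case .
qed

text \<open>
  With \<open>lam b = 0\<close>: the conjugate partition of \<open>lam\<close>, padded with zeros to length \<open>n\<close>.
\<close>

fun part_list_below :: "nat \<Rightarrow> (nat \<Rightarrow> nat) \<Rightarrow> nat \<Rightarrow> int list" where
  "part_list_below n lam 0 = replicate (n - lam 0) 0"
| "part_list_below n lam (Suc b) = replicate (lam b - lam (Suc b)) (int (Suc b)) @ part_list_below n lam b"

lemma part_list_below_cong: "(\<And>i. i \<le> b \<Longrightarrow> lam i = mu i) \<Longrightarrow> part_list_below n lam b = part_list_below n mu b"
  by (induction b) auto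

lemma length_part_list_below:
  assumes "antimono lam" "lam 0 \<le> n"
  shows "length (part_list_below n lam b) = n - lam b"
proof (induction b)
  case (Suc b)
  have "lam (Suc b) \<le> lam b" "lam b \<le> lam 0" using assms(1) by (auto intro: antimonoD)
  then show ?case using Suc assms by simp
qed simp

text \<open>Treats n as the part preceding \<open>mu 0\<close>: then the entry i occurs
  \<open>prev_part n mu i - mu i\<close> times in the conjugate list, for i = 0 as well.\<close>

definition prev_part :: "nat \<Rightarrow> (nat \<Rightarrow> nat) \<Rightarrow> nat \<Rightarrow> nat" where
  "prev_part n mu i = (case i of 0 \<Rightarrow> n | Suc j \<Rightarrow> mu j)"

lemma prev_part_simps [simp]: "prev_part n mu 0 = n" "prev_part n mu (Suc j) = mu j" by (simp_all add: prev_part_def)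

lemma sum_reindex_shift: "(\<Sum>v\<in>{a..b}. G v) = (\<Sum>j\<le>b - a. G (a + j))" if "a \<le> (b :: nat)"
  by (rule sum.reindex_bij_witness[of _ "\<lambda>j. a + j" "\<lambda>v. v - a"]) (use that in auto)

lemma sum_reindex_rev: "(\<Sum>v\<in>{a..b}. G v) = (\<Sum>j\<le>b - a. G (b - j))" if "a \<le> (b :: nat)"
  by (rule sum.reindex_bij_witness[of _ "\<lambda>j. b - j" "\<lambda>v. b - v"]) (use that in auto)

text \<open>The number \<open>lam i - mu i\<close> says how many entries i become i + 1. Kept
  entries b + 1 and raised entries b merge into one block, which is exactly the block of b + 1 in
  the list of \<open>lam\<close>.\<close>

lemma raise_sum_part_list_below:
  assumes "hl_relation_list n Y" "antimono mu" "mu 0 \<le> n"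
  shows "length pre + (n - mu b) = n \<Longrightarrow> raise_sum \<phi> Y pre (part_list_below n mu b) =
    (\<Sum>lam\<in>fun_box (Suc b) mu (prev_part n mu). (\<Prod>i\<le>b. gauss_binom (prev_part n mu i - mu i) (lam i - mu i)) *
       (fps_const (\<phi> (\<Sum>i\<le>b. lam i - mu i)) *
       Y (pre @ replicate (lam b - mu b) (int (Suc b)) @ part_list_below n lam b)))"
proof (induction b arbitrary: pre \<phi>)
  case 0
  have "raise_sum \<phi> Y pre (replicate (n - mu 0) 0 @ []) = (\<Sum>j\<le>n - mu 0. gauss_binom (n - mu 0) j *
     raise_sum (\<lambda>r. \<phi> (r + j)) Y (pre @ replicate j (0 + 1) @ replicate (n - mu 0 - j) 0) [])"
    by (rule raise_sum_block[OF assms(1)]) (use 0 in simp)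
  then show ?case using assms(3)
    by (simp add: sum_fun_box_Suc fun_box_0 sum_reindex_shift lessThan_Suc_atMost[symmetric] diff_diff_eq)
next
  case (Suc b)
  let ?m = "mu b - mu (Suc b)"
  have mono: "mu (Suc b) \<le> mu b" "mu b \<le> mu 0" "mu (Suc b) \<le> mu 0" using assms(2) by (auto intro: antimonoD)
  let ?A = "\<lambda>j lam. (\<Prod>i\<le>b. gauss_binom (prev_part n mu i - mu i) (lam i - mu i)) * (fps_const (\<phi> ((\<Sum>i\<le>b. lam i - mu i) + j)) *
      Y ((pre @ replicate j (int (Suc b) + 1) @ replicate (?m - j) (int (Suc b))) @
        replicate (lam b - mu b) (int (Suc b)) @ part_list_below n lam b))"
  have "raise_sum \<phi> Y pre (part_list_below n mu (Suc b)) = (\<Sum>j\<le>?m. gauss_binom ?m j *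
     raise_sum (\<lambda>r. \<phi> (r + j)) Y (pre @ replicate j (int (Suc b) + 1) @ replicate (?m - j) (int (Suc b))) (part_list_below n mu b))"
    unfolding part_list_below.simps
    by (rule raise_sum_block[OF assms(1)]) (use Suc.prems mono assms in \<open>simp add: length_part_list_below\<close>)
  also have "\<dots> = (\<Sum>j\<le>?m. gauss_binom ?m j * (\<Sum>lam\<in>fun_box (Suc b) mu (prev_part n mu). ?A j lam))"
  proof (rule sum.cong)
    fix j assume "j \<in> {..?m}"
    then show "gauss_binom ?m j * raise_sum (\<lambda>r. \<phi> (r + j)) Y (pre @ replicate j (int (Suc b) + 1) @ replicate (?m - j) (int (Suc b))) (part_list_below n mu b) =
      gauss_binom ?m j * (\<Sum>lam\<in>fun_box (Suc b) mu (prev_part n mu). ?A j lam)"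
      by (subst Suc.IH) (use Suc.prems mono assms in auto)
  qed simp
  also have "\<dots> = (\<Sum>j\<le>?m. \<Sum>lam\<in>fun_box (Suc b) mu (prev_part n mu). gauss_binom ?m j * ?A j lam)"
    by (simp only: sum_distrib_left)
  also have "\<dots> = (\<Sum>lam\<in>fun_box (Suc (Suc b)) mu (prev_part n mu). (\<Prod>i\<le>Suc b. gauss_binom (prev_part n mu i - mu i) (lam i - mu i)) *
       (fps_const (\<phi> (\<Sum>i\<le>Suc b. lam i - mu i)) *
       Y (pre @ replicate (lam (Suc b) - mu (Suc b)) (int (Suc (Suc b))) @ part_list_below n lam (Suc b))))"
    unfolding sum_fun_box_Suc[where b = "Suc b"] prev_part_simps sum_reindex_shift[OF mono(1)]
  proof (intro sum.cong refl)
    fix j lam assume j: "j \<in> {..?m}" and lam: "lam \<in> fun_box (Suc b) mu (prev_part n mu)"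
    define lam' where "lam' = lam(Suc b := mu (Suc b) + j)"
    have l: "mu b \<le> lam b" using lam by (auto simp: fun_box_def dest!: spec[of _ b])
    have c: "part_list_below n lam' b = part_list_below n lam b" by (rule part_list_below_cong) (simp add: lam'_def)
    have "lam b - lam' (Suc b) = (?m - j) + (lam b - mu b)" using j l mono(1) by (simp add: lam'_def)
    then have "part_list_below n lam' (Suc b) = (replicate (?m - j) (int (Suc b)) @ replicate (lam b - mu b) (int (Suc b))) @ part_list_below n lam b"
      unfolding part_list_below.simps c replicate_add[symmetric] by (simp add: lam'_def)
    then have 1: "Y (pre @ replicate (lam' (Suc b) - mu (Suc b)) (int (Suc (Suc b))) @ part_list_below n lam' (Suc b)) =
      Y ((pre @ replicate j (int (Suc b) + 1) @ replicate (?m - j) (int (Suc b))) @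
        replicate (lam b - mu b) (int (Suc b)) @ part_list_below n lam b)"
      by (simp add: lam'_def add_ac)
    have 2: "(\<Sum>i\<le>Suc b. lam' i - mu i) = (\<Sum>i\<le>b. lam i - mu i) + j" by (simp add: lam'_def)
    have 3: "(\<Prod>i\<le>Suc b. gauss_binom (prev_part n mu i - mu i) (lam' i - mu i)) = (\<Prod>i\<le>b. gauss_binom (prev_part n mu i - mu i) (lam i - mu i)) * (gauss_binom ?m j :: 'a fps)"
      by (simp add: lam'_def)
    show "gauss_binom ?m j * ?A j lam = (\<Prod>i\<le>Suc b. gauss_binom (prev_part n mu i - mu i) ((lam(Suc b := mu (Suc b) + j)) i - mu i)) *
       (fps_const (\<phi> (\<Sum>i\<le>Suc b. (lam(Suc b := mu (Suc b) + j)) i - mu i)) *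
       Y (pre @ replicate ((lam(Suc b := mu (Suc b) + j)) (Suc b) - mu (Suc b)) (int (Suc (Suc b))) @ part_list_below n (lam(Suc b := mu (Suc b) + j)) (Suc b)))"
      unfolding lam'_def[symmetric] 1 2 3 by (simp only: mult_ac)
  qed
  finally show ?case .
qed

text \<open>The update \<open>mu(b := lam b)\<close> expresses that the blocks above b have not yet
  handed down any entries when the tail of the list is treated.\<close>

lemma lower_sum_part_list_below:
  assumes "hl_relation_list n Y" "antimono lam" "lam 0 \<le> n" "\<And>xs x. x < 0 \<Longrightarrow> length xs + 1 = n \<Longrightarrow> Y (xs @ [x]) = 0"
  shows "length pre + (n - lam b) = n \<Longrightarrow> lower_sum \<phi> Y pre (part_list_below n lam b) =
    (\<Sum>mu\<in>fun_box b (\<lambda>i. lam (Suc i)) lam. (\<Prod>i<b. gauss_binom (lam i - lam (Suc i)) (lam i - mu i)) *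
       (fps_const (\<phi> (\<Sum>i<b. lam i - mu i)) * Y (pre @ part_list_below n (mu(b := lam b)) b)))"
proof (induction b arbitrary: pre \<phi>)
  case 0
  let ?m = "n - lam 0"
  have "lower_sum \<phi> Y pre (replicate ?m 0 @ []) = (\<Sum>j\<le>?m. gauss_binom ?m j *
     lower_sum (\<lambda>r. \<phi> (r + j)) Y (pre @ replicate (?m - j) 0 @ replicate j (0 - 1)) [])"
    by (rule lower_sum_block[OF assms(1)]) (use 0 in simp)
  \<comment> \<open>A lowered zero becomes -1 and ends up last in the list, where \<open>Y\<close>
    vanishes; so no zero may be lowered.\<close>
  also have "\<dots> = (\<Sum>j\<in>{0}. gauss_binom ?m j * lower_sum (\<lambda>r. \<phi> (r + j)) Y (pre @ replicate (?m - j) 0 @ replicate j (0 - 1)) [])"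
  proof (rule sum.mono_neutral_right)
    show "\<forall>j\<in>{..?m} - {0}. gauss_binom ?m j * lower_sum (\<lambda>r. \<phi> (r + j)) Y (pre @ replicate (?m - j) 0 @ replicate j (0 - 1)) [] = 0"
    proof
      fix j assume "j \<in> {..?m} - {0}"
      then obtain i where j: "j = Suc i" "Suc i \<le> ?m" by (cases j) auto
      then have "Y ((pre @ replicate (?m - j) 0 @ replicate i (- 1)) @ [- 1]) = 0"
        by (intro assms(4)) (use 0 in auto)
      then show "gauss_binom ?m j * lower_sum (\<lambda>r. \<phi> (r + j)) Y (pre @ replicate (?m - j) 0 @ replicate j (0 - 1)) [] = 0"
        by (simp add: j replicate_append_same)
    qed
  qed auto
  finally show ?case by (simp add: fun_box_0)
next
  case (Suc b)
  let ?m = "lam b - lam (Suc b)"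
  have mono: "lam (Suc b) \<le> lam b" "lam b \<le> lam 0" "lam (Suc b) \<le> lam 0" using assms(2) by (auto intro: antimonoD)
  let ?A = "\<lambda>j mu. (\<Prod>i<b. gauss_binom (lam i - lam (Suc i)) (lam i - mu i)) * (fps_const (\<phi> ((\<Sum>i<b. lam i - mu i) + j)) *
      Y ((pre @ replicate (?m - j) (int (Suc b)) @ replicate j (int (Suc b) - 1)) @ part_list_below n (mu(b := lam b)) b))"
  have "lower_sum \<phi> Y pre (part_list_below n lam (Suc b)) = (\<Sum>j\<le>?m. gauss_binom ?m j *
     lower_sum (\<lambda>r. \<phi> (r + j)) Y (pre @ replicate (?m - j) (int (Suc b)) @ replicate j (int (Suc b) - 1)) (part_list_below n lam b))"
    unfolding part_list_below.simps
    by (rule lower_sum_block[OF assms(1)]) (use Suc.prems mono assms in \<open>simp add: length_part_list_below\<close>)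
  also have "\<dots> = (\<Sum>j\<le>?m. gauss_binom ?m j * (\<Sum>mu\<in>fun_box b (\<lambda>i. lam (Suc i)) lam. ?A j mu))"
  proof (rule sum.cong)
    fix j assume "j \<in> {..?m}"
    then show "gauss_binom ?m j * lower_sum (\<lambda>r. \<phi> (r + j)) Y (pre @ replicate (?m - j) (int (Suc b)) @ replicate j (int (Suc b) - 1)) (part_list_below n lam b) =
      gauss_binom ?m j * (\<Sum>mu\<in>fun_box b (\<lambda>i. lam (Suc i)) lam. ?A j mu)"
      by (subst Suc.IH) (use Suc.prems mono assms in auto)
  qed simp
  also have "\<dots> = (\<Sum>j\<le>?m. \<Sum>mu\<in>fun_box b (\<lambda>i. lam (Suc i)) lam. gauss_binom ?m j * ?A j mu)"
    by (simp only: sum_distrib_left)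
  also have "\<dots> = (\<Sum>mu\<in>fun_box (Suc b) (\<lambda>i. lam (Suc i)) lam. (\<Prod>i<Suc b. gauss_binom (lam i - lam (Suc i)) (lam i - mu i)) *
       (fps_const (\<phi> (\<Sum>i<Suc b. lam i - mu i)) * Y (pre @ part_list_below n (mu(Suc b := lam (Suc b))) (Suc b))))"
    unfolding sum_fun_box_Suc sum_reindex_rev[OF mono(1)]
  proof (intro sum.cong refl)
    fix j mu assume j: "j \<in> {..?m}" and mu: "mu \<in> fun_box b (\<lambda>i. lam (Suc i)) lam"
    define mu' where "mu' = mu(b := lam b - j)"
    have "part_list_below n (mu'(Suc b := lam (Suc b))) (Suc b) = replicate (?m - j) (int (Suc b)) @ replicate j (int b) @ part_list_below n (mu(b := lam b)) b"
    proof (cases b)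
      case 0
      have "replicate (n - (lam b - j)) (0 :: int) = replicate (j + (n - lam b)) 0"
        using j assms(3) mono 0 by (intro arg_cong2[where f = replicate]) auto
      then show ?thesis by (simp add: 0 mu'_def replicate_add diff_right_commute)
    next
      case (Suc a)
      have l: "lam b \<le> mu a" using mu Suc by (auto simp: fun_box_def dest!: spec[of _ a])
      have c: "part_list_below n (mu'(Suc b := lam (Suc b))) a = part_list_below n (mu(b := lam b)) a"
        by (rule part_list_below_cong) (simp add: mu'_def Suc)
      have "mu a - (lam b - j) = j + (mu a - lam b)" using l j by auto
      then have "replicate (mu a - (lam b - j)) (int b) = replicate j (int b) @ replicate (mu a - lam b) (int b)"
        by (simp add: replicate_add)
      then show ?thesis using c by (simp add: Suc mu'_def diff_right_commute)
    qed
    then have 1: "Y (pre @ part_list_below n (mu'(Suc b := lam (Suc b))) (Suc b)) =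
      Y ((pre @ replicate (?m - j) (int (Suc b)) @ replicate j (int (Suc b) - 1)) @ part_list_below n (mu(b := lam b)) b)"
      by simp
    have 2: "(\<Sum>i<Suc b. lam i - mu' i) = (\<Sum>i<b. lam i - mu i) + j" using j by (simp add: mu'_def)
    have 3: "(\<Prod>i<Suc b. gauss_binom (lam i - lam (Suc i)) (lam i - mu' i)) = (\<Prod>i<b. gauss_binom (lam i - lam (Suc i)) (lam i - mu i)) * (gauss_binom ?m j :: 'a fps)"
      using j by (simp add: mu'_def)
    show "gauss_binom ?m j * ?A j mu = (\<Prod>i<Suc b. gauss_binom (lam i - lam (Suc i)) (lam i - (mu(b := lam b - j)) i)) *
       (fps_const (\<phi> (\<Sum>i<Suc b. lam i - (mu(b := lam b - j)) i)) *
       Y (pre @ part_list_below n ((mu(b := lam b - j))(Suc b := lam (Suc b))) (Suc b)))"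
      unfolding mu'_def[symmetric] 1 2 3 by (simp only: mult_ac)
  qed
  finally show ?case .
qed

section \<open>Partitions and Pieri rules\<close>

lemma partition_antimono: "is_partition lam \<Longrightarrow> i \<le> j \<Longrightarrow> lam j \<le> lam i"
  by (simp add: is_partition_def antimonoD)

lemma partition_zero: "is_partition lam \<Longrightarrow> lam b = 0 \<Longrightarrow> b \<le> i \<Longrightarrow> lam i = 0"
  using partition_antimono[of lam b i] by simp

lemma partition_bound:
  assumes "is_partition lam"
  obtains b where "B \<le> b" "lam b = 0"
proof -
  have "finite {i. lam i \<noteq> 0}" using assms by (simp add: is_partition_def)
  then obtain m where "\<forall>i\<in>{i. lam i \<noteq> 0}. i \<le> m" using finite_nat_set_iff_bounded_le by blast
  then have "lam (max B (Suc m)) = 0" by (metis (mono_tags, lifting) max.cobounded2 mem_Collect_eq not_less_eq_eq)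
  then show thesis using that[of "max B (Suc m)"] by simp
qed

lemma partitionI:
  assumes "\<And>i. lam (Suc i) \<le> lam i" "lam b = 0"
  shows "is_partition lam"
proof -
  have a: "antimono lam" unfolding antimono_iff_le_Suc using assms(1) by blast
  have "{i. lam i \<noteq> 0} \<subseteq> {..<b}"
  proof
    fix i assume i: "i \<in> {i. lam i \<noteq> 0}"
    have "\<not> b \<le> i" using antimonoD[OF a, of b i] assms(2) i by auto
    then show "i \<in> {..<b}" by simp
  qed
  then show ?thesis using a finite_subset unfolding is_partition_def by blast
qed

lemma psize_eq:
  assumes "is_partition lam" "lam b = 0"
  shows "psize lam = (\<Sum>i<b. lam i)"
proof -
  have "Sum_any lam = (\<Sum>i\<in>{..<b}. lam i)"
  proof (rule Sum_any.expand_superset)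
    show "{a. lam a \<noteq> 0} \<subseteq> {..<b}" using partition_zero[OF assms] by (metis (mono_tags, lifting) lessThan_iff mem_Collect_eq not_le subsetI)
  qed simp
  then show ?thesis by (simp add: psize_def)
qed

text \<open>By \<open>part_list_eq\<close> every zero of \<open>lam\<close> gives the same list; the
  least one only fixes a definite choice.\<close>

definition part_list :: "nat \<Rightarrow> (nat \<Rightarrow> nat) \<Rightarrow> int list" where
  "part_list n lam = part_list_below n lam (LEAST b. lam b = 0)"

lemma part_list_below_stable:
  assumes "is_partition lam" "lam z = 0"
  shows "part_list_below n lam (z + j) = part_list_below n lam z"
proof (induction j)
  case (Suc j)
  have "lam (z + j) = 0" using partition_zero[OF assms] by simp
  then show ?case using Suc by simp
qed simp

lemma part_list_eq:
  assumes "is_partition lam" "lam b = 0"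
  shows "part_list n lam = part_list_below n lam b"
proof -
  define z where "z = (LEAST b. lam b = 0)"
  have "lam z = 0" "z \<le> b" unfolding z_def using assms(2) by (rule LeastI, rule Least_le)
  then show ?thesis
    using part_list_below_stable[OF assms(1), of z n "b - z"] by (simp add: part_list_def z_def[symmetric])
qed

definition part_exp :: "nat \<Rightarrow> (nat \<Rightarrow> nat) \<Rightarrow> nat \<Rightarrow> int" where "part_exp n lam = list_exp (part_list n lam)"

definition Parts :: "nat \<Rightarrow> (nat \<Rightarrow> nat) set" where "Parts n = {lam. is_partition lam \<and> lam 0 \<le> n}"

lemma length_part_list: assumes "lam \<in> Parts n" shows "length (part_list n lam) = n"
proof -
  obtain b where "lam b = 0" using partition_bound assms unfolding Parts_def by blast
  then show ?thesis using assms length_part_list_below[of lam n b] part_list_eq[of lam b n] by (simp add: Parts_def is_partition_def)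
qed

lemma set_part_list_below: "x \<in> set (part_list_below n lam b) \<Longrightarrow> 0 \<le> x \<and> x \<le> int b"
  by (induction b) auto

lemma sorted_part_list_below: "sorted_wrt (\<ge>) (part_list_below n lam b)"
proof (induction b)
  case 0
  then show ?case by (simp add: sorted_wrt_iff_nth_less)
next
  case (Suc b)
  have "sorted_wrt (\<ge>) (replicate m (x :: int))" for m x by (induction m) auto
  then show ?case using Suc set_part_list_below[of _ n lam b] by (fastforce simp: sorted_wrt_append)
qed

lemma sum_list_part_list_below:
  assumes "antimono lam"
  shows "sum_list (part_list_below n lam b) + int b * int (lam b) = int (\<Sum>i<b. lam i)"
proof (induction b)
  case (Suc b)
  have "lam (Suc b) \<le> lam b" using assms by (auto intro: antimonoD)
  then show ?case using Suc by (simp add: sum_list_replicate algebra_simps of_nat_diff)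
qed (simp add: sum_list_replicate)

lemma even_part_list_below:
  assumes "antimono lam"
  shows "(\<forall>x\<in>set (part_list_below n lam b). even x) \<longleftrightarrow> (\<forall>i<b. even i \<longrightarrow> lam i = lam (Suc i))"
proof (induction b)
  case (Suc b)
  have "lam (Suc b) \<le> lam b" using assms by (auto intro: antimonoD)
  moreover have "(\<forall>x\<in>set (replicate m y). even x) \<longleftrightarrow> m = 0 \<or> even (y :: int)" for m y by auto
  moreover have "even (int (Suc b)) \<longleftrightarrow> odd b" by simp
  ultimately show ?case using Suc by (simp only: part_list_below.simps set_append ball_Un less_Suc_eq) auto
qed auto

lemma list_exp_nth: "k < length xs \<Longrightarrow> list_exp xs k = xs ! (length xs - Suc k)"
  by (simp add: list_exp_def rev_nth)

lemma dominant_list_exp: assumes "sorted_wrt (\<ge>) xs" shows "dominant (length xs) (list_exp xs)"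
  unfolding dominant_def
proof (intro allI impI)
  fix k l assume "k \<le> l" "l < length xs"
  then show "list_exp xs k \<le> list_exp xs l"
    by (cases "k = l") (use assms in \<open>auto simp: list_exp_nth sorted_wrt_iff_nth_less\<close>)
qed

lemma dominant_part_exp: "lam \<in> Parts n \<Longrightarrow> dominant n (part_exp n lam)"
  using dominant_list_exp[of "part_list n lam"] sorted_part_list_below length_part_list[of lam n] by (simp add: part_exp_def part_list_def)

lemma supp_below_list_exp: "supp_below (length xs) (list_exp xs)" by (simp add: supp_below_def list_exp_def)

lemma supp_below_part_exp: "lam \<in> Parts n \<Longrightarrow> supp_below n (part_exp n lam)"
  using supp_below_list_exp[of "part_list n lam"] length_part_list[of lam n] by (simp add: part_exp_def)

lemma list_exp_mem: "k < length xs \<Longrightarrow> list_exp xs k \<in> set xs" by (simp add: list_exp_nth)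

lemma part_exp_ge_0: "part_exp n lam k \<ge> 0"
  using list_exp_mem[of k "part_list n lam"] set_part_list_below by (cases "k < length (part_list n lam)") (auto simp: part_exp_def part_list_def list_exp_def)

lemma exp_size_list_exp: "exp_size (length xs) (list_exp xs) = sum_list xs"
proof -
  have "(\<Sum>k<length xs. list_exp xs k) = (\<Sum>k<length (rev xs). rev xs ! k)" by (simp add: list_exp_def)
  also have "\<dots> = sum_list (rev xs)" by (simp add: sum_list_sum_nth lessThan_atLeast0)
  finally show ?thesis by (simp add: exp_size_def)
qed

lemma exp_size_part_exp: assumes "lam \<in> Parts n" shows "exp_size n (part_exp n lam) = int (psize lam)"
proof -
  obtain b where b: "lam b = 0" using partition_bound assms unfolding Parts_def by blast
  have "exp_size n (part_exp n lam) = sum_list (part_list n lam)"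
    using exp_size_list_exp[of "part_list n lam"] length_part_list[OF assms] by (simp add: part_exp_def)
  also have "\<dots> = int (psize lam)"
    using sum_list_part_list_below[of lam n b] assms b by (simp add: Parts_def is_partition_def part_list_eq[of lam b] psize_eq[of lam b])
  finally show ?thesis .
qed

text \<open>In the usual numbering the first part equals the second, the third equals the fourth,
  and so on: the conjugate has only even parts.\<close>

definition paired :: "(nat \<Rightarrow> nat) \<Rightarrow> bool" where "paired lam \<longleftrightarrow> (\<forall>k. lam (2 * k) = lam (Suc (2 * k)))"

lemma even_part_exp: assumes "lam \<in> Parts n" shows "(\<forall>k<n. even (part_exp n lam k)) \<longleftrightarrow> paired lam"
proof -
  have p: "is_partition lam" using assms by (simp add: Parts_def)
  obtain b where b: "lam b = 0" using partition_bound[OF p] by blast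
  have "(\<forall>k<n. even (part_exp n lam k)) \<longleftrightarrow> (\<forall>x\<in>set (rev (part_list n lam)). even x)"
    unfolding all_set_conv_all_nth using length_part_list[OF assms] by (simp add: part_exp_def list_exp_def)
  also have "\<dots> \<longleftrightarrow> (\<forall>i<b. even i \<longrightarrow> lam i = lam (Suc i))"
    using even_part_list_below[of lam n b] p by (simp add: part_list_eq[OF p b] is_partition_def)
  also have "\<dots> \<longleftrightarrow> (\<forall>i. even i \<longrightarrow> lam i = lam (Suc i))"
    using partition_zero[OF p b] by (metis le_SucI not_le)
  also have "\<dots> \<longleftrightarrow> paired lam" unfolding paired_def by (metis dvd_triv_left evenE)
  finally show ?thesis .
qed

lemma filter_sorted:
  "sorted_wrt (\<ge>) xs \<Longrightarrow> filter (\<lambda>x. x \<le> c + 1) xs = filter (\<lambda>x. x = c + 1) xs @ filter (\<lambda>x. x \<le> (c :: int)) xs"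
proof (induction xs)
  case (Cons y ys)
  show ?case
  proof (cases "y \<le> c")
    case True
    then have "filter (\<lambda>x. x = c + 1) ys = []" using Cons.prems by (auto simp: filter_empty_conv)
    then show ?thesis using True Cons by simp
  qed (use Cons in auto)
qed simp

lemma length_filter_split: "(\<And>x. x \<in> set xs \<Longrightarrow> P x \<longleftrightarrow> Q x \<or> R x) \<Longrightarrow> (\<And>x. \<not> (Q x \<and> R x)) \<Longrightarrow>
   length (filter P xs) = length (filter Q xs) + length (filter R xs)"
proof (induction xs)
  case (Cons x xs)
  have "length (filter P xs) = length (filter Q xs) + length (filter R xs)" using Cons by simp
  moreover have "P x \<longleftrightarrow> Q x \<or> R x" "\<not> (Q x \<and> R x)" using Cons.prems by simp_all
  ultimately show ?case by auto
qed simp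

lemma list_exp_surj:
  assumes "sorted_wrt (\<ge>) xs" "\<And>x. x \<in> set xs \<Longrightarrow> 0 \<le> x"
  obtains lam where "lam \<in> Parts (length xs)" "part_list (length xs) lam = xs"
proof -
  let ?n = "length xs"
  define lam where "lam = (\<lambda>i. length (filter (\<lambda>x. int i < x) xs))"
  have lam: "lam i = length (filter (\<lambda>x. x = int i + 1) xs) + lam (Suc i)" for i
    unfolding lam_def by (rule length_filter_split) auto
  then have mono: "lam (Suc i) \<le> lam i" for i by (metis le_add2)
  have part_list_below: "part_list_below ?n lam b = filter (\<lambda>x. x \<le> int b) xs" for b
  proof (induction b)
    case 0
    have "?n = length (filter (\<lambda>x. True) xs)" by simp
    also have "\<dots> = length (filter (\<lambda>x. x \<le> 0) xs) + lam 0"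
      unfolding lam_def by (rule length_filter_split) auto
    finally have "?n - lam 0 = length (filter (\<lambda>x. x \<le> 0) xs)" by simp
    moreover have "filter (\<lambda>x. x \<le> 0) xs = replicate (length (filter (\<lambda>x. x \<le> 0) xs)) 0"
      by (rule replicate_eqI) (use assms(2) in force)+
    ultimately show ?case by simp
  next
    case (Suc b)
    have "filter (\<lambda>x. x = int b + 1) xs = replicate (length (filter (\<lambda>x. x = int b + 1) xs)) (int b + 1)"
      by (rule replicate_eqI) auto
    moreover have "lam b - lam (Suc b) = length (filter (\<lambda>x. x = int b + 1) xs)" using lam[of b] by simp
    ultimately show ?case using filter_sorted[OF assms(1), of "int b"] Suc by (simp add: add.commute)
  qed
  obtain B :: nat where B: "\<And>x. x \<in> set xs \<Longrightarrow> x \<le> int B"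
  proof
    show "x \<le> int (nat (sum_list xs))" if "x \<in> set xs" for x
      using member_le_sum_list[OF that assms(2)] by linarith
  qed
  have "filter (\<lambda>x. int B < x) xs = []" by (auto simp: filter_empty_conv not_less B)
  then have "lam B = 0" by (simp add: lam_def)
  then have p: "is_partition lam" using mono by (intro partitionI[of lam B])
  have "part_list ?n lam = xs" using part_list_eq[OF p \<open>lam B = 0\<close>] part_list_below[of B] B by (simp add: filter_id_conv)
  moreover have "lam \<in> Parts ?n" using p by (simp add: Parts_def lam_def)
  ultimately show thesis by (rule that[rotated])
qed

lemma part_exp_surj:
  assumes "dominant n a" "supp_below n a" "\<And>k. k < n \<Longrightarrow> 0 \<le> a k"
  obtains lam where "lam \<in> Parts n" "part_exp n lam = a"
proof -
  let ?xs = "rev (map a [0..<n])"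
  have "sorted_wrt (\<ge>) ?xs"
    using assms(1) by (auto simp: sorted_wrt_iff_nth_less rev_nth dominant_def)
  then obtain lam where "lam \<in> Parts (length ?xs)" "part_list (length ?xs) lam = ?xs"
    by (rule list_exp_surj) (use assms(3) in auto)
  moreover have "list_exp ?xs = a" using assms(2) by (auto simp: list_exp_def supp_below_def fun_eq_iff)
  ultimately show thesis using that[of lam] by (simp add: part_exp_def)
qed

section \<open>Horizontal strips and their weights\<close>

definition interlacing :: "(nat \<Rightarrow> nat) \<Rightarrow> (nat \<Rightarrow> nat) \<Rightarrow> bool" where
  "interlacing lam mu \<longleftrightarrow> (\<forall>i. mu i \<le> lam i \<and> lam (Suc i) \<le> mu i)"

definition strips_above :: "nat \<Rightarrow> (nat \<Rightarrow> nat) \<Rightarrow> (nat \<Rightarrow> nat) set" where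
  "strips_above n mu = {lam. interlacing lam mu \<and> lam 0 \<le> n}"

definition strips_below :: "(nat \<Rightarrow> nat) \<Rightarrow> (nat \<Rightarrow> nat) set" where
  "strips_below lam = {mu. interlacing lam mu}"

text \<open>On interlacing pairs this is the coefficient of the skew q-Whittaker polynomial in one
  variable, see \<open>qwhit1_eq\<close>.\<close>

definition strip_wt :: "(nat \<Rightarrow> nat) \<Rightarrow> (nat \<Rightarrow> nat) \<Rightarrow> 'f::field fps" where
  "strip_wt lam mu = Prod_any (\<lambda>i. gauss_binom (lam i - lam (Suc i)) (lam i - mu i))"

text \<open>The denominator in the summand of Z. In terms of the conjugate padded to length n it
  runs over the multiplicities of all entries, zeros included.\<close>

definition inv_norm :: "nat \<Rightarrow> (nat \<Rightarrow> nat) \<Rightarrow> 'f::field fps" where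
  "inv_norm n lam = inv_qfac (n - lam 0) * Prod_any (\<lambda>i. inv_qfac (lam i - lam (Suc i)))"

lemma interlacingD: "interlacing lam mu \<Longrightarrow> mu i \<le> lam i" "interlacing lam mu \<Longrightarrow> lam (Suc i) \<le> mu i"
  by (auto simp: interlacing_def)

lemma fun_box_iff: "f \<in> fun_box b lo hi \<longleftrightarrow> (\<forall>i<b. lo i \<le> f i \<and> f i \<le> hi i) \<and> (\<forall>i\<ge>b. f i = 0)"
  by (auto simp: fun_box_def not_less)

lemma strips_above_fun_box:
  assumes "is_partition mu" "mu b = 0"
  shows "strips_above n mu = fun_box (Suc b) mu (prev_part n mu)"
proof (intro equalityI subsetI)
  fix lam assume "lam \<in> strips_above n mu"
  then have *: "interlacing lam mu" "lam 0 \<le> n" by (auto simp: strips_above_def)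
  have "lam i \<le> prev_part n mu i" for i using * by (cases i) (auto simp: interlacing_def)
  moreover have "lam i = 0" if "i \<ge> Suc b" for i
    using interlacingD(2)[OF *(1), of "i - 1"] partition_zero[OF assms, of "i - 1"] that by simp
  ultimately show "lam \<in> fun_box (Suc b) mu (prev_part n mu)" using * by (simp add: fun_box_iff interlacing_def)
next
  fix lam assume *: "lam \<in> fun_box (Suc b) mu (prev_part n mu)"
  have "mu i \<le> lam i" for i using * partition_zero[OF assms, of i] by (cases "i \<le> b") (auto simp: fun_box_iff)
  moreover have "lam (Suc i) \<le> mu i" for i
  proof (cases "Suc i \<le> b")
    case True
    then have "lam (Suc i) \<le> prev_part n mu (Suc i)" using * unfolding fun_box_iff by (meson less_Suc_eq_le)
    then show ?thesis by simp
  next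
    case False then show ?thesis using * by (simp add: fun_box_iff)
  qed
  moreover have "lam 0 \<le> n" using * by (auto simp: fun_box_iff dest: spec[of _ 0])
  ultimately show "lam \<in> strips_above n mu" by (simp add: strips_above_def interlacing_def)
qed

lemma strips_below_fun_box:
  assumes "is_partition lam" "lam b = 0"
  shows "strips_below lam = fun_box b (\<lambda>i. lam (Suc i)) lam"
proof -
  have z: "lam i = 0" "lam (Suc i) = 0" if "b \<le> i" for i using partition_zero[OF assms] that by simp_all
  show ?thesis
  proof (intro equalityI subsetI)
    fix mu assume "mu \<in> strips_below lam"
    then have "mu i \<le> lam i" "lam (Suc i) \<le> mu i" for i by (auto simp: strips_below_def interlacing_def)
    then show "mu \<in> fun_box b (\<lambda>i. lam (Suc i)) lam" unfolding fun_box_iff by (metis le_zero_eq z(1))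
  next
    fix mu assume "mu \<in> fun_box b (\<lambda>i. lam (Suc i)) lam"
    then have "mu i \<le> lam i \<and> lam (Suc i) \<le> mu i" for i
      using z[of i] by (cases "i < b") (auto simp: fun_box_iff)
    then show "mu \<in> strips_below lam" by (simp add: strips_below_def interlacing_def)
  qed
qed

lemma strips_above_partition: "is_partition mu \<Longrightarrow> lam \<in> strips_above n mu \<Longrightarrow> lam \<in> Parts n"
proof -
  assume *: "is_partition mu" "lam \<in> strips_above n mu"
  obtain b where b: "mu b = 0" using partition_bound[OF *(1)] by blast
  have i: "interlacing lam mu" using *(2) by (simp add: strips_above_def)
  have "is_partition lam"
  proof (rule partitionI)
    show "lam (Suc j) \<le> lam j" for j using interlacingD[OF i, of j] by simp
    show "lam (Suc b) = 0" using interlacingD(2)[OF i, of b] b by simp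
  qed
  then show ?thesis using *(2) by (simp add: Parts_def strips_above_def)
qed

lemma strips_below_partition: "lam \<in> Parts n \<Longrightarrow> mu \<in> strips_below lam \<Longrightarrow> mu \<in> Parts n"
proof -
  assume *: "lam \<in> Parts n" "mu \<in> strips_below lam"
  obtain b where b: "lam b = 0" using partition_bound *(1) unfolding Parts_def by blast
  have i: "interlacing lam mu" using *(2) by (simp add: strips_below_def)
  have "is_partition mu"
  proof (rule partitionI)
    show "mu (Suc j) \<le> mu j" for j using interlacingD(1)[OF i, of "Suc j"] interlacingD(2)[OF i, of j] by simp
    show "mu b = 0" using interlacingD(1)[OF i, of b] b by simp
  qed
  then show ?thesis using *(1) interlacingD(1)[OF i, of 0] by (simp add: Parts_def)
qed

lemma finite_strips_above [simp]: "is_partition mu \<Longrightarrow> finite (strips_above n mu)"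
  using partition_bound[of mu 0] strips_above_fun_box[of mu _ n] by (metis finite_fun_box)

lemma finite_strips_below [simp]: "lam \<in> Parts n \<Longrightarrow> finite (strips_below lam)"
  using partition_bound[of lam 0] strips_below_fun_box[of lam] by (metis finite_fun_box Parts_def mem_Collect_eq)

lemma strip_wt_eq:
  assumes "is_partition lam" "lam b = 0"
  shows "strip_wt lam mu = (\<Prod>i<b. gauss_binom (lam i - lam (Suc i)) (lam i - mu i) :: 'f::field fps)"
  unfolding strip_wt_def
proof (rule Prod_any.expand_superset)
  show "{a. gauss_binom (lam a - lam (Suc a)) (lam a - mu a) \<noteq> (1 :: 'f fps)} \<subseteq> {..<b}"
  proof
    fix i assume i: "i \<in> {a. gauss_binom (lam a - lam (Suc a)) (lam a - mu a) \<noteq> (1 :: 'f fps)}"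
    have "\<not> b \<le> i" using partition_zero[OF assms, of i] i by auto
    then show "i \<in> {..<b}" by simp
  qed
qed simp

lemma inv_norm_eq:
  assumes "is_partition lam" "lam b = 0"
  shows "inv_norm n lam = inv_qfac (n - lam 0) * (\<Prod>i<b. inv_qfac (lam i - lam (Suc i)) :: 'f::field fps)"
  unfolding inv_norm_def
proof (rule arg_cong[where f = "(*) (inv_qfac (n - lam 0))"], rule Prod_any.expand_superset)
  show "{a. inv_qfac (lam a - lam (Suc a)) \<noteq> (1 :: 'f fps)} \<subseteq> {..<b}"
  proof
    fix i assume i: "i \<in> {a. inv_qfac (lam a - lam (Suc a)) \<noteq> (1 :: 'f fps)}"
    have "\<not> b \<le> i" using partition_zero[OF assms, of i] i by auto
    then show "i \<in> {..<b}" by simp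
  qed
qed simp

text \<open>Raising produces binomials over the multiplicities of \<open>mu\<close>, while
  \<open>strip_wt\<close> has those of \<open>lam\<close>. After a shift of the index both have the
  same denominators, and their numerators are the two norms.\<close>

lemma inv_norm_gauss_binom:
  assumes "is_partition mu" "mu b = 0" "mu 0 \<le> n" "lam \<in> strips_above n mu"
  shows "inv_norm n mu * (\<Prod>i\<le>b. gauss_binom (prev_part n mu i - mu i) (lam i - mu i)) = inv_norm n lam * (strip_wt lam mu :: 'f::field fps)"
proof -
  have p: "is_partition lam" using strips_above_partition[OF assms(1,4)] by (simp add: Parts_def)
  have i: "interlacing lam mu" using assms(4) by (simp add: strips_above_def)
  have z: "lam (Suc b) = 0" using interlacingD(2)[OF i, of b] assms(2) by simp
  have m: "mu i \<le> lam i" "lam i \<le> prev_part n mu i" for i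
    using assms(4) by (auto simp: strips_above_def interlacing_def prev_part_def split: nat.split)
  have 1: "gauss_binom (prev_part n mu i - mu i) (lam i - mu i) = qfac (prev_part n mu i - mu i) * (inv_qfac (lam i - mu i) * (inv_qfac (prev_part n mu i - lam i) :: 'f fps))" for i
    using m[of i] by (simp add: gauss_binom_def mult.assoc)
  have 2: "gauss_binom (lam i - lam (Suc i)) (lam i - mu i) = qfac (lam i - lam (Suc i)) * (inv_qfac (lam i - mu i) * (inv_qfac (mu i - lam (Suc i)) :: 'f fps))" for i
    using interlacingD[OF i, of i] by (simp add: gauss_binom_def mult.assoc)
  have 3: "(\<Prod>i\<le>b. qfac (prev_part n mu i - mu i)) = qfac (n - mu 0) * (\<Prod>i<b. qfac (mu i - mu (Suc i)) :: 'f fps)"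
    by (simp add: prod.atMost_shift)
  have 4: "(\<Prod>i\<le>b. inv_qfac (prev_part n mu i - lam i)) = inv_qfac (n - lam 0) * (\<Prod>i<b. inv_qfac (mu i - lam (Suc i)) :: 'f fps)"
    by (simp add: prod.atMost_shift)
  have 5: "(\<Prod>i<Suc b. inv_qfac (mu i - lam (Suc i))) = (\<Prod>i<b. inv_qfac (mu i - lam (Suc i)) :: 'f fps)"
    using assms(2) by simp
  have 6: "(\<Prod>i\<in>I. inv_qfac (f i)) * (\<Prod>i\<in>I. qfac (f i)) = (1 :: 'f fps)" for I and f :: "nat \<Rightarrow> nat"
    by (simp add: prod.distrib[symmetric])
  have "inv_norm n mu * (\<Prod>i\<le>b. gauss_binom (prev_part n mu i - mu i) (lam i - mu i)) =
    (inv_qfac (n - mu 0) * qfac (n - mu 0)) * ((\<Prod>i<b. inv_qfac (mu i - mu (Suc i))) * (\<Prod>i<b. qfac (mu i - mu (Suc i)))) *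
    ((\<Prod>i\<le>b. inv_qfac (lam i - mu i)) * (inv_qfac (n - lam 0) * (\<Prod>i<b. inv_qfac (mu i - lam (Suc i)) :: 'f fps)))"
    unfolding inv_norm_eq[OF assms(1,2)] 1 prod.distrib 3 4 by (simp only: mult_ac)
  also have "\<dots> = (\<Prod>i\<le>b. inv_qfac (lam i - mu i)) * (inv_qfac (n - lam 0) * (\<Prod>i<b. inv_qfac (mu i - lam (Suc i)) :: 'f fps))"
    unfolding 6 qfac_inverse by simp
  also have "\<dots> = inv_qfac (n - lam 0) * ((\<Prod>i<Suc b. inv_qfac (lam i - lam (Suc i))) * (\<Prod>i<Suc b. qfac (lam i - lam (Suc i)))) *
      ((\<Prod>i<Suc b. inv_qfac (lam i - mu i)) * (\<Prod>i<Suc b. inv_qfac (mu i - lam (Suc i))))"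
    unfolding 5 6 by (simp add: lessThan_Suc_atMost mult_ac)
  also have "\<dots> = inv_norm n lam * strip_wt lam mu"
    unfolding inv_norm_eq[OF p z] strip_wt_eq[OF p z] 2 prod.distrib by (simp only: mult_ac)
  finally show ?thesis .
qed

lemma psize_diff:
  assumes "is_partition lam" "is_partition mu" "lam b = 0" "mu b = 0" "\<And>i. mu i \<le> lam i"
  shows "(\<Sum>i<b. lam i - mu i) = psize lam - psize mu"
  unfolding psize_eq[OF assms(1,3)] psize_eq[OF assms(2,4)]
  using assms(5) by (intro sum_subtractf_nat)

lemma Pieri_up:
  assumes "hl_relation n X" "mu \<in> Parts n"
    and E: "\<And>as \<phi>. length as = n \<Longrightarrow> X\<phi> \<phi> (list_exp as) = raise_sum \<phi> (\<lambda>xs. X (list_exp xs)) [] as"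
  shows "inv_norm n mu * X\<phi> \<phi> (part_exp n mu) = (\<Sum>lam\<in>strips_above n mu. inv_norm n lam * (strip_wt lam mu * (fps_const (\<phi> (psize lam - psize mu)) * (X (part_exp n lam) :: 'f::field fps))))"
proof -
  have p: "is_partition mu" "mu 0 \<le> n" "antimono mu" using assms by (auto simp: Parts_def is_partition_def)
  obtain b where b: "mu b = 0" using partition_bound[OF p(1)] by blast
  have "X\<phi> \<phi> (part_exp n mu) = raise_sum \<phi> (\<lambda>xs. X (list_exp xs)) [] (part_list_below n mu b)"
    using E[OF length_part_list[OF assms(2)]] by (simp add: part_exp_def part_list_eq[OF p(1) b])
  also have "\<dots> = (\<Sum>lam\<in>fun_box (Suc b) mu (prev_part n mu). (\<Prod>i\<le>b. gauss_binom (prev_part n mu i - mu i) (lam i - mu i)) *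
       (fps_const (\<phi> (\<Sum>i\<le>b. lam i - mu i)) *
       X (list_exp ([] @ replicate (lam b - mu b) (int (Suc b)) @ part_list_below n lam b))))"
    by (rule raise_sum_part_list_below[OF hl_relation_list_exp[OF assms(1)] p(3,2)]) (simp add: b)
  finally have *: "X\<phi> \<phi> (part_exp n mu) = \<dots>" .
  show ?thesis unfolding * sum_distrib_left strips_above_fun_box[OF p(1) b, symmetric]
  proof (rule sum.cong)
    fix lam assume lam: "lam \<in> strips_above n mu"
    have q: "is_partition lam" using strips_above_partition[OF p(1) lam] by (simp add: Parts_def)
    have i: "interlacing lam mu" using lam by (simp add: strips_above_def)
    have z: "lam (Suc b) = 0" "mu (Suc b) = 0" using interlacingD(2)[OF i, of b] b partition_zero[OF p(1) b] by auto
    have 1: "(\<Sum>i\<le>b. lam i - mu i) = psize lam - psize mu"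
      using psize_diff[OF q p(1) z interlacingD(1)[OF i]] by (simp only: lessThan_Suc_atMost)
    have 2: "list_exp ([] @ replicate (lam b - mu b) (int (Suc b)) @ part_list_below n lam b) = part_exp n lam"
      unfolding part_exp_def part_list_eq[OF q z(1)] by (simp add: z b)
    show "inv_norm n mu * ((\<Prod>i\<le>b. gauss_binom (prev_part n mu i - mu i) (lam i - mu i)) * (fps_const (\<phi> (\<Sum>i\<le>b. lam i - mu i)) *
       X (list_exp ([] @ replicate (lam b - mu b) (int (Suc b)) @ part_list_below n lam b)))) =
      inv_norm n lam * (strip_wt lam mu * (fps_const (\<phi> (psize lam - psize mu)) * X (part_exp n lam)))"
      unfolding 1 2 using inv_norm_gauss_binom[OF p(1) b p(2) lam, where 'f = 'f] by (simp only: mult.assoc[symmetric])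
  qed simp
qed

lemma Pieri_down:
  assumes "hl_relation n X" "lam \<in> Parts n" "\<And>xs x. x < 0 \<Longrightarrow> length xs + 1 = n \<Longrightarrow> X (list_exp (xs @ [x])) = 0"
    and E: "\<And>as \<phi>. length as = n \<Longrightarrow> X\<phi> \<phi> (list_exp as) = lower_sum \<phi> (\<lambda>xs. X (list_exp xs)) [] as"
  shows "X\<phi> \<phi> (part_exp n lam) = (\<Sum>mu\<in>strips_below lam. strip_wt lam mu * (fps_const (\<phi> (psize lam - psize mu)) * (X (part_exp n mu) :: 'f::field fps)))"
proof -
  have p: "is_partition lam" "lam 0 \<le> n" "antimono lam" using assms by (auto simp: Parts_def is_partition_def)
  obtain b where b: "lam b = 0" using partition_bound[OF p(1)] by blast
  have "X\<phi> \<phi> (part_exp n lam) = lower_sum \<phi> (\<lambda>xs. X (list_exp xs)) [] (part_list_below n lam b)"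
    using E[OF length_part_list[OF assms(2)]] by (simp add: part_exp_def part_list_eq[OF p(1) b])
  also have "\<dots> = (\<Sum>mu\<in>fun_box b (\<lambda>i. lam (Suc i)) lam. (\<Prod>i<b. gauss_binom (lam i - lam (Suc i)) (lam i - mu i)) *
       (fps_const (\<phi> (\<Sum>i<b. lam i - mu i)) * X (list_exp ([] @ part_list_below n (mu(b := lam b)) b))))"
    by (rule lower_sum_part_list_below[OF hl_relation_list_exp[OF assms(1)] p(3,2) assms(3)]) (simp_all add: b)
  finally have *: "X\<phi> \<phi> (part_exp n lam) = \<dots>" .
  show ?thesis unfolding * strips_below_fun_box[OF p(1) b, symmetric]
  proof (rule sum.cong)
    fix mu assume mu: "mu \<in> strips_below lam"
    have q: "is_partition mu" using strips_below_partition[OF assms(2) mu] by (simp add: Parts_def)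
    have i: "interlacing lam mu" using mu by (simp add: strips_below_def)
    have z: "mu b = 0" using interlacingD(1)[OF i, of b] b by simp
    have 1: "(\<Sum>i<b. lam i - mu i) = psize lam - psize mu"
      by (rule psize_diff[OF p(1) q b z interlacingD(1)[OF i]])
    have "mu(b := lam b) = mu" using b z by auto
    then have 2: "list_exp ([] @ part_list_below n (mu(b := lam b)) b) = part_exp n mu"
      unfolding part_exp_def part_list_eq[OF q z] by simp
    show "(\<Prod>i<b. gauss_binom (lam i - lam (Suc i)) (lam i - mu i)) * (fps_const (\<phi> (\<Sum>i<b. lam i - mu i)) * X (list_exp ([] @ part_list_below n (mu(b := lam b)) b))) =
      strip_wt lam mu * (fps_const (\<phi> (psize lam - psize mu)) * X (part_exp n mu))"
      unfolding 1 2 strip_wt_eq[OF p(1) b] ..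
  qed simp
qed

section \<open>Expansion of antisymmetric functions\<close>

definition parts_of_size :: "nat \<Rightarrow> nat \<Rightarrow> (nat \<Rightarrow> nat) set" where
  "parts_of_size n d = {lam \<in> Parts n. psize lam = d}"

lemma psize_fun_box:
  assumes "is_partition lam" "psize lam \<le> d"
  shows "lam \<in> fun_box d (\<lambda>_. 0) (\<lambda>_. d)"
proof -
  obtain b where b: "Suc d \<le> b" "lam b = 0" using partition_bound[OF assms(1)] by blast
  have s: "psize lam = (\<Sum>i<b. lam i)" by (rule psize_eq[OF assms(1) b(2)])
  have "lam i = 0" if "d \<le> i" for i
  proof (rule ccontr)
    assume "lam i \<noteq> 0"
    then have "1 \<le> lam j" if "j < Suc d" for j
      using partition_antimono[OF assms(1), of j i] that \<open>d \<le> i\<close> by simp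
    then have "(\<Sum>j<Suc d. 1) \<le> (\<Sum>j<Suc d. lam j)" by (intro sum_mono) simp
    also have "\<dots> \<le> (\<Sum>j<b. lam j)" by (rule sum_mono2) (use b in auto)
    finally show False using s assms(2) by simp
  qed
  moreover have "lam i \<le> d" for i
  proof (cases "i < b")
    case True
    then have "lam i \<le> (\<Sum>i<b. lam i)" by (intro member_le_sum) auto
    then show ?thesis using s assms(2) by simp
  next
    case False then show ?thesis using partition_zero[OF assms(1) b(2), of i] by simp
  qed
  ultimately show ?thesis by (simp add: fun_box_iff)
qed

lemma finite_parts_of_size [simp]: "finite (parts_of_size n d)"
  by (rule finite_subset[of _ "fun_box d (\<lambda>_. 0) (\<lambda>_. d)"]) (auto simp: parts_of_size_def Parts_def psize_fun_box)

text \<open>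
  \<open>up_pairing\<close> pairs a Hall--Littlewood function with a symmetric series through \<open>K\<close>, and
  \<open>down_coeff\<close> is the coefficient of an antisymmetric series on the dual side.
\<close>

definition up_pairing :: "nat \<Rightarrow> 'f::field_char_0 laurent fps \<Rightarrow> (nat \<Rightarrow> nat) \<Rightarrow> 'f fps" where
  "up_pairing n S lam = inv_norm n lam * ev (\<lambda>b. K n (part_exp n lam + b)) (HH n * S)"

definition down_coeff :: "nat \<Rightarrow> 'f::field_char_0 laurent fps \<Rightarrow> (nat \<Rightarrow> nat) \<Rightarrow> 'f fps" where
  "down_coeff n y lam = coeff_at (part_exp n lam) (GG n * y)"

lemma up_pairing_elem_sym:
  assumes "mu \<in> Parts n" "symm_fps n S"
  shows "up_pairing n (elem_sym n \<phi> * S) mu =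
    (\<Sum>lam\<in>strips_above n mu. fps_const (\<phi> (psize lam - psize mu)) * (strip_wt lam mu * up_pairing n S lam))"
proof -
  let ?X = "\<lambda>S a. ev (\<lambda>b. K n (a + b)) (HH n * S)"
  have "inv_norm n mu * ?X (elem_sym n \<phi> * S) (part_exp n mu) =
    (\<Sum>lam\<in>strips_above n mu. inv_norm n lam * (strip_wt lam mu * (fps_const (\<phi> (psize lam - psize mu)) * ?X S (part_exp n lam))))"
  proof (rule Pieri_up[OF hl_relation_up[OF K_antisym_fun assms(2)] assms(1), where X\<phi> = "\<lambda>\<phi>. ?X (elem_sym n \<phi> * S)"])
    fix as :: "int list" and \<phi> :: "nat \<Rightarrow> 'a" assume "length as = n"
    then show "?X (elem_sym n \<phi> * S) (list_exp as) = raise_sum \<phi> (\<lambda>xs. ?X S (list_exp xs)) [] as"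
      using ev_elem_sym_raise_sum[of "K n" "[]" as \<phi> "HH n * S"] by (simp add: mult.left_commute)
  qed
  then show ?thesis by (simp add: up_pairing_def mult_ac)
qed

text \<open>The condition on b 0 passes to \<open>GG n * y\<close> and makes its coefficients vanish
  at lists ending in a negative entry, as the lowering rule requires.\<close>

definition skew_homog :: "nat \<Rightarrow> nat \<Rightarrow> 'f::field_char_0 laurent fps \<Rightarrow> bool" where
  "skew_homog n d y \<longleftrightarrow> skew n y \<and> exps_in (\<lambda>b. 0 \<le> b 0 \<and> supp_below n b \<and> exp_size n b = int d) y"

lemma coeff_at_exps_in: "exps_in P y \<Longrightarrow> \<not> P a \<Longrightarrow> coeff_at a y = 0"
  by (rule fps_ext) (simp, metis exps_in_def not_in_keys_iff_lookup_eq_zero)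

lemma exps_in_GG: "exps_in (\<lambda>b. 0 \<le> b 0 \<and> supp_below n b \<and> exp_size n b = 0) (GG n :: 'f::comm_ring_1 laurent fps)"
  unfolding GG_def
proof (rule exps_in_prod[where P = "\<lambda>i b. 0 \<le> b 0 \<and> supp_below n b \<and> exp_size n b = 0" and Q = "\<lambda>i b. 0 \<le> b 0 \<and> supp_below n b \<and> exp_size n b = 0"])
  fix p assume p: "p \<in> pairs_less n"
  show "exps_in (\<lambda>b. 0 \<le> b 0 \<and> supp_below n b \<and> exp_size n b = 0) (geom (unit_exp (fst p) - unit_exp (snd p)) :: 'f laurent fps)"
    by (rule exps_in_geom) (use p in \<open>auto simp: pairs_less_def supp_below_simps additive_wt_scale_exp[OF additive_wt_exp_size] exp_size_pair, auto simp: scale_exp_def unit_exp_def\<close>)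
qed (use additive_wt_exp_size[of n] in \<open>auto simp: supp_below_simps additive_wt_0 additive_wt_def\<close>)

lemma exps_in_GG_mult:
  assumes "skew_homog n d y"
  shows "exps_in (\<lambda>b. 0 \<le> b 0 \<and> supp_below n b \<and> exp_size n b = int d) (GG n * y)"
  by (rule exps_in_mult[OF exps_in_GG, where Q = "\<lambda>b. 0 \<le> b 0 \<and> supp_below n b \<and> exp_size n b = int d"])
    (use assms additive_wt_exp_size[of n] in \<open>auto simp: skew_homog_def supp_below_simps additive_wt_def\<close>)

lemma down_coeff_elem_sym:
  assumes "skew_homog n d y" "lam \<in> Parts n"
  shows "down_coeff n (elem_sym n \<phi> * y) lam =
    (\<Sum>mu\<in>strips_below lam. fps_const (\<phi> (psize lam - psize mu)) * (strip_wt lam mu * down_coeff n y mu))"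
proof -
  let ?X = "\<lambda>y a. coeff_at a (GG n * y)"
  have "?X (elem_sym n \<phi> * y) (part_exp n lam) =
    (\<Sum>mu\<in>strips_below lam. strip_wt lam mu * (fps_const (\<phi> (psize lam - psize mu)) * ?X y (part_exp n mu)))"
  proof (rule Pieri_down[OF hl_relation_down assms(2), where X\<phi> = "\<lambda>\<phi>. ?X (elem_sym n \<phi> * y)"])
    show "skew n y" using assms by (simp add: skew_homog_def)
    fix as :: "int list" and \<phi> :: "nat \<Rightarrow> 'a" assume "length as = n"
    then show "?X (elem_sym n \<phi> * y) (list_exp as) = lower_sum \<phi> (\<lambda>xs. ?X y (list_exp xs)) [] as"
      using coeff_at_elem_sym_lower_sum[of "[]" as \<phi> "GG n * y"] by (simp add: mult.left_commute)
  next
    fix xs :: "int list" and x :: int assume "x < 0"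
    then show "coeff_at (list_exp (xs @ [x])) (GG n * y) = 0"
      by (intro coeff_at_exps_in[OF exps_in_GG_mult[OF assms(1)]]) (simp add: list_exp_def)
  qed
  then show ?thesis by (simp add: down_coeff_def mult_ac)
qed

lemma exps_in_elem_sym: "exps_in (\<lambda>b. 0 \<le> b 0 \<and> supp_below n b \<and> exp_size n b = int r) (elem_sym n (kdelta r) :: 'f::comm_ring_1 laurent fps)"
proof (induction n arbitrary: r)
  case 0
  show ?case by (cases r) (auto simp: kdelta_def supp_below_simps exp_size_def intro!: exps_in_1, simp add: exps_in_def)
next
  case (Suc n)
  have mono: "0 \<le> b 0 \<and> supp_below (Suc n) b \<and> exp_size (Suc n) b = int r" if "0 \<le> b 0 \<and> supp_below n b \<and> exp_size n b = int r" for b r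
    using that by (simp add: supp_below_def exp_size_def)
  have 1: "exps_in (\<lambda>b. 0 \<le> b 0 \<and> supp_below (Suc n) b \<and> exp_size (Suc n) b = int r) (elem_sym n (kdelta r) :: 'f laurent fps)" for r
    using Suc.IH[of r] mono unfolding exps_in_def by blast
  show ?case
  proof (cases r)
    case 0 then show ?thesis using 1[of 0] by (simp only: elem_sym_kdelta_0)
  next
    case (Suc r')
    have "exps_in (\<lambda>b. 0 \<le> b 0 \<and> supp_below (Suc n) b \<and> exp_size (Suc n) b = int r) (mon (unit_exp n) * elem_sym n (kdelta r') :: 'f laurent fps)"
      by (rule exps_in_mult[OF exps_in_mon[where P = "\<lambda>b. b = unit_exp n"] 1[of r']])
        (use additive_wt_exp_size[of "Suc n"] in \<open>auto simp: Suc supp_below_simps additive_wt_def exp_size_unit, auto simp: unit_exp_def\<close>)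
    then show ?thesis using 1[of r] unfolding Suc elem_sym_kdelta_Suc by (intro exps_in_add)
  qed
qed

lemma skew_homog_elem_sym: "skew_homog n d y \<Longrightarrow> skew_homog n (d + r) (elem_sym n (kdelta r) * y)"
  unfolding skew_homog_def
  using additive_wt_exp_size[of n] by (auto intro!: skew_mult symm_fps_elem_sym exps_in_mult[OF exps_in_elem_sym[of n r]] simp: supp_below_simps additive_wt_def)

lemma skew_homog_emb: "skew_homog n d y \<Longrightarrow> skew_homog n d (emb c * y)"
  unfolding skew_homog_def
  by (auto intro!: skew_emb exps_in_mult[OF exps_in_emb[where P = "\<lambda>b. b = 0"]])

lemma skew_homog_0: "skew_homog n d 0"
  using skew_sum[of "{}" n "\<lambda>_. 0"] by (auto simp: skew_homog_def exps_in_def)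

lemma skew_homog_add: "skew_homog n d x \<Longrightarrow> skew_homog n d y \<Longrightarrow> skew_homog n d (x + y)"
  using skew_sum[of "{0,1::nat}" n "\<lambda>i. if i = 0 then x else y"] by (auto simp: skew_homog_def intro: exps_in_add)

lemma skew_homog_diff: "skew_homog n d x \<Longrightarrow> skew_homog n d y \<Longrightarrow> skew_homog n d (x - y)"
  using skew_homog_add[of n d x "emb (- 1) * y"] skew_homog_emb[of n d y "- 1"] by (simp add: emb_uminus)

text \<open>States that pairing y with a symmetric series may be computed through the
  Hall-Littlewood expansion of y. The prefactor is determined by the case y =
  \<open>DL\<close>.\<close>

definition glued :: "nat \<Rightarrow> nat \<Rightarrow> 'f::field_char_0 laurent fps \<Rightarrow> bool" where
  "glued n d y \<longleftrightarrow> skew_homog n d y \<and> (\<forall>S. symm_fps n S \<longrightarrow>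
     fps_const (fact n) * (1 - fps_X) ^ n * (\<Sum>nu\<in>parts_of_size n d. down_coeff n y nu * up_pairing n S nu) = ev (K n) (y * S))"

lemma glued_0: "glued n d 0"
  by (simp add: glued_def skew_homog_0 down_coeff_def coeff_at_ev)

lemma glued_add: "glued n d x \<Longrightarrow> glued n d y \<Longrightarrow> glued n d (x + y)"
  by (simp add: glued_def skew_homog_add down_coeff_def distrib_left distrib_right coeff_at_add ev_add sum.distrib)

lemma glued_emb: "glued n d y \<Longrightarrow> glued n d (emb c * y)"
proof -
  assume *: "glued n d y"
  have 1: "down_coeff n (emb c * y) nu = c * down_coeff n y nu" for nu
    by (simp add: down_coeff_def mult.left_commute[of _ "emb c"] coeff_at_emb)
  have "fps_const (fact n) * (1 - fps_X) ^ n * (\<Sum>nu\<in>parts_of_size n d. down_coeff n (emb c * y) nu * up_pairing n S nu)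
    = c * (fps_const (fact n) * (1 - fps_X) ^ n * (\<Sum>nu\<in>parts_of_size n d. down_coeff n y nu * up_pairing n S nu))" for S
    unfolding 1 sum_distrib_left by (rule sum.cong) (simp_all only: mult_ac)
  then show ?thesis using * by (simp add: glued_def skew_homog_emb mult.assoc ev_emb)
qed

lemma glued_sum: "(\<And>i. i \<in> A \<Longrightarrow> glued n d (f i)) \<Longrightarrow> glued n d (sum f A)"
  by (induction A rule: infinite_finite_induct) (auto intro: glued_0 glued_add)

lemma glued_diff: "glued n d x \<Longrightarrow> glued n d y \<Longrightarrow> glued n d (x - y)"
  using glued_add[of n d x "emb (- 1) * y"] glued_emb[of n d y "- 1"] by (simp add: emb_uminus)

lemma psize_interlacing:
  assumes "is_partition lam" "is_partition mu" "interlacing lam mu"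
  shows "psize mu \<le> psize lam"
proof -
  obtain b where b: "lam b = 0" using partition_bound[OF assms(1)] by blast
  then have "mu b = 0" using interlacingD(1)[OF assms(3), of b] by simp
  then show ?thesis using psize_eq[OF assms(1) b] psize_eq[OF assms(2)] interlacingD(1)[OF assms(3)]
    by (simp add: sum_mono)
qed

lemma sum_strips_swap:
  fixes G :: "_ \<Rightarrow> _ \<Rightarrow> 'f::field_char_0 fps"
  shows "(\<Sum>nu\<in>parts_of_size n (d + r). \<Sum>mu\<in>strips_below nu. fps_const (kdelta r (psize nu - psize mu)) * G nu mu) =
    (\<Sum>mu\<in>parts_of_size n d. \<Sum>nu\<in>strips_above n mu. fps_const (kdelta r (psize nu - psize mu)) * G nu mu)"
proof -
  have "(\<Sum>mu\<in>strips_below nu. fps_const (kdelta r (psize nu - psize mu)) * G nu mu) =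
      (\<Sum>mu\<in>{mu \<in> parts_of_size n d. interlacing nu mu}. fps_const (kdelta r (psize nu - psize mu)) * G nu mu)"
    if nu: "nu \<in> parts_of_size n (d + r)" for nu
  proof (rule sum.mono_neutral_right)
    show "finite (strips_below nu)" using nu by (auto simp: parts_of_size_def)
    show "{mu \<in> parts_of_size n d. interlacing nu mu} \<subseteq> strips_below nu" by (auto simp: strips_below_def)
    show "\<forall>mu\<in>strips_below nu - {mu \<in> parts_of_size n d. interlacing nu mu}. fps_const (kdelta r (psize nu - psize mu)) * G nu mu = 0"
    proof
      fix mu assume mu: "mu \<in> strips_below nu - {mu \<in> parts_of_size n d. interlacing nu mu}"
      have p: "mu \<in> Parts n" using mu nu strips_below_partition by (auto simp: parts_of_size_def)
      have "psize mu \<le> psize nu" using psize_interlacing[of nu mu] mu nu p by (auto simp: parts_of_size_def Parts_def strips_below_def)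
      then have "psize nu - psize mu \<noteq> r" using mu nu p by (auto simp: parts_of_size_def strips_below_def)
      then show "fps_const (kdelta r (psize nu - psize mu)) * G nu mu = 0" by (simp add: kdelta_def)
    qed
  qed
  moreover have "(\<Sum>nu\<in>strips_above n mu. fps_const (kdelta r (psize nu - psize mu)) * G nu mu) =
      (\<Sum>nu\<in>{nu \<in> parts_of_size n (d + r). interlacing nu mu}. fps_const (kdelta r (psize nu - psize mu)) * G nu mu)"
    if mu: "mu \<in> parts_of_size n d" for mu
  proof (rule sum.mono_neutral_right)
    have m: "is_partition mu" using mu by (auto simp: parts_of_size_def Parts_def)
    show "finite (strips_above n mu)" using m by simp
    show "{nu \<in> parts_of_size n (d + r). interlacing nu mu} \<subseteq> strips_above n mu" by (auto simp: strips_above_def parts_of_size_def Parts_def)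
    show "\<forall>nu\<in>strips_above n mu - {nu \<in> parts_of_size n (d + r). interlacing nu mu}. fps_const (kdelta r (psize nu - psize mu)) * G nu mu = 0"
    proof
      fix nu assume nu: "nu \<in> strips_above n mu - {nu \<in> parts_of_size n (d + r). interlacing nu mu}"
      have p: "nu \<in> Parts n" using mu nu strips_above_partition[OF m] by auto
      have "psize mu \<le> psize nu" using psize_interlacing[of nu mu] m nu p by (auto simp: Parts_def strips_above_def)
      then have "psize nu - psize mu \<noteq> r" using mu nu p by (auto simp: parts_of_size_def strips_above_def)
      then show "fps_const (kdelta r (psize nu - psize mu)) * G nu mu = 0" by (simp add: kdelta_def)
    qed
  qed
  ultimately show ?thesis by (simp add: sum.swap_restrict[of "parts_of_size n (d + r)" "parts_of_size n d"])
qed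

text \<open>Both Pieri rules carry the same weights \<open>strip_wt\<close>, so they are adjoint:
  the factor e_r passes from y over to \<open>S\<close>.\<close>

lemma glued_elem_sym:
  assumes "glued n d y"
  shows "glued n (d + r) (elem_sym n (kdelta r) * y)"
  unfolding glued_def
proof (intro conjI allI impI)
  have g: "skew_homog n d y" using assms by (simp add: glued_def)
  then show "skew_homog n (d + r) (elem_sym n (kdelta r) * y)" by (rule skew_homog_elem_sym)
  fix S :: "'a laurent fps" assume S: "symm_fps n S"
  have "(\<Sum>nu\<in>parts_of_size n (d + r). down_coeff n (elem_sym n (kdelta r) * y) nu * up_pairing n S nu) =
    (\<Sum>nu\<in>parts_of_size n (d + r). \<Sum>mu\<in>strips_below nu. fps_const (kdelta r (psize nu - psize mu)) * (strip_wt nu mu * down_coeff n y mu * up_pairing n S nu))"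
  proof (intro sum.cong refl)
    fix nu assume "nu \<in> parts_of_size n (d + r)"
    then have "nu \<in> Parts n" by (simp add: parts_of_size_def)
    then show "down_coeff n (elem_sym n (kdelta r) * y) nu * up_pairing n S nu =
      (\<Sum>mu\<in>strips_below nu. fps_const (kdelta r (psize nu - psize mu)) * (strip_wt nu mu * down_coeff n y mu * up_pairing n S nu))"
      by (simp only: down_coeff_elem_sym[OF g] sum_distrib_right mult.assoc)
  qed
  also have "\<dots> = (\<Sum>mu\<in>parts_of_size n d. \<Sum>nu\<in>strips_above n mu. fps_const (kdelta r (psize nu - psize mu)) * (strip_wt nu mu * down_coeff n y mu * up_pairing n S nu))"
    by (rule sum_strips_swap)
  also have "\<dots> = (\<Sum>mu\<in>parts_of_size n d. down_coeff n y mu * up_pairing n (elem_sym n (kdelta r) * S) mu)"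
  proof (intro sum.cong refl)
    fix mu assume "mu \<in> parts_of_size n d"
    then have "mu \<in> Parts n" by (simp add: parts_of_size_def)
    then show "(\<Sum>nu\<in>strips_above n mu. fps_const (kdelta r (psize nu - psize mu)) * (strip_wt nu mu * down_coeff n y mu * up_pairing n S nu)) =
      down_coeff n y mu * up_pairing n (elem_sym n (kdelta r) * S) mu"
      unfolding up_pairing_elem_sym[OF \<open>mu \<in> Parts n\<close> S] sum_distrib_left by (simp only: mult_ac)
  qed
  finally have "fps_const (fact n) * (1 - fps_X) ^ n * (\<Sum>nu\<in>parts_of_size n (d + r). down_coeff n (elem_sym n (kdelta r) * y) nu * up_pairing n S nu) =
    ev (K n) (y * (elem_sym n (kdelta r) * S))"
    using assms symm_fps_mult[OF symm_fps_elem_sym S] by (simp add: glued_def)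
  then show "fps_const (fact n) * (1 - fps_X) ^ n * (\<Sum>nu\<in>parts_of_size n (d + r). down_coeff n (elem_sym n (kdelta r) * y) nu * up_pairing n S nu) =
    ev (K n) (elem_sym n (kdelta r) * y * S)" by (simp only: mult_ac)
qed

text \<open>Because \<open>GG n\<close> begins with 1, the lowest coefficient of y in q reappears
  unchanged in \<open>GG n * y\<close>. By antisymmetry it is determined by dominant exponents, and
  those in the support are the exponents of partitions of size d.\<close>

lemma skew_homog_zero:
  assumes "skew_homog n d y" "\<And>nu. nu \<in> parts_of_size n d \<Longrightarrow> down_coeff n y nu = 0"
  shows "y = 0"
proof (rule fps_ext)
  fix i
  have sk: "skew n y" and exps_in: "exps_in (\<lambda>b. 0 \<le> b 0 \<and> supp_below n b \<and> exp_size n b = int d) y"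
    using assms by (auto simp: skew_homog_def)
  have "fps_nth y i = 0"
  proof (induction i rule: less_induct)
    case (less i)
    have GG0: "fps_nth (GG n) 0 = (1 :: 'a laurent)" unfolding GG_def nth_0_prod by simp
    have top: "lk (fps_nth y i) a = fps_nth (coeff_at a (GG n * y)) i" for a
    proof -
      have "fps_nth (GG n * y) i = (\<Sum>j\<in>{0..i}. fps_nth (GG n) j * fps_nth y (i - j))" by (rule fps_mult_nth)
      also have "\<dots> = (\<Sum>j\<in>{0}. fps_nth (GG n) j * fps_nth y (i - j))"
        by (rule sum.mono_neutral_right) (use less in auto)
      finally show ?thesis by (simp add: GG0)
    qed
    have "lk (fps_nth y i) a = 0" for a
    proof (rule antisym_fun_zero[where n = n and F = "lk (fps_nth y i)" and P = "\<lambda>_. True"])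
      show "antisym_fun n (lk (fps_nth y i))" unfolding antisym_fun_def
      proof (intro allI impI)
        fix k and a :: "nat \<Rightarrow> int" assume k: "Suc k < n"
        have "coeff_at (swap_exp k (dot_swap k a)) (swap_fps k y) = - coeff_at (swap_exp k (dot_swap k a) - (unit_exp (Suc k) - unit_exp k)) y"
          using sk k by (simp only: skew_def coeff_at_uminus coeff_at_mon)
        moreover have "swap_exp k (dot_swap k a) - (unit_exp (Suc k) - unit_exp k) = a" by (auto simp: swap_exp_def dot_swap_def unit_exp_def fun_eq_iff)
        ultimately have "coeff_at (dot_swap k a) y = - coeff_at a y" by (simp only: coeff_at_swap_fps swap_exp_involution)
        then show "lk (fps_nth y i) (dot_swap k a) = - lk (fps_nth y i) a" by (metis coeff_at_nth fps_neg_nth)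
      qed
      fix a :: "nat \<Rightarrow> int" assume dom: "dominant n a"
      show "lk (fps_nth y i) a = 0"
      proof (cases "0 \<le> a 0 \<and> supp_below n a \<and> exp_size n a = int d")
        case True
        have "0 \<le> a k" if "k < n" for k using dom True that unfolding dominant_def by (metis le0 order_trans)
        then obtain lam where lam: "lam \<in> Parts n" "part_exp n lam = a" using part_exp_surj[of n a] dom True by blast
        then have "lam \<in> parts_of_size n d" using exp_size_part_exp[OF lam(1)] True by (simp add: parts_of_size_def)
        then show ?thesis using assms(2)[of lam] lam top[of a] by (simp add: down_coeff_def)
      next
        case False then show ?thesis using exps_in by (metis (mono_tags, lifting) exps_in_def not_in_keys_iff_lookup_eq_zero)
      qed
    qed auto
    then show ?case by (intro poly_mapping_eqI) simp
  qed
  then show "fps_nth y i = fps_nth 0 i" by simp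
qed

lemma psize_zero_iff: "is_partition lam \<Longrightarrow> psize lam = 0 \<longleftrightarrow> lam = (\<lambda>_. 0)"
  using psize_fun_box[of lam 0] by (auto simp: fun_box_0 psize_def)

lemma parts_of_size_0: "parts_of_size n 0 = {\<lambda>_. 0}"
proof -
  have "is_partition (\<lambda>_. 0)" by (rule partitionI) auto
  then show ?thesis using psize_zero_iff by (auto simp: parts_of_size_def Parts_def psize_def)
qed

lemma part_exp_0: "part_exp n (\<lambda>_. 0) = 0"
proof -
  have "is_partition (\<lambda>_. 0)" by (rule partitionI) auto
  from part_list_eq[OF this, where b = 0 and n = n] show ?thesis by (auto simp: part_exp_def list_exp_def fun_eq_iff rev_nth)
qed

lemma coeff_at_mult_zero:
  fixes \<theta> :: "(nat \<Rightarrow> int) \<Rightarrow> int"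
  defines "P \<equiv> \<lambda>b. \<theta> b \<ge> 0 \<and> (\<theta> b = 0 \<longrightarrow> b = 0)"
  assumes "exps_in P g" "exps_in P (h :: 'f::comm_ring_1 laurent fps)" "additive_wt \<theta>"
  shows "coeff_at 0 (g * h) = coeff_at 0 g * coeff_at 0 h"
proof (rule fps_ext)
  fix i
  have "lk (fps_nth g j * fps_nth h k) 0 = lk (fps_nth g j) 0 * lk (fps_nth h k) 0" for j k
    by (rule lookup_mult_zero[OF _ _ assms(4)]) (use assms(2,3) in \<open>auto simp: exps_in1_def exps_in_def P_def\<close>)
  then show "fps_nth (coeff_at 0 (g * h)) i = fps_nth (coeff_at 0 g * coeff_at 0 h) i"
    by (simp add: fps_mult_nth lookup_eq_ev1 ev1_sum)
qed

lemma coeff_at_prod_zero: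
  fixes \<theta> :: "(nat \<Rightarrow> int) \<Rightarrow> int"
  defines "P \<equiv> \<lambda>b. \<theta> b \<ge> 0 \<and> (\<theta> b = 0 \<longrightarrow> b = 0)"
  assumes "additive_wt \<theta>" "\<And>i. i \<in> I \<Longrightarrow> exps_in P (g i) \<and> coeff_at 0 (g i) = (1 :: 'f::comm_ring_1 fps)" "finite I"
  shows "exps_in P (prod g I) \<and> coeff_at 0 (prod g I) = 1"
  using assms(4,3)
proof (induction I rule: finite_induct)
  case empty
  have "coeff_at 0 (1 :: 'f laurent fps) = 1" by (rule fps_ext) (simp add: fps_one_nth)
  moreover have "P 0" using additive_wt_0[OF assms(2)] by (simp add: P_def)
  ultimately show ?case unfolding prod.empty by (intro conjI exps_in_1)
next
  case (insert i I)
  have *: "exps_in P (g i)" "exps_in P (prod g I)" using insert by auto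
  then have "exps_in P (g i * prod g I)"
    by (rule exps_in_mult) (use assms(2) in \<open>auto simp: P_def additive_wt_def add_nonneg_eq_0_iff\<close>)
  moreover have "coeff_at 0 (g i * prod g I) = coeff_at 0 (g i) * coeff_at 0 (prod g I)"
    using * unfolding P_def by (rule coeff_at_mult_zero[OF _ _ assms(2)])
  moreover have "coeff_at 0 (g i) = 1" "coeff_at 0 (prod g I) = 1" using insert by blast+
  ultimately show ?case unfolding prod.insert[OF insert.hyps] by (simp only: mult_1_left)
qed

text \<open>Every exponent z_k/z_l with k < l has positive weight l - k, so in both
  \<open>GG\<close> and \<open>DL\<close> only the constant terms 1 reach exponent 0.\<close>

lemma down_coeff_DL: "down_coeff n (fps_const (DL n)) (\<lambda>_. 0) = (1 :: 'f::field_char_0 fps)"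
proof -
  let ?t = "weight (\<lambda>k. - int k) n"
  have w: "?t (unit_exp (fst p) - unit_exp (snd p)) > 0" if "p \<in> pairs_less n" for p
    using that by (auto simp: additive_wt_minus[OF additive_wt_weight] weight_unit_exp pairs_less_def)
  have G: "exps_in (\<lambda>b. ?t b \<ge> 0 \<and> (?t b = 0 \<longrightarrow> b = 0)) (GG n :: 'f laurent fps) \<and> coeff_at 0 (GG n) = (1 :: 'f fps)"
    unfolding GG_def
  proof (rule coeff_at_prod_zero[OF additive_wt_weight])
    fix p assume p: "p \<in> pairs_less n"
    let ?u = "unit_exp (fst p) - unit_exp (snd p)"
    have scale_exp: "?t (scale_exp i ?u) = int i * ?t ?u" for i by (rule additive_wt_scale_exp[OF additive_wt_weight])
    then have z: "scale_exp i ?u = 0 \<longleftrightarrow> i = 0" for i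
      using w[OF p] additive_wt_0[OF additive_wt_weight, of "\<lambda>k. - int k" n] by (metis mult_eq_0_iff scale_exp_0 of_nat_eq_0_iff less_irrefl)
    have "exps_in (\<lambda>b. ?t b \<ge> 0 \<and> (?t b = 0 \<longrightarrow> b = 0)) (geom ?u :: 'f laurent fps)"
      by (rule exps_in_geom) (use w[OF p] in \<open>auto simp only: scale_exp z mult_eq_0_iff of_nat_eq_0_iff zero_le_mult_iff of_nat_0_le_iff less_irrefl less_imp_le\<close>)
    moreover have "coeff_at 0 (geom ?u) = (1 :: 'f fps)"
      by (rule fps_ext) (use z in \<open>simp add: lookup_single fps_one_nth when_def\<close>)
    ultimately show "exps_in (\<lambda>b. ?t b \<ge> 0 \<and> (?t b = 0 \<longrightarrow> b = 0)) (geom ?u :: 'f laurent fps) \<and> coeff_at 0 (geom ?u) = (1 :: 'f fps)" ..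
  qed simp
  have D: "exps_in (\<lambda>b. ?t b \<ge> 0 \<and> (?t b = 0 \<longrightarrow> b = 0)) (fps_const (DL n) :: 'f laurent fps)"
  proof -
    have "exps_in1 (\<lambda>b. ?t b \<ge> 0 \<and> (?t b = 0 \<longrightarrow> b = 0)) (DL n :: 'f laurent)"
      unfolding DL_def
    proof (rule exps_in1_prod)
      fix p assume p: "p \<in> pairs_less n"
      show "exps_in1 (\<lambda>b. ?t b \<ge> 0 \<and> (?t b = 0 \<longrightarrow> b = 0)) (1 - sgl (unit_exp (fst p) - unit_exp (snd p)) 1 :: 'f laurent)"
        by (rule exps_in1_bin) (use w[OF p] in \<open>simp_all add: additive_wt_0[OF additive_wt_weight]\<close>)
    qed (use additive_wt_weight[of "\<lambda>k. - int k" n] in \<open>auto simp: additive_wt_0 additive_wt_def add_nonneg_eq_0_iff\<close>)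
    then show ?thesis by (simp add: exps_in_def exps_in1_def)
  qed
  have "coeff_at 0 (fps_const (DL n)) = (1 :: 'f fps)"
    by (rule fps_ext) (simp add: lookup_DL_0 fps_one_nth)
  then show ?thesis using coeff_at_mult_zero[OF _ D additive_wt_weight] G by (simp add: down_coeff_def part_exp_0)
qed

lemma skew_DL: "skew n (fps_const (DL n) :: 'f::field_char_0 laurent fps)"
  unfolding skew_def
proof (intro allI impI)
  fix k assume k: "Suc k < n"
  show "swap_fps k (fps_const (DL n) :: 'f laurent fps) = - (mon (unit_exp (Suc k) - unit_exp k) * fps_const (DL n))"
  proof -
    have "swap_fps k (fps_const (DL n) :: 'f laurent fps) = fps_const (swap1 k (DL n))" by (rule fps_ext) simp
    also have "\<dots> = - (mon (unit_exp (Suc k) - unit_exp k) * fps_const (DL n))"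
      unfolding swap1_DL[OF k] mon_def by (simp only: fps_const_neg fps_const_mult)
    finally show ?thesis .
  qed
qed

lemma skew_homog_DL: "skew_homog n 0 (fps_const (DL n) :: 'f::field_char_0 laurent fps)"
  using skew_DL[of n] exps_in1_DL[of n, where 'f = 'f] by (auto simp: skew_homog_def exps_in_def exps_in1_def supp_below_def exp_size_def)

lemma qfac_prod: "qfac n = (1 - fps_X) ^ n * (\<Prod>m<n. \<Sum>i\<le>m. fps_X ^ i :: 'f::field fps)"
proof (induction n)
  case (Suc n)
  have "1 - fps_X ^ Suc n = (1 - fps_X) * (\<Sum>i\<le>n. fps_X ^ i :: 'f fps)"
    using one_diff_power_eq[of "fps_X :: 'f fps" "Suc n"] by (simp only: lessThan_Suc_atMost)
  then show ?case unfolding qfac_Suc Suc by (simp add: mult_ac del: power_Suc) (simp add: mult_ac)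
qed simp

text \<open>Only the empty partition occurs. On the expansion side \<open>HH\<close> is evaluated
  with p = q, and its q-factorial with the powers of 1 - q cancels the norm; on the other side
  \<open>DL\<close> with p = 1 gives n!.\<close>

lemma glued_DL: "glued n 0 (fps_const (DL n) :: 'f::field_char_0 laurent fps)"
  unfolding glued_def
proof (intro conjI allI impI)
  show "skew_homog n 0 (fps_const (DL n) :: 'f laurent fps)" by (rule skew_homog_DL)
  fix S :: "'f laurent fps" assume S: "symm_fps n S"
  have X: "emb fps_X = (fps_X :: 'f laurent fps)" by (rule fps_ext) (simp add: fps_X_def)
  have "HH n = (\<Prod>q\<in>pairs_less n. lin_gen fps_X (unit_exp (fst q) - unit_exp (snd q)) :: 'f laurent fps)"
    by (simp add: HH_def lin_gen_def lin_def X)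
  then have H: "ev (K n) (HH n * S) = (\<Prod>m<n. \<Sum>i\<le>m. fps_X ^ i) * ev (K n) S"
    by (simp only: ev_lin_gen_all[OF K_antisym_fun S])
  have c: "fps_const (\<Prod>p\<in>I. f p) = (\<Prod>p\<in>I. fps_const (f p :: 'f laurent))" for I :: "(nat \<times> nat) set" and f
    by (induction I rule: infinite_finite_induct) (simp_all del: fps_const_mult add: fps_const_mult[symmetric])
  have "fps_const (DL n) = (\<Prod>q\<in>pairs_less n. lin_gen 1 (unit_exp (fst q) - unit_exp (snd q)) :: 'f laurent fps)"
    unfolding DL_def c by (rule prod.cong) (simp_all add: lin_gen_def mon_def)
  then have D: "ev (K n) (fps_const (DL n) * S) = (\<Prod>m<n. \<Sum>i\<le>m. 1 ^ i) * ev (K n) S"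
    by (simp only: ev_lin_gen_all[OF K_antisym_fun S])
  have f: "(\<Prod>m<n. \<Sum>i\<le>m. 1 ^ i) = (fps_const (fact n) :: 'f fps)"
  proof (induction n)
    case (Suc n)
    have "(\<Sum>i\<le>n. 1 ^ i) = (fps_const (of_nat (Suc n)) :: 'f fps)" by (simp only: power_one sum_constant card_atMost fps_of_nat mult_1_right)
    then show ?case unfolding prod.lessThan_Suc Suc fact_Suc by (simp only: fps_const_mult mult.commute[of "of_nat _"])
  qed simp
  have cc0: "inv_norm n (\<lambda>_. 0) = (inv_qfac n :: 'f fps)" by (simp add: inv_norm_def)
  have U0: "up_pairing n S (\<lambda>_. 0) = inv_qfac n * ((\<Prod>m<n. \<Sum>i\<le>m. fps_X ^ i) * ev (K n) S)"
    unfolding up_pairing_def cc0 part_exp_0 using H by simp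
  have "fps_const (fact n) * (1 - fps_X) ^ n * up_pairing n S (\<lambda>_. 0) = fps_const (fact n) * (qfac n * inv_qfac n) * ev (K n) S"
    unfolding U0 qfac_prod by (simp only: mult_ac)
  then show "fps_const (fact n) * (1 - fps_X) ^ n * (\<Sum>nu\<in>parts_of_size n 0. down_coeff n (fps_const (DL n)) nu * up_pairing n S nu) =
      ev (K n) (fps_const (DL n) * S)"
    unfolding parts_of_size_0 D f by (simp add: down_coeff_DL)
qed

definition tail_part :: "(nat \<Rightarrow> nat) \<Rightarrow> nat \<Rightarrow> nat" where "tail_part lam = (\<lambda>i. lam (Suc i))"

lemma tail_part_Parts:
  assumes "lam \<in> Parts n"
  shows "tail_part lam \<in> Parts n" "psize lam = psize (tail_part lam) + lam 0" "interlacing lam (tail_part lam)"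
proof -
  have p: "is_partition lam" "lam 0 \<le> n" using assms by (auto simp: Parts_def)
  obtain b where b: "lam b = 0" using partition_bound[OF p(1)] by blast
  have z: "lam (Suc b) = 0" using partition_zero[OF p(1) b] by simp
  have a: "lam (Suc i) \<le> lam i" for i by (rule partition_antimono[OF p(1)]) simp
  have q: "is_partition (tail_part lam)"
    by (rule partitionI[of _ b]) (use a z in \<open>auto simp: tail_part_def\<close>)
  then show "tail_part lam \<in> Parts n" using a[of 0] p by (simp add: Parts_def tail_part_def)
  have "psize lam = (\<Sum>i<Suc b. lam i)" by (rule psize_eq[OF p(1) z])
  also have "\<dots> = lam 0 + (\<Sum>i<b. lam (Suc i))" by (rule sum.lessThan_Suc_shift)
  also have "(\<Sum>i<b. lam (Suc i)) = psize (tail_part lam)"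
    using psize_eq[OF q, of b] z by (simp add: tail_part_def)
  finally show "psize lam = psize (tail_part lam) + lam 0" by simp
  show "interlacing lam (tail_part lam)" using a by (simp add: interlacing_def tail_part_def)
qed

text \<open>
  Multiplication by \<open>e\<^sub>r\<close> with \<open>r = lam 0\<close> maps the element for the tail of \<open>lam\<close> to that for \<open>lam\<close> plus
  terms with a larger first part.
\<close>

lemma glued_generate:
  "lam \<in> parts_of_size n d \<Longrightarrow> \<exists>y :: 'f::field_char_0 laurent fps. glued n d y \<and> (\<forall>nu\<in>parts_of_size n d. down_coeff n y nu = (if nu = lam then 1 else 0))"
proof (induction d arbitrary: lam rule: less_induct)
  case (less d)
  show ?case
  proof (cases "d = 0")
    case True
    then show ?thesis using less.prems glued_DL[of n] down_coeff_DL[of n] by (intro exI[of _ "fps_const (DL n)"]) (auto simp: parts_of_size_0)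
  next
    case False
    show ?thesis using less.prems
    \<comment> \<open>First parts are at most n, so corrections by partitions with larger first part
      terminate.\<close>
    proof (induction "n - lam 0" arbitrary: lam rule: less_induct)
      case inner: less
      have lam: "lam \<in> Parts n" "psize lam = d" "is_partition lam" using inner.prems by (auto simp: parts_of_size_def Parts_def)
      have part_exp: "0 < lam 0"
      proof (rule ccontr)
        assume "\<not> 0 < lam 0"
        then have "lam 0 = 0" by simp
        then have "psize lam = 0" using psize_eq[OF lam(3), of 0] by simp
        then show False using lam False by simp
      qed
      let ?s = "tail_part lam"
      have d: "d = psize ?s + lam 0" using tail_part_Parts(2)[OF lam(1)] lam(2) by simp
      have s: "?s \<in> parts_of_size n (psize ?s)" using tail_part_Parts[OF lam(1)] by (simp add: parts_of_size_def)
      obtain y :: "'f laurent fps" where y: "glued n (psize ?s) y" "\<forall>nu\<in>parts_of_size n (psize ?s). down_coeff n y nu = (if nu = ?s then 1 else 0)"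
        using less.IH[OF _ s] d part_exp by auto
      define y1 where "y1 = elem_sym n (kdelta (lam 0)) * y"
      have y1: "glued n d y1" unfolding y1_def d using glued_elem_sym[OF y(1)] by blast
      have g: "skew_homog n (psize ?s) y" using y(1) by (simp add: glued_def)
      have D1: "down_coeff n y1 nu = (if interlacing nu ?s then strip_wt nu ?s else 0)" if nu: "nu \<in> parts_of_size n d" for nu
      proof -
        have nuP: "nu \<in> Parts n" using nu by (simp add: parts_of_size_def)
        have "down_coeff n y1 nu = (\<Sum>mu\<in>strips_below nu. fps_const (kdelta (lam 0) (psize nu - psize mu)) * (strip_wt nu mu * down_coeff n y mu))"
          unfolding y1_def by (rule down_coeff_elem_sym[OF g nuP])
        also have "\<dots> = (\<Sum>mu\<in>strips_below nu. if mu = ?s then strip_wt nu ?s else 0)"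
        proof (rule sum.cong)
          fix mu assume mu: "mu \<in> strips_below nu"
          have muP: "mu \<in> Parts n" by (rule strips_below_partition[OF nuP mu])
          have le: "psize mu \<le> d" using psize_interlacing[of nu mu] mu nu muP by (auto simp: parts_of_size_def Parts_def strips_below_def)
          show "fps_const (kdelta (lam 0) (psize nu - psize mu)) * (strip_wt nu mu * down_coeff n y mu) = (if mu = ?s then strip_wt nu ?s else 0)"
          proof (cases "psize mu = psize ?s")
            case True
            then have "down_coeff n y mu = (if mu = ?s then 1 else 0)" using y(2) muP by (simp add: parts_of_size_def)
            moreover have "kdelta (lam 0) (psize nu - psize mu) = (1 :: 'f)"
              using True nu d by (simp add: parts_of_size_def kdelta_def)
            ultimately show ?thesis by simp
          next
            case False
            then have "psize nu - psize mu \<noteq> lam 0" using le nu d by (auto simp: parts_of_size_def)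
            then show ?thesis using False by (auto simp: kdelta_def)
          qed
        qed simp
        also have "\<dots> = (if interlacing nu ?s then strip_wt nu ?s else 0)"
          unfolding sum.delta[OF finite_strips_below[OF nuP]] by (simp add: strips_below_def)
        finally show ?thesis .
      qed
      have wt1: "strip_wt lam ?s = (1 :: 'f fps)" by (simp add: strip_wt_def tail_part_def)
      let ?B = "{nu \<in> parts_of_size n d. lam 0 < nu 0}"
      \<comment> \<open>Interlacing with the tail bounds every later part of \<open>nu\<close> by
        that of \<open>lam\<close>. Equal sizes then force a first part at least
        \<open>lam 0\<close>, with equality only for \<open>nu = lam\<close>.\<close>
      have tri: "nu = lam \<or> lam 0 < nu 0" if nu: "nu \<in> parts_of_size n d" "interlacing nu ?s" for nu
      proof (cases "lam 0 < nu 0")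
        case False
        have nuP: "nu \<in> Parts n" "psize nu = d" using nu by (auto simp: parts_of_size_def)
        have le: "tail_part nu i \<le> tail_part lam i" for i using interlacingD(2)[OF nu(2), of i] by (simp add: tail_part_def)
        obtain b where b: "Suc 0 \<le> b" "lam b = 0" using partition_bound[OF lam(3)] by blast
        obtain b' where b': "b \<le> b'" "nu b' = 0" using partition_bound[of nu] nuP unfolding Parts_def by blast
        have z: "lam (Suc b') = 0" "nu (Suc b') = 0"
          using partition_zero[OF lam(3) b(2), of "Suc b'"] partition_zero[of nu b' "Suc b'"] b' nuP by (auto simp: Parts_def)
        have P: "is_partition (tail_part nu)" "is_partition (tail_part lam)"
          using tail_part_Parts(1)[OF nuP(1)] tail_part_Parts(1)[OF lam(1)] by (auto simp: Parts_def)
        have S: "psize (tail_part nu) = (\<Sum>i<b'. tail_part nu i)" "psize (tail_part lam) = (\<Sum>i<b'. tail_part lam i)"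
          by (rule psize_eq[OF P(1)], use z in \<open>simp add: tail_part_def\<close>, rule psize_eq[OF P(2)], use z in \<open>simp add: tail_part_def\<close>)
        have "psize (tail_part nu) \<le> psize (tail_part lam)" unfolding S by (rule sum_mono) (rule le)
        then have eq: "nu 0 = lam 0" "psize (tail_part nu) = psize (tail_part lam)"
          using False tail_part_Parts(2)[OF nuP(1)] tail_part_Parts(2)[OF lam(1)] nuP(2) lam(2) by auto
        have "tail_part nu i = tail_part lam i" for i
        proof (cases "i < b'")
          case True
          show ?thesis
          proof (rule ccontr)
            assume "tail_part nu i \<noteq> tail_part lam i"
            then have "tail_part nu i < tail_part lam i" using le[of i] by simp
            then have "(\<Sum>i<b'. tail_part nu i) < (\<Sum>i<b'. tail_part lam i)"
              by (intro sum_strict_mono_ex1) (use True le in auto)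
            then show False using eq(2) S by simp
          qed
        next
          case False
          then show ?thesis using partition_zero[OF P(1), of b' i] partition_zero[OF P(2), of b' i] z by (simp add: tail_part_def)
        qed
        then have "nu i = lam i" for i by (cases i) (use eq(1) in \<open>auto simp: tail_part_def\<close>)
        then show ?thesis by auto
      qed simp
      have "\<forall>nu\<in>?B. \<exists>y :: 'f laurent fps. glued n d y \<and> (\<forall>x\<in>parts_of_size n d. down_coeff n y x = (if x = nu then 1 else 0))"
      proof
        fix nu assume nu: "nu \<in> ?B"
        then have "n - nu 0 < n - lam 0" "nu \<in> parts_of_size n d" by (auto simp: parts_of_size_def Parts_def)
        then show "\<exists>y :: 'f laurent fps. glued n d y \<and> (\<forall>x\<in>parts_of_size n d. down_coeff n y x = (if x = nu then 1 else 0))"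
          by (rule inner.hyps)
      qed
      from bchoice[OF this] obtain Y :: "_ \<Rightarrow> 'f laurent fps"
        where Y': "\<forall>nu\<in>?B. glued n d (Y nu) \<and> (\<forall>x\<in>parts_of_size n d. down_coeff n (Y nu) x = (if x = nu then 1 else 0))" by (rule exE)
      have Y: "glued n d (Y nu)" if "nu \<in> ?B" for nu using Y' that by blast
      have YD: "down_coeff n (Y nu) x = (if x = nu then 1 else 0)" if "nu \<in> ?B" "x \<in> parts_of_size n d" for nu x using Y' that by blast
      let ?y = "y1 - (\<Sum>nu\<in>?B. emb (down_coeff n y1 nu) * Y nu)"
      have "glued n d ?y" by (intro glued_diff y1 glued_sum glued_emb Y)
      moreover have "down_coeff n ?y x = (if x = lam then 1 else 0)" if x: "x \<in> parts_of_size n d" for x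
      proof -
        have "down_coeff n ?y x = down_coeff n y1 x - (\<Sum>nu\<in>?B. down_coeff n y1 nu * down_coeff n (Y nu) x)"
          by (simp add: down_coeff_def right_diff_distrib sum_distrib_left mult.left_commute[of _ "emb _"] coeff_at_diff coeff_at_sum coeff_at_emb)
        also have "(\<Sum>nu\<in>?B. down_coeff n y1 nu * down_coeff n (Y nu) x) = (\<Sum>nu\<in>?B. if x = nu then down_coeff n y1 nu else 0)"
          by (rule sum.cong) (use YD x in auto)
        also have "\<dots> = (if lam 0 < x 0 then down_coeff n y1 x else 0)" using x by simp
        also have "down_coeff n y1 x - \<dots> = (if x = lam then 1 else 0)"
          using D1[OF x] tri[OF x] wt1 tail_part_Parts(3)[OF lam(1)] by auto
        finally show ?thesis .
      qed
      ultimately show ?case by blast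
    qed
  qed
qed

text \<open>Subtracting from y its expansion in the elements of \<open>glued_generate\<close> leaves
  a series all of whose \<open>down_coeff\<close> vanish, hence 0.\<close>

lemma glued_all:
  assumes "skew_homog n d (y :: 'f::field_char_0 laurent fps)"
  shows "glued n d y"
proof -
  have "\<forall>lam\<in>parts_of_size n d. \<exists>y :: 'f laurent fps. glued n d y \<and> (\<forall>nu\<in>parts_of_size n d. down_coeff n y nu = (if nu = lam then 1 else 0))"
    using glued_generate by blast
  from bchoice[OF this] obtain Y :: "_ \<Rightarrow> 'f laurent fps"
    where Y': "\<forall>nu\<in>parts_of_size n d. glued n d (Y nu) \<and> (\<forall>x\<in>parts_of_size n d. down_coeff n (Y nu) x = (if x = nu then 1 else 0))" by (rule exE)
  have Y: "glued n d (Y nu)" if "nu \<in> parts_of_size n d" for nu using Y' that by blast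
  have YD: "down_coeff n (Y nu) x = (if x = nu then 1 else 0)" if "nu \<in> parts_of_size n d" "x \<in> parts_of_size n d" for nu x using Y' that by blast
  let ?z = "\<Sum>nu\<in>parts_of_size n d. emb (down_coeff n y nu) * Y nu"
  have z: "glued n d ?z" by (intro glued_sum glued_emb Y)
  have "y - ?z = 0"
  proof (rule skew_homog_zero)
    show "skew_homog n d (y - ?z)" using z by (intro skew_homog_diff assms) (simp add: glued_def)
    fix x assume x: "x \<in> parts_of_size n d"
    have "down_coeff n (y - ?z) x = down_coeff n y x - (\<Sum>nu\<in>parts_of_size n d. down_coeff n y nu * down_coeff n (Y nu) x)"
      by (simp add: down_coeff_def right_diff_distrib sum_distrib_left mult.left_commute[of _ "emb _"] coeff_at_diff coeff_at_sum coeff_at_emb)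
    also have "(\<Sum>nu\<in>parts_of_size n d. down_coeff n y nu * down_coeff n (Y nu) x) = (\<Sum>nu\<in>parts_of_size n d. if x = nu then down_coeff n y nu else 0)"
      by (rule sum.cong) (use YD x in auto)
    finally show "down_coeff n (y - ?z) x = 0" using x by simp
  qed
  then show ?thesis using z by simp
qed

section \<open>The coefficients of \<open>t\<close>\<close>

lemma exps_in_AA_BB: "exps_in (\<lambda>b. 0 \<le> b 0) (AA n :: 'f::comm_ring_1 laurent fps)" "exps_in (\<lambda>b. 0 \<le> b 0) (BB n :: 'f::comm_ring_1 laurent fps)"
proof -
  show "exps_in (\<lambda>b. 0 \<le> b 0) (AA n :: 'f laurent fps)" unfolding AA_def
    by (rule exps_in_prod[where P = "\<lambda>i b. 0 \<le> b 0" and Q = "\<lambda>i b. 0 \<le> b 0"]) (auto intro!: exps_in_geom simp: scale_exp_def unit_exp_def)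
  show "exps_in (\<lambda>b. 0 \<le> b 0) (BB n :: 'f laurent fps)" unfolding BB_def
    by (rule exps_in_prod[where P = "\<lambda>i b. 0 \<le> b 0" and Q = "\<lambda>i b. 0 \<le> b 0"]) (auto intro!: exps_in_lin simp: unit_exp_def)
qed

lemma skew_homog_YY: "skew_homog n (2 * m) (YY n m :: 'f::field_char_0 laurent fps)"
  unfolding skew_homog_def
proof
  show "skew n (YY n m :: 'f laurent fps)" unfolding skew_def
  proof (intro allI impI, rule fps_ext)
    fix k i assume k: "Suc k < n"
    have AB: "swap1 k (fps_nth (AA n) j) = (fps_nth (AA n) j :: 'f laurent)" "swap1 k (fps_nth (BB n) j) = (fps_nth (BB n) j :: 'f laurent)" for j
      using symm_fps_AA[of n] symm_fps_BB[of n] k unfolding symm_fps_def by (metis swap_fps_nth)+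
    have m: "fps_nth (mon a * y) i = sgl a 1 * fps_nth y i" for a and y :: "'f laurent fps" by (simp add: mon_def)
    show "fps_nth (swap_fps k (YY n m)) i = (fps_nth (- (mon (unit_exp (Suc k) - unit_exp k) * YY n m)) i :: 'f laurent)"
    proof (cases "i \<le> m")
      case True
      then have Y: "fps_nth (YY n m) i = (fps_nth (BB n) i * (fps_nth (AA n) (m - i) * DL n) :: 'f laurent)" by (simp add: YY_def)
      show ?thesis unfolding swap_fps_nth fps_neg_nth m Y swap1_mult AB swap1_DL[OF k] by (simp only: mult_minus_right mult_ac)
    next
      case False
      then have Y: "fps_nth (YY n m) i = (0 :: 'f laurent)" by (simp add: YY_def)
      show ?thesis unfolding swap_fps_nth fps_neg_nth m Y by simp
    qed
  qed
  show "exps_in (\<lambda>b. 0 \<le> b 0 \<and> supp_below n b \<and> exp_size n b = int (2 * m)) (YY n m :: 'f laurent fps)"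
  proof (rule exps_inI)
    fix i b assume b: "b \<in> Poly_Mapping.keys (fps_nth (YY n m :: 'f laurent fps) i)"
    then have i: "i \<le> m" by (auto simp: YY_def split: if_splits)
    have A: "exps_in1 (\<lambda>b. 0 \<le> b 0 \<and> supp_below n b \<and> exp_size n b = 2 * int j) (fps_nth (AA n) j :: 'f laurent)" for j
      using exps_in_AA_BB(1)[of n, where 'f = 'f] graded_AA[of n, where 'f = 'f] by (auto simp: exps_in1_def exps_in_def graded_def)
    have B: "exps_in1 (\<lambda>b. 0 \<le> b 0 \<and> supp_below n b \<and> exp_size n b = 2 * int j) (fps_nth (BB n) j :: 'f laurent)" for j
      using exps_in_AA_BB(2)[of n, where 'f = 'f] graded_BB[of n, where 'f = 'f] by (auto simp: exps_in1_def exps_in_def graded_def)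
    have D: "exps_in1 (\<lambda>b. 0 \<le> b 0 \<and> supp_below n b \<and> exp_size n b = 0) (DL n :: 'f laurent)"
      using exps_in1_DL[of n, where 'f = 'f] by (auto simp: exps_in1_def supp_below_def exp_size_def)
    have "exps_in1 (\<lambda>b. 0 \<le> b 0 \<and> supp_below n b \<and> exp_size n b = 2 * int (m - i)) (fps_nth (AA n) (m - i) * DL n :: 'f laurent)"
      by (rule exps_in1_mult[OF A D]) (use additive_wt_exp_size[of n] in \<open>auto simp: supp_below_simps additive_wt_def\<close>)
    from exps_in1_mult[OF B this, of i "\<lambda>b. 0 \<le> b 0 \<and> supp_below n b \<and> exp_size n b = int (2 * m)"]
    have "exps_in1 (\<lambda>b. 0 \<le> b 0 \<and> supp_below n b \<and> exp_size n b = int (2 * m)) (fps_nth (YY n m) i :: 'f laurent)"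
      using i additive_wt_exp_size[of n] by (auto simp: YY_def supp_below_simps additive_wt_def)
    then show "0 \<le> b 0 \<and> supp_below n b \<and> exp_size n b = int (2 * m)" using b by (simp add: exps_in1_def)
  qed
qed

text \<open>The factor \<open>AA\<close> and the power of 1 - q are built in so that g = 1 gives, by
  \<open>even_char_HH_AA\<close>, the norm on paired partitions and 0 elsewhere. Multiplying g by
  elementary symmetric polynomials then acts by Pieri sums.\<close>

definition ell :: "nat \<Rightarrow> 'f::field_char_0 laurent fps \<Rightarrow> (nat \<Rightarrow> nat) \<Rightarrow> 'f fps" where
  "ell n g lam = (1 - fps_X) ^ n * up_pairing n (AA n * g) lam"

definition paired_sum :: "nat \<Rightarrow> nat \<Rightarrow> 'f::field_char_0 laurent fps \<Rightarrow> 'f fps" where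
  "paired_sum n m g = (\<Sum>lam\<in>{lam \<in> parts_of_size n (2 * m). paired lam}. ell n g lam)"

text \<open>By \<open>even_char_BB_GG\<close> the expansion coefficients of \<open>YY n m\<close>
  are the indicator of \<open>paired\<close>, so the sum over paired partitions is the expansion
  side of \<open>glued_all\<close>.\<close>

lemma paired_sum_ev:
  assumes "symm_fps n g"
  shows "fps_const (fact n) * paired_sum n m g = ev (K n) (YY n m * (AA n * g))"
proof -
  have D: "down_coeff n (YY n m) nu = (if paired nu then 1 else (0 :: 'a fps))" if "nu \<in> parts_of_size n (2 * m)" for nu
  proof -
    have nu: "nu \<in> Parts n" "psize nu = 2 * m" using that by (auto simp: parts_of_size_def)
    have "down_coeff n (YY n m) nu = ev (\<lambda>b. K n (part_exp n nu - b)) (BB n * GG n :: 'a laurent fps)"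
      unfolding down_coeff_def by (rule coeff_at_YY) (use supp_below_part_exp[OF nu(1)] exp_size_part_exp[OF nu(1)] nu(2) in auto)
    also have "\<dots> = (if \<forall>k<n. even (part_exp n nu k) then 1 else 0)"
      by (rule even_char_BB_GG[OF dominant_part_exp[OF nu(1)] part_exp_ge_0])
    finally show ?thesis by (simp only: even_part_exp[OF nu(1)])
  qed
  have "fps_const (fact n) * paired_sum n m g =
      fps_const (fact n) * (1 - fps_X) ^ n * (\<Sum>nu\<in>parts_of_size n (2 * m). if paired nu then up_pairing n (AA n * g) nu else 0)"
    by (simp add: paired_sum_def ell_def sum_distrib_left[symmetric] sum.inter_filter mult.assoc)
  also have "(\<Sum>nu\<in>parts_of_size n (2 * m). if paired nu then up_pairing n (AA n * g) nu else 0) =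
      (\<Sum>nu\<in>parts_of_size n (2 * m). down_coeff n (YY n m) nu * up_pairing n (AA n * g) nu)"
    by (rule sum.cong) (auto simp: D)
  also have "fps_const (fact n) * (1 - fps_X) ^ n * \<dots> = ev (K n) (YY n m * (AA n * g))"
    using glued_all[OF skew_homog_YY[of n m, where 'f = 'a]] symm_fps_mult[OF symm_fps_AA assms] unfolding glued_def by blast
  finally show ?thesis .
qed

text \<open>It matters that \<open>E\<close> is free of q: then q^i arises only from B_k in
  \<open>YY\<close> and A_{i-k} in \<open>AA\<close>, with A_{m-k} supplied by the degree.
  Exchanging i and m permutes these factors.\<close>

lemma paired_sum_symmetric:
  assumes "symm_fps n (fps_const E :: 'f::field_char_0 laurent fps)"
  shows "fps_nth (paired_sum n m (fps_const E)) i = fps_nth (paired_sum n i (fps_const E)) m"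
proof -
  let ?T = "\<lambda>i m k. ev1 (K n) (fps_nth (BB n) k * (fps_nth (AA n) (m - k) * DL n) * (fps_nth (AA n) (i - k) * E))"
  have Y: "fps_nth (YY n m) k = (if k \<le> m then fps_nth (BB n) k * (fps_nth (AA n) (m - k) * DL n) else (0 :: 'f laurent))" for m k
    by (simp add: YY_def)
  have "fps_nth (fps_const (fact n) * paired_sum n m (fps_const E)) i = (\<Sum>k\<in>{0..i}. if k \<le> m then ?T i m k else 0)" for m i
    unfolding paired_sum_ev[OF assms] ev_nth fps_mult_nth[of "YY n m"] ev1_sum
    by (rule sum.cong) (auto simp: Y)
  also have "(\<Sum>k\<in>{0..i}. if k \<le> m then ?T i m k else 0) = (\<Sum>k\<in>{k. k \<le> i \<and> k \<le> m}. ?T i m k)" for m i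
    by (rule sum.mono_neutral_cong_right) auto
  finally have *: "fact n * fps_nth (paired_sum n m (fps_const E)) i = (\<Sum>k\<in>{k. k \<le> i \<and> k \<le> m}. ?T i m k)" for m i
    by simp
  have "(\<Sum>k\<in>{k. k \<le> i \<and> k \<le> m}. ?T i m k) = (\<Sum>k\<in>{k. k \<le> m \<and> k \<le> i}. ?T m i k)"
    by (rule sum.cong) (auto simp: mult_ac)
  then have "fact n * fps_nth (paired_sum n m (fps_const E)) i = fact n * fps_nth (paired_sum n i (fps_const E)) m"
    unfolding * .
  then show ?thesis by simp
qed

lemma ell_1:
  assumes "lam \<in> Parts n"
  shows "ell n 1 lam = (if paired lam then inv_norm n lam else (0 :: 'f::field_char_0 fps))"
proof -
  have "ell n 1 lam = inv_norm n lam * ((1 - fps_X) ^ n * ev (\<lambda>b. K n (part_exp n lam + b)) (HH n * AA n :: 'f laurent fps))"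
    by (simp add: ell_def up_pairing_def mult_ac)
  also have "\<dots> = inv_norm n lam * (if paired lam then 1 else 0)"
    unfolding even_char_HH_AA[OF dominant_part_exp[OF assms] part_exp_ge_0] even_part_exp[OF assms] ..
  finally show ?thesis by simp
qed

lemma ell_elem_sym:
  assumes "mu \<in> Parts n" "symm_fps n g"
  shows "ell n (elem_sym n \<phi> * g) mu =
    (\<Sum>lam\<in>strips_above n mu. fps_const (\<phi> (psize lam - psize mu)) * (strip_wt lam mu * ell n g lam))"
proof -
  have "AA n * (elem_sym n \<phi> * g) = elem_sym n \<phi> * (AA n * g)" by (simp only: mult_ac)
  then show ?thesis unfolding ell_def
    using up_pairing_elem_sym[OF assms(1) symm_fps_mult[OF symm_fps_AA assms(2)], of \<phi>] by (simp add: sum_distrib_left mult_ac)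
qed

lemma elem_sym_const: "\<exists>E. elem_sym n \<phi> = fps_const E"
proof (induction n arbitrary: \<phi>)
  case 0
  show ?case by (rule exI[of _ "sgl 0 (\<phi> 0)"], rule fps_ext) simp
next
  case (Suc n)
  obtain E E' where "elem_sym n \<phi> = fps_const E" "elem_sym n (\<lambda>r. \<phi> (Suc r)) = fps_const E'" using Suc by blast
  then show ?case by (auto simp: mon_def)
qed

section \<open>Boundary factors\<close>

text \<open>
  \<open>double_up s\<close> and \<open>double_down s\<close> are the only partitions with \<open>\<lambda>\<^sub>1 = \<lambda>\<^sub>2, \<lambda>\<^sub>3 = \<lambda>\<^sub>4, \<dots>\<close> in a strip above
  and below \<open>s\<close>, respectively.
\<close>

definition double_up :: "(nat \<Rightarrow> nat) \<Rightarrow> nat \<Rightarrow> nat" where "double_up s = (\<lambda>i. s (2 * (i div 2)))"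
definition double_down :: "(nat \<Rightarrow> nat) \<Rightarrow> nat \<Rightarrow> nat" where "double_down s = (\<lambda>i. s (Suc (2 * (i div 2))))"
text \<open>The number of columns of odd length.\<close>

definition even_gap_sum :: "(nat \<Rightarrow> nat) \<Rightarrow> nat" where "even_gap_sum s = Sum_any (\<lambda>k. s (2 * k) - s (Suc (2 * k)))"
text \<open>The sum of the second, fourth, ... parts in the usual numbering; it will be the exponent
  of t.\<close>

definition odd_index_sum :: "(nat \<Rightarrow> nat) \<Rightarrow> nat" where "odd_index_sum s = Sum_any (\<lambda>k. s (Suc (2 * k)))"

lemma prod_pairs: "(\<Prod>i<2 * b. f i) = (\<Prod>k<b. f (2 * k) * f (Suc (2 * k)) :: 'c::comm_monoid_mult)"
  by (induction b) (simp_all add: mult.assoc)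
lemma sum_pairs: "(\<Sum>i<2 * b. f i) = (\<Sum>k<b. f (2 * k) + f (Suc (2 * k)) :: 'c::comm_monoid_add)"
  by (induction b) (simp_all add: add.assoc)

lemma even_gap_sum_eq:
  assumes "is_partition s" "s (2 * b) = 0"
  shows "even_gap_sum s = (\<Sum>k<b. s (2 * k) - s (Suc (2 * k)))"
  unfolding even_gap_sum_def
proof (rule Sum_any.expand_superset)
  show "{a. s (2 * a) - s (Suc (2 * a)) \<noteq> 0} \<subseteq> {..<b}"
  proof
    fix k assume k: "k \<in> {a. s (2 * a) - s (Suc (2 * a)) \<noteq> 0}"
    then have "s (2 * k) \<noteq> 0" by auto
    then have "\<not> b \<le> k" using partition_zero[OF assms, of "2 * k"] by auto
    then show "k \<in> {..<b}" by simp
  qed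
qed simp

lemma odd_index_sum_eq:
  assumes "is_partition s" "s (2 * b) = 0"
  shows "odd_index_sum s = (\<Sum>k<b. s (Suc (2 * k)))"
  unfolding odd_index_sum_def
proof (rule Sum_any.expand_superset)
  show "{a. s (Suc (2 * a)) \<noteq> 0} \<subseteq> {..<b}"
  proof
    fix k assume k: "k \<in> {a. s (Suc (2 * a)) \<noteq> 0}"
    then have "\<not> b \<le> k" using partition_zero[OF assms, of "Suc (2 * k)"] by auto
    then show "k \<in> {..<b}" by simp
  qed
qed simp

lemma even_bound:
  assumes "is_partition s"
  obtains b where "s (2 * b) = 0"
proof -
  obtain b where "s b = 0" using partition_bound[OF assms] by blast
  then show thesis using partition_zero[OF assms, of b "2 * b"] that by simp
qed

lemma psize_pairs:
  assumes "is_partition s"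
  shows "psize s = even_gap_sum s + 2 * odd_index_sum s"
proof -
  obtain b where b: "s (2 * b) = 0" using even_bound[OF assms] .
  have le: "s (Suc (2 * k)) \<le> s (2 * k)" for k by (rule partition_antimono[OF assms]) simp
  have "s (2 * k) + s (Suc (2 * k)) = (s (2 * k) - s (Suc (2 * k))) + 2 * s (Suc (2 * k))" for k using le[of k] by simp
  then show ?thesis unfolding psize_eq[OF assms b] even_gap_sum_eq[OF assms b] odd_index_sum_eq[OF assms b] sum_pairs sum_distrib_left sum.distrib[symmetric]
    by (rule sum.cong[OF refl])
qed

lemma paired_eq: "paired lam \<Longrightarrow> lam i = lam (2 * (i div 2))"
  by (cases "even i") (auto simp: paired_def elim!: evenE oddE)

text \<open>Interlacing gives s (2 k) <= lam (2 k) = lam (2 k + 1) <= s (2 k), so \<open>lam\<close>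
  is forced. Of each pair of binomials one is trivial, and the other converts the norm of
  \<open>double_up s\<close> into that of s.\<close>

lemma double_up:
  assumes "s \<in> Parts n"
  shows "double_up s \<in> strips_above n s" "paired (double_up s)" "psize (double_up s) - psize s = even_gap_sum s" "inv_norm n (double_up s) * strip_wt (double_up s) s = (inv_norm n s :: 'f::field fps)"
    "\<And>lam. lam \<in> strips_above n s \<Longrightarrow> paired lam \<Longrightarrow> lam = double_up s"
proof -
  have p: "is_partition s" "s 0 \<le> n" using assms by (auto simp: Parts_def)
  have mono: "i \<le> j \<Longrightarrow> s j \<le> s i" for i j by (rule partition_antimono[OF p(1)])
  have il: "interlacing (double_up s) s" unfolding interlacing_def double_up_def by (intro allI conjI mono) auto
  show up: "double_up s \<in> strips_above n s" using il p by (simp add: strips_above_def) (simp add: double_up_def)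
  show ev: "paired (double_up s)" by (simp add: paired_def double_up_def)
  obtain b where b: "s (2 * b) = 0" using even_bound[OF p(1)] .
  have q: "is_partition (double_up s)" using strips_above_partition[OF p(1) up] by (simp add: Parts_def)
  have z: "double_up s (2 * b) = 0" using b by (simp add: double_up_def)
  have v: "double_up s (2 * k) = s (2 * k)" "double_up s (Suc (2 * k)) = s (2 * k)" "double_up s (Suc (Suc (2 * k))) = s (Suc (Suc (2 * k)))" for k
    by (simp_all add: double_up_def)
  have "psize (double_up s) = (\<Sum>k<b. 2 * s (2 * k))" unfolding psize_eq[OF q z] sum_pairs by (intro sum.cong refl) (unfold v, simp)
  moreover have "psize s + even_gap_sum s = (\<Sum>k<b. 2 * s (2 * k))"
    unfolding psize_eq[OF p(1) b] even_gap_sum_eq[OF p(1) b] sum_pairs sum.distrib[symmetric]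
  proof (intro sum.cong refl)
    fix k
    have "s (Suc (2 * k)) \<le> s (2 * k)" by (rule mono) simp
    then show "s (2 * k) + s (Suc (2 * k)) + (s (2 * k) - s (Suc (2 * k))) = 2 * s (2 * k)" by simp
  qed
  ultimately show "psize (double_up s) - psize s = even_gap_sum s" by simp
  have "(\<Prod>i<2 * b. inv_qfac (double_up s i - double_up s (Suc i))) * (\<Prod>i<2 * b. gauss_binom (double_up s i - double_up s (Suc i)) (double_up s i - s i))
    = (\<Prod>i<2 * b. inv_qfac (s i - s (Suc i)) :: 'f fps)"
    unfolding prod_pairs prod.distrib[symmetric]
  proof (rule prod.cong)
    fix k
    have "s (2 * k) - s (Suc (Suc (2 * k))) - (s (2 * k) - s (Suc (2 * k))) = s (Suc (2 * k)) - s (Suc (Suc (2 * k)))"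
      using mono[of "2 * k" "Suc (2 * k)"] mono[of "Suc (2 * k)" "Suc (Suc (2 * k))"] by simp
    then have "gauss_binom (s (2 * k) - s (Suc (Suc (2 * k)))) (s (2 * k) - s (Suc (2 * k))) = qfac (s (2 * k) - s (Suc (Suc (2 * k)))) *
       (inv_qfac (s (2 * k) - s (Suc (2 * k))) * (inv_qfac (s (Suc (2 * k)) - s (Suc (Suc (2 * k)))) :: 'f fps))"
      by (simp add: gauss_binom_def mult.assoc)
    then show "inv_qfac (double_up s (2 * k) - double_up s (Suc (2 * k))) * inv_qfac (double_up s (Suc (2 * k)) - double_up s (Suc (Suc (2 * k)))) *
      (gauss_binom (double_up s (2 * k) - double_up s (Suc (2 * k))) (double_up s (2 * k) - s (2 * k)) *
       gauss_binom (double_up s (Suc (2 * k)) - double_up s (Suc (Suc (2 * k)))) (double_up s (Suc (2 * k)) - s (Suc (2 * k)))) =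
      (inv_qfac (s (2 * k) - s (Suc (2 * k))) * inv_qfac (s (Suc (2 * k)) - s (Suc (Suc (2 * k)))) :: 'f fps)"
      unfolding v by (simp add: mult.assoc[symmetric])
  qed simp
  moreover have "double_up s 0 = s 0" by (simp add: double_up_def)
  ultimately show "inv_norm n (double_up s) * strip_wt (double_up s) s = (inv_norm n s :: 'f fps)"
    unfolding inv_norm_eq[OF q z] strip_wt_eq[OF q z] inv_norm_eq[OF p(1) b] by (simp add: mult.assoc)
  fix lam assume lam: "lam \<in> strips_above n s" "paired lam"
  have il: "interlacing lam s" using lam by (simp add: strips_above_def)
  show "lam = double_up s"
  proof
    fix i
    have e: "lam (2 * (i div 2)) = lam (Suc (2 * (i div 2)))" using lam(2) by (simp add: paired_def)
    have "lam i = lam (2 * (i div 2))" by (rule paired_eq[OF lam(2)])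
    also have "\<dots> = s (2 * (i div 2))" using interlacingD[OF il, of "2 * (i div 2)"] e by simp
    finally show "lam i = double_up s i" by (simp add: double_up_def)
  qed
qed

text \<open>A paired partition below s is squeezed onto s (2 k + 1). Both binomials of a pair are
  then trivial, one choosing everything and the other nothing, so the weight is 1 without any
  norm.\<close>

lemma double_down:
  assumes "s \<in> Parts n"
  shows "double_down s \<in> strips_below s" "paired (double_down s)" "psize s - psize (double_down s) = even_gap_sum s" "psize (double_down s) = 2 * odd_index_sum s" "strip_wt s (double_down s) = (1 :: 'f::field fps)"
    "\<And>mu. mu \<in> strips_below s \<Longrightarrow> paired mu \<Longrightarrow> mu = double_down s"
proof -
  have p: "is_partition s" "s 0 \<le> n" using assms by (auto simp: Parts_def)
  have mono: "i \<le> j \<Longrightarrow> s j \<le> s i" for i j by (rule partition_antimono[OF p(1)])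
  have il: "interlacing s (double_down s)" unfolding interlacing_def double_down_def
  proof (intro allI conjI mono)
    show "i \<le> Suc (2 * (i div 2))" "Suc (2 * (i div 2)) \<le> Suc i" for i :: nat by presburger+
  qed
  show dn: "double_down s \<in> strips_below s" using il by (simp add: strips_below_def)
  show ev: "paired (double_down s)" by (simp add: paired_def double_down_def)
  obtain b where b: "s (2 * b) = 0" using even_bound[OF p(1)] .
  have q: "is_partition (double_down s)" using strips_below_partition[OF assms dn] by (simp add: Parts_def)
  have z: "double_down s (2 * b) = 0" using interlacingD(1)[OF il, of "2 * b"] b by simp
  have v: "double_down s (2 * k) = s (Suc (2 * k))" "double_down s (Suc (2 * k)) = s (Suc (2 * k))" for k
    by (simp_all add: double_down_def)
  show o: "psize (double_down s) = 2 * odd_index_sum s"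
    unfolding psize_eq[OF q z] odd_index_sum_eq[OF p(1) b] sum_pairs sum_distrib_left by (rule sum.cong) (simp_all add: v)
  then show "psize s - psize (double_down s) = even_gap_sum s" using psize_pairs[OF p(1)] by simp
  show "strip_wt s (double_down s) = (1 :: 'f fps)" unfolding strip_wt_eq[OF p(1) b] prod_pairs by (simp add: v)
  fix mu assume mu: "mu \<in> strips_below s" "paired mu"
  have il: "interlacing s mu" using mu by (simp add: strips_below_def)
  show "mu = double_down s"
  proof
    fix i
    have e: "mu (2 * (i div 2)) = mu (Suc (2 * (i div 2)))" using mu(2) by (simp add: paired_def)
    have "mu i = mu (2 * (i div 2))" by (rule paired_eq[OF mu(2)])
    also have "\<dots> = s (Suc (2 * (i div 2)))"
      using interlacingD(2)[OF il, of "2 * (i div 2)"] interlacingD(1)[OF il, of "Suc (2 * (i div 2))"] e by simp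
    finally show "mu i = double_down s i" by (simp add: double_down_def)
  qed
qed

abbreviation powers :: "'f::comm_ring_1 \<Rightarrow> nat \<Rightarrow> 'f" where "powers a \<equiv> (\<lambda>r. a ^ r)"

lemma symm_fps_1: "symm_fps n 1" using symm_fps_emb[of n 1] by simp

lemma ell_powers:
  assumes "s \<in> Parts n"
  shows "ell n (elem_sym n (powers a)) s = inv_norm n s * fps_const (a ^ even_gap_sum s)"
proof -
  have p: "is_partition s" using assms by (simp add: Parts_def)
  have "ell n (elem_sym n (powers a)) s = (\<Sum>lam\<in>strips_above n s. fps_const (a ^ (psize lam - psize s)) * (strip_wt lam s * ell n 1 lam))"
    using ell_elem_sym[OF assms symm_fps_1, of "powers a"] by simp
  also have "\<dots> = (\<Sum>lam\<in>strips_above n s. if lam = double_up s then inv_norm n s * fps_const (a ^ even_gap_sum s) else 0)"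
  proof (rule sum.cong)
    fix lam assume lam: "lam \<in> strips_above n s"
    show "fps_const (a ^ (psize lam - psize s)) * (strip_wt lam s * ell n 1 lam) = (if lam = double_up s then inv_norm n s * fps_const (a ^ even_gap_sum s) else 0)"
    proof (cases "paired lam")
      case True
      have l: "lam = double_up s" by (rule double_up(5)[OF assms lam True])
      have "ell n 1 (double_up s) = (inv_norm n (double_up s) :: 'a fps)" using ell_1[OF strips_above_partition[OF p lam], where 'f = 'a] True l by simp
      then have "strip_wt (double_up s) s * ell n 1 (double_up s) = (inv_norm n s :: 'a fps)" using double_up(4)[OF assms, where 'f = 'a] by (simp only: mult.commute)
      then show ?thesis unfolding l by (simp add: double_up(3)[OF assms] mult.commute)
    next
      case False
      then have "lam \<noteq> double_up s" using double_up(2)[OF assms] by auto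
      then show ?thesis using False ell_1[OF strips_above_partition[OF p lam], where 'f = 'a] by simp
    qed
  qed simp
  also have "\<dots> = inv_norm n s * fps_const (a ^ even_gap_sum s)" using double_up(1)[OF assms] p by simp
  finally show ?thesis .
qed

lemma qbinom_gauss_binom: "qbinom m k = gauss_binom m k"
  by (simp add: qbinom_def gauss_binom_def qfac_def[symmetric] divide_qp2)

lemma prod_fps_const: "fps_const (\<Prod>i\<in>I. f i) = (\<Prod>i\<in>I. fps_const (f i :: 'c::comm_ring_1))"
  by (induction I rule: infinite_finite_induct) (simp_all del: fps_const_mult add: fps_const_mult[symmetric])

lemma prod_shift_pairs:
  "(\<Prod>i<2 * c. f i) * f (2 * c) = f 0 * (\<Prod>k<c. f (Suc (2 * k)) * f (Suc (Suc (2 * k))) :: 'c::comm_monoid_mult)"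
  by (induction c) (simp_all add: mult_ac)

lemma mult_part_conj:
  assumes "is_partition lam"
  shows "mult_part (Suc i) (conj_part lam) = lam i - lam (Suc i)"
proof -
  have c: "conj_part lam j = Suc i \<longleftrightarrow> lam (Suc i) \<le> j \<and> j < lam i" for j
  proof -
    obtain b where b: "lam b = 0" using partition_bound[OF assms] by blast
    \<comment> \<open>The indices k with j < lam k form an initial segment, whose length is the
      least k with lam k <= j.\<close>
    define c where "c = (LEAST k. lam k \<le> j)"
    have "lam c \<le> j" unfolding c_def by (rule LeastI[of _ b]) (simp add: b)
    moreover have "j < lam k" if "k < c" for k using not_less_Least[of k "\<lambda>k. lam k \<le> j"] that unfolding c_def by simp
    ultimately have "j < lam k \<longleftrightarrow> k < c" for k
      using partition_antimono[OF assms, of c k] by (meson le_less_trans not_le)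
    then have lam: "{k. j < lam k} = {..<c}" "\<And>k. j < lam k \<longleftrightarrow> k < c" by auto
    then have "conj_part lam j = c" by (simp add: conj_part_def)
    then show ?thesis using lam(2)[of i] lam(2)[of "Suc i"] by auto
  qed
  have "{j. conj_part lam j = Suc i} = {lam (Suc i)..<lam i}" unfolding c by auto
  then show ?thesis by (simp add: mult_part_def)
qed

lemma rogers_szego_zero [simp]: "rogers_szego 0 z = 1" by (simp add: rogers_szego_def qbinom_gauss_binom)
lemma rogers_szego_hom_zero [simp]: "rogers_szego_hom 0 a b = 1" by (simp add: rogers_szego_hom_def qbinom_gauss_binom)

lemma h_part_conj:
  assumes "is_partition lam" "lam (2 * b) = 0"
  shows "h_part (conj_part lam) x y = (\<Prod>k<b. rogers_szego_hom (lam (2 * k) - lam (Suc (2 * k))) x y *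
     rogers_szego (lam (Suc (2 * k)) - lam (Suc (Suc (2 * k)))) (x * y) :: 'f::field fps)"
proof -
  let ?f = "\<lambda>k. rogers_szego_hom (lam (2 * k) - lam (Suc (2 * k))) x y *
     rogers_szego (lam (Suc (2 * k)) - lam (Suc (Suc (2 * k)))) (x * y) :: 'f fps"
  have "h_part (conj_part lam) x y = Prod_any ?f"
    unfolding h_part_def using mult_part_conj[OF assms(1)] by simp
  also have "\<dots> = (\<Prod>k<b. ?f k)"
  proof (rule Prod_any.expand_superset)
    show "{a. ?f a \<noteq> 1} \<subseteq> {..<b}"
    proof
      fix k assume k: "k \<in> {a. ?f a \<noteq> 1}"
      have "\<not> b \<le> k"
      proof
        assume "b \<le> k"
        then have "lam (2 * k) = 0" "lam (Suc (2 * k)) = 0" using partition_zero[OF assms] by simp_all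
        then show False using k by simp
      qed
      then show "k \<in> {..<b}" by simp
    qed
  qed simp
  finally show ?thesis .
qed

lemma sum_prod_strips_above:
  assumes "is_partition lam" "lam (Suc (2 * b)) = 0"
  shows "(\<Sum>s\<in>strips_above n lam. \<Prod>i<2 * Suc b. G i (s i)) = (\<Prod>i<2 * Suc b. \<Sum>v\<in>{lam i..prev_part n lam i}. (G i v :: 'c::comm_semiring_1))"
proof -
  have "Suc (Suc (2 * b)) = 2 * Suc b" by simp
  then show ?thesis unfolding strips_above_fun_box[OF assms] by (simp only: sum_prod_fun_box)
qed

text \<open>In the Pieri sum each s i ranges independently over an interval and the weight splits
  over the rows, so the sum is a product of sums over one row. Each of these is a Rogers-Szego
  polynomial, of one kind or the other by the parity of the row.\<close>

lemma ell_powers_powers: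
  assumes "lam \<in> Parts n"
  shows "ell n (elem_sym n (powers b) * elem_sym n (powers a)) lam =
    rogers_szego (n - lam 0) (a * b) * h_part (conj_part lam) a b * (inv_norm n lam :: 'f::field_char_0 fps)"
proof -
  have p: "is_partition lam" "lam 0 \<le> n" using assms by (auto simp: Parts_def)
  have mono: "i \<le> j \<Longrightarrow> lam j \<le> lam i" for i j by (rule partition_antimono[OF p(1)])
  obtain c where c: "lam (2 * c) = 0" using even_bound[OF p(1)] .
  let ?B = "Suc (2 * c)"
  have z: "lam ?B = 0" using partition_zero[OF p(1) c] by simp
  \<comment> \<open>In an even row every added box counts once for b and once for the odd columns
    that carry a. In an odd row an added box counts for b and takes away one of the a's still due to
    the gap lam (i - 1) - s i.\<close>
  let ?w = "\<lambda>i v. if even i then (a * b) ^ (v - lam i) else a ^ (lam (i - 1) - v) * b ^ (v - lam i)"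
  let ?g = "\<lambda>i v. gauss_binom (prev_part n lam i - lam i) (v - lam i) * fps_const (?w i v)"
  let ?R = "\<lambda>i. if even i then rogers_szego (prev_part n lam i - lam i) (a * b) else rogers_szego_hom (prev_part n lam i - lam i) a b"
  have "ell n (elem_sym n (powers b) * elem_sym n (powers a)) lam =
    (\<Sum>s\<in>strips_above n lam. fps_const (b ^ (psize s - psize lam)) * (strip_wt s lam * ell n (elem_sym n (powers a)) s))"
    by (rule ell_elem_sym[OF assms symm_fps_elem_sym])
  also have "\<dots> = (\<Sum>s\<in>strips_above n lam. inv_norm n lam * (\<Prod>i<2 * Suc c. ?g i (s i)))"
  proof (rule sum.cong)
    fix s assume s: "s \<in> strips_above n lam"
    have sP: "s \<in> Parts n" by (rule strips_above_partition[OF p(1) s])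
    then have sp: "is_partition s" by (simp add: Parts_def)
    have il: "interlacing s lam" using s by (simp add: strips_above_def)
    have z2: "s (2 * Suc c) = 0" "lam (2 * Suc c) = 0"
      using interlacingD(2)[OF il, of ?B] z partition_zero[OF p(1) z, of "2 * Suc c"] by simp_all
    have cs: "inv_norm n s * strip_wt s lam = inv_norm n lam * (\<Prod>i<2 * Suc c. gauss_binom (prev_part n lam i - lam i) (s i - lam i) :: 'f fps)"
      using inv_norm_gauss_binom[OF p(1) z p(2) s, where 'f = 'f, symmetric] by (simp only: lessThan_Suc_atMost[symmetric] mult_2 add_Suc add_Suc_right)
    have "b ^ (psize s - psize lam) * a ^ even_gap_sum s = (\<Prod>i<2 * Suc c. ?w i (s i))"
    proof -
      have "b ^ (psize s - psize lam) * a ^ even_gap_sum s =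
        (\<Prod>k<Suc c. b ^ (s (2 * k) - lam (2 * k)) * b ^ (s (Suc (2 * k)) - lam (Suc (2 * k))) * a ^ (s (2 * k) - s (Suc (2 * k))))"
        unfolding psize_diff[OF sp p(1) z2 interlacingD(1)[OF il], symmetric] even_gap_sum_eq[OF sp z2(1)] sum_pairs
        by (simp only: power_sum sum.distrib power_add prod.distrib)
      also have "\<dots> = (\<Prod>k<Suc c. ?w (2 * k) (s (2 * k)) * ?w (Suc (2 * k)) (s (Suc (2 * k))))"
      proof (rule prod.cong)
        fix k
        have "s (2 * k) - s (Suc (2 * k)) = (s (2 * k) - lam (2 * k)) + (lam (2 * k) - s (Suc (2 * k)))"
          using interlacingD[OF il, of "2 * k"] by simp
        then have "a ^ (s (2 * k) - s (Suc (2 * k))) = a ^ (s (2 * k) - lam (2 * k)) * a ^ (lam (2 * k) - s (Suc (2 * k)))"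
          by (simp only: power_add)
        then show "b ^ (s (2 * k) - lam (2 * k)) * b ^ (s (Suc (2 * k)) - lam (Suc (2 * k))) * a ^ (s (2 * k) - s (Suc (2 * k))) =
          ?w (2 * k) (s (2 * k)) * ?w (Suc (2 * k)) (s (Suc (2 * k)))"
          by (simp add: power_mult_distrib mult_ac)
      qed simp
      finally show ?thesis by (simp only: prod_pairs)
    qed
    then have w: "fps_const (b ^ (psize s - psize lam)) * fps_const (a ^ even_gap_sum s) = (\<Prod>i<2 * Suc c. fps_const (?w i (s i)))"
      by (simp only: fps_const_mult prod_fps_const)
    have "fps_const (b ^ (psize s - psize lam)) * (strip_wt s lam * ell n (elem_sym n (powers a)) s) =
      (inv_norm n s * strip_wt s lam) * (fps_const (b ^ (psize s - psize lam)) * fps_const (a ^ even_gap_sum s))"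
      unfolding ell_powers[OF sP] by (simp only: mult_ac)
    then show "fps_const (b ^ (psize s - psize lam)) * (strip_wt s lam * ell n (elem_sym n (powers a)) s) = inv_norm n lam * (\<Prod>i<2 * Suc c. ?g i (s i))"
      unfolding cs w by (simp only: prod.distrib mult.assoc)
  qed simp
  also have "\<dots> = inv_norm n lam * (\<Prod>i<2 * Suc c. \<Sum>v\<in>{lam i..prev_part n lam i}. ?g i v)"
    unfolding sum_distrib_left[symmetric] using sum_prod_strips_above[OF p(1) z, where G = ?g and n = n] by (simp only:)
  also have "(\<Prod>i<2 * Suc c. \<Sum>v\<in>{lam i..prev_part n lam i}. ?g i v) = (\<Prod>i<2 * Suc c. ?R i)"
  proof (rule prod.cong)
    fix i
    have le: "lam i \<le> prev_part n lam i" using p(2) mono by (cases i) auto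
    have o: "lam (i - 1) = prev_part n lam i" if "odd i" using that by (cases i) auto
    then have o': "lam (i - Suc 0) = prev_part n lam i" if "odd i" using that by simp
    show "(\<Sum>v\<in>{lam i..prev_part n lam i}. ?g i v) = ?R i"
      unfolding sum_reindex_shift[OF le]
      by (auto simp: rogers_szego_def rogers_szego_hom_def qbinom_gauss_binom o' diff_diff_left intro!: sum.cong)
  qed simp
  \<comment> \<open>The rows 2 k + 1 and 2 k + 2 form the k-th factor of \<open>h_part\<close>, and
    row 0 gives the factor with n - lam 0; a trivial last factor completes the pairing.\<close>
  also have "\<dots> = (\<Prod>i<2 * Suc c. ?R i) * ?R (2 * Suc c)" using z by simp
  also have "\<dots> = ?R 0 * (\<Prod>k<Suc c. ?R (Suc (2 * k)) * ?R (Suc (Suc (2 * k))))" by (rule prod_shift_pairs)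
  also have "\<dots> = rogers_szego (n - lam 0) (a * b) * h_part (conj_part lam) a b"
    using h_part_conj[OF p(1), of "Suc c" a b] z partition_zero[OF p(1) z, of "2 * Suc c"] by simp
  finally show ?thesis by (simp only: mult_ac)
qed

text \<open>The same row-by-row factorization for strips below. With x the square root of t, the
  negative powers from c / x and d / x are absorbed by x to the size of \<open>mu\<close>, and only
  t to the power \<open>odd_index_sum s\<close> is left.\<close>

lemma R_expand:
  assumes "mu \<in> Parts n" "x \<noteq> 0"
  shows "fps_const (x ^ psize mu) * h_part (conj_part mu) (c / x) (d / x) =
    (\<Sum>s\<in>strips_below mu. strip_wt mu s * (fps_const (c ^ (psize mu - psize s) * d ^ even_gap_sum s * x ^ (2 * odd_index_sum s)) :: 'f::field fps))"
proof -
  have p: "is_partition mu" using assms by (simp add: Parts_def)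
  obtain b where z: "mu (2 * b) = 0" using even_bound[OF p] .
  let ?w = "\<lambda>i v. c ^ (mu i - v) * (if even i then d ^ (v - mu (Suc i)) else d ^ (mu i - v) * x ^ (2 * v))"
  let ?g = "\<lambda>i v. gauss_binom (mu i - mu (Suc i)) (mu i - v) * fps_const (?w i v)"
  let ?R = "\<lambda>i. if even i then fps_const (x ^ (mu i - mu (Suc i))) * rogers_szego_hom (mu i - mu (Suc i)) (c / x) (d / x)
     else fps_const (x ^ (2 * mu i)) * rogers_szego (mu i - mu (Suc i)) ((c / x) * (d / x))"
  have "(\<Sum>s\<in>strips_below mu. strip_wt mu s * fps_const (c ^ (psize mu - psize s) * d ^ even_gap_sum s * x ^ (2 * odd_index_sum s))) =
    (\<Sum>s\<in>strips_below mu. \<Prod>i<2 * b. ?g i (s i))"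
  proof (rule sum.cong)
    fix s assume s: "s \<in> strips_below mu"
    have sp: "is_partition s" using strips_below_partition[OF assms(1) s] by (simp add: Parts_def)
    have il: "interlacing mu s" using s by (simp add: strips_below_def)
    have zs: "s (2 * b) = 0" using interlacingD(1)[OF il, of "2 * b"] z by simp
    have "c ^ (psize mu - psize s) * d ^ even_gap_sum s * x ^ (2 * odd_index_sum s) =
      (\<Prod>k<b. c ^ (mu (2 * k) - s (2 * k)) * c ^ (mu (Suc (2 * k)) - s (Suc (2 * k))) * d ^ (s (2 * k) - s (Suc (2 * k))) * x ^ (2 * s (Suc (2 * k))))"
      unfolding psize_diff[OF p sp z zs interlacingD(1)[OF il], symmetric] even_gap_sum_eq[OF sp zs] odd_index_sum_eq[OF sp zs] sum_pairs sum_distrib_left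
      by (simp only: power_sum sum.distrib power_add prod.distrib)
    also have "\<dots> = (\<Prod>k<b. ?w (2 * k) (s (2 * k)) * ?w (Suc (2 * k)) (s (Suc (2 * k))))"
    proof (rule prod.cong)
      fix k
      have "s (2 * k) - s (Suc (2 * k)) = (s (2 * k) - mu (Suc (2 * k))) + (mu (Suc (2 * k)) - s (Suc (2 * k)))"
        using interlacingD(2)[OF il, of "2 * k"] interlacingD(1)[OF il, of "Suc (2 * k)"] by simp
      then have "d ^ (s (2 * k) - s (Suc (2 * k))) = d ^ (s (2 * k) - mu (Suc (2 * k))) * d ^ (mu (Suc (2 * k)) - s (Suc (2 * k)))"
        by (simp only: power_add)
      then show "c ^ (mu (2 * k) - s (2 * k)) * c ^ (mu (Suc (2 * k)) - s (Suc (2 * k))) * d ^ (s (2 * k) - s (Suc (2 * k))) * x ^ (2 * s (Suc (2 * k))) =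
        ?w (2 * k) (s (2 * k)) * ?w (Suc (2 * k)) (s (Suc (2 * k)))"
        by (simp add: mult_ac)
    qed simp
    finally have "c ^ (psize mu - psize s) * d ^ even_gap_sum s * x ^ (2 * odd_index_sum s) = (\<Prod>i<2 * b. ?w i (s i))"
      by (simp only: prod_pairs)
    then have "fps_const (c ^ (psize mu - psize s) * d ^ even_gap_sum s * x ^ (2 * odd_index_sum s)) = (\<Prod>i<2 * b. fps_const (?w i (s i)))"
      by (simp only: prod_fps_const)
    then show "strip_wt mu s * fps_const (c ^ (psize mu - psize s) * d ^ even_gap_sum s * x ^ (2 * odd_index_sum s)) = (\<Prod>i<2 * b. ?g i (s i))"
      by (simp only: strip_wt_eq[OF p z] prod.distrib)
  qed simp
  also have "\<dots> = (\<Prod>i<2 * b. \<Sum>v\<in>{mu (Suc i)..mu i}. ?g i v)"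
    unfolding strips_below_fun_box[OF p z] by (rule sum_prod_fun_box)
  also have "\<dots> = (\<Prod>i<2 * b. ?R i)"
  proof (rule prod.cong)
    fix i
    have le: "mu (Suc i) \<le> mu i" by (rule partition_antimono[OF p]) simp
    let ?m = "mu i - mu (Suc i)"
    show "(\<Sum>v\<in>{mu (Suc i)..mu i}. ?g i v) = ?R i"
    proof (cases "even i")
      case True
      have "(\<Sum>v\<in>{mu (Suc i)..mu i}. ?g i v) = (\<Sum>k\<le>?m. fps_const (x ^ ?m) * (gauss_binom ?m k * fps_const ((c / x) ^ (?m - k) * (d / x) ^ k)))"
        unfolding sum_reindex_shift[OF le]
      proof (rule sum.cong)
        fix k assume k: "k \<in> {..?m}"
        then have "?m = (?m - k) + k" by simp
        then have "x ^ ?m = x ^ (?m - k) * x ^ k" by (metis power_add)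
        then have "c ^ (?m - k) * d ^ k = x ^ ?m * ((c / x) ^ (?m - k) * (d / x) ^ k)"
          using assms(2) by (simp add: power_divide)
        moreover have "gauss_binom ?m (?m - k) = (gauss_binom ?m k :: 'f fps)" by (rule gauss_binom_diff) (use k in simp)
        moreover have "mu i - (mu (Suc i) + k) = ?m - k" by simp
        ultimately show "?g i (mu (Suc i) + k) = fps_const (x ^ ?m) * (gauss_binom ?m k * fps_const ((c / x) ^ (?m - k) * (d / x) ^ k))"
          using True by (simp only: if_True add_diff_cancel_left' mult.left_commute[of "fps_const _"] fps_const_mult)
      qed simp
      then show ?thesis using True by (simp add: rogers_szego_hom_def qbinom_gauss_binom sum_distrib_left)
    next
      case False
      have "(\<Sum>v\<in>{mu (Suc i)..mu i}. ?g i v) = (\<Sum>k\<le>?m. fps_const (x ^ (2 * mu i)) * (gauss_binom ?m k * fps_const (((c / x) * (d / x)) ^ k)))"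
        unfolding sum_reindex_rev[OF le]
      proof (rule sum.cong)
        fix k assume k: "k \<in> {..?m}"
        then have "2 * mu i = 2 * (mu i - k) + (k + k)" using le by simp
        then have "x ^ (2 * mu i) = x ^ (2 * (mu i - k)) * (x ^ k * x ^ k)" by (simp only: power_add)
        then have "c ^ k * (d ^ k * x ^ (2 * (mu i - k))) = x ^ (2 * mu i) * ((c / x) * (d / x)) ^ k"
          using assms(2) by (simp add: power_divide power_mult_distrib)
        moreover have "mu i - (mu i - k) = k" using k le by simp
        ultimately show "?g i (mu i - k) = fps_const (x ^ (2 * mu i)) * (gauss_binom ?m k * fps_const (((c / x) * (d / x)) ^ k))"
          using False by (simp only: if_False mult.left_commute[of "fps_const _"] fps_const_mult)
      qed simp
      then show ?thesis using False by (simp add: rogers_szego_def qbinom_gauss_binom sum_distrib_left)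
    qed
  qed simp
  also have "\<dots> = (\<Prod>k<b. (fps_const (x ^ (mu (2 * k) - mu (Suc (2 * k)))) * fps_const (x ^ (2 * mu (Suc (2 * k))))) *
     (rogers_szego_hom (mu (2 * k) - mu (Suc (2 * k))) (c / x) (d / x) *
     rogers_szego (mu (Suc (2 * k)) - mu (Suc (Suc (2 * k)))) ((c / x) * (d / x))))"
    unfolding prod_pairs by (rule prod.cong) (simp_all add: mult_ac)
  also have "\<dots> = (\<Prod>k<b. fps_const (x ^ (mu (2 * k) + mu (Suc (2 * k))))) * h_part (conj_part mu) (c / x) (d / x)"
    unfolding h_part_conj[OF p z] prod.distrib[symmetric]
  proof (rule prod.cong)
    fix k
    have "mu (Suc (2 * k)) \<le> mu (2 * k)" by (rule partition_antimono[OF p]) simp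
    then have "mu (2 * k) - mu (Suc (2 * k)) + 2 * mu (Suc (2 * k)) = mu (2 * k) + mu (Suc (2 * k))" by simp
    then have "fps_const (x ^ (mu (2 * k) - mu (Suc (2 * k)))) * fps_const (x ^ (2 * mu (Suc (2 * k)))) = fps_const (x ^ (mu (2 * k) + mu (Suc (2 * k))))"
      by (metis fps_const_mult power_add)
    then show "(fps_const (x ^ (mu (2 * k) - mu (Suc (2 * k)))) * fps_const (x ^ (2 * mu (Suc (2 * k))))) *
     (rogers_szego_hom (mu (2 * k) - mu (Suc (2 * k))) (c / x) (d / x) *
     rogers_szego (mu (Suc (2 * k)) - mu (Suc (Suc (2 * k)))) ((c / x) * (d / x))) =
     fps_const (x ^ (mu (2 * k) + mu (Suc (2 * k)))) * (rogers_szego_hom (mu (2 * k) - mu (Suc (2 * k))) (c / x) (d / x) *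
     rogers_szego (mu (Suc (2 * k)) - mu (Suc (Suc (2 * k)))) ((c / x) * (d / x)))" by (simp only:)
  qed simp
  also have "(\<Prod>k<b. fps_const (x ^ (mu (2 * k) + mu (Suc (2 * k))))) = fps_const (x ^ psize mu)"
    unfolding psize_eq[OF p z] sum_pairs power_sum prod_fps_const ..
  finally show ?thesis ..
qed

section \<open>Skew q-Whittaker polynomials\<close>

lemma qwhit1_eq:
  assumes "is_partition nu"
  shows "qwhit1 k nu mu = (if interlacing nu mu then sgl (sgl k (psize nu - psize mu)) (strip_wt nu mu) else (0 :: _ \<Rightarrow>\<^sub>0 'f::field fps))"
proof (cases "interlacing nu mu")
  case True
  have "qpoch qvar (nu i - nu (Suc i)) / (qpoch qvar (nu i - mu i) * qpoch qvar (mu i - nu (Suc i))) =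
    (gauss_binom (nu i - nu (Suc i)) (nu i - mu i) :: 'f fps)" for i
    using interlacingD[OF True, of i] by (simp add: qfac_def[symmetric] divide_qp2 gauss_binom_def)
  then show ?thesis using True by (simp add: qwhit1_def strip_wt_def interlacing_def)
next
  case False
  then have "\<not> (\<forall>i. mu i \<le> nu i \<and> nu (Suc i) \<le> mu i)" by (simp only: interlacing_def not_False_eq_True)
  then show ?thesis unfolding qwhit1_def interlacing_def by (simp only: if_False)
qed

lemma lookup_mult_single:
  "lk (p * sgl (sgl (k :: nat) (r :: nat)) w) \<alpha> = (if r \<le> lk \<alpha> k then lk p (\<alpha> - sgl k r) * w else (0 :: 'c::comm_ring_1))"
proof -
  let ?b = "sgl k r"
  have e: "lk (p * sgl ?b w) \<alpha> = w * ev1 (\<lambda>c. if ?b + c = \<alpha> then 1 else 0) p"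
    unfolding lookup_eq_ev1 mult.commute[of p] ev1_single_mult ..
  show ?thesis
  proof (cases "r \<le> lk \<alpha> k")
    case True
    then have "?b + (\<alpha> - ?b) = \<alpha>"
      by (intro poly_mapping_eqI) (auto simp: lookup_add lookup_minus lookup_single when_def)
    then have "?b + c = \<alpha> \<longleftrightarrow> c = \<alpha> - ?b" for c by (metis add_left_cancel)
    then show ?thesis using True unfolding e by (simp add: lookup_eq_ev1[symmetric] mult.commute)
  next
    case False
    have "?b + c \<noteq> \<alpha>" for c
    proof
      assume "?b + c = \<alpha>"
      then have "lk \<alpha> k = r + lk c k" by (metis lookup_add lookup_single_eq)
      then show False using False by simp
    qed
    then show ?thesis using False unfolding e by (simp add: ev1_def)
  qed
qed

definition parts_upto_size :: "nat \<Rightarrow> nat \<Rightarrow> (nat \<Rightarrow> nat) set" where "parts_upto_size n D = {lam \<in> Parts n. psize lam \<le> D}"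

lemma finite_parts_upto_size [simp]: "finite (parts_upto_size n D)"
  by (rule finite_subset[of _ "fun_box D (\<lambda>_. 0) (\<lambda>_. D)"]) (auto simp: parts_upto_size_def Parts_def psize_fun_box)

lemma finite_between: "is_partition lam \<Longrightarrow> finite {nu. is_partition nu \<and> mu \<le> nu \<and> nu \<le> lam}"
proof -
  assume p: "is_partition lam"
  obtain b where b: "lam b = 0" using partition_bound[OF p] by blast
  have "nu \<in> fun_box b (\<lambda>_. 0) lam" if "nu \<le> lam" for nu
    unfolding fun_box_iff using le_funD[OF that] partition_zero[OF p b] by (metis le0 le_zero_eq)
  then show ?thesis by (intro finite_subset[OF _ finite_fun_box[of b "\<lambda>_. 0" lam]]) auto
qed

lemma strips_above_psize:
  assumes "mu \<in> Parts n" "nu \<in> strips_above n mu"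
  shows "psize mu \<le> psize nu" "psize nu \<le> psize mu + n"
proof -
  have p: "is_partition mu" "is_partition nu" using assms strips_above_partition[of mu nu n] by (auto simp: Parts_def)
  have il: "interlacing nu mu" "nu 0 \<le> n" using assms by (auto simp: strips_above_def)
  show "psize mu \<le> psize nu" by (rule psize_interlacing[OF p(2,1) il(1)])
  obtain b where b: "mu b = 0" using partition_bound[OF p(1)] by blast
  then have z: "nu (Suc b) = 0" using interlacingD(2)[OF il(1), of b] by simp
  have "psize nu = nu 0 + (\<Sum>i<b. nu (Suc i))" unfolding psize_eq[OF p(2) z] by (rule sum.lessThan_Suc_shift)
  also have "\<dots> \<le> n + psize mu" unfolding psize_eq[OF p(1) b]
    by (intro add_mono sum_mono il interlacingD(2)[OF il(1)])
  finally show "psize nu \<le> psize mu + n" by simp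
qed

text \<open>Each variable adds a horizontal strip, which has at most n boxes when the first part is
  at most n. For fixed \<open>mu\<close> this leaves finitely many \<open>lam\<close>.\<close>

lemma qwhit_support:
  assumes "lam \<in> Parts n" "mu \<in> Parts n" "qwhit k lam mu \<noteq> (0 :: _ \<Rightarrow>\<^sub>0 'f::field fps)"
  shows "mu \<le> lam \<and> psize lam \<le> psize mu + k * n"
  using assms(2,3)
proof (induction k arbitrary: mu)
  case 0
  then show ?case by (auto split: if_splits)
next
  case (Suc k)
  from Suc.prems(2) obtain nu where nu: "is_partition nu" "mu \<le> nu" "nu \<le> lam"
    "qwhit k lam nu * qwhit1 k nu mu \<noteq> (0 :: _ \<Rightarrow>\<^sub>0 'f fps)"
    using sum.neutral[of "{nu. is_partition nu \<and> mu \<le> nu \<and> nu \<le> lam}" "\<lambda>nu. qwhit k lam nu * qwhit1 k nu mu :: _ \<Rightarrow>\<^sub>0 'f fps"]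
    by auto
  then have ne: "qwhit k lam nu \<noteq> (0 :: _ \<Rightarrow>\<^sub>0 'f fps)" "qwhit1 k nu mu \<noteq> (0 :: _ \<Rightarrow>\<^sub>0 'f fps)" by auto
  have il: "interlacing nu mu" using ne(2) unfolding qwhit1_eq[OF nu(1)] by (auto split: if_splits)
  have n0: "nu 0 \<le> n" using le_funD[OF nu(3), of 0] assms(1) by (simp add: Parts_def)
  have P: "nu \<in> Parts n" using nu(1) n0 by (simp add: Parts_def)
  have "psize nu \<le> psize mu + n" by (rule strips_above_psize(2)[OF Suc.prems(1)]) (use il n0 in \<open>simp add: strips_above_def\<close>)
  moreover have "psize lam \<le> psize nu + k * n" using Suc.IH[OF P ne(1)] by simp
  ultimately show ?case using nu by auto
qed

text \<open>Replaces the range of the branching rule by strips above \<open>mu\<close>, which does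
  not involve \<open>lam\<close>; the sum over \<open>lam\<close> can then be moved inside.\<close>

lemma lookup_qwhit_Suc:
  assumes "lam \<in> Parts n" "mu \<in> Parts n"
  shows "lk (qwhit (Suc k) lam mu) \<alpha> = (\<Sum>nu\<in>strips_above n mu. if psize nu - psize mu \<le> lk \<alpha> k
     then lk (qwhit k lam nu) (\<alpha> - sgl k (psize nu - psize mu)) * (strip_wt nu mu :: 'f::field fps) else 0)"
proof -
  have p: "is_partition lam" "is_partition mu" using assms by (auto simp: Parts_def)
  let ?A = "{nu. is_partition nu \<and> mu \<le> nu \<and> nu \<le> lam}"
  let ?q = "\<lambda>nu. qwhit k lam nu * qwhit1 k nu mu :: _ \<Rightarrow>\<^sub>0 'f fps"
  have "qwhit (Suc k) lam mu = (\<Sum>nu\<in>strips_above n mu. ?q nu)"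
    unfolding qwhit.simps
  proof (rule sum.mono_neutral_cong)
    show "finite (strips_above n mu)" using p by simp
    show "finite ?A" by (rule finite_between[OF p(1)])
    show "?q nu = 0" if "nu \<in> strips_above n mu - ?A" for nu
    proof -
      have P: "nu \<in> Parts n" using strips_above_partition[OF p(2)] that by blast
      have "mu \<le> nu" using that by (auto simp: strips_above_def le_fun_def interlacing_def)
      then have "\<not> nu \<le> lam" using that P by (auto simp: Parts_def)
      then have "qwhit k lam nu = (0 :: _ \<Rightarrow>\<^sub>0 'f fps)" using qwhit_support[OF assms(1) P] by blast
      then show ?thesis by simp
    qed
    show "?q nu = 0" if nu: "nu \<in> ?A - strips_above n mu" for nu
    proof -
      have "nu 0 \<le> n" using nu assms(1) le_funD[of nu lam 0] by (auto simp: Parts_def)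
      then have "\<not> interlacing nu mu" using nu by (auto simp: strips_above_def)
      then show ?thesis using nu by (simp add: qwhit1_eq)
    qed
  qed simp
  then have "lk (qwhit (Suc k) lam mu) \<alpha> = (\<Sum>nu\<in>strips_above n mu. lk (?q nu) \<alpha>)"
    by (simp only: lookup_sum)
  also have "\<dots> = (\<Sum>nu\<in>strips_above n mu. if psize nu - psize mu \<le> lk \<alpha> k
     then lk (qwhit k lam nu) (\<alpha> - sgl k (psize nu - psize mu)) * strip_wt nu mu else 0)"
  proof (rule sum.cong)
    fix nu assume nu: "nu \<in> strips_above n mu"
    then have "is_partition nu" "interlacing nu mu" using strips_above_partition[OF p(2) nu] by (auto simp: Parts_def strips_above_def)
    then show "lk (?q nu) \<alpha> = (if psize nu - psize mu \<le> lk \<alpha> k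
     then lk (qwhit k lam nu) (\<alpha> - sgl k (psize nu - psize mu)) * strip_wt nu mu else 0)"
      by (simp add: qwhit1_eq lookup_mult_single)
  qed simp
  finally show ?thesis .
qed

lemma symm_fps_prod: "(\<And>i. i \<in> I \<Longrightarrow> symm_fps n (f i)) \<Longrightarrow> symm_fps n (prod f I)"
  by (induction I rule: infinite_finite_induct) (auto intro: symm_fps_1 symm_fps_mult)

text \<open>One branching step in the variable x_k with exponent r is a Pieri sum, that is,
  multiplication of g by e_r. The bound D only has to be large enough for the sum to reach every
  \<open>lam\<close> in the support.\<close>

lemma ell_qwhit:
  assumes "symm_fps n (g :: 'f::field_char_0 laurent fps)"
  shows "mu \<in> Parts n \<Longrightarrow> psize mu + k * n \<le> D \<Longrightarrow>
    (\<Sum>lam\<in>parts_upto_size n D. ell n g lam * lk (qwhit k lam mu) \<alpha>) =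
    (if Poly_Mapping.keys \<alpha> \<subseteq> {..<k} then ell n ((\<Prod>i<k. elem_sym n (kdelta (lk \<alpha> i))) * g) mu else 0)"
proof (induction k arbitrary: mu \<alpha>)
  case 0
  have "(\<Sum>lam\<in>parts_upto_size n D. ell n g lam * lk (qwhit 0 lam mu) \<alpha>) = (\<Sum>lam\<in>parts_upto_size n D. if lam = mu then ell n g mu * lk 1 \<alpha> else 0)"
    by (rule sum.cong) auto
  also have "\<dots> = ell n g mu * lk 1 \<alpha>"
  proof -
    have "mu \<in> parts_upto_size n D" using 0 by (simp add: parts_upto_size_def)
    then show ?thesis by (simp only: sum.delta[OF finite_parts_upto_size] if_True)
  qed
  finally show ?case by (simp add: lookup_one when_def)
next
  case (Suc k)
  have p: "is_partition mu" using Suc.prems by (simp add: Parts_def)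
  let ?r = "\<lambda>nu. psize nu - psize mu"
  let ?c = "Poly_Mapping.keys \<alpha> \<subseteq> {..<Suc k}"
  \<comment> \<open>Subtraction of exponents truncates at 0. So one condition bounds the strip size
    by the exponent of x_k, and the other, that x_k is used up, bounds it from below.\<close>
  have key: "?r nu \<le> lk \<alpha> k \<and> Poly_Mapping.keys (\<alpha> - sgl k (?r nu)) \<subseteq> {..<k} \<longleftrightarrow> ?c \<and> ?r nu = lk \<alpha> k" for nu
  proof -
    have "Poly_Mapping.keys (\<alpha> - sgl k r) \<subseteq> {..<k} \<longleftrightarrow> (\<forall>i\<ge>k. lk \<alpha> i - lk (sgl k r) i = 0)" for r
      unfolding subset_iff in_keys_iff lookup_minus by (metis lessThan_iff not_le)
    also have "(\<forall>i\<ge>k. lk \<alpha> i - lk (sgl k r) i = 0) \<longleftrightarrow> lk \<alpha> k \<le> r \<and> (\<forall>i\<ge>Suc k. lk \<alpha> i = 0)" for r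
      by (auto simp: lookup_single when_def)
    finally have 1: "Poly_Mapping.keys (\<alpha> - sgl k r) \<subseteq> {..<k} \<longleftrightarrow> lk \<alpha> k \<le> r \<and> (\<forall>i\<ge>Suc k. lk \<alpha> i = 0)" for r .
    have 2: "?c \<longleftrightarrow> (\<forall>i\<ge>Suc k. lk \<alpha> i = 0)"
      unfolding subset_iff in_keys_iff by (metis lessThan_iff not_le)
    show ?thesis unfolding 1 2 by auto
  qed
  have "(\<Sum>lam\<in>parts_upto_size n D. ell n g lam * lk (qwhit (Suc k) lam mu) \<alpha>) =
    (\<Sum>lam\<in>parts_upto_size n D. \<Sum>nu\<in>strips_above n mu. strip_wt nu mu * (if ?r nu \<le> lk \<alpha> k then ell n g lam * lk (qwhit k lam nu) (\<alpha> - sgl k (?r nu)) else 0))"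
  proof (rule sum.cong)
    fix lam assume "lam \<in> parts_upto_size n D"
    then have l: "lam \<in> Parts n" by (simp add: parts_upto_size_def)
    show "ell n g lam * lk (qwhit (Suc k) lam mu) \<alpha> =
      (\<Sum>nu\<in>strips_above n mu. strip_wt nu mu * (if ?r nu \<le> lk \<alpha> k then ell n g lam * lk (qwhit k lam nu) (\<alpha> - sgl k (?r nu)) else 0))"
      unfolding lookup_qwhit_Suc[OF l Suc.prems(1)] sum_distrib_left
      by (rule sum.cong) (simp_all add: mult_ac)
  qed simp
  also have "\<dots> = (\<Sum>nu\<in>strips_above n mu. strip_wt nu mu * (if ?r nu \<le> lk \<alpha> k then (\<Sum>lam\<in>parts_upto_size n D. ell n g lam * lk (qwhit k lam nu) (\<alpha> - sgl k (?r nu))) else 0))"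
    by (subst sum.swap) (auto simp: sum_distrib_left intro!: sum.cong)
  also have "\<dots> = (\<Sum>nu\<in>strips_above n mu. if ?c then fps_const (kdelta (lk \<alpha> k) (?r nu)) * (strip_wt nu mu * ell n ((\<Prod>i<k. elem_sym n (kdelta (lk \<alpha> i))) * g) nu) else 0)"
  proof (rule sum.cong)
    fix nu assume nu: "nu \<in> strips_above n mu"
    have P: "nu \<in> Parts n" by (rule strips_above_partition[OF p nu])
    have D: "psize nu + k * n \<le> D" using strips_above_psize(2)[OF Suc.prems(1) nu] Suc.prems(2) by simp
    have pr: "(\<Prod>i<k. elem_sym n (kdelta (lk (\<alpha> - sgl k r) i))) = (\<Prod>i<k. elem_sym n (kdelta (lk \<alpha> i)) :: 'f laurent fps)" for r
      by (rule prod.cong) (auto simp: lookup_minus lookup_single when_def)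
    show "strip_wt nu mu * (if ?r nu \<le> lk \<alpha> k then (\<Sum>lam\<in>parts_upto_size n D. ell n g lam * lk (qwhit k lam nu) (\<alpha> - sgl k (?r nu))) else 0) =
      (if ?c then fps_const (kdelta (lk \<alpha> k) (?r nu)) * (strip_wt nu mu * ell n ((\<Prod>i<k. elem_sym n (kdelta (lk \<alpha> i))) * g) nu) else 0)"
      unfolding Suc.IH[OF P D] pr using key[of nu] by (auto simp: kdelta_def)
  qed simp
  also have "\<dots> = (if ?c then ell n (elem_sym n (kdelta (lk \<alpha> k)) * ((\<Prod>i<k. elem_sym n (kdelta (lk \<alpha> i))) * g)) mu else 0)"
    by (simp add: ell_elem_sym[OF Suc.prems(1) symm_fps_mult[OF symm_fps_prod[OF symm_fps_elem_sym] assms]])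
  also have "elem_sym n (kdelta (lk \<alpha> k)) * ((\<Prod>i<k. elem_sym n (kdelta (lk \<alpha> i))) * g) = (\<Prod>i<Suc k. elem_sym n (kdelta (lk \<alpha> i))) * g"
    by (simp only: prod.lessThan_Suc mult_ac)
  finally show ?case .
qed

section \<open>The coefficients of Z\<close>

definition parts_odd_index_sum :: "nat \<Rightarrow> nat \<Rightarrow> (nat \<Rightarrow> nat) set" where "parts_odd_index_sum n j = {s \<in> Parts n. odd_index_sum s = j}"

lemma double_down_Parts:
  assumes "s \<in> Parts n"
  shows "double_down s \<in> Parts n" "s \<in> strips_above n (double_down s)"
  using strips_below_partition[OF assms double_down(1)[OF assms]] double_down(1)[OF assms] assms by (auto simp: strips_above_def strips_below_def Parts_def)

text \<open>Such an s lies in a strip above \<open>double_down s\<close>, a partition of size 2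
  j.\<close>

lemma finite_parts_odd_index_sum [simp]: "finite (parts_odd_index_sum n j)"
proof (rule finite_subset)
  show "parts_odd_index_sum n j \<subseteq> (\<Union>kap\<in>parts_of_size n (2 * j). strips_above n kap)"
  proof
    fix s assume "s \<in> parts_odd_index_sum n j"
    then have s: "s \<in> Parts n" "odd_index_sum s = j" by (auto simp: parts_odd_index_sum_def)
    show "s \<in> (\<Union>kap\<in>parts_of_size n (2 * j). strips_above n kap)"
      by (rule UN_I[of "double_down s"]) (use double_down_Parts[OF s(1)] double_down(4)[OF s(1)] s(2) in \<open>auto simp: parts_of_size_def\<close>)
  qed
  show "finite (\<Union>kap\<in>parts_of_size n (2 * j). strips_above n kap)" 
    by (rule finite_UN_I[OF finite_parts_of_size]) (rule finite_strips_above, simp add: parts_of_size_def Parts_def)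
qed

text \<open>Every s lies above exactly one paired partition, \<open>double_down s\<close>, and with
  weight 1. So the paired partitions together with their strips are just all s with the given
  \<open>odd_index_sum\<close>: the power of t has become a size.\<close>

lemma paired_sum_powers:
  assumes "symm_fps n g"
  shows "paired_sum n j (elem_sym n (powers d) * g) = (\<Sum>s\<in>parts_odd_index_sum n j. fps_const (d ^ even_gap_sum s) * ell n g (s :: nat \<Rightarrow> nat) :: 'f::field_char_0 fps)"
proof -
  let ?A = "{kap \<in> parts_of_size n (2 * j). paired kap}"
  let ?G = "\<lambda>kap s. fps_const (d ^ (psize s - psize kap)) * (strip_wt s kap * ell n g s)"
  have up_pairing: "strips_above n kap = {s \<in> parts_odd_index_sum n j. interlacing s kap}" if kap: "kap \<in> ?A" for kap
  proof -
    have K: "kap \<in> Parts n" "psize kap = 2 * j" "paired kap" using kap by (auto simp: parts_of_size_def)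
    have "odd_index_sum s = j" if s: "s \<in> strips_above n kap" for s
    proof -
      have P: "s \<in> Parts n" using strips_above_partition[OF _ s] K by (auto simp: Parts_def)
      have "kap = double_down s" by (rule double_down(6)[OF P _ K(3)]) (use s in \<open>simp add: strips_above_def strips_below_def\<close>)
      then show ?thesis using double_down(4)[OF P] K(2) by simp
    qed
    then show ?thesis using strips_above_partition[of kap _ n] K(1) by (auto simp: parts_odd_index_sum_def strips_above_def Parts_def)
  qed
  have "paired_sum n j (elem_sym n (powers d) * g) = (\<Sum>kap\<in>?A. \<Sum>s\<in>strips_above n kap. ?G kap s)"
    unfolding paired_sum_def by (rule sum.cong) (auto simp: parts_of_size_def ell_elem_sym[OF _ assms])
  also have "\<dots> = (\<Sum>kap\<in>?A. \<Sum>s\<in>{s \<in> parts_odd_index_sum n j. interlacing s kap}. ?G kap s)"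
    by (rule sum.cong) (simp_all only: up_pairing)
  also have "\<dots> = (\<Sum>s\<in>parts_odd_index_sum n j. \<Sum>kap\<in>{kap \<in> ?A. interlacing s kap}. ?G kap s)"
    by (rule sum.swap_restrict) simp_all
  also have "\<dots> = (\<Sum>s\<in>parts_odd_index_sum n j. fps_const (d ^ even_gap_sum s) * ell n g s)"
  proof (rule sum.cong)
    fix s assume "s \<in> parts_odd_index_sum n j"
    then have s: "s \<in> Parts n" "odd_index_sum s = j" by (auto simp: parts_odd_index_sum_def)
    have "double_down s \<in> ?A" "interlacing s (double_down s)"
      using double_down(1,2,4)[OF s(1)] double_down_Parts(1)[OF s(1)] s(2) by (auto simp: parts_of_size_def strips_below_def)
    moreover have "kap = double_down s" if "kap \<in> ?A" "interlacing s kap" for kap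
      by (rule double_down(6)[OF s(1)]) (use that in \<open>auto simp: strips_below_def\<close>)
    ultimately have "{kap \<in> ?A. interlacing s kap} = {double_down s}" by blast
    then show "(\<Sum>kap\<in>{kap \<in> ?A. interlacing s kap}. ?G kap s) = fps_const (d ^ even_gap_sum s) * ell n g s"
      using double_down(3)[OF s(1)] double_down(5)[OF s(1), where 'f = 'f] by simp
  qed simp
  finally show ?thesis .
qed

section \<open>Series free of the square root of t\<close>

definition fls_lift :: "'a::field fps \<Rightarrow> 'a fls fps" where "fls_lift f = Abs_fps (\<lambda>i. fls_const (fps_nth f i))"

lemma fls_lift_nth [simp]: "fps_nth (fls_lift f) i = fls_const (fps_nth f i)" by (simp add: fls_lift_def)

lemma fls_const_sum: "fls_const (sum f A) = (\<Sum>a\<in>A. fls_const (f a))"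
  by (induction A rule: infinite_finite_induct) (auto simp flip: fls_plus_const)

lemma fls_lift_mult: "fls_lift (f * g) = fls_lift f * fls_lift g"
  by (rule fps_ext) (simp add: fps_mult_nth fls_const_sum)

lemma fls_lift_1: "fls_lift 1 = 1" by (rule fps_ext) (simp add: fps_one_nth)

text \<open>The preceding results are used over the field \<open>'a fls\<close>. In each summand the
  square root of t occurs only as an explicit power, the rest being constant in it, so reading off a
  power of t amounts to selecting terms.\<close>

definition t_free :: "'a::field fls fps \<Rightarrow> bool" where "t_free y \<longleftrightarrow> (\<exists>f. y = fls_lift f)"

lemma t_free_mult: "t_free x \<Longrightarrow> t_free y \<Longrightarrow> t_free (x * y)" by (auto simp: t_free_def fls_lift_mult[symmetric])
lemma t_free_add: "t_free x \<Longrightarrow> t_free y \<Longrightarrow> t_free (x + y)"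
proof -
  have "fls_lift f + fls_lift g = fls_lift (f + g)" for f g :: "'a fps" by (rule fps_ext) (simp add: fls_plus_const)
  then show "t_free x \<Longrightarrow> t_free y \<Longrightarrow> t_free (x + y)" by (auto simp: t_free_def)
qed
lemma t_free_0: "t_free 0" unfolding t_free_def by (rule exI[of _ 0], rule fps_ext) simp
lemma t_free_1: "t_free 1" unfolding t_free_def using fls_lift_1 by metis
lemma t_free_sum: "(\<And>i. i \<in> A \<Longrightarrow> t_free (f i)) \<Longrightarrow> t_free (sum f A)"
  by (induction A rule: infinite_finite_induct) (auto intro: t_free_0 t_free_add)
lemma t_free_prod: "(\<And>i. i \<in> A \<Longrightarrow> t_free (f i)) \<Longrightarrow> t_free (prod f A)"
  by (induction A rule: infinite_finite_induct) (auto intro: t_free_1 t_free_mult)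
lemma t_free_const: "t_free (fps_const (fls_const c))"
  unfolding t_free_def by (rule exI[of _ "fps_const c"], rule fps_ext) simp

lemma fls_lift_qfac: "fls_lift (qfac m) = qfac m"
proof (induction m)
  case 0 then show ?case by (simp add: fls_lift_1)
next
  case (Suc m)
  have "fls_lift (1 - fps_X ^ Suc m) = (1 - fps_X ^ Suc m :: 'a fls fps)"
    by (rule fps_ext) (simp add: fps_one_nth del: power_Suc)
  then show ?case by (simp only: qfac_Suc fls_lift_mult Suc)
qed

lemma t_free_qfac: "t_free (qfac m)" unfolding t_free_def using fls_lift_qfac by metis

lemma t_free_inv_qfac: "t_free (inv_qfac m)"
proof -
  have "qfac m * fls_lift (inv_qfac m) = (1 :: 'a fls fps)" unfolding fls_lift_qfac[symmetric] fls_lift_mult[symmetric] by (simp add: fls_lift_1)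
  then have "inv_qfac m = inv_qfac m * (qfac m * (fls_lift (inv_qfac m) :: 'a fls fps))" by simp
  also have "\<dots> = fls_lift (inv_qfac m)" by (simp only: mult.assoc[symmetric] qfac_inverse mult_1_left)
  finally show ?thesis unfolding t_free_def by blast
qed

lemma t_free_gauss_binom: "t_free (gauss_binom m k)" unfolding gauss_binom_def by (intro t_free_mult t_free_qfac t_free_inv_qfac)

lemma t_free_rogers_szego: "t_free (rogers_szego m (fls_const a))" "t_free (rogers_szego_hom m (fls_const a) (fls_const b))"
  unfolding rogers_szego_def rogers_szego_hom_def qbinom_gauss_binom fls_const_power[symmetric] fls_const_mult_const
  by (intro t_free_sum t_free_mult t_free_gauss_binom t_free_const)+

lemma t_free_strip_wt: "is_partition lam \<Longrightarrow> t_free (strip_wt lam mu)"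
  using partition_bound[of lam 0] by (metis strip_wt_eq t_free_prod t_free_gauss_binom)

lemma t_free_inv_norm: "is_partition lam \<Longrightarrow> t_free (inv_norm n lam)"
  using partition_bound[of lam 0] inv_norm_eq[of lam _ n] by (metis t_free_prod t_free_mult t_free_inv_qfac)

lemma t_free_h_part: "is_partition lam \<Longrightarrow> t_free (h_part (conj_part lam) (fls_const a) (fls_const b))"
  using even_bound[of lam] by (metis (no_types, lifting) h_part_conj fls_const_mult_const t_free_prod t_free_mult t_free_rogers_szego)

lemma t_free_lookup_qwhit:
  assumes "lam \<in> Parts n"
  shows "mu \<in> Parts n \<Longrightarrow> t_free (lk (qwhit k lam mu) \<alpha> :: 'a::field fls fps)"
proof (induction k arbitrary: mu \<alpha>)
  case 0
  show ?case by (auto simp: lookup_one when_def intro: t_free_0 t_free_1)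
next
  case (Suc k)
  have p: "is_partition mu" using Suc.prems by (simp add: Parts_def)
  have "t_free (lk (qwhit k lam nu) \<beta> * strip_wt nu mu :: 'a fls fps)" if "nu \<in> strips_above n mu" for nu \<beta>
  proof -
    have P: "nu \<in> Parts n" by (rule strips_above_partition[OF p that])
    moreover have "is_partition nu" using P by (simp add: Parts_def)
    ultimately show ?thesis by (intro t_free_mult Suc.IH[OF P] t_free_strip_wt)
  qed
  then show ?case unfolding lookup_qwhit_Suc[OF assms Suc.prems] by (auto intro!: t_free_sum t_free_0)
qed

lemma t_free_extract:
  assumes "t_free y"
  shows "fls_nth (fps_nth (y * fps_const (fls_X ^ p)) i) r = (if r = int p then fls_nth (fps_nth y i) 0 else 0)"
  using assms by (auto simp: t_free_def)

lemma divide_inv_norm: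
  assumes "is_partition lam"
  shows "A / (qfac (n - lam 0) * Prod_any (\<lambda>i. qfac (lam i - lam (Suc i)))) = (A * inv_norm n lam :: 'f::field fps)"
proof -
  obtain b where b: "lam b = 0" using partition_bound[OF assms] by blast
  have "Prod_any (\<lambda>i. qfac (lam i - lam (Suc i))) = (\<Prod>i<b. qfac (lam i - lam (Suc i)) :: 'f fps)"
  proof (rule Prod_any.expand_superset)
    show "{i. qfac (lam i - lam (Suc i)) \<noteq> (1 :: 'f fps)} \<subseteq> {..<b}"
    proof
      fix i assume i: "i \<in> {i. qfac (lam i - lam (Suc i)) \<noteq> (1 :: 'f fps)}"
      have "\<not> b \<le> i" using partition_zero[OF assms b, of i] i by auto
      then show "i \<in> {..<b}" by simp
    qed
  qed simp
  then have D: "(qfac (n - lam 0) * Prod_any (\<lambda>i. qfac (lam i - lam (Suc i)))) * inv_norm n lam = (1 :: 'f fps)" (is "?D * _ = _")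
  proof -
    assume P: "Prod_any (\<lambda>i. qfac (lam i - lam (Suc i))) = (\<Prod>i<b. qfac (lam i - lam (Suc i)) :: 'f fps)"
    have "?D * inv_norm n lam = (qfac (n - lam 0) * inv_qfac (n - lam 0)) * ((\<Prod>i<b. qfac (lam i - lam (Suc i))) * (\<Prod>i<b. inv_qfac (lam i - lam (Suc i))))"
      unfolding inv_norm_eq[OF assms b] P by (simp only: mult_ac)
    then show ?thesis by (simp add: prod.distrib[symmetric])
  qed
  have "fps_nth (?D * inv_norm n lam) 0 = (1 :: 'f)" unfolding D by simp
  then have "fps_nth ?D 0 \<noteq> (0 :: 'f)" by auto
  then show ?thesis using fps_inverse_unique[OF D] by (simp add: fps_divide_unit)
qed

text \<open>After \<open>R_expand\<close> the power t^j selects the s with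
  \<open>odd_index_sum s = j\<close>. For these, the sums over \<open>lam\<close>, \<open>mu\<close>
  and s are evaluated from the outside inwards, each turning its weights into a factor of one
  product.\<close>

lemma Z_nth:
  fixes a b c d :: "'a::field_char_0"
  defines "e \<equiv> \<lambda>n x. elem_sym n (powers (fls_const x)) :: 'a fls laurent fps"
  assumes "k = (case N of enat k \<Rightarrow> k | \<infinity> \<Rightarrow> (LEAST k. Poly_Mapping.keys \<alpha> \<subseteq> {..<k}))"
  shows "fps_nth (fps_nth (Z n N a b c d \<alpha>) i) j =
    (if Poly_Mapping.keys \<alpha> \<subseteq> {..<k} then
      fls_nth (fps_nth (paired_sum n j (e n d * (e n c * ((\<Prod>i<k. elem_sym n (kdelta (lk \<alpha> i))) * (e n b * e n a))))) i) 0 else 0)"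
proof -
  let ?g = "e n b * e n a"
  let ?W = "(\<Prod>i<k. elem_sym n (kdelta (lk \<alpha> i))) :: 'a fls laurent fps"
  let ?c = "Poly_Mapping.keys \<alpha> \<subseteq> {..<k}"
  have sg: "symm_fps n ?g" unfolding e_def by (intro symm_fps_mult symm_fps_elem_sym)
  have sW: "symm_fps n (?W * ?g)" by (intro symm_fps_mult symm_fps_prod symm_fps_elem_sym sg)
  have sc: "symm_fps n (e n c * (?W * ?g))" unfolding e_def by (intro symm_fps_mult symm_fps_prod symm_fps_elem_sym)
  \<comment> \<open>Only those \<open>mu\<close> matter that lie in a strip above some selected s,
    and they are finitely many.\<close>
  define M where "M = (\<Union>s\<in>parts_odd_index_sum n j. strips_above n s)"
  have QP: "s \<in> Parts n" "is_partition s" if "s \<in> parts_odd_index_sum n j" for s using that by (auto simp: parts_odd_index_sum_def Parts_def)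
  have finM [simp]: "finite M" unfolding M_def using QP by simp
  have MP: "mu \<in> Parts n" if "mu \<in> M" for mu using that QP strips_above_partition unfolding M_def by blast
  \<comment> \<open>The sum of all sizes in M serves as a common bound for
    \<open>ell_qwhit\<close>.\<close>
  define D where "D = (\<Sum>mu\<in>M. psize mu) + k * n"
  have MD: "psize mu + k * n \<le> D" if "mu \<in> M" for mu
    using member_le_sum[OF that, of psize] by (simp add: D_def)
  define R where "R mu s = strip_wt mu s * fps_const (fls_const c ^ (psize mu - psize s) * fls_const d ^ even_gap_sum s)" for mu s
  define T where "T = (\<lambda>(lam, mu). if is_partition lam \<and> is_partition mu \<and> mu \<le> lam \<and> lam 0 \<le> n
     then fls_nth (fps_nth (Z_summand n N a b c d \<alpha> lam mu) i) (2 * int j) else 0)"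
  have T: "T (lam, mu) = (\<Sum>s\<in>{s \<in> strips_below mu. odd_index_sum s = j}. fls_nth (fps_nth (ell n ?g lam * lk (qwhit k lam mu) \<alpha> * R mu s) i) 0)"
    if P: "lam \<in> Parts n" "mu \<in> Parts n" for lam mu
  proof -
    have lp: "is_partition lam" "lam 0 \<le> n" and mp: "is_partition mu" using P by (auto simp: Parts_def)
    let ?y = "\<lambda>s. ell n ?g lam * lk (qwhit k lam mu) \<alpha> * R mu s"
    have X0: "fls_X \<noteq> (0 :: 'a fls)" by simp
    have c1: "t_free (ell n ?g lam)"
      unfolding e_def ell_powers_powers[OF P(1)] fls_const_mult_const by (intro t_free_mult t_free_rogers_szego t_free_h_part t_free_inv_norm lp)
    have c2: "t_free (R mu s)" for s
      unfolding R_def fls_const_power[symmetric] fls_const_mult_const by (intro t_free_mult t_free_strip_wt t_free_const mp)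
    have cs: "t_free (?y s)" for s
      by (intro t_free_mult c1 c2 t_free_lookup_qwhit[OF P])
    have "Z_summand n N a b c d \<alpha> lam mu = ell n ?g lam * lk (qwhit k lam mu) \<alpha> *
      (fps_const (sqrt_t ^ psize mu) * h_part (conj_part mu) (fls_const c / sqrt_t) (fls_const d / sqrt_t))"
      unfolding Z_summand_def qfac_def[symmetric] divide_inv_norm[OF lp(1)] qwhit_coeff_def assms(2)[symmetric] e_def ell_powers_powers[OF P(1)] ..
    also have "\<dots> = (\<Sum>s\<in>strips_below mu. ?y s * fps_const (fls_X ^ (2 * odd_index_sum s)))"
      unfolding R_expand[OF P(2) X0] sum_distrib_left R_def
      by (rule sum.cong) (simp_all only: mult.assoc fps_const_mult)
    finally have "fls_nth (fps_nth (Z_summand n N a b c d \<alpha> lam mu) i) (2 * int j) =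
        (\<Sum>s\<in>strips_below mu. if odd_index_sum s = j then fls_nth (fps_nth (?y s) i) 0 else 0)"
      by (simp only: fps_sum_nth fls_nth_sum t_free_extract[OF cs]) (rule sum.cong, auto)
    also have "\<dots> = (\<Sum>s\<in>{s \<in> strips_below mu. odd_index_sum s = j}. fls_nth (fps_nth (?y s) i) 0)"
      using finite_strips_below[OF P(2)] by (simp add: sum.inter_filter)
    finally have *: "fls_nth (fps_nth (Z_summand n N a b c d \<alpha> lam mu) i) (2 * int j) = \<dots>" .
    show ?thesis
    proof (cases "mu \<le> lam")
      case True then show ?thesis using * lp mp by (simp add: T_def)
    next
      \<comment> \<open>\<open>T\<close> excludes such pairs explicitly; on the right they vanish
        with the q-Whittaker polynomial.\<close>
      case False
      then have "qwhit k lam mu = (0 :: _ \<Rightarrow>\<^sub>0 'a fls fps)" using qwhit_support[OF P] by blast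
      then show ?thesis using False by (simp add: T_def)
    qed
  qed
  have "fps_nth (fps_nth (Z n N a b c d \<alpha>) i) j = Sum_any T"
    by (simp add: Z_def T_def)
  also have "\<dots> = (\<Sum>x\<in>parts_upto_size n D \<times> M. T x)"
  proof (rule Sum_any.expand_superset)
    show "{x. T x \<noteq> 0} \<subseteq> parts_upto_size n D \<times> M"
    proof
      fix x assume "x \<in> {x. T x \<noteq> 0}"
      then obtain lam mu where x: "x = (lam, mu)" and ne: "T (lam, mu) \<noteq> 0" by (cases x) auto
      then have c: "is_partition lam" "is_partition mu" "mu \<le> lam" "lam 0 \<le> n" by (auto simp: T_def split: if_splits)
      then have P: "lam \<in> Parts n" "mu \<in> Parts n" using le_funD[OF c(3), of 0] by (auto simp: Parts_def)
      obtain s where s: "s \<in> strips_below mu" "odd_index_sum s = j"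
        and ne': "fls_nth (fps_nth (ell n ?g lam * lk (qwhit k lam mu) \<alpha> * R mu s) i) 0 \<noteq> 0"
        using ne unfolding T[OF P] by (auto elim: sum.not_neutral_contains_not_neutral)
      have "s \<in> parts_odd_index_sum n j" using strips_below_partition[OF P(2) s(1)] s(2) by (simp add: parts_odd_index_sum_def)
      moreover have "mu \<in> strips_above n s" using s P by (simp add: strips_below_def strips_above_def Parts_def)
      ultimately have M: "mu \<in> M" unfolding M_def by blast
      have "qwhit k lam mu \<noteq> (0 :: _ \<Rightarrow>\<^sub>0 'a fls fps)" using ne' by auto
      then have "psize lam \<le> D" using qwhit_support[OF P] MD[OF M] by (meson le_trans)
      then show "x \<in> parts_upto_size n D \<times> M" using M P x by (simp add: parts_upto_size_def)
    qed
  qed simp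
  also have "\<dots> = (\<Sum>lam\<in>parts_upto_size n D. \<Sum>mu\<in>M. T (lam, mu))" by (simp add: sum.cartesian_product)
  also have "\<dots> = (\<Sum>mu\<in>M. \<Sum>lam\<in>parts_upto_size n D. T (lam, mu))" by (rule sum.swap)
  also have "\<dots> = (\<Sum>mu\<in>M. \<Sum>lam\<in>parts_upto_size n D. \<Sum>s\<in>{s \<in> parts_odd_index_sum n j. interlacing mu s}.
      fls_nth (fps_nth (ell n ?g lam * lk (qwhit k lam mu) \<alpha> * R mu s) i) 0)"
  proof (intro sum.cong refl)
    fix mu lam assume m: "mu \<in> M" "lam \<in> parts_upto_size n D"
    have "{s \<in> strips_below mu. odd_index_sum s = j} = {s \<in> parts_odd_index_sum n j. interlacing mu s}"
      using strips_below_partition[OF MP[OF m(1)]] by (auto simp: parts_odd_index_sum_def strips_below_def)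
    then show "T (lam, mu) = (\<Sum>s\<in>{s \<in> parts_odd_index_sum n j. interlacing mu s}.
      fls_nth (fps_nth (ell n ?g lam * lk (qwhit k lam mu) \<alpha> * R mu s) i) 0)"
      using T[OF _ MP[OF m(1)], of lam] m(2) by (simp add: parts_upto_size_def)
  qed
  also have "\<dots> = (\<Sum>mu\<in>M. \<Sum>s\<in>{s \<in> parts_odd_index_sum n j. interlacing mu s}. \<Sum>lam\<in>parts_upto_size n D.
      fls_nth (fps_nth (ell n ?g lam * lk (qwhit k lam mu) \<alpha> * R mu s) i) 0)"
    by (intro sum.cong refl sum.swap)
  also have "\<dots> = fls_nth (fps_nth (\<Sum>mu\<in>M. \<Sum>s\<in>{s \<in> parts_odd_index_sum n j. interlacing mu s}.
      (\<Sum>lam\<in>parts_upto_size n D. ell n ?g lam * lk (qwhit k lam mu) \<alpha>) * R mu s) i) 0"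
    by (simp only: fps_sum_nth fls_nth_sum sum_distrib_right)
  also have "(\<Sum>mu\<in>M. \<Sum>s\<in>{s \<in> parts_odd_index_sum n j. interlacing mu s}. (\<Sum>lam\<in>parts_upto_size n D. ell n ?g lam * lk (qwhit k lam mu) \<alpha>) * R mu s) =
    (\<Sum>mu\<in>M. \<Sum>s\<in>{s \<in> parts_odd_index_sum n j. interlacing mu s}. (if ?c then ell n (?W * ?g) mu else 0) * R mu s)"
    by (intro sum.cong refl) (simp only: ell_qwhit[OF sg MP MD])
  also have "\<dots> = (\<Sum>s\<in>parts_odd_index_sum n j. \<Sum>mu\<in>{mu \<in> M. interlacing mu s}. (if ?c then ell n (?W * ?g) mu else 0) * R mu s)"
    by (rule sum.swap_restrict) simp_all
  also have "\<dots> = (\<Sum>s\<in>parts_odd_index_sum n j. if ?c then fps_const (fls_const d ^ even_gap_sum s) * ell n (e n c * (?W * ?g)) s else 0)"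
  proof (rule sum.cong)
    fix s assume s: "s \<in> parts_odd_index_sum n j"
    have "{mu \<in> M. interlacing mu s} = strips_above n s"
      using s MP by (auto simp: M_def strips_above_def Parts_def)
    then show "(\<Sum>mu\<in>{mu \<in> M. interlacing mu s}. (if ?c then ell n (?W * ?g) mu else 0) * R mu s) =
      (if ?c then fps_const (fls_const d ^ even_gap_sum s) * ell n (e n c * (?W * ?g)) s else 0)"
      unfolding e_def ell_elem_sym[OF QP(1)[OF s] sW[unfolded e_def]] R_def sum_distrib_left
      by (auto simp: mult_ac fps_const_mult[symmetric] simp del: fps_const_mult intro!: sum.cong)
  qed simp
  also have "\<dots> = (if ?c then paired_sum n j (e n d * (e n c * (?W * ?g))) else 0)"
    using paired_sum_powers[OF sc, of j "fls_const d"] by (simp add: e_def)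
  finally show ?thesis by simp
qed

lemma elem_sym_prod_const: "\<exists>E. (\<Prod>i\<in>I. elem_sym n (\<phi> i)) = fps_const E"
proof (induction I rule: infinite_finite_induct)
  case (insert x F)
  obtain E E' where "(\<Prod>i\<in>F. elem_sym n (\<phi> i)) = fps_const E" "elem_sym n (\<phi> x) = fps_const E'" using insert elem_sym_const by metis
  then show ?case using insert by auto
qed (auto intro: exI[of _ 1] simp: fps_const_1_eq_1[symmetric] simp del: fps_const_1_eq_1)

theorem theorem1p1:
  fixes n :: nat and N :: enat and a b c d :: "'a::field_char_0"
  shows "(\<forall>\<alpha> i j. fps_nth (fps_nth (Z n N a b c d \<alpha>) i) j = fps_nth (fps_nth (Z n N a b c d \<alpha>) j) i) \<and>
         (\<forall>a' b' c' d'. mset [a', b', c', d'] = mset [a, b, c, d] \<longrightarrow>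
            Z n N a' b' c' d' = Z n N a b c d)"
proof (intro conjI allI impI)
  fix \<alpha> :: "nat \<Rightarrow>\<^sub>0 nat" and i j :: nat
  define k where "k = (case N of enat k \<Rightarrow> k | \<infinity> \<Rightarrow> (LEAST k. Poly_Mapping.keys \<alpha> \<subseteq> {..<k}))"
  let ?e = "\<lambda>x. elem_sym n (powers (fls_const x)) :: 'a fls laurent fps"
  let ?E = "?e d * (?e c * ((\<Prod>i<k. elem_sym n (kdelta (lk \<alpha> i))) * (?e b * ?e a)))"
  have s: "symm_fps n ?E" by (intro symm_fps_mult symm_fps_prod symm_fps_elem_sym)
  \<comment> \<open>All factors are constant in q, as \<open>paired_sum_symmetric\<close> requires
    of their product.\<close>
  obtain Ea Eb Ec Ed W where "?e a = fps_const Ea" "?e b = fps_const Eb" "?e c = fps_const Ec" "?e d = fps_const Ed"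
    "(\<Prod>i<k. elem_sym n (kdelta (lk \<alpha> i))) = (fps_const W :: 'a fls laurent fps)"
    using elem_sym_const elem_sym_prod_const by metis
  then have E: "?E = fps_const (Ed * (Ec * (W * (Eb * Ea))))" by simp
  have "fps_nth (paired_sum n j ?E) i = fps_nth (paired_sum n i ?E) j" using s unfolding E by (rule paired_sum_symmetric)
  then show "fps_nth (fps_nth (Z n N a b c d \<alpha>) i) j = fps_nth (fps_nth (Z n N a b c d \<alpha>) j) i"
    unfolding Z_nth[OF k_def] by simp
next
  fix a' b' c' d' assume perm: "mset [a', b', c', d'] = mset [a, b, c, d]"
  let ?e = "\<lambda>x. elem_sym n (powers (fls_const x)) :: 'a fls laurent fps"
  \<comment> \<open>The product is commutative, so the parameters enter only through their
    multiset.\<close>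
  have e: "?e z * (?e y * (W * (?e x * ?e w))) = W * prod_mset (image_mset ?e (mset [w, x, y, z]))" for w x y z W
    by (simp add: mult_ac)
  show "Z n N a' b' c' d' = Z n N a b c d"
    by (intro ext fps_ext) (simp only: Z_nth[OF refl] e perm)
qed

end
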